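(* Let $\mathcal{E}$ be a locally cartesian closed category with finite limits, and let $\mathbf{A}$ be an internal category in $\mathcal{E}$. Then $\mathbf{A}$ is complete if and only if it is cocomplete (both in the internal sense).
   Context: $\mathcal{E}$ is equipped with a functorial choice of binary products and a chosen terminal object $\mathbb{1}$. $\mathrm{Cat}_{\mathcal{E}}$ denotes the 2-category of internal categories in $\mathcal{E}$, internal functors and internal natural transformations. It has finite limits (computed on objects of objects and objects of arrows), with terminal object $\mathbb{1}_{\mathrm{Cat}_{\mathcal{E}}}$, and is cartesian closed; $[\mathbf{D},\mathbf{A}]$ denotes the exponential (the internal category of functors $\mathbf{D}\to\mathbf{A}$ and natural transformations), $\Delta\colon\mathbf{A}\to[\mathbf{D},\mathbf{A}]$ the diagonal functor, and for a functor $D\colon\mathbf{D}\to\mathbf{A}$, $\ulcorner D\urcorner\colon\mathbb{1}_{\mathrm{Cat}_{\mathcal{E}}}\to[\mathbf{D},\mathbf{A}]$ is the corresponding point. For an object $I$ of $\mathcal{E}$, $I^*\colon\mathcal{E}\to\mathcal{E}/I$ is pullback along $I\to\mathbb{1}$. It preserves finite limits and exponentials and induces $I^*\colon\mathrm{Cat}_{\mathcal{E}}\to\mathrm{Cat}_{\mathcal{E}/I}$, with a canonical isomorphism $I^*[\mathbf{D},\mathbf{A}]\cong[I^*\mathbf{D},I^*\mathbf{A}]$. Each slice $\mathcal{E}/I$ is again locally cartesian closed with finite limits, so all the definitions given here also apply with $\mathcal{E}/I$ in place of $\mathcal{E}$. A diagram of shape $\mathbf{D}$ in $\mathbf{A}$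 is an internal functor $D\colon\mathbf{D}\to\mathbf{A}$. A cone over $D$ with vertex $V\colon\mathbb{1}_{\mathrm{Cat}_{\mathcal{E}}}\to\mathbf{A}$ is a natural transformation $\gamma\colon\Delta V\to\ulcorner D\urcorner$; a morphism of cones $(V_0,\gamma_0)\to(V_1,\gamma_1)$ is a natural transformation $h\colon V_0\to V_1$ with $\gamma_1\circ(\Delta h)=\gamma_0$. Dually, a cocone over $D$ with vertex $V$ is a natural transformation $\gamma\colon\ulcorner D\urcorner\to\Delta V$, and a morphism of cocones $(V_0,\gamma_0)\to(V_1,\gamma_1)$ is $h\colon V_0\to V_1$ with $(\Delta h)\circ\gamma_0=\gamma_1$. A cone (cocone) over $D$ is sent by $I^*$ (and the canonical isomorphism $I^*[\mathbf{D},\mathbf{A}]\cong[I^*\mathbf{D},I^*\mathbf{A}]$) to a cone (cocone) over $I^*D\colon I^*\mathbf{D}\to I^*\mathbf{A}$. A cone $(V,\gamma)$ over $D$ is universal, and $V$ is a limit of $D$, if for every object $I$ of $\mathcal{E}$ the cone $I^*(V,\gamma)$ is a terminal object in the (external) category of cones over $I^*D$. Dually, a cocone $(V,\gamma)$ over $D$ is universal, and $V$ is a colimit of $D$, if for every object $I$ of $\mathcal{E}$ the cocone $I^*(V,\gamma)$ is an initial object in the (external) category of cocones over $I^*D$. An internal category $\mathbf{A}$ in $\mathcal{E}$ is complete (respectively, cocomplete) if, for every object $I$ of $\mathcal{E}$, every diagram $D\colon\mathbf{D}\to I^*\mathbf{A}$ in $\mathrm{Cat}_{\mathcal{E}/I}$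 (of any shape $\mathbf{D}$ an internal category in $\mathcal{E}/I$) admits a limit (respectively, a colimit) relative to $\mathcal{E}/I$, that is, there is a cone (respectively, cocone) $(V,\gamma)$ over $D$ in $\mathrm{Cat}_{\mathcal{E}/I}$ such that, for every object $K$ of $\mathcal{E}/I$, $K^*(V,\gamma)$ is a terminal object in the (external) category of cones over $K^*D$ (respectively, an initial object in the (external) category of cocones over $K^*D$), where $K^*\colon\mathrm{Cat}_{\mathcal{E}/I}\to\mathrm{Cat}_{(\mathcal{E}/I)/K}$ is induced by pullback along the unique arrow from $K$ to the terminal object of $\mathcal{E}/I$. *)

theory Defs
  imports Main
begin

section \<open>Categories\<close>

record ('o, 'a) category =
  Obj :: "'o set"
  Arr :: "'a set"
  Dom :: "'a \<Rightarrow> 'o"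
  Cod :: "'a \<Rightarrow> 'o"
  Ide :: "'o \<Rightarrow> 'a"
  Comp :: "'a \<Rightarrow> 'a \<Rightarrow> 'a" (infixl "\<cdot>\<index>" 70)

text \<open>Composition is written in the usual order: \<open>g \<cdot> f\<close> is first \<open>f\<close>, then \<open>g\<close>.\<close>

definition hom :: "('o, 'a, 'm) category_scheme \<Rightarrow> 'o \<Rightarrow> 'o \<Rightarrow> 'a set" where
  "hom C X Y = {f \<in> Arr C. Dom C f = X \<and> Cod C f = Y}"

definition is_category :: "('o, 'a, 'm) category_scheme \<Rightarrow> bool" where
  "is_category C \<longleftrightarrow>
     (\<forall>f\<in>Arr C. Dom C f \<in> Obj C \<and> Cod C f \<in> Obj C) \<and>
     (\<forall>X\<in>Obj C. Ide C X \<in> hom C X X) \<and>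
     (\<forall>X\<in>Obj C. \<forall>Y\<in>Obj C. \<forall>Z\<in>Obj C. \<forall>f\<in>hom C X Y. \<forall>g\<in>hom C Y Z. g \<cdot>\<^bsub>C\<^esub> f \<in> hom C X Z) \<and>
     (\<forall>f\<in>Arr C. f \<cdot>\<^bsub>C\<^esub> Ide C (Dom C f) = f \<and> Ide C (Cod C f) \<cdot>\<^bsub>C\<^esub> f = f) \<and>
     (\<forall>f\<in>Arr C. \<forall>g\<in>Arr C. \<forall>h\<in>Arr C. Cod C f = Dom C g \<and> Cod C g = Dom C h \<longrightarrow>
        h \<cdot>\<^bsub>C\<^esub> (g \<cdot>\<^bsub>C\<^esub> f) = (h \<cdot>\<^bsub>C\<^esub> g) \<cdot>\<^bsub>C\<^esub> f)"

definition is_terminal :: "('o, 'a, 'm) category_scheme \<Rightarrow> 'o \<Rightarrow> bool" where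
  "is_terminal C T \<longleftrightarrow> T \<in> Obj C \<and> (\<forall>X\<in>Obj C. \<exists>!f. f \<in> hom C X T)"

definition is_initial :: "('o, 'a, 'm) category_scheme \<Rightarrow> 'o \<Rightarrow> bool" where
  "is_initial C T \<longleftrightarrow> T \<in> Obj C \<and> (\<forall>X\<in>Obj C. \<exists>!f. f \<in> hom C T X)"

definition is_product ::
  "('o, 'a, 'm) category_scheme \<Rightarrow> 'o \<Rightarrow> 'o \<Rightarrow> 'o \<Rightarrow> 'a \<Rightarrow> 'a \<Rightarrow> bool" where
  "is_product C X Y P p q \<longleftrightarrow>
     P \<in> Obj C \<and> p \<in> hom C P X \<and> q \<in> hom C P Y \<and>
     (\<forall>Z\<in>Obj C. \<forall>f\<in>hom C Z X. \<forall>g\<in>hom C Z Y.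
        \<exists>!u. u \<in> hom C Z P \<and> p \<cdot>\<^bsub>C\<^esub> u = f \<and> q \<cdot>\<^bsub>C\<^esub> u = g)"

definition is_pullback ::
  "('o, 'a, 'm) category_scheme \<Rightarrow> 'a \<Rightarrow> 'a \<Rightarrow> 'o \<Rightarrow> 'a \<Rightarrow> 'a \<Rightarrow> bool" where
  "is_pullback C f g P p q \<longleftrightarrow>
     f \<in> Arr C \<and> g \<in> Arr C \<and> Cod C f = Cod C g \<and>
     P \<in> Obj C \<and> p \<in> hom C P (Dom C f) \<and> q \<in> hom C P (Dom C g) \<and>
     f \<cdot>\<^bsub>C\<^esub> p = g \<cdot>\<^bsub>C\<^esub> q \<and>
     (\<forall>Z\<in>Obj C. \<forall>h\<in>hom C Z (Dom C f). \<forall>k\<in>hom C Z (Dom C g). f \<cdot>\<^bsub>C\<^esub> h = g \<cdot>\<^bsub>C\<^esub> k \<longrightarrow>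
        (\<exists>!u. u \<in> hom C Z P \<and> p \<cdot>\<^bsub>C\<^esub> u = h \<and> q \<cdot>\<^bsub>C\<^esub> u = k))"


section \<open>Finite limits\<close>

definition ext_functor ::
  "('j, 'b, 'n) category_scheme \<Rightarrow> ('o, 'a, 'm) category_scheme \<Rightarrow> ('j \<Rightarrow> 'o) \<Rightarrow> ('b \<Rightarrow> 'a) \<Rightarrow> bool"
where
  "ext_functor J C fo fa \<longleftrightarrow>
     (\<forall>j\<in>Obj J. fo j \<in> Obj C \<and> fa (Ide J j) = Ide C (fo j)) \<and>
     (\<forall>b\<in>Arr J. fa b \<in> hom C (fo (Dom J b)) (fo (Cod J b))) \<and>
     (\<forall>b\<in>Arr J. \<forall>c\<in>Arr J. Cod J b = Dom J c \<longrightarrow> fa (c \<cdot>\<^bsub>J\<^esub> b) = fa c \<cdot>\<^bsub>C\<^esub> fa b)"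

definition ext_cone ::
  "('j, 'b, 'n) category_scheme \<Rightarrow> ('o, 'a, 'm) category_scheme \<Rightarrow> ('j \<Rightarrow> 'o) \<Rightarrow> ('b \<Rightarrow> 'a) \<Rightarrow>
     'o \<Rightarrow> ('j \<Rightarrow> 'a) \<Rightarrow> bool" where
  "ext_cone J C fo fa L \<pi> \<longleftrightarrow>
     L \<in> Obj C \<and> (\<forall>j\<in>Obj J. \<pi> j \<in> hom C L (fo j)) \<and>
     (\<forall>b\<in>Arr J. fa b \<cdot>\<^bsub>C\<^esub> \<pi> (Dom J b) = \<pi> (Cod J b))"

definition ext_limit ::
  "('j, 'b, 'n) category_scheme \<Rightarrow> ('o, 'a, 'm) category_scheme \<Rightarrow> ('j \<Rightarrow> 'o) \<Rightarrow> ('b \<Rightarrow> 'a) \<Rightarrow>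
     'o \<Rightarrow> ('j \<Rightarrow> 'a) \<Rightarrow> bool" where
  "ext_limit J C fo fa L \<pi> \<longleftrightarrow>
     ext_cone J C fo fa L \<pi> \<and>
     (\<forall>Z \<zeta>. ext_cone J C fo fa Z \<zeta> \<longrightarrow>
        (\<exists>!u. u \<in> hom C Z L \<and> (\<forall>j\<in>Obj J. \<pi> j \<cdot>\<^bsub>C\<^esub> u = \<zeta> j)))"

text \<open>Up to isomorphism, the objects and the arrows of a finite category may be taken to be
  natural numbers.\<close>

definition has_finite_limits :: "('o, 'a, 'm) category_scheme \<Rightarrow> bool" where
  "has_finite_limits C \<longleftrightarrow>
     (\<forall>(J :: (nat, nat) category) fo fa.
        is_category J \<and> finite (Obj J) \<and> finite (Arr J) \<and> ext_functor J C fo fa \<longrightarrow>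
        (\<exists>L \<pi>. ext_limit J C fo fa L \<pi>))"


section \<open>Categories with chosen finite products\<close>

record ('o, 'a) cart_category = "('o, 'a) category" +
  One :: 'o
  Prod :: "'o \<Rightarrow> 'o \<Rightarrow> 'o"
  Pr1 :: "'o \<Rightarrow> 'o \<Rightarrow> 'a"
  Pr2 :: "'o \<Rightarrow> 'o \<Rightarrow> 'a"

definition cartesian :: "('o, 'a, 'm) cart_category_scheme \<Rightarrow> bool" where
  "cartesian C \<longleftrightarrow>
     is_category C \<and> is_terminal C (One C) \<and>
     (\<forall>X\<in>Obj C. \<forall>Y\<in>Obj C. is_product C X Y (Prod C X Y) (Pr1 C X Y) (Pr2 C X Y))"

definition pair :: "('o, 'a, 'm) cart_category_scheme \<Rightarrow> 'a \<Rightarrow> 'a \<Rightarrow> 'a" where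
  "pair C f g =
     (THE u. u \<in> hom C (Dom C f) (Prod C (Cod C f) (Cod C g)) \<and>
             Pr1 C (Cod C f) (Cod C g) \<cdot>\<^bsub>C\<^esub> u = f \<and> Pr2 C (Cod C f) (Cod C g) \<cdot>\<^bsub>C\<^esub> u = g)"

text \<open>The arrow part of the product functor determined by the chosen products.\<close>

definition prod_map :: "('o, 'a, 'm) cart_category_scheme \<Rightarrow> 'a \<Rightarrow> 'a \<Rightarrow> 'a" where
  "prod_map C f g =
     pair C (f \<cdot>\<^bsub>C\<^esub> Pr1 C (Dom C f) (Dom C g)) (g \<cdot>\<^bsub>C\<^esub> Pr2 C (Dom C f) (Dom C g))"

definition is_exponential ::
  "('o, 'a, 'm) cart_category_scheme \<Rightarrow> 'o \<Rightarrow> 'o \<Rightarrow> 'o \<Rightarrow> 'a \<Rightarrow> bool" where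
  "is_exponential C D A X ev \<longleftrightarrow>
     X \<in> Obj C \<and> ev \<in> hom C (Prod C X D) A \<and>
     (\<forall>Z\<in>Obj C. \<forall>f\<in>hom C (Prod C Z D) A.
        \<exists>!u. u \<in> hom C Z X \<and> ev \<cdot>\<^bsub>C\<^esub> prod_map C u (Ide C D) = f)"

definition cartesian_closed :: "('o, 'a, 'm) cart_category_scheme \<Rightarrow> bool" where
  "cartesian_closed C \<longleftrightarrow>
     cartesian C \<and> (\<forall>D\<in>Obj C. \<forall>A\<in>Obj C. \<exists>X ev. is_exponential C D A X ev)"

definition exponential :: "('o, 'a, 'm) cart_category_scheme \<Rightarrow> 'o \<Rightarrow> 'o \<Rightarrow> 'o \<times> 'a" where
  "exponential C D A = (SOME (X, ev). is_exponential C D A X ev)"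

abbreviation Exp :: "('o, 'a, 'm) cart_category_scheme \<Rightarrow> 'o \<Rightarrow> 'o \<Rightarrow> 'o" where
  "Exp C D A \<equiv> fst (exponential C D A)"

abbreviation Ev :: "('o, 'a, 'm) cart_category_scheme \<Rightarrow> 'o \<Rightarrow> 'o \<Rightarrow> 'a" where
  "Ev C D A \<equiv> snd (exponential C D A)"

text \<open>The transpose \<open>Z \<rightarrow> [D, A]\<close> of an arrow \<open>f : Z \<times> D \<rightarrow> A\<close>.\<close>

definition transpose ::
  "('o, 'a, 'm) cart_category_scheme \<Rightarrow> 'o \<Rightarrow> 'o \<Rightarrow> 'o \<Rightarrow> 'a \<Rightarrow> 'a" where
  "transpose C D A Z f =
     (THE u. u \<in> hom C Z (Exp C D A) \<and> Ev C D A \<cdot>\<^bsub>C\<^esub> prod_map C u (Ide C D) = f)"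


section \<open>Slices\<close>

text \<open>An object of the slice over \<open>I\<close> is an arrow with codomain \<open>I\<close>; an arrow \<open>f \<rightarrow> g\<close> of the
  slice is a triple \<open>(f, h, g)\<close> with \<open>g \<cdot> h = f\<close>.\<close>

definition slice_base ::
  "('o, 'a, 'm) category_scheme \<Rightarrow> 'o \<Rightarrow> ('a, 'a \<times> 'a \<times> 'a) category" where
  "slice_base E I =
     \<lparr>Obj = {f \<in> Arr E. Cod E f = I},
      Arr = {(f, h, g). f \<in> Arr E \<and> Cod E f = I \<and> g \<in> Arr E \<and> Cod E g = I \<and>
                        h \<in> hom E (Dom E f) (Dom E g) \<and> g \<cdot>\<^bsub>E\<^esub> h = f},
      Dom = (\<lambda>(f, h, g). f),
      Cod = (\<lambda>(f, h, g). g),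
      Ide = (\<lambda>f. (f, Ide E (Dom E f), f)),
      Comp = (\<lambda>(f', h', g') (f, h, g). (f, h' \<cdot>\<^bsub>E\<^esub> h, g'))\<rparr>"

definition slice_product ::
  "('o, 'a, 'm) category_scheme \<Rightarrow> 'o \<Rightarrow> 'a \<Rightarrow> 'a \<Rightarrow> 'a \<times> ('a \<times> 'a \<times> 'a) \<times> ('a \<times> 'a \<times> 'a)" where
  "slice_product E I f g = (SOME (P, p, q). is_product (slice_base E I) f g P p q)"

definition slice ::
  "('o, 'a, 'm) category_scheme \<Rightarrow> 'o \<Rightarrow> ('a, 'a \<times> 'a \<times> 'a) cart_category" where
  "slice E I =
     category.extend (slice_base E I)
       \<lparr>One = Ide E I,
        Prod = (\<lambda>f g. fst (slice_product E I f g)),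
        Pr1 = (\<lambda>f g. fst (snd (slice_product E I f g))),
        Pr2 = (\<lambda>f g. snd (snd (slice_product E I f g)))\<rparr>"

definition locally_cartesian_closed :: "('o, 'a, 'm) category_scheme \<Rightarrow> bool" where
  "locally_cartesian_closed E \<longleftrightarrow> (\<forall>I\<in>Obj E. cartesian_closed (slice E I))"

text \<open>The functor \<open>I\<^sup>*\<close> to the slice over \<open>I\<close>: pullback along \<open>I \<rightarrow> 1\<close>, that is, the chosen
  product with \<open>I\<close> together with its projection to \<open>I\<close>.\<close>

definition pull_ob :: "('o, 'a, 'm) cart_category_scheme \<Rightarrow> 'o \<Rightarrow> 'o \<Rightarrow> 'a" where
  "pull_ob E I X = Pr1 E I X"

definition pull_ar :: "('o, 'a, 'm) cart_category_scheme \<Rightarrow> 'o \<Rightarrow> 'a \<Rightarrow> 'a \<times> 'a \<times> 'a" where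
  "pull_ar E I f =
     (pull_ob E I (Dom E f), prod_map E (Ide E I) f, pull_ob E I (Cod E f))"


section \<open>Internal categories, functors and natural transformations\<close>

text \<open>The object \<open>ICp\<close> of composable pairs, with its projections to the first and the second arrow
  of a pair, is part of the data; it can be any pullback of target and source. In this way
  finite-limit preserving functors act on internal categories componentwise.\<close>

record ('o, 'a) icat =
  IOb :: 'o
  IAr :: 'o
  ICp :: 'o
  ISrc :: 'a
  ITgt :: 'a
  IIde :: 'a
  IFst :: 'a
  ISnd :: 'a
  ICmp :: 'a

text \<open>The composite of two generalised elements \<open>f, g : Z \<rightarrow> IAr X\<close> with \<open>ITgt f = ISrc g\<close>:
  first \<open>f\<close>, then \<open>g\<close>.\<close>

definition icomp ::
  "('o, 'a, 'm) category_scheme \<Rightarrow> ('o, 'a) icat \<Rightarrow> 'a \<Rightarrow> 'a \<Rightarrow> 'a" where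
  "icomp E X f g =
     ICmp X \<cdot>\<^bsub>E\<^esub>
       (THE u. u \<in> hom E (Dom E f) (ICp X) \<and> IFst X \<cdot>\<^bsub>E\<^esub> u = f \<and> ISnd X \<cdot>\<^bsub>E\<^esub> u = g)"

definition is_icat :: "('o, 'a, 'm) category_scheme \<Rightarrow> ('o, 'a) icat \<Rightarrow> bool" where
  "is_icat E X \<longleftrightarrow>
     IOb X \<in> Obj E \<and> IAr X \<in> Obj E \<and>
     ISrc X \<in> hom E (IAr X) (IOb X) \<and> ITgt X \<in> hom E (IAr X) (IOb X) \<and>
     IIde X \<in> hom E (IOb X) (IAr X) \<and> ICmp X \<in> hom E (ICp X) (IAr X) \<and>
     is_pullback E (ITgt X) (ISrc X) (ICp X) (IFst X) (ISnd X) \<and>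
     ISrc X \<cdot>\<^bsub>E\<^esub> IIde X = Ide E (IOb X) \<and> ITgt X \<cdot>\<^bsub>E\<^esub> IIde X = Ide E (IOb X) \<and>
     ISrc X \<cdot>\<^bsub>E\<^esub> ICmp X = ISrc X \<cdot>\<^bsub>E\<^esub> IFst X \<and> ITgt X \<cdot>\<^bsub>E\<^esub> ICmp X = ITgt X \<cdot>\<^bsub>E\<^esub> ISnd X \<and>
     icomp E X (IIde X \<cdot>\<^bsub>E\<^esub> ISrc X) (Ide E (IAr X)) = Ide E (IAr X) \<and>
     icomp E X (Ide E (IAr X)) (IIde X \<cdot>\<^bsub>E\<^esub> ITgt X) = Ide E (IAr X) \<and>
     (\<forall>Z\<in>Obj E. \<forall>f\<in>hom E Z (IAr X). \<forall>g\<in>hom E Z (IAr X). \<forall>h\<in>hom E Z (IAr X).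
        ITgt X \<cdot>\<^bsub>E\<^esub> f = ISrc X \<cdot>\<^bsub>E\<^esub> g \<and> ITgt X \<cdot>\<^bsub>E\<^esub> g = ISrc X \<cdot>\<^bsub>E\<^esub> h \<longrightarrow>
        icomp E X (icomp E X f g) h = icomp E X f (icomp E X g h))"

record ('o, 'a) ifun =
  FDom :: "('o, 'a) icat"
  FCod :: "('o, 'a) icat"
  FOb :: 'a
  FAr :: 'a

definition is_ifun :: "('o, 'a, 'm) category_scheme \<Rightarrow> ('o, 'a) ifun \<Rightarrow> bool" where
  "is_ifun E F \<longleftrightarrow>
     (let X = FDom F; Y = FCod F in
       is_icat E X \<and> is_icat E Y \<and>
       FOb F \<in> hom E (IOb X) (IOb Y) \<and> FAr F \<in> hom E (IAr X) (IAr Y) \<and>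
       ISrc Y \<cdot>\<^bsub>E\<^esub> FAr F = FOb F \<cdot>\<^bsub>E\<^esub> ISrc X \<and> ITgt Y \<cdot>\<^bsub>E\<^esub> FAr F = FOb F \<cdot>\<^bsub>E\<^esub> ITgt X \<and>
       FAr F \<cdot>\<^bsub>E\<^esub> IIde X = IIde Y \<cdot>\<^bsub>E\<^esub> FOb F \<and>
       FAr F \<cdot>\<^bsub>E\<^esub> ICmp X = icomp E Y (FAr F \<cdot>\<^bsub>E\<^esub> IFst X) (FAr F \<cdot>\<^bsub>E\<^esub> ISnd X))"

definition ifun_id :: "('o, 'a, 'm) category_scheme \<Rightarrow> ('o, 'a) icat \<Rightarrow> ('o, 'a) ifun" where
  "ifun_id E X = \<lparr>FDom = X, FCod = X, FOb = Ide E (IOb X), FAr = Ide E (IAr X)\<rparr>"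

definition ifun_comp ::
  "('o, 'a, 'm) category_scheme \<Rightarrow> ('o, 'a) ifun \<Rightarrow> ('o, 'a) ifun \<Rightarrow> ('o, 'a) ifun" where
  "ifun_comp E G F =
     \<lparr>FDom = FDom F, FCod = FCod G, FOb = FOb G \<cdot>\<^bsub>E\<^esub> FOb F, FAr = FAr G \<cdot>\<^bsub>E\<^esub> FAr F\<rparr>"

definition icat_one :: "('o, 'a, 'm) cart_category_scheme \<Rightarrow> ('o, 'a) icat" where
  "icat_one E =
     \<lparr>IOb = One E, IAr = One E, ICp = One E, ISrc = Ide E (One E), ITgt = Ide E (One E),
      IIde = Ide E (One E), IFst = Ide E (One E), ISnd = Ide E (One E), ICmp = Ide E (One E)\<rparr>"

definition icat_prod ::
  "('o, 'a, 'm) cart_category_scheme \<Rightarrow> ('o, 'a) icat \<Rightarrow> ('o, 'a) icat \<Rightarrow> ('o, 'a) icat" where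
  "icat_prod E X Y =
     \<lparr>IOb = Prod E (IOb X) (IOb Y), IAr = Prod E (IAr X) (IAr Y), ICp = Prod E (ICp X) (ICp Y),
      ISrc = prod_map E (ISrc X) (ISrc Y), ITgt = prod_map E (ITgt X) (ITgt Y),
      IIde = prod_map E (IIde X) (IIde Y), IFst = prod_map E (IFst X) (IFst Y),
      ISnd = prod_map E (ISnd X) (ISnd Y), ICmp = prod_map E (ICmp X) (ICmp Y)\<rparr>"

definition Cat ::
  "('o, 'a, 'm) cart_category_scheme \<Rightarrow> (('o, 'a) icat, ('o, 'a) ifun) cart_category" where
  "Cat E =
     \<lparr>Obj = {X. is_icat E X},
      Arr = {F. is_ifun E F},
      Dom = FDom,
      Cod = FCod,
      Ide = ifun_id E,
      Comp = ifun_comp E,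
      One = icat_one E,
      Prod = icat_prod E,
      Pr1 = (\<lambda>X Y. \<lparr>FDom = icat_prod E X Y, FCod = X,
                    FOb = Pr1 E (IOb X) (IOb Y), FAr = Pr1 E (IAr X) (IAr Y)\<rparr>),
      Pr2 = (\<lambda>X Y. \<lparr>FDom = icat_prod E X Y, FCod = Y,
                    FOb = Pr2 E (IOb X) (IOb Y), FAr = Pr2 E (IAr X) (IAr Y)\<rparr>)\<rparr>"

record ('o, 'a) inat =
  NDom :: "('o, 'a) ifun"
  NCod :: "('o, 'a) ifun"
  NMap :: 'a

definition is_inat :: "('o, 'a, 'm) category_scheme \<Rightarrow> ('o, 'a) inat \<Rightarrow> bool" where
  "is_inat E \<alpha> \<longleftrightarrow>
     (let F = NDom \<alpha>; G = NCod \<alpha>; X = FDom F; Y = FCod F in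
       is_ifun E F \<and> is_ifun E G \<and> FDom G = X \<and> FCod G = Y \<and>
       NMap \<alpha> \<in> hom E (IOb X) (IAr Y) \<and>
       ISrc Y \<cdot>\<^bsub>E\<^esub> NMap \<alpha> = FOb F \<and> ITgt Y \<cdot>\<^bsub>E\<^esub> NMap \<alpha> = FOb G \<and>
       icomp E Y (FAr F) (NMap \<alpha> \<cdot>\<^bsub>E\<^esub> ITgt X) = icomp E Y (NMap \<alpha> \<cdot>\<^bsub>E\<^esub> ISrc X) (FAr G))"

definition inat_id :: "('o, 'a, 'm) category_scheme \<Rightarrow> ('o, 'a) ifun \<Rightarrow> ('o, 'a) inat" where
  "inat_id E F = \<lparr>NDom = F, NCod = F, NMap = IIde (FCod F) \<cdot>\<^bsub>E\<^esub> FOb F\<rparr>"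

text \<open>Vertical composition (\<open>\<alpha>\<close> first, then \<open>\<beta>\<close>) and the two whiskerings.\<close>

definition inat_comp ::
  "('o, 'a, 'm) category_scheme \<Rightarrow> ('o, 'a) inat \<Rightarrow> ('o, 'a) inat \<Rightarrow> ('o, 'a) inat" where
  "inat_comp E \<beta> \<alpha> =
     \<lparr>NDom = NDom \<alpha>, NCod = NCod \<beta>, NMap = icomp E (FCod (NDom \<alpha>)) (NMap \<alpha>) (NMap \<beta>)\<rparr>"

definition whisker_left ::
  "('o, 'a, 'm) category_scheme \<Rightarrow> ('o, 'a) ifun \<Rightarrow> ('o, 'a) inat \<Rightarrow> ('o, 'a) inat" where
  "whisker_left E H \<alpha> =
     \<lparr>NDom = ifun_comp E H (NDom \<alpha>), NCod = ifun_comp E H (NCod \<alpha>), NMap = FAr H \<cdot>\<^bsub>E\<^esub> NMap \<alpha>\<rparr>"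

definition whisker_right ::
  "('o, 'a, 'm) category_scheme \<Rightarrow> ('o, 'a) inat \<Rightarrow> ('o, 'a) ifun \<Rightarrow> ('o, 'a) inat" where
  "whisker_right E \<alpha> K =
     \<lparr>NDom = ifun_comp E (NDom \<alpha>) K, NCod = ifun_comp E (NCod \<alpha>) K, NMap = NMap \<alpha> \<cdot>\<^bsub>E\<^esub> FOb K\<rparr>"


section \<open>The action of \<open>I\<^sup>*\<close> on internal categories\<close>

definition pull_icat ::
  "('o, 'a, 'm) cart_category_scheme \<Rightarrow> 'o \<Rightarrow> ('o, 'a) icat \<Rightarrow> ('a, 'a \<times> 'a \<times> 'a) icat" where
  "pull_icat E I X =
     \<lparr>IOb = pull_ob E I (IOb X), IAr = pull_ob E I (IAr X), ICp = pull_ob E I (ICp X),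
      ISrc = pull_ar E I (ISrc X), ITgt = pull_ar E I (ITgt X), IIde = pull_ar E I (IIde X),
      IFst = pull_ar E I (IFst X), ISnd = pull_ar E I (ISnd X), ICmp = pull_ar E I (ICmp X)\<rparr>"

definition pull_ifun ::
  "('o, 'a, 'm) cart_category_scheme \<Rightarrow> 'o \<Rightarrow> ('o, 'a) ifun \<Rightarrow> ('a, 'a \<times> 'a \<times> 'a) ifun" where
  "pull_ifun E I F =
     \<lparr>FDom = pull_icat E I (FDom F), FCod = pull_icat E I (FCod F),
      FOb = pull_ar E I (FOb F), FAr = pull_ar E I (FAr F)\<rparr>"

definition pull_inat ::
  "('o, 'a, 'm) cart_category_scheme \<Rightarrow> 'o \<Rightarrow> ('o, 'a) inat \<Rightarrow> ('a, 'a \<times> 'a \<times> 'a) inat" where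
  "pull_inat E I \<alpha> =
     \<lparr>NDom = pull_ifun E I (NDom \<alpha>), NCod = pull_ifun E I (NCod \<alpha>), NMap = pull_ar E I (NMap \<alpha>)\<rparr>"

text \<open>The canonical isomorphism \<open>1 \<cong> I\<^sup>*1\<close>.\<close>

definition pull_one_iso ::
  "('o, 'a, 'm) cart_category_scheme \<Rightarrow> 'o \<Rightarrow> ('a, 'a \<times> 'a \<times> 'a) ifun" where
  "pull_one_iso E I =
     (THE u. u \<in> hom (Cat (slice E I)) (One (Cat (slice E I))) (pull_icat E I (One (Cat E))))"

text \<open>The canonical isomorphism \<open>I\<^sup>*[D, A] \<cong> [I\<^sup>*D, I\<^sup>*A]\<close>. It is the transpose of
  \<open>I\<^sup>*[D, A] \<times> I\<^sup>*D \<cong> I\<^sup>*([D, A] \<times> D) \<rightarrow> I\<^sup>*A\<close>; the equation below is this condition, precomposed with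
  the canonical isomorphism \<open>I\<^sup>*([D, A] \<times> D) \<cong> I\<^sup>*[D, A] \<times> I\<^sup>*D\<close>.\<close>

definition pull_exp_iso ::
  "('o, 'a, 'm) cart_category_scheme \<Rightarrow> 'o \<Rightarrow> ('o, 'a) icat \<Rightarrow> ('o, 'a) icat \<Rightarrow>
     ('a, 'a \<times> 'a \<times> 'a) ifun" where
  "pull_exp_iso E I D A =
     (let C = Cat (slice E I); X = Exp (Cat E) D A; D' = pull_icat E I D; A' = pull_icat E I A in
       THE k. k \<in> hom C (pull_icat E I X) (Exp C D' A') \<and>
         Ev C D' A' \<cdot>\<^bsub>C\<^esub>
           pair C (k \<cdot>\<^bsub>C\<^esub> pull_ifun E I (Pr1 (Cat E) X D)) (pull_ifun E I (Pr2 (Cat E) X D))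
         = pull_ifun E I (Ev (Cat E) D A))"


section \<open>Cones and cocones\<close>

definition diag ::
  "('o, 'a, 'm) cart_category_scheme \<Rightarrow> ('o, 'a) icat \<Rightarrow> ('o, 'a) icat \<Rightarrow> ('o, 'a) ifun" where
  "diag E D A = transpose (Cat E) D A A (Pr1 (Cat E) A D)"

text \<open>The point \<open>1 \<rightarrow> [D, A]\<close> corresponding to a functor \<open>F : D \<rightarrow> A\<close>.\<close>

definition point :: "('o, 'a, 'm) cart_category_scheme \<Rightarrow> ('o, 'a) ifun \<Rightarrow> ('o, 'a) ifun" where
  "point E F =
     transpose (Cat E) (FDom F) (FCod F) (One (Cat E))
       (F \<cdot>\<^bsub>Cat E\<^esub> Pr2 (Cat E) (One (Cat E)) (FDom F))"

text \<open>A (co)cone is a pair \<open>(V, \<gamma>)\<close> of its vertex and its natural transformation.\<close>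

type_synonym ('o, 'a) icone = "('o, 'a) ifun \<times> ('o, 'a) inat"

definition is_cone ::
  "('o, 'a, 'm) cart_category_scheme \<Rightarrow> ('o, 'a) ifun \<Rightarrow> ('o, 'a) icone \<Rightarrow> bool" where
  "is_cone E F = (\<lambda>(V, \<gamma>).
     V \<in> hom (Cat E) (One (Cat E)) (FCod F) \<and> is_inat E \<gamma> \<and>
     NDom \<gamma> = diag E (FDom F) (FCod F) \<cdot>\<^bsub>Cat E\<^esub> V \<and> NCod \<gamma> = point E F)"

definition is_cocone ::
  "('o, 'a, 'm) cart_category_scheme \<Rightarrow> ('o, 'a) ifun \<Rightarrow> ('o, 'a) icone \<Rightarrow> bool" where
  "is_cocone E F = (\<lambda>(V, \<gamma>).
     V \<in> hom (Cat E) (One (Cat E)) (FCod F) \<and> is_inat E \<gamma> \<and>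
     NDom \<gamma> = point E F \<and> NCod \<gamma> = diag E (FDom F) (FCod F) \<cdot>\<^bsub>Cat E\<^esub> V)"

definition cone_map ::
  "('o, 'a, 'm) cart_category_scheme \<Rightarrow> ('o, 'a) ifun \<Rightarrow>
     ('o, 'a) icone \<Rightarrow> ('o, 'a) inat \<Rightarrow> ('o, 'a) icone \<Rightarrow> bool" where
  "cone_map E F c\<^sub>0 h c\<^sub>1 \<longleftrightarrow>
     is_inat E h \<and> NDom h = fst c\<^sub>0 \<and> NCod h = fst c\<^sub>1 \<and>
     inat_comp E (snd c\<^sub>1) (whisker_left E (diag E (FDom F) (FCod F)) h) = snd c\<^sub>0"

definition cocone_map ::
  "('o, 'a, 'm) cart_category_scheme \<Rightarrow> ('o, 'a) ifun \<Rightarrow>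
     ('o, 'a) icone \<Rightarrow> ('o, 'a) inat \<Rightarrow> ('o, 'a) icone \<Rightarrow> bool" where
  "cocone_map E F c\<^sub>0 h c\<^sub>1 \<longleftrightarrow>
     is_inat E h \<and> NDom h = fst c\<^sub>0 \<and> NCod h = fst c\<^sub>1 \<and>
     inat_comp E (whisker_left E (diag E (FDom F) (FCod F)) h) (snd c\<^sub>0) = snd c\<^sub>1"

definition Cones ::
  "('o, 'a, 'm) cart_category_scheme \<Rightarrow> ('o, 'a) ifun \<Rightarrow>
     (('o, 'a) icone, ('o, 'a) icone \<times> ('o, 'a) inat \<times> ('o, 'a) icone) category" where
  "Cones E F =
     \<lparr>Obj = {c. is_cone E F c},
      Arr = {(c, h, d). is_cone E F c \<and> is_cone E F d \<and> cone_map E F c h d},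
      Dom = (\<lambda>(c, h, d). c),
      Cod = (\<lambda>(c, h, d). d),
      Ide = (\<lambda>c. (c, inat_id E (fst c), c)),
      Comp = (\<lambda>(c', h', d') (c, h, d). (c, inat_comp E h' h, d'))\<rparr>"

definition Cocones ::
  "('o, 'a, 'm) cart_category_scheme \<Rightarrow> ('o, 'a) ifun \<Rightarrow>
     (('o, 'a) icone, ('o, 'a) icone \<times> ('o, 'a) inat \<times> ('o, 'a) icone) category" where
  "Cocones E F =
     \<lparr>Obj = {c. is_cocone E F c},
      Arr = {(c, h, d). is_cocone E F c \<and> is_cocone E F d \<and> cocone_map E F c h d},
      Dom = (\<lambda>(c, h, d). c),
      Cod = (\<lambda>(c, h, d). d),
      Ide = (\<lambda>c. (c, inat_id E (fst c), c)),
      Comp = (\<lambda>(c', h', d') (c, h, d). (c, inat_comp E h' h, d'))\<rparr>"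

text \<open>The image under \<open>I\<^sup>*\<close> of a (co)cone over \<open>F\<close>, reindexed along the canonical isomorphisms
  \<open>1 \<cong> I\<^sup>*1\<close> and \<open>I\<^sup>*[D, A] \<cong> [I\<^sup>*D, I\<^sup>*A]\<close>.\<close>

definition pull_icone ::
  "('o, 'a, 'm) cart_category_scheme \<Rightarrow> 'o \<Rightarrow> ('o, 'a) ifun \<Rightarrow> ('o, 'a) icone \<Rightarrow>
     ('a, 'a \<times> 'a \<times> 'a) icone" where
  "pull_icone E I F = (\<lambda>(V, \<gamma>).
     (pull_ifun E I V \<cdot>\<^bsub>Cat (slice E I)\<^esub> pull_one_iso E I,
      whisker_left (slice E I) (pull_exp_iso E I (FDom F) (FCod F))
        (whisker_right (slice E I) (pull_inat E I \<gamma>) (pull_one_iso E I))))"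

definition universal_cone ::
  "('o, 'a, 'm) cart_category_scheme \<Rightarrow> ('o, 'a) ifun \<Rightarrow> ('o, 'a) icone \<Rightarrow> bool" where
  "universal_cone E F c \<longleftrightarrow>
     is_cone E F c \<and>
     (\<forall>I\<in>Obj E. is_terminal (Cones (slice E I) (pull_ifun E I F)) (pull_icone E I F c))"

definition universal_cocone ::
  "('o, 'a, 'm) cart_category_scheme \<Rightarrow> ('o, 'a) ifun \<Rightarrow> ('o, 'a) icone \<Rightarrow> bool" where
  "universal_cocone E F c \<longleftrightarrow>
     is_cocone E F c \<and>
     (\<forall>I\<in>Obj E. is_initial (Cocones (slice E I) (pull_ifun E I F)) (pull_icone E I F c))"


section \<open>Completeness and cocompleteness\<close>

definition internally_complete ::
  "('o, 'a, 'm) cart_category_scheme \<Rightarrow> ('o, 'a) icat \<Rightarrow> bool" where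
  "internally_complete E A \<longleftrightarrow>
     (\<forall>I\<in>Obj E. \<forall>F. is_ifun (slice E I) F \<and> FCod F = pull_icat E I A \<longrightarrow>
        (\<exists>c. universal_cone (slice E I) F c))"

definition internally_cocomplete ::
  "('o, 'a, 'm) cart_category_scheme \<Rightarrow> ('o, 'a) icat \<Rightarrow> bool" where
  "internally_cocomplete E A \<longleftrightarrow>
     (\<forall>I\<in>Obj E. \<forall>F. is_ifun (slice E I) F \<and> FCod F = pull_icat E I A \<longrightarrow>
        (\<exists>c. universal_cocone (slice E I) F c))"

end

theory Submission
  imports Defs
begin

text \<open>A colimit of \<open>F\<close> is the limit of the projection to \<open>A\<close> from the category of cocones over \<open>F\<close>, and
  internally this category is small. Because \<open>C\<close> is cartesian closed with equalisers,
  cocones over \<open>F\<close> with parameters in \<open>Z\<close> are represented by an object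
  \<open>N\<close>; an arrow of \<open>A\<close> out of the vertex of a cocone extends that cocone,
  so \<open>N\<close> and the pullback of the source map of \<open>A\<close> along the vertex map
  \<open>N \<rightarrow> A\<close> form an internal category with a functor to \<open>A\<close>. The
  limit \<open>L\<close> of this functor carries a cocone \<open>c\<close> by the universal
  property, and the leg of the limit cone at \<open>c\<close> is the identity, which makes
  \<open>c\<close> initial. The converse is the same statement for the opposite category.

  Everything is stable under \<open>I\<^sup>*\<close> because cones over \<open>I\<^sup>*F\<close> are \<open>I\<close>-indexed families of cones over \<open>F\<close>,
  and the argument applies in every slice because an iterated slice of \<open>C\<close> is isomorphic to a
  slice of \<open>C\<close>.\<close>

text \<open>The obstacle lies between the definitions and the argument. A cone is a transformation
  between points of \<open>[D, A]\<close>, an exponential picked by choice from its universal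
  property in \<open>Cat\<close>. The base need not have coproducts, so there is no interval
  category through which that property would show what an arrow of \<open>[D, A]\<close> is. Hence
  one exponential is built by hand and its description is carried to the chosen one. From then on
  \<open>euniv\<close> and \<open>ecouniv\<close> express universality by arrows of the base alone:
  a stage \<open>Z\<close> replaces pulling back to the slice over \<open>Z\<close>, and the main
  argument never mentions slices.

  Equations are tested on generalised elements, arrows from an arbitrary stage. This form is stable
  under precomposition, so it survives every change of stage, and it lets the simplifier calculate
  as with sets. The solution set of the classical adjoint functor theorem has no counterpart here:
  the diagram is indexed by all cocones, and the colimit cocone occurs among them.\<close>

locale cart =
  fixes C :: "('o, 'a) cart_category" (structure)
  assumes cartesian: "cartesian C"
begin

section \<open>Calculus of generalised elements in a category with chosen finite products\<close>

lemma is_cat: "is_category C"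
  using cartesian by (simp add: cartesian_def)

lemma in_hom_iff [simp]: "f \<in> hom C X Y \<longleftrightarrow> f \<in> Arr C \<and> Dom C f = X \<and> Cod C f = Y"
  by (simp add: hom_def)

lemma Obj_Dom [simp]: "f \<in> Arr C \<Longrightarrow> Dom C f \<in> Obj C"
  and Obj_Cod [simp]: "f \<in> Arr C \<Longrightarrow> Cod C f \<in> Obj C"
  using is_cat by (auto simp: is_category_def)

lemma Ide_simps [simp]:
  "X \<in> Obj C \<Longrightarrow> Ide C X \<in> Arr C"
  "X \<in> Obj C \<Longrightarrow> Dom C (Ide C X) = X"
  "X \<in> Obj C \<Longrightarrow> Cod C (Ide C X) = X"
  using is_cat by (auto simp: is_category_def)

lemma comp_in_hom:
  assumes "f \<in> Arr C" "g \<in> Arr C" "Cod C f = Dom C g"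
  shows "g \<cdot> f \<in> hom C (Dom C f) (Cod C g)"
proof -
  have "\<forall>X\<in>Obj C. \<forall>Y\<in>Obj C. \<forall>Z\<in>Obj C. \<forall>f\<in>hom C X Y. \<forall>g\<in>hom C Y Z. g \<cdot> f \<in> hom C X Z"
    using is_cat by (simp add: is_category_def)
  then show ?thesis
    using assms by (metis Obj_Cod Obj_Dom in_hom_iff)
qed

lemma comp_simps [simp]:
  assumes "f \<in> Arr C" "g \<in> Arr C" "Cod C f = Dom C g"
  shows "g \<cdot> f \<in> Arr C" "Dom C (g \<cdot> f) = Dom C f" "Cod C (g \<cdot> f) = Cod C g"
  using comp_in_hom[OF assms] by simp_all

lemma comp_Ide [simp]:
  "f \<in> Arr C \<Longrightarrow> Dom C f = X \<Longrightarrow> f \<cdot> Ide C X = f"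
  "f \<in> Arr C \<Longrightarrow> Cod C f = X \<Longrightarrow> Ide C X \<cdot> f = f"
  using is_cat by (auto simp: is_category_def)

lemma comp_assoc [simp]:
  "f \<in> Arr C \<Longrightarrow> g \<in> Arr C \<Longrightarrow> h \<in> Arr C \<Longrightarrow> Cod C f = Dom C g \<Longrightarrow> Cod C g = Dom C h \<Longrightarrow>
    (h \<cdot> g) \<cdot> f = h \<cdot> (g \<cdot> f)"
  using is_cat by (auto simp: is_category_def)

text \<open>The simplifier associates composites to the right, so a known equation
  \<open>f \<cdot> g = h\<close> no longer matches inside a longer composite. This rule restates it
  for that position; it is how nearly every equation between arrows is evaluated at an
  element.\<close>

lemma comp_eq_comp:
  assumes "f \<cdot> g = h" "f \<in> Arr C" "g \<in> Arr C" "Cod C g = Dom C f" "x \<in> Arr C" "Cod C x = Dom C g"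
  shows "f \<cdot> (g \<cdot> x) = h \<cdot> x"
  using assms by (metis comp_assoc)

definition bang :: "'o \<Rightarrow> 'a" where
  "bang Z = (THE u. u \<in> hom C Z (One C))"

lemma One_Obj [simp]: "One C \<in> Obj C"
  using cartesian by (simp add: cartesian_def is_terminal_def)

lemma One_unique: "Z \<in> Obj C \<Longrightarrow> \<exists>!u. u \<in> hom C Z (One C)"
  using cartesian by (auto simp: cartesian_def is_terminal_def)

lemma bang_simps [simp]:
  "Z \<in> Obj C \<Longrightarrow> bang Z \<in> Arr C"
  "Z \<in> Obj C \<Longrightarrow> Dom C (bang Z) = Z"
  "Z \<in> Obj C \<Longrightarrow> Cod C (bang Z) = One C"
  using theI'[OF One_unique, folded bang_def] by auto

lemma bang_eq: "u \<in> Arr C \<Longrightarrow> Cod C u = One C \<Longrightarrow> u = bang (Dom C u)"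
  using One_unique[of "Dom C u"] bang_simps[of "Dom C u"] by auto

lemma bang_comp [simp]: "u \<in> Arr C \<Longrightarrow> Cod C u = Z \<Longrightarrow> bang Z \<cdot> u = bang (Dom C u)"
  using bang_eq[of "bang Z \<cdot> u"] by auto

lemma bang_One [simp]: "bang (One C) = Ide C (One C)"
  using bang_eq[of "Ide C (One C)"] by simp

lemma product: "X \<in> Obj C \<Longrightarrow> Y \<in> Obj C \<Longrightarrow> is_product C X Y (Prod C X Y) (Pr1 C X Y) (Pr2 C X Y)"
  using cartesian by (simp add: cartesian_def)

lemma Prod_simps [simp]:
  assumes "X \<in> Obj C" "Y \<in> Obj C"
  shows "Prod C X Y \<in> Obj C"
    "Pr1 C X Y \<in> Arr C" "Dom C (Pr1 C X Y) = Prod C X Y" "Cod C (Pr1 C X Y) = X"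
    "Pr2 C X Y \<in> Arr C" "Dom C (Pr2 C X Y) = Prod C X Y" "Cod C (Pr2 C X Y) = Y"
  using product[OF assms] by (auto simp: is_product_def)

lemma pair_unique:
  assumes "f \<in> Arr C" "g \<in> Arr C" "Dom C f = Dom C g"
  shows "\<exists>!u. u \<in> hom C (Dom C f) (Prod C (Cod C f) (Cod C g)) \<and>
    Pr1 C (Cod C f) (Cod C g) \<cdot> u = f \<and> Pr2 C (Cod C f) (Cod C g) \<cdot> u = g"
proof -
  have "is_product C (Cod C f) (Cod C g) (Prod C (Cod C f) (Cod C g))
      (Pr1 C (Cod C f) (Cod C g)) (Pr2 C (Cod C f) (Cod C g))"
    using assms by (simp add: product)
  then have "\<forall>Z\<in>Obj C. \<forall>f'\<in>hom C Z (Cod C f). \<forall>g'\<in>hom C Z (Cod C g).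
        \<exists>!u. u \<in> hom C Z (Prod C (Cod C f) (Cod C g)) \<and> Pr1 C (Cod C f) (Cod C g) \<cdot> u = f' \<and>
          Pr2 C (Cod C f) (Cod C g) \<cdot> u = g'"
    unfolding is_product_def by blast
  moreover have "f \<in> hom C (Dom C f) (Cod C f)" "g \<in> hom C (Dom C f) (Cod C g)" "Dom C f \<in> Obj C"
    using assms by auto
  ultimately show ?thesis by blast
qed

lemma pair_simps:
  assumes "f \<in> Arr C" "g \<in> Arr C" "Dom C f = Dom C g"
  shows "pair C f g \<in> Arr C" "Dom C (pair C f g) = Dom C f"
    "Cod C (pair C f g) = Prod C (Cod C f) (Cod C g)"
    "Pr1 C (Cod C f) (Cod C g) \<cdot> pair C f g = f" "Pr2 C (Cod C f) (Cod C g) \<cdot> pair C f g = g"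
  using theI'[OF pair_unique[OF assms], folded pair_def] by auto

lemma pair_simps' [simp]:
  assumes "f \<in> Arr C" "g \<in> Arr C" "Dom C f = Dom C g"
  shows "pair C f g \<in> Arr C" "Dom C (pair C f g) = Dom C f"
    "Cod C (pair C f g) = Prod C (Cod C f) (Cod C g)"
    "Cod C f = X \<Longrightarrow> Cod C g = Y \<Longrightarrow> Pr1 C X Y \<cdot> pair C f g = f"
    "Cod C f = X \<Longrightarrow> Cod C g = Y \<Longrightarrow> Pr2 C X Y \<cdot> pair C f g = g"
  using pair_simps[OF assms] by auto

lemma Prod_ext:
  assumes "u \<in> Arr C" "v \<in> Arr C" "Dom C u = Dom C v" "Cod C u = Prod C X Y" "Cod C v = Prod C X Y"
    and "X \<in> Obj C" "Y \<in> Obj C"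
    and "Pr1 C X Y \<cdot> u = Pr1 C X Y \<cdot> v" "Pr2 C X Y \<cdot> u = Pr2 C X Y \<cdot> v"
  shows "u = v"
  using pair_unique[of "Pr1 C X Y \<cdot> v" "Pr2 C X Y \<cdot> v"] assms by auto

lemma pair_eta [simp]:
  "u \<in> Arr C \<Longrightarrow> Cod C u = Prod C X Y \<Longrightarrow> X \<in> Obj C \<Longrightarrow> Y \<in> Obj C \<Longrightarrow>
    pair C (Pr1 C X Y \<cdot> u) (Pr2 C X Y \<cdot> u) = u"
  by (rule Prod_ext[of _ _ X Y]) auto

lemma pair_Pr [simp]:
  "X \<in> Obj C \<Longrightarrow> Y \<in> Obj C \<Longrightarrow> pair C (Pr1 C X Y) (Pr2 C X Y) = Ide C (Prod C X Y)"
  by (rule Prod_ext[of _ _ X Y]) auto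

lemma pair_comp [simp]:
  assumes "f \<in> Arr C" "g \<in> Arr C" "Dom C f = Dom C g" "u \<in> Arr C" "Cod C u = Dom C f"
  shows "pair C f g \<cdot> u = pair C (f \<cdot> u) (g \<cdot> u)"
proof (rule Prod_ext[of _ _ "Cod C f" "Cod C g"])
  show "Pr1 C (Cod C f) (Cod C g) \<cdot> (pair C f g \<cdot> u) = Pr1 C (Cod C f) (Cod C g) \<cdot> pair C (f \<cdot> u) (g \<cdot> u)"
    using comp_assoc[of u "pair C f g" "Pr1 C (Cod C f) (Cod C g)"] assms by simp
  show "Pr2 C (Cod C f) (Cod C g) \<cdot> (pair C f g \<cdot> u) = Pr2 C (Cod C f) (Cod C g) \<cdot> pair C (f \<cdot> u) (g \<cdot> u)"
    using comp_assoc[of u "pair C f g" "Pr2 C (Cod C f) (Cod C g)"] assms by simp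
qed (use assms in auto)

lemma pair_inject [simp]:
  assumes "f \<in> Arr C" "g \<in> Arr C" "Dom C f = Dom C g" "f' \<in> Arr C" "g' \<in> Arr C" "Dom C f' = Dom C g'"
    "Cod C f' = Cod C f" "Cod C g' = Cod C g"
  shows "pair C f g = pair C f' g' \<longleftrightarrow> f = f' \<and> g = g'"
  using pair_simps[OF assms(1-3)] pair_simps[OF assms(4-6)] assms by metis

lemma prod_map_eq [simp]:
  "Dom C f = X \<Longrightarrow> Dom C g = Y \<Longrightarrow>
    prod_map C f g = pair C (f \<cdot> Pr1 C X Y) (g \<cdot> Pr2 C X Y)"
  by (simp add: prod_map_def)

text \<open>The two projections form the generic pair of elements: their pairing is the identity, so
  agreement at that single pair is already agreement of the arrows.\<close>

lemma Prod_arr_ext: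
  assumes "f \<in> hom C (Prod C X Y) Z" "g \<in> hom C (Prod C X Y) Z" "X \<in> Obj C" "Y \<in> Obj C"
    and "\<And>x y. x \<in> Arr C \<Longrightarrow> y \<in> Arr C \<Longrightarrow> Dom C x = Dom C y \<Longrightarrow> Cod C x = X \<Longrightarrow> Cod C y = Y \<Longrightarrow>
      f \<cdot> pair C x y = g \<cdot> pair C x y"
  shows "f = g"
  using assms(1-4) assms(5)[of "Pr1 C X Y" "Pr2 C X Y"] by simp

lemma arr_ext:
  assumes "f \<in> Arr C" "g \<in> Arr C" "Dom C f = X" "Dom C g = X"
    and "\<And>x. x \<in> Arr C \<Longrightarrow> Cod C x = X \<Longrightarrow> f \<cdot> x = g \<cdot> x"
  shows "f = g"
  using assms(1-4) assms(5)[of "Ide C X"] by auto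

section \<open>Internal categories through generalised elements\<close>

lemma icat_data [simp]:
  assumes "is_icat C X"
  shows "IOb X \<in> Obj C" "IAr X \<in> Obj C" "ICp X \<in> Obj C"
    "ISrc X \<in> Arr C" "Dom C (ISrc X) = IAr X" "Cod C (ISrc X) = IOb X"
    "ITgt X \<in> Arr C" "Dom C (ITgt X) = IAr X" "Cod C (ITgt X) = IOb X"
    "IIde X \<in> Arr C" "Dom C (IIde X) = IOb X" "Cod C (IIde X) = IAr X"
    "ICmp X \<in> Arr C" "Dom C (ICmp X) = ICp X" "Cod C (ICmp X) = IAr X"
    "IFst X \<in> Arr C" "Dom C (IFst X) = ICp X" "Cod C (IFst X) = IAr X"
    "ISnd X \<in> Arr C" "Dom C (ISnd X) = ICp X" "Cod C (ISnd X) = IAr X"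
  using assms by (auto simp: is_icat_def is_pullback_def)

definition composable :: "('o, 'a) icat \<Rightarrow> 'a \<Rightarrow> 'a \<Rightarrow> bool" where
  "composable X f g \<longleftrightarrow> f \<in> Arr C \<and> g \<in> Arr C \<and> Dom C f = Dom C g \<and> Cod C f = IAr X \<and> Cod C g = IAr X \<and>
    ITgt X \<cdot> f = ISrc X \<cdot> g"

lemma pullback_simps:
  assumes "is_pullback C f g P p q"
  shows "P \<in> Obj C" "p \<in> hom C P (Dom C f)" "q \<in> hom C P (Dom C g)" "f \<cdot> p = g \<cdot> q"
  using assms unfolding is_pullback_def by blast+

lemma pullback_unique:
  assumes "is_pullback C f g P p q" "h \<in> Arr C" "k \<in> Arr C" "Dom C h = Dom C k"
    "Cod C h = Dom C f" "Cod C k = Dom C g" "f \<cdot> h = g \<cdot> k"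
  shows "\<exists>!u. u \<in> hom C (Dom C h) P \<and> p \<cdot> u = h \<and> q \<cdot> u = k"
proof -
  have "\<forall>Z\<in>Obj C. \<forall>h\<in>hom C Z (Dom C f). \<forall>k\<in>hom C Z (Dom C g). f \<cdot> h = g \<cdot> k \<longrightarrow>
        (\<exists>!u. u \<in> hom C Z P \<and> p \<cdot> u = h \<and> q \<cdot> u = k)"
    using assms(1) unfolding is_pullback_def by blast
  moreover have "h \<in> hom C (Dom C h) (Dom C f)" "k \<in> hom C (Dom C h) (Dom C g)"
    using assms by auto
  ultimately show ?thesis
    using assms(2,7) Obj_Dom by blast
qed

text \<open>The definite description inside \<open>icomp\<close>, isolated so that composing is
  pairing followed by \<open>ICmp\<close>.\<close>

definition ipair :: "('o, 'a) icat \<Rightarrow> 'a \<Rightarrow> 'a \<Rightarrow> 'a" where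
  "ipair X f g = (THE u. u \<in> hom C (Dom C f) (ICp X) \<and> IFst X \<cdot> u = f \<and> ISnd X \<cdot> u = g)"

lemma icomp_ipair: "icomp C X f g = ICmp X \<cdot> ipair X f g"
  by (simp add: icomp_def ipair_def)

text \<open>Stated from the pullback property, so that it is available while a structure is still
  being shown to be an internal category, as in \<open>icatI\<close> and
  \<open>icat_exists\<close>.\<close>

lemma ipair_unique:
  assumes "is_pullback C (ITgt X) (ISrc X) (ICp X) (IFst X) (ISnd X)"
    "Dom C (ITgt X) = IAr X" "Dom C (ISrc X) = IAr X" "composable X f g"
  shows "\<exists>!u. u \<in> hom C (Dom C f) (ICp X) \<and> IFst X \<cdot> u = f \<and> ISnd X \<cdot> u = g"
  using pullback_unique[OF assms(1)] assms(2-) by (auto simp: composable_def)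

lemma ipair_simps:
  assumes "is_pullback C (ITgt X) (ISrc X) (ICp X) (IFst X) (ISnd X)"
    "Dom C (ITgt X) = IAr X" "Dom C (ISrc X) = IAr X" "composable X f g"
  shows "ipair X f g \<in> Arr C" "Dom C (ipair X f g) = Dom C f" "Cod C (ipair X f g) = ICp X"
    "IFst X \<cdot> ipair X f g = f" "ISnd X \<cdot> ipair X f g = g"
  using theI'[OF ipair_unique[OF assms], folded ipair_def] by auto

lemma ipair_eqI:
  assumes "is_pullback C (ITgt X) (ISrc X) (ICp X) (IFst X) (ISnd X)"
    "Dom C (ITgt X) = IAr X" "Dom C (ISrc X) = IAr X" "composable X f g"
    and "u \<in> Arr C" "Dom C u = Dom C f" "Cod C u = ICp X" "IFst X \<cdot> u = f" "ISnd X \<cdot> u = g"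
  shows "ipair X f g = u"
proof -
  have "u \<in> hom C (Dom C f) (ICp X) \<and> IFst X \<cdot> u = f \<and> ISnd X \<cdot> u = g"
    "ipair X f g \<in> hom C (Dom C f) (ICp X) \<and> IFst X \<cdot> ipair X f g = f \<and> ISnd X \<cdot> ipair X f g = g"
    using assms(5-) ipair_simps[OF assms(1-4)] by simp_all
  then show ?thesis
    using ipair_unique[OF assms(1-4)] by blast
qed

lemma icat_pb:
  assumes "is_icat C X"
  shows "is_pullback C (ITgt X) (ISrc X) (ICp X) (IFst X) (ISnd X)"
    "Dom C (ITgt X) = IAr X" "Dom C (ISrc X) = IAr X"
proof -
  show "is_pullback C (ITgt X) (ISrc X) (ICp X) (IFst X) (ISnd X)"
    using assms unfolding is_icat_def by blast
qed (use assms in simp_all)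

lemma composable_comp:
  assumes "is_icat C X" "composable X f g" "u \<in> Arr C" "Cod C u = Dom C f"
  shows "composable X (f \<cdot> u) (g \<cdot> u)"
proof -
  have "ITgt X \<cdot> (f \<cdot> u) = ISrc X \<cdot> (g \<cdot> u)"
    using assms comp_eq_comp[of "ITgt X" f "ISrc X \<cdot> g" u] by (simp add: composable_def)
  then show ?thesis
    using assms by (simp add: composable_def)
qed

text \<open>Composition is natural in the stage, because the arrow into the pullback of composable
  pairs is unique and hence commutes with precomposition.\<close>

lemma icomp_comp:
  assumes "is_icat C X" "composable X f g" "u \<in> Arr C" "Cod C u = Dom C f"
  shows "icomp C X f g \<cdot> u = icomp C X (f \<cdot> u) (g \<cdot> u)"
proof -
  note pb = icat_pb[OF assms(1)]
  note i = ipair_simps[OF pb assms(2)]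
  have "ipair X (f \<cdot> u) (g \<cdot> u) = ipair X f g \<cdot> u"
    apply (rule ipair_eqI[OF pb composable_comp[OF assms]])
    using assms i comp_eq_comp[OF i(4), of u] comp_eq_comp[OF i(5), of u]
    by (auto simp: composable_def)
  then show ?thesis
    using assms i by (simp add: icomp_ipair)
qed

lemma icomp_typing:
  assumes "is_icat C X" "composable X f g"
  shows "icomp C X f g \<in> Arr C" "Dom C (icomp C X f g) = Dom C f" "Cod C (icomp C X f g) = IAr X"
    "ISrc X \<cdot> icomp C X f g = ISrc X \<cdot> f" "ITgt X \<cdot> icomp C X f g = ITgt X \<cdot> g"
proof -
  note i = ipair_simps[OF icat_pb[OF assms(1)] assms(2)]
  show "icomp C X f g \<in> Arr C" "Dom C (icomp C X f g) = Dom C f" "Cod C (icomp C X f g) = IAr X"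
    by (simp_all add: icomp_ipair assms(1) i)
  have s: "ISrc X \<cdot> ICmp X = ISrc X \<cdot> IFst X" "ITgt X \<cdot> ICmp X = ITgt X \<cdot> ISnd X"
    using assms(1) unfolding is_icat_def by blast+
  have "ISrc X \<cdot> (ICmp X \<cdot> ipair X f g) = (ISrc X \<cdot> IFst X) \<cdot> ipair X f g"
    by (rule comp_eq_comp[OF s(1)]) (simp_all add: assms(1) i)
  moreover have "ITgt X \<cdot> (ICmp X \<cdot> ipair X f g) = (ITgt X \<cdot> ISnd X) \<cdot> ipair X f g"
    by (rule comp_eq_comp[OF s(2)]) (simp_all add: assms(1) i)
  ultimately show "ISrc X \<cdot> icomp C X f g = ISrc X \<cdot> f" "ITgt X \<cdot> icomp C X f g = ITgt X \<cdot> g"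
    by (simp_all add: icomp_ipair assms(1) i)
qed

lemma icat_Ide0 [simp]:
  assumes "is_icat C X"
  shows "ISrc X \<cdot> IIde X = Ide C (IOb X)" "ITgt X \<cdot> IIde X = Ide C (IOb X)"
  using assms unfolding is_icat_def by blast+

lemma icat_Ide [simp]:
  assumes "is_icat C X" "x \<in> Arr C" "Cod C x = IOb X"
  shows "ISrc X \<cdot> (IIde X \<cdot> x) = x" "ITgt X \<cdot> (IIde X \<cdot> x) = x"
proof -
  note s = icat_Ide0[OF assms(1)]
  show "ISrc X \<cdot> (IIde X \<cdot> x) = x" "ITgt X \<cdot> (IIde X \<cdot> x) = x"
    using assms comp_eq_comp[OF s(1), of x] comp_eq_comp[OF s(2), of x] by auto
qed

lemma icomp_simps [simp]:
  assumes "is_icat C X" "f \<in> Arr C" "g \<in> Arr C" "Dom C f = Dom C g" "Cod C f = IAr X" "Cod C g = IAr X"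
    "ITgt X \<cdot> f = ISrc X \<cdot> g"
  shows "icomp C X f g \<in> Arr C" "Dom C (icomp C X f g) = Dom C f" "Cod C (icomp C X f g) = IAr X"
    "ISrc X \<cdot> icomp C X f g = ISrc X \<cdot> f" "ITgt X \<cdot> icomp C X f g = ITgt X \<cdot> g"
    "u \<in> Arr C \<Longrightarrow> Cod C u = Dom C f \<Longrightarrow> icomp C X f g \<cdot> u = icomp C X (f \<cdot> u) (g \<cdot> u)"
  using icomp_typing[OF assms(1), of f g] icomp_comp[OF assms(1), of f g u] assms
  by (auto simp: composable_def)

lemma icomp_Ide [simp]:
  assumes "is_icat C X" "f \<in> Arr C" "Cod C f = IAr X"
  shows "ISrc X \<cdot> f = x \<Longrightarrow> icomp C X (IIde X \<cdot> x) f = f"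
    "ITgt X \<cdot> f = x \<Longrightarrow> icomp C X f (IIde X \<cdot> x) = f"
proof -
  let ?I = "Ide C (IAr X)"
  have "icomp C X (IIde X \<cdot> ISrc X) ?I = ?I" "icomp C X ?I (IIde X \<cdot> ITgt X) = ?I"
    using assms unfolding is_icat_def by blast+
  then have "icomp C X (IIde X \<cdot> ISrc X) ?I \<cdot> f = f" "icomp C X ?I (IIde X \<cdot> ITgt X) \<cdot> f = f"
    using assms by auto
  then show "ISrc X \<cdot> f = x \<Longrightarrow> icomp C X (IIde X \<cdot> x) f = f"
    "ITgt X \<cdot> f = x \<Longrightarrow> icomp C X f (IIde X \<cdot> x) = f"
    using assms by auto
qed

lemma icomp_assoc:
  assumes "is_icat C X" "f \<in> Arr C" "g \<in> Arr C" "h \<in> Arr C" "Dom C f = Dom C g" "Dom C g = Dom C h"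
    "Cod C f = IAr X" "Cod C g = IAr X" "Cod C h = IAr X"
    "ITgt X \<cdot> f = ISrc X \<cdot> g" "ITgt X \<cdot> g = ISrc X \<cdot> h"
  shows "icomp C X (icomp C X f g) h = icomp C X f (icomp C X g h)"
proof -
  have "\<forall>Z\<in>Obj C. \<forall>f\<in>hom C Z (IAr X). \<forall>g\<in>hom C Z (IAr X). \<forall>h\<in>hom C Z (IAr X).
        ITgt X \<cdot> f = ISrc X \<cdot> g \<and> ITgt X \<cdot> g = ISrc X \<cdot> h \<longrightarrow>
        icomp C X (icomp C X f g) h = icomp C X f (icomp C X g h)"
    using assms(1) unfolding is_icat_def by blast
  then show ?thesis
    using assms by (metis in_hom_iff Obj_Dom)
qed

text \<open>The axioms of \<open>is_icat\<close> on endpoints and units are equations between fixed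
  arrows. Asking for them at all elements is more convenient to prove, and the fixed arrows are
  recovered at the generic element: the identity of \<open>IAr X\<close> for the unit laws, the pair
  \<open>IFst X\<close>, \<open>ISnd X\<close> for the endpoints of composites.\<close>

lemma icatI:
  assumes "IOb X \<in> Obj C" "IAr X \<in> Obj C" "ISrc X \<in> hom C (IAr X) (IOb X)" "ITgt X \<in> hom C (IAr X) (IOb X)"
    "IIde X \<in> hom C (IOb X) (IAr X)" "ICmp X \<in> hom C (ICp X) (IAr X)"
    "is_pullback C (ITgt X) (ISrc X) (ICp X) (IFst X) (ISnd X)"
    "ISrc X \<cdot> IIde X = Ide C (IOb X)" "ITgt X \<cdot> IIde X = Ide C (IOb X)"
    and src_tgt: "\<And>f g. composable X f g \<Longrightarrow> ISrc X \<cdot> icomp C X f g = ISrc X \<cdot> f"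
      "\<And>f g. composable X f g \<Longrightarrow> ITgt X \<cdot> icomp C X f g = ITgt X \<cdot> g"
    and unit: "\<And>f. f \<in> Arr C \<Longrightarrow> Cod C f = IAr X \<Longrightarrow> icomp C X (IIde X \<cdot> (ISrc X \<cdot> f)) f = f"
      "\<And>f. f \<in> Arr C \<Longrightarrow> Cod C f = IAr X \<Longrightarrow> icomp C X f (IIde X \<cdot> (ITgt X \<cdot> f)) = f"
    and assoc: "\<And>f g h. composable X f g \<Longrightarrow> composable X g h \<Longrightarrow>
      icomp C X (icomp C X f g) h = icomp C X f (icomp C X g h)"
  shows "is_icat C X"
proof -
  note pb = assms(7)
  have d: "Dom C (ITgt X) = IAr X" "Dom C (ISrc X) = IAr X"
    using assms by auto
  have c: "composable X (IFst X) (ISnd X)"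
    using pullback_simps[OF pb] d by (auto simp: composable_def)
  \<comment> \<open>The two projections are the generic composable pair, so their composite is
    \<open>ICmp X\<close> itself.\<close>
  have "ipair X (IFst X) (ISnd X) = Ide C (ICp X)"
    using ipair_eqI[OF pb d c, of "Ide C (ICp X)"] pullback_simps[OF pb] d by simp
  then have "icomp C X (IFst X) (ISnd X) = ICmp X"
    using assms(6) by (simp add: icomp_ipair)
  then have st: "ISrc X \<cdot> ICmp X = ISrc X \<cdot> IFst X" "ITgt X \<cdot> ICmp X = ITgt X \<cdot> ISnd X"
    using src_tgt[OF c] by auto
  have a: "\<forall>Z\<in>Obj C. \<forall>f\<in>hom C Z (IAr X). \<forall>g\<in>hom C Z (IAr X). \<forall>h\<in>hom C Z (IAr X).
        ITgt X \<cdot> f = ISrc X \<cdot> g \<and> ITgt X \<cdot> g = ISrc X \<cdot> h \<longrightarrow>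
        icomp C X (icomp C X f g) h = icomp C X f (icomp C X g h)"
    using assoc by (simp add: composable_def)
  have u: "icomp C X (IIde X \<cdot> ISrc X) (Ide C (IAr X)) = Ide C (IAr X)"
    "icomp C X (Ide C (IAr X)) (IIde X \<cdot> ITgt X) = Ide C (IAr X)"
    using unit[of "Ide C (IAr X)"] assms(1-5) by simp_all
  show ?thesis
    unfolding is_icat_def using assms(1-9) st a u by blast
qed

text \<open>An internal category may be given by composing generalised elements, naturally in the stage.\<close>

lemma icat_exists:
  assumes "X\<^sub>0 \<in> Obj C" "X\<^sub>1 \<in> Obj C" "s \<in> hom C X\<^sub>1 X\<^sub>0" "t \<in> hom C X\<^sub>1 X\<^sub>0" "i \<in> hom C X\<^sub>0 X\<^sub>1"
    "is_pullback C t s P p q" "s \<cdot> i = Ide C X\<^sub>0" "t \<cdot> i = Ide C X\<^sub>0"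
    and m: "\<And>f g. f \<in> Arr C \<Longrightarrow> g \<in> Arr C \<Longrightarrow> Cod C f = X\<^sub>1 \<Longrightarrow> Cod C g = X\<^sub>1 \<Longrightarrow> Dom C f = Dom C g \<Longrightarrow>
      t \<cdot> f = s \<cdot> g \<Longrightarrow> m f g \<in> hom C (Dom C f) X\<^sub>1 \<and> s \<cdot> m f g = s \<cdot> f \<and> t \<cdot> m f g = t \<cdot> g"
    and nat: "\<And>f g u. f \<in> Arr C \<Longrightarrow> g \<in> Arr C \<Longrightarrow> Cod C f = X\<^sub>1 \<Longrightarrow> Cod C g = X\<^sub>1 \<Longrightarrow> Dom C f = Dom C g \<Longrightarrow>
      t \<cdot> f = s \<cdot> g \<Longrightarrow> u \<in> Arr C \<Longrightarrow> Cod C u = Dom C f \<Longrightarrow> m f g \<cdot> u = m (f \<cdot> u) (g \<cdot> u)"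
    and unit: "\<And>f. f \<in> Arr C \<Longrightarrow> Cod C f = X\<^sub>1 \<Longrightarrow> m (i \<cdot> (s \<cdot> f)) f = f"
      "\<And>f. f \<in> Arr C \<Longrightarrow> Cod C f = X\<^sub>1 \<Longrightarrow> m f (i \<cdot> (t \<cdot> f)) = f"
    and assoc: "\<And>f g h. f \<in> Arr C \<Longrightarrow> g \<in> Arr C \<Longrightarrow> h \<in> Arr C \<Longrightarrow> Cod C f = X\<^sub>1 \<Longrightarrow> Cod C g = X\<^sub>1 \<Longrightarrow>
      Cod C h = X\<^sub>1 \<Longrightarrow> Dom C f = Dom C g \<Longrightarrow> Dom C g = Dom C h \<Longrightarrow> t \<cdot> f = s \<cdot> g \<Longrightarrow> t \<cdot> g = s \<cdot> h \<Longrightarrow>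
      m (m f g) h = m f (m g h)"
  shows "\<exists>X. is_icat C X \<and> IOb X = X\<^sub>0 \<and> IAr X = X\<^sub>1 \<and> ISrc X = s \<and> ITgt X = t \<and> IIde X = i \<and>
    (\<forall>f g. composable X f g \<longrightarrow> icomp C X f g = m f g)"
proof -
  \<comment> \<open>Composition is the value of \<open>m\<close> at the generic composable pair
    \<open>p\<close>, \<open>q\<close>. Naturality of \<open>m\<close> then determines it at every
    other pair.\<close>
  let ?X = "\<lparr>IOb = X\<^sub>0, IAr = X\<^sub>1, ICp = P, ISrc = s, ITgt = t, IIde = i, IFst = p, ISnd = q, ICmp = m p q\<rparr>"
  have pq: "p \<in> hom C P X\<^sub>1" "q \<in> hom C P X\<^sub>1" "t \<cdot> p = s \<cdot> q"
    using pullback_simps[OF assms(6)] assms(3,4) by simp_all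
  have pb: "is_pullback C (ITgt ?X) (ISrc ?X) (ICp ?X) (IFst ?X) (ISnd ?X)"
    "Dom C (ITgt ?X) = IAr ?X" "Dom C (ISrc ?X) = IAr ?X"
    using assms(3,4,6) by auto
  have m_eq: "icomp C ?X f g = m f g" if "composable ?X f g" for f g
  proof -
    define u where "u = ipair ?X f g"
    note u = ipair_simps[OF pb that, folded u_def, simplified]
    have "m p q \<cdot> u = m (p \<cdot> u) (q \<cdot> u)"
      using pq u by (intro nat) simp_all
    then show ?thesis
      using u by (simp add: icomp_ipair u_def)
  qed
  have c: "composable ?X f g \<longleftrightarrow> f \<in> Arr C \<and> g \<in> Arr C \<and> Cod C f = X\<^sub>1 \<and> Cod C g = X\<^sub>1 \<and>
    Dom C f = Dom C g \<and> t \<cdot> f = s \<cdot> g" for f g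
    by (auto simp: composable_def)
  have i: "s \<cdot> (i \<cdot> x) = x" "t \<cdot> (i \<cdot> x) = x" if "x \<in> Arr C" "Cod C x = X\<^sub>0" for x
    using that assms(1-8) comp_eq_comp[OF assms(7), of x] comp_eq_comp[OF assms(8), of x] by auto
  have "is_icat C ?X"
  proof (rule icatI)
    show "icomp C ?X (icomp C ?X f g) h = icomp C ?X f (icomp C ?X g h)"
      if "composable ?X f g" "composable ?X g h" for f g h
    proof -
      have "composable ?X (m f g) h" "composable ?X f (m g h)"
        using that m[of f g] m[of g h] by (auto simp: c)
      then show ?thesis
        using that assoc[of f g h] by (auto simp: m_eq c)
    qed
    show "icomp C ?X (IIde ?X \<cdot> (ISrc ?X \<cdot> f)) f = f" "icomp C ?X f (IIde ?X \<cdot> (ITgt ?X \<cdot> f)) = f"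
      if "f \<in> Arr C" "Cod C f = IAr ?X" for f
      using that unit[of f] m_eq[of "i \<cdot> (s \<cdot> f)" f] m_eq[of f "i \<cdot> (t \<cdot> f)"] assms(1-8)
      by (auto simp: c i)
  next
    fix f g assume "composable ?X f g"
    then show "ISrc ?X \<cdot> icomp C ?X f g = ISrc ?X \<cdot> f" "ITgt ?X \<cdot> icomp C ?X f g = ITgt ?X \<cdot> g"
      using m[of f g] by (auto simp: m_eq c)
  qed (use assms(1-8) pb m[of p q] pq in auto)
  then show ?thesis
    using m_eq by (intro exI[of _ ?X]) simp
qed


lemma pullbackI:
  assumes "f \<in> Arr C" "g \<in> Arr C" "Cod C f = Cod C g" "P \<in> Obj C"
    "p \<in> hom C P (Dom C f)" "q \<in> hom C P (Dom C g)" "f \<cdot> p = g \<cdot> q"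
    and ex: "\<And>h k. h \<in> Arr C \<Longrightarrow> k \<in> Arr C \<Longrightarrow> Dom C h = Dom C k \<Longrightarrow> Cod C h = Dom C f \<Longrightarrow> Cod C k = Dom C g \<Longrightarrow>
      f \<cdot> h = g \<cdot> k \<Longrightarrow> \<exists>u. u \<in> hom C (Dom C h) P \<and> p \<cdot> u = h \<and> q \<cdot> u = k"
    and un: "\<And>u v. u \<in> Arr C \<Longrightarrow> v \<in> Arr C \<Longrightarrow> Dom C u = Dom C v \<Longrightarrow> Cod C u = P \<Longrightarrow> Cod C v = P \<Longrightarrow>
      p \<cdot> u = p \<cdot> v \<Longrightarrow> q \<cdot> u = q \<cdot> v \<Longrightarrow> u = v"
  shows "is_pullback C f g P p q"
proof -
  have "\<exists>!u. u \<in> hom C Z P \<and> p \<cdot> u = h \<and> q \<cdot> u = k"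
    if hk: "h \<in> hom C Z (Dom C f)" "k \<in> hom C Z (Dom C g)" "f \<cdot> h = g \<cdot> k" for Z h k
  proof -
    obtain u where "u \<in> hom C Z P \<and> p \<cdot> u = h \<and> q \<cdot> u = k"
      using ex[of h k] hk by auto
    moreover have "v = w" if "v \<in> hom C Z P \<and> p \<cdot> v = h \<and> q \<cdot> v = k" "w \<in> hom C Z P \<and> p \<cdot> w = h \<and> q \<cdot> w = k"
      for v w
      by (rule un) (use that in auto)
    ultimately show ?thesis
      by blast
  qed
  then show ?thesis
    unfolding is_pullback_def using assms(1-7) by blast
qed

lemma pullback_ext:
  assumes "is_pullback C f g P p q" "u \<in> Arr C" "v \<in> Arr C" "Dom C u = Dom C v" "Cod C u = P" "Cod C v = P"
    "p \<cdot> u = p \<cdot> v" "q \<cdot> u = q \<cdot> v"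
  shows "u = v"
proof -
  note pb = pullback_simps[OF assms(1)]
  have fg: "f \<in> Arr C" "g \<in> Arr C"
    using assms(1) unfolding is_pullback_def by blast+
  have "f \<cdot> (p \<cdot> v) = g \<cdot> (q \<cdot> v)"
    using comp_eq_comp[OF pb(4), of v] pb assms(2-6) fg by simp
  then have "\<exists>!w. w \<in> hom C (Dom C (p \<cdot> v)) P \<and> p \<cdot> w = p \<cdot> v \<and> q \<cdot> w = q \<cdot> v"
    using pb fg assms(2-6) by (intro pullback_unique[OF assms(1)]) simp_all
  moreover have "u \<in> hom C (Dom C (p \<cdot> v)) P" "v \<in> hom C (Dom C (p \<cdot> v)) P"
    using pb assms(2-6) by simp_all
  ultimately show ?thesis
    using assms(7,8) by blast
qed

section \<open>Internal functors through generalised elements\<close>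

definition is_functor :: "('o, 'a) icat \<Rightarrow> ('o, 'a) icat \<Rightarrow> 'a \<Rightarrow> 'a \<Rightarrow> bool" where
  "is_functor X Y f\<^sub>0 f\<^sub>1 \<longleftrightarrow>
    f\<^sub>0 \<in> hom C (IOb X) (IOb Y) \<and> f\<^sub>1 \<in> hom C (IAr X) (IAr Y) \<and>
    (\<forall>f. f \<in> Arr C \<and> Cod C f = IAr X \<longrightarrow>
      ISrc Y \<cdot> (f\<^sub>1 \<cdot> f) = f\<^sub>0 \<cdot> (ISrc X \<cdot> f) \<and> ITgt Y \<cdot> (f\<^sub>1 \<cdot> f) = f\<^sub>0 \<cdot> (ITgt X \<cdot> f)) \<and>
    (\<forall>x. x \<in> Arr C \<and> Cod C x = IOb X \<longrightarrow> f\<^sub>1 \<cdot> (IIde X \<cdot> x) = IIde Y \<cdot> (f\<^sub>0 \<cdot> x)) \<and>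
    (\<forall>f g. composable X f g \<longrightarrow> f\<^sub>1 \<cdot> icomp C X f g = icomp C Y (f\<^sub>1 \<cdot> f) (f\<^sub>1 \<cdot> g))"

lemma functor_simps:
  assumes "is_functor X Y f\<^sub>0 f\<^sub>1"
  shows "f\<^sub>0 \<in> Arr C" "Dom C f\<^sub>0 = IOb X" "Cod C f\<^sub>0 = IOb Y"
    "f\<^sub>1 \<in> Arr C" "Dom C f\<^sub>1 = IAr X" "Cod C f\<^sub>1 = IAr Y"
    "\<And>f. f \<in> Arr C \<Longrightarrow> Cod C f = IAr X \<Longrightarrow> ISrc Y \<cdot> (f\<^sub>1 \<cdot> f) = f\<^sub>0 \<cdot> (ISrc X \<cdot> f)"
    "\<And>f. f \<in> Arr C \<Longrightarrow> Cod C f = IAr X \<Longrightarrow> ITgt Y \<cdot> (f\<^sub>1 \<cdot> f) = f\<^sub>0 \<cdot> (ITgt X \<cdot> f)"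
    "\<And>x. x \<in> Arr C \<Longrightarrow> Cod C x = IOb X \<Longrightarrow> f\<^sub>1 \<cdot> (IIde X \<cdot> x) = IIde Y \<cdot> (f\<^sub>0 \<cdot> x)"
    "\<And>f g. f \<in> Arr C \<Longrightarrow> g \<in> Arr C \<Longrightarrow> Dom C f = Dom C g \<Longrightarrow> Cod C f = IAr X \<Longrightarrow> Cod C g = IAr X \<Longrightarrow>
      ITgt X \<cdot> f = ISrc X \<cdot> g \<Longrightarrow> f\<^sub>1 \<cdot> icomp C X f g = icomp C Y (f\<^sub>1 \<cdot> f) (f\<^sub>1 \<cdot> g)"
  using assms unfolding is_functor_def composable_def by auto

lemma ipair_typing:
  assumes "is_icat C X" "composable X f g"
  shows "ipair X f g \<in> Arr C" "Dom C (ipair X f g) = Dom C f" "Cod C (ipair X f g) = ICp X"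
    "IFst X \<cdot> ipair X f g = f" "ISnd X \<cdot> ipair X f g = g"
  using ipair_simps[OF icat_pb[OF assms(1)] assms(2)] .

lemma composable_Fst_Snd:
  assumes "is_icat C X"
  shows "composable X (IFst X) (ISnd X)"
  using pullback_simps[OF icat_pb(1)[OF assms]] assms by (simp add: composable_def)

lemma icomp_Fst_Snd:
  assumes "is_icat C X"
  shows "icomp C X (IFst X) (ISnd X) = ICmp X"
  using ipair_eqI[OF icat_pb[OF assms] composable_Fst_Snd[OF assms], of "Ide C (ICp X)"] assms
  by (simp add: icomp_ipair)

text \<open>From left to right the equations are precomposed with an element; from right to left
  they are evaluated at identities and, for composition, at the generic composable pair. All later
  work with functors uses the elementwise side.\<close>

lemma is_ifun_iff:
  "is_ifun C F \<longleftrightarrow> is_icat C (FDom F) \<and> is_icat C (FCod F) \<and> is_functor (FDom F) (FCod F) (FOb F) (FAr F)"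
    (is "?L \<longleftrightarrow> ?R")
proof
  assume L: ?L
  obtain X Y f\<^sub>0 f\<^sub>1 where F: "F = \<lparr>FDom = X, FCod = Y, FOb = f\<^sub>0, FAr = f\<^sub>1\<rparr>"
    by (cases F)
  have c: "is_icat C X" "is_icat C Y"
    and t: "f\<^sub>0 \<in> hom C (IOb X) (IOb Y)" "f\<^sub>1 \<in> hom C (IAr X) (IAr Y)"
    and e: "ISrc Y \<cdot> f\<^sub>1 = f\<^sub>0 \<cdot> ISrc X" "ITgt Y \<cdot> f\<^sub>1 = f\<^sub>0 \<cdot> ITgt X" "f\<^sub>1 \<cdot> IIde X = IIde Y \<cdot> f\<^sub>0"
      "f\<^sub>1 \<cdot> ICmp X = icomp C Y (f\<^sub>1 \<cdot> IFst X) (f\<^sub>1 \<cdot> ISnd X)"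
    using L unfolding F is_ifun_def Let_def by simp_all
  have s: "ISrc Y \<cdot> (f\<^sub>1 \<cdot> f) = f\<^sub>0 \<cdot> (ISrc X \<cdot> f)" "ITgt Y \<cdot> (f\<^sub>1 \<cdot> f) = f\<^sub>0 \<cdot> (ITgt X \<cdot> f)"
    if "f \<in> Arr C" "Cod C f = IAr X" for f
    using c t that comp_eq_comp[OF e(1), of f] comp_eq_comp[OF e(2), of f] by simp_all
  have i: "f\<^sub>1 \<cdot> (IIde X \<cdot> x) = IIde Y \<cdot> (f\<^sub>0 \<cdot> x)" if "x \<in> Arr C" "Cod C x = IOb X" for x
    using c t that comp_eq_comp[OF e(3), of x] by simp
  have "f\<^sub>1 \<cdot> icomp C X f g = icomp C Y (f\<^sub>1 \<cdot> f) (f\<^sub>1 \<cdot> g)" if fg: "composable X f g" for f g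
  proof -
    define u where "u = ipair X f g"
    note u = ipair_typing[OF c(1) fg, folded u_def]
    note fs = composable_Fst_Snd[OF c(1)]
    have "f\<^sub>1 \<cdot> (ICmp X \<cdot> u) = icomp C Y (f\<^sub>1 \<cdot> IFst X) (f\<^sub>1 \<cdot> ISnd X) \<cdot> u"
      by (rule comp_eq_comp[OF e(4)]) (simp_all add: c t[simplified] u)
    also have "\<dots> = icomp C Y (f\<^sub>1 \<cdot> f) (f\<^sub>1 \<cdot> g)"
      using fs by (simp add: c t[simplified] u s composable_def)
    finally show ?thesis
      by (simp add: icomp_ipair u_def)
  qed
  then show ?R
    unfolding F using c t s i by (simp add: is_functor_def)
next
  assume R: ?R
  obtain X Y f\<^sub>0 f\<^sub>1 where F: "F = \<lparr>FDom = X, FCod = Y, FOb = f\<^sub>0, FAr = f\<^sub>1\<rparr>"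
    by (cases F)
  have c: "is_icat C X" "is_icat C Y" and f: "is_functor X Y f\<^sub>0 f\<^sub>1"
    using R unfolding F by simp_all
  note s = functor_simps[OF f]
  have "ISrc Y \<cdot> f\<^sub>1 = f\<^sub>0 \<cdot> ISrc X" "ITgt Y \<cdot> f\<^sub>1 = f\<^sub>0 \<cdot> ITgt X" "f\<^sub>1 \<cdot> IIde X = IIde Y \<cdot> f\<^sub>0"
    using s(7)[of "Ide C (IAr X)"] s(8)[of "Ide C (IAr X)"] s(9)[of "Ide C (IOb X)"] c s(1-6) by simp_all
  moreover have "f\<^sub>1 \<cdot> ICmp X = icomp C Y (f\<^sub>1 \<cdot> IFst X) (f\<^sub>1 \<cdot> ISnd X)"
    using s(10)[of "IFst X" "ISnd X"] icomp_Fst_Snd[OF c(1)] composable_Fst_Snd[OF c(1)] c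
    by (simp add: composable_def)
  ultimately show ?L
    unfolding F is_ifun_def Let_def using c s(1-6) by simp
qed

section \<open>The cartesian structure on internal categories\<close>

lemma Cat_simps:
  "Obj (Cat C) = {X. is_icat C X}" "Arr (Cat C) = {F. is_ifun C F}" "Dom (Cat C) = FDom" "Cod (Cat C) = FCod"
  "Ide (Cat C) = ifun_id C" "Comp (Cat C) = ifun_comp C" "One (Cat C) = icat_one C" "Prod (Cat C) = icat_prod C"
  "Pr1 (Cat C) X Y = \<lparr>FDom = icat_prod C X Y, FCod = X, FOb = Pr1 C (IOb X) (IOb Y), FAr = Pr1 C (IAr X) (IAr Y)\<rparr>"
  "Pr2 (Cat C) X Y = \<lparr>FDom = icat_prod C X Y, FCod = Y, FOb = Pr2 C (IOb X) (IOb Y), FAr = Pr2 C (IAr X) (IAr Y)\<rparr>"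
  by (simp_all add: Cat_def)

lemma icat_prod_simps [simp]:
  "IOb (icat_prod C X Y) = Prod C (IOb X) (IOb Y)" "IAr (icat_prod C X Y) = Prod C (IAr X) (IAr Y)"
  "ICp (icat_prod C X Y) = Prod C (ICp X) (ICp Y)"
  "ISrc (icat_prod C X Y) = prod_map C (ISrc X) (ISrc Y)" "ITgt (icat_prod C X Y) = prod_map C (ITgt X) (ITgt Y)"
  "IIde (icat_prod C X Y) = prod_map C (IIde X) (IIde Y)" "IFst (icat_prod C X Y) = prod_map C (IFst X) (IFst Y)"
  "ISnd (icat_prod C X Y) = prod_map C (ISnd X) (ISnd Y)" "ICmp (icat_prod C X Y) = prod_map C (ICmp X) (ICmp Y)"
  by (simp_all add: icat_prod_def)

lemma Prod_cases:
  assumes "f \<in> Arr C" "Dom C f = W" "Cod C f = Prod C X Y" "X \<in> Obj C" "Y \<in> Obj C"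
  obtains f\<^sub>1 f\<^sub>2 where "f = pair C f\<^sub>1 f\<^sub>2" "f\<^sub>1 \<in> Arr C" "f\<^sub>2 \<in> Arr C" "Dom C f\<^sub>1 = W" "Dom C f\<^sub>2 = W"
    "Cod C f\<^sub>1 = X" "Cod C f\<^sub>2 = Y"
  by (rule that[of "Pr1 C X Y \<cdot> f" "Pr2 C X Y \<cdot> f"]) (simp_all add: assms)

text \<open>Limits commute with products: a compatible pair of arrows into the products splits into
  one compatible pair for each factor, and these are paired again afterwards.\<close>

lemma icat_prod_pullback:
  assumes X: "is_icat C X" and Y: "is_icat C Y"
  shows "is_pullback C (ITgt (icat_prod C X Y)) (ISrc (icat_prod C X Y)) (ICp (icat_prod C X Y))
    (IFst (icat_prod C X Y)) (ISnd (icat_prod C X Y))"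
proof (rule pullbackI)
  have [simp]: "ITgt X \<cdot> (IFst X \<cdot> x) = ISrc X \<cdot> (ISnd X \<cdot> x)" if "x \<in> Arr C" "Cod C x = ICp X" for x
    using composable_comp[OF X composable_Fst_Snd[OF X], of x] X that by (simp add: composable_def)
  have [simp]: "ITgt Y \<cdot> (IFst Y \<cdot> x) = ISrc Y \<cdot> (ISnd Y \<cdot> x)" if "x \<in> Arr C" "Cod C x = ICp Y" for x
    using composable_comp[OF Y composable_Fst_Snd[OF Y], of x] Y that by (simp add: composable_def)
  show "ITgt (icat_prod C X Y) \<cdot> IFst (icat_prod C X Y) = ISrc (icat_prod C X Y) \<cdot> ISnd (icat_prod C X Y)"
    using X Y by simp
next
  fix h k assume hk: "h \<in> Arr C" "k \<in> Arr C" "Dom C h = Dom C k" "Cod C h = Dom C (ITgt (icat_prod C X Y))"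
    "Cod C k = Dom C (ISrc (icat_prod C X Y))" "ITgt (icat_prod C X Y) \<cdot> h = ISrc (icat_prod C X Y) \<cdot> k"
  obtain W where W: "Dom C h = W" "Dom C k = W"
    using hk(3) by simp
  have c: "Cod C h = Prod C (IAr X) (IAr Y)" "Cod C k = Prod C (IAr X) (IAr Y)"
    using hk(4,5) X Y by simp_all
  obtain h\<^sub>1 h\<^sub>2 where h: "h = pair C h\<^sub>1 h\<^sub>2" "h\<^sub>1 \<in> Arr C" "h\<^sub>2 \<in> Arr C" "Dom C h\<^sub>1 = W" "Dom C h\<^sub>2 = W"
    "Cod C h\<^sub>1 = IAr X" "Cod C h\<^sub>2 = IAr Y"
    by (rule Prod_cases[OF hk(1) W(1) c(1) icat_data(2)[OF X] icat_data(2)[OF Y]])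
  obtain k\<^sub>1 k\<^sub>2 where k: "k = pair C k\<^sub>1 k\<^sub>2" "k\<^sub>1 \<in> Arr C" "k\<^sub>2 \<in> Arr C" "Dom C k\<^sub>1 = W" "Dom C k\<^sub>2 = W"
    "Cod C k\<^sub>1 = IAr X" "Cod C k\<^sub>2 = IAr Y"
    by (rule Prod_cases[OF hk(2) W(2) c(2) icat_data(2)[OF X] icat_data(2)[OF Y]])
  have "ITgt X \<cdot> h\<^sub>1 = ISrc X \<cdot> k\<^sub>1" "ITgt Y \<cdot> h\<^sub>2 = ISrc Y \<cdot> k\<^sub>2"
    using hk(6) h(2-) k(2-) X Y unfolding h(1) k(1) by simp_all
  then have c': "composable X h\<^sub>1 k\<^sub>1" "composable Y h\<^sub>2 k\<^sub>2"
    using h(2-) k(2-) by (simp_all add: composable_def)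
  note u = ipair_typing[OF X c'(1)] ipair_typing[OF Y c'(2)]
  show "\<exists>u. u \<in> hom C (Dom C h) (ICp (icat_prod C X Y)) \<and> IFst (icat_prod C X Y) \<cdot> u = h \<and> ISnd (icat_prod C X Y) \<cdot> u = k"
    unfolding W h(1) k(1)
    by (rule exI[of _ "pair C (ipair X h\<^sub>1 k\<^sub>1) (ipair Y h\<^sub>2 k\<^sub>2)"]) (simp add: X Y u h(2-) k(2-))
next
  fix u v assume uv: "u \<in> Arr C" "v \<in> Arr C" "Dom C u = Dom C v" "Cod C u = ICp (icat_prod C X Y)"
    "Cod C v = ICp (icat_prod C X Y)" "IFst (icat_prod C X Y) \<cdot> u = IFst (icat_prod C X Y) \<cdot> v"
    "ISnd (icat_prod C X Y) \<cdot> u = ISnd (icat_prod C X Y) \<cdot> v"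
  show "u = v"
  proof (rule Prod_ext[of _ _ "ICp X" "ICp Y"])
    show "Pr1 C (ICp X) (ICp Y) \<cdot> u = Pr1 C (ICp X) (ICp Y) \<cdot> v"
      by (rule pullback_ext[OF icat_pb(1)[OF X]]) (use uv X Y in simp_all)
    show "Pr2 C (ICp X) (ICp Y) \<cdot> u = Pr2 C (ICp X) (ICp Y) \<cdot> v"
      by (rule pullback_ext[OF icat_pb(1)[OF Y]]) (use uv X Y in simp_all)
  qed (use uv X Y in simp_all)
qed (use X Y in simp_all)

lemma icomp_prod:
  assumes X: "is_icat C X" and Y: "is_icat C Y"
    and "f \<in> Arr C" "f' \<in> Arr C" "g \<in> Arr C" "g' \<in> Arr C" "Dom C f' = Dom C f" "Dom C g = Dom C f" "Dom C g' = Dom C f"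
    "Cod C f = IAr X" "Cod C f' = IAr Y" "Cod C g = IAr X" "Cod C g' = IAr Y"
    "ITgt X \<cdot> f = ISrc X \<cdot> g" "ITgt Y \<cdot> f' = ISrc Y \<cdot> g'"
  shows "icomp C (icat_prod C X Y) (pair C f f') (pair C g g') = pair C (icomp C X f g) (icomp C Y f' g')"
proof -
  have c: "composable X f g" "composable Y f' g'"
    using assms by (simp_all add: composable_def)
  note u = ipair_typing[OF X c(1)] ipair_typing[OF Y c(2)]
  have "ipair (icat_prod C X Y) (pair C f f') (pair C g g') = pair C (ipair X f g) (ipair Y f' g')"
    using assms u
    by (intro ipair_eqI[OF icat_prod_pullback[OF X Y]]) (simp_all add: composable_def)
  then show ?thesis
    using assms(3-) u by (simp add: icomp_ipair X Y)
qed

lemma is_icat_prod [simp]: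
  assumes X: "is_icat C X" and Y: "is_icat C Y"
  shows "is_icat C (icat_prod C X Y)"
proof (rule icatI)
  have cases: thesis if "composable (icat_prod C X Y) f g"
    and "\<And>f\<^sub>1 f\<^sub>2 g\<^sub>1 g\<^sub>2. f = pair C f\<^sub>1 f\<^sub>2 \<Longrightarrow> g = pair C g\<^sub>1 g\<^sub>2 \<Longrightarrow> f\<^sub>1 \<in> Arr C \<Longrightarrow> f\<^sub>2 \<in> Arr C \<Longrightarrow> g\<^sub>1 \<in> Arr C \<Longrightarrow> g\<^sub>2 \<in> Arr C \<Longrightarrow>
      Dom C f\<^sub>2 = Dom C f\<^sub>1 \<Longrightarrow> Dom C g\<^sub>1 = Dom C f\<^sub>1 \<Longrightarrow> Dom C g\<^sub>2 = Dom C f\<^sub>1 \<Longrightarrow> Cod C f\<^sub>1 = IAr X \<Longrightarrow> Cod C f\<^sub>2 = IAr Y \<Longrightarrow>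
      Cod C g\<^sub>1 = IAr X \<Longrightarrow> Cod C g\<^sub>2 = IAr Y \<Longrightarrow> ITgt X \<cdot> f\<^sub>1 = ISrc X \<cdot> g\<^sub>1 \<Longrightarrow> ITgt Y \<cdot> f\<^sub>2 = ISrc Y \<cdot> g\<^sub>2 \<Longrightarrow> thesis"
    for f g thesis
  proof -
    have fg: "f \<in> Arr C" "g \<in> Arr C" "Dom C f = Dom C g" "Cod C f = Prod C (IAr X) (IAr Y)" "Cod C g = Prod C (IAr X) (IAr Y)"
      using that(1) by (simp_all add: composable_def)
    obtain W where W: "Dom C f = W" "Dom C g = W"
      using fg(3) by simp
    have e: "ITgt (icat_prod C X Y) \<cdot> f = ISrc (icat_prod C X Y) \<cdot> g"
      using that(1) unfolding composable_def by blast
    obtain f\<^sub>1 f\<^sub>2 where f: "f = pair C f\<^sub>1 f\<^sub>2" "f\<^sub>1 \<in> Arr C" "f\<^sub>2 \<in> Arr C" "Dom C f\<^sub>1 = W" "Dom C f\<^sub>2 = W"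
      "Cod C f\<^sub>1 = IAr X" "Cod C f\<^sub>2 = IAr Y"
      by (rule Prod_cases[OF fg(1) W(1) fg(4) icat_data(2)[OF X] icat_data(2)[OF Y]])
    obtain g\<^sub>1 g\<^sub>2 where g: "g = pair C g\<^sub>1 g\<^sub>2" "g\<^sub>1 \<in> Arr C" "g\<^sub>2 \<in> Arr C" "Dom C g\<^sub>1 = W" "Dom C g\<^sub>2 = W"
      "Cod C g\<^sub>1 = IAr X" "Cod C g\<^sub>2 = IAr Y"
      by (rule Prod_cases[OF fg(2) W(2) fg(5) icat_data(2)[OF X] icat_data(2)[OF Y]])
    have "ITgt X \<cdot> f\<^sub>1 = ISrc X \<cdot> g\<^sub>1" "ITgt Y \<cdot> f\<^sub>2 = ISrc Y \<cdot> g\<^sub>2"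
      using e f(2-) g(2-) X Y unfolding f(1) g(1) by simp_all
    then show ?thesis
      using that(2)[OF f(1) g(1) f(2,3) g(2,3)] f(2-) g(2-) by simp
  qed
  show "ISrc (icat_prod C X Y) \<cdot> icomp C (icat_prod C X Y) f g = ISrc (icat_prod C X Y) \<cdot> f"
    "ITgt (icat_prod C X Y) \<cdot> icomp C (icat_prod C X Y) f g = ITgt (icat_prod C X Y) \<cdot> g"
    if "composable (icat_prod C X Y) f g" for f g
    by (rule cases[OF that]; simp add: icomp_prod X Y)+
  show "icomp C (icat_prod C X Y) (icomp C (icat_prod C X Y) f g) h = icomp C (icat_prod C X Y) f (icomp C (icat_prod C X Y) g h)"
    if c: "composable (icat_prod C X Y) f g" "composable (icat_prod C X Y) g h" for f g h
  proof (rule cases[OF c(1)])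
    fix f\<^sub>1 f\<^sub>2 g\<^sub>1 g\<^sub>2
    assume f: "f = pair C f\<^sub>1 f\<^sub>2" "g = pair C g\<^sub>1 g\<^sub>2" "f\<^sub>1 \<in> Arr C" "f\<^sub>2 \<in> Arr C" "g\<^sub>1 \<in> Arr C" "g\<^sub>2 \<in> Arr C"
      "Dom C f\<^sub>2 = Dom C f\<^sub>1" "Dom C g\<^sub>1 = Dom C f\<^sub>1" "Dom C g\<^sub>2 = Dom C f\<^sub>1" "Cod C f\<^sub>1 = IAr X" "Cod C f\<^sub>2 = IAr Y"
      "Cod C g\<^sub>1 = IAr X" "Cod C g\<^sub>2 = IAr Y" "ITgt X \<cdot> f\<^sub>1 = ISrc X \<cdot> g\<^sub>1" "ITgt Y \<cdot> f\<^sub>2 = ISrc Y \<cdot> g\<^sub>2"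
    have e: "ITgt (icat_prod C X Y) \<cdot> g = ISrc (icat_prod C X Y) \<cdot> h"
      using c(2) unfolding composable_def by blast
    have hh: "h \<in> Arr C" "Dom C h = Dom C g" "Cod C h = Prod C (IAr X) (IAr Y)"
      using c(2) by (simp_all add: composable_def)
    obtain W where W: "Dom C h = W"
      by simp
    obtain h\<^sub>1 h\<^sub>2 where h: "h = pair C h\<^sub>1 h\<^sub>2" "h\<^sub>1 \<in> Arr C" "h\<^sub>2 \<in> Arr C" "Dom C h\<^sub>1 = W" "Dom C h\<^sub>2 = W"
      "Cod C h\<^sub>1 = IAr X" "Cod C h\<^sub>2 = IAr Y"
      by (rule Prod_cases[OF hh(1) W hh(3) icat_data(2)[OF X] icat_data(2)[OF Y]])
    have W: "Dom C f\<^sub>1 = W"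
      using f hh(2) W by simp
    note f = f(1-6) f(7-9)[unfolded W] f(10-) W
    have "ITgt X \<cdot> g\<^sub>1 = ISrc X \<cdot> h\<^sub>1" "ITgt Y \<cdot> g\<^sub>2 = ISrc Y \<cdot> h\<^sub>2"
      using e h(2-) f(3-) X Y unfolding f(2) h(1) by simp_all
    then show ?thesis
      using f(3-) h(2-) unfolding f(1,2) h(1) by (simp add: icomp_prod X Y icomp_assoc)
  qed
  fix f assume f: "f \<in> Arr C" "Cod C f = IAr (icat_prod C X Y)"
  obtain W where W: "Dom C f = W"
    by simp
  obtain f\<^sub>1 f\<^sub>2 where f': "f = pair C f\<^sub>1 f\<^sub>2" "f\<^sub>1 \<in> Arr C" "f\<^sub>2 \<in> Arr C" "Dom C f\<^sub>1 = W" "Dom C f\<^sub>2 = W"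
    "Cod C f\<^sub>1 = IAr X" "Cod C f\<^sub>2 = IAr Y"
    by (rule Prod_cases[OF f(1) W f(2)[simplified] icat_data(2)[OF X] icat_data(2)[OF Y]])
  show "icomp C (icat_prod C X Y) (IIde (icat_prod C X Y) \<cdot> (ISrc (icat_prod C X Y) \<cdot> f)) f = f"
    "icomp C (icat_prod C X Y) f (IIde (icat_prod C X Y) \<cdot> (ITgt (icat_prod C X Y) \<cdot> f)) = f"
    using f'(2-) unfolding f'(1) by (simp_all add: icomp_prod X Y)
qed (use X Y icat_prod_pullback[OF X Y] in simp_all)

end

lemma ifun_eqI: "FDom F = FDom G \<Longrightarrow> FCod F = FCod G \<Longrightarrow> FOb F = FOb G \<Longrightarrow> FAr F = FAr G \<Longrightarrow> (F :: ('o, 'a) ifun) = G"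
  by (cases F; cases G) simp

context cart
begin

lemma functorI:
  assumes "f\<^sub>0 \<in> hom C (IOb X) (IOb Y)" "f\<^sub>1 \<in> hom C (IAr X) (IAr Y)"
    and "\<And>f. f \<in> Arr C \<Longrightarrow> Cod C f = IAr X \<Longrightarrow> ISrc Y \<cdot> (f\<^sub>1 \<cdot> f) = f\<^sub>0 \<cdot> (ISrc X \<cdot> f)"
    and "\<And>f. f \<in> Arr C \<Longrightarrow> Cod C f = IAr X \<Longrightarrow> ITgt Y \<cdot> (f\<^sub>1 \<cdot> f) = f\<^sub>0 \<cdot> (ITgt X \<cdot> f)"
    and "\<And>x. x \<in> Arr C \<Longrightarrow> Cod C x = IOb X \<Longrightarrow> f\<^sub>1 \<cdot> (IIde X \<cdot> x) = IIde Y \<cdot> (f\<^sub>0 \<cdot> x)"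
    and "\<And>f g. f \<in> Arr C \<Longrightarrow> g \<in> Arr C \<Longrightarrow> Dom C f = Dom C g \<Longrightarrow> Cod C f = IAr X \<Longrightarrow> Cod C g = IAr X \<Longrightarrow>
      ITgt X \<cdot> f = ISrc X \<cdot> g \<Longrightarrow> f\<^sub>1 \<cdot> icomp C X f g = icomp C Y (f\<^sub>1 \<cdot> f) (f\<^sub>1 \<cdot> g)"
  shows "is_functor X Y f\<^sub>0 f\<^sub>1"
  unfolding is_functor_def composable_def using assms by blast

lemma functor_Ide:
  assumes "is_icat C X"
  shows "is_functor X X (Ide C (IOb X)) (Ide C (IAr X))"
  by (rule functorI) (simp_all add: assms)

lemma functor_comp:
  assumes X: "is_icat C X" and Y: "is_icat C Y" and Z: "is_icat C Z"
    and f: "is_functor X Y f\<^sub>0 f\<^sub>1" and g: "is_functor Y Z g\<^sub>0 g\<^sub>1"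
  shows "is_functor X Z (g\<^sub>0 \<cdot> f\<^sub>0) (g\<^sub>1 \<cdot> f\<^sub>1)"
  by (rule functorI) (simp_all add: X Y Z functor_simps[OF f] functor_simps[OF g])

lemma ifun_comp_simps [simp]:
  "FDom (ifun_comp C G F) = FDom F" "FCod (ifun_comp C G F) = FCod G"
  "FOb (ifun_comp C G F) = FOb G \<cdot> FOb F" "FAr (ifun_comp C G F) = FAr G \<cdot> FAr F"
  by (simp_all add: ifun_comp_def)

lemma ifun_id_simps [simp]:
  "FDom (ifun_id C X) = X" "FCod (ifun_id C X) = X"
  "FOb (ifun_id C X) = Ide C (IOb X)" "FAr (ifun_id C X) = Ide C (IAr X)"
  by (simp_all add: ifun_id_def)

lemma ifun_icat:
  assumes "is_ifun C F"
  shows "is_icat C (FDom F)" "is_icat C (FCod F)" "is_functor (FDom F) (FCod F) (FOb F) (FAr F)"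
  using assms by (simp_all add: is_ifun_iff)

lemmas ifun_simps = functor_simps[OF ifun_icat(3)]

lemma ifun_comp_is_ifun:
  assumes "is_ifun C F" "is_ifun C G" "FCod F = FDom G"
  shows "is_ifun C (ifun_comp C G F)"
  using functor_comp[OF ifun_icat(1)[OF assms(1)] ifun_icat(2)[OF assms(1)] ifun_icat(2)[OF assms(2)]
      ifun_icat(3)[OF assms(1)]] ifun_icat[OF assms(1)] ifun_icat[OF assms(2)] assms(3)
  by (simp add: is_ifun_iff)

lemma is_category_Cat: "is_category (Cat C)"
proof -
  have "ifun_comp C F (ifun_id C (FDom F)) = F" "ifun_comp C (ifun_id C (FCod F)) F = F" if "is_ifun C F" for F
    by (rule ifun_eqI; simp add: ifun_simps[OF that])+
  moreover have "ifun_comp C H (ifun_comp C G F) = ifun_comp C (ifun_comp C H G) F"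
    if "is_ifun C F" "is_ifun C G" "is_ifun C H" "FCod F = FDom G" "FCod G = FDom H" for F G H
    by (rule ifun_eqI) (simp_all add: ifun_simps[OF that(1)] ifun_simps[OF that(2)] ifun_simps[OF that(3)] that(4,5))
  moreover have "is_ifun C (ifun_id C X)" if "is_icat C X" for X
    using that functor_Ide[OF that] by (simp add: is_ifun_iff)
  ultimately show ?thesis
    unfolding is_category_def Cat_simps hom_def
    by (auto simp: ifun_icat ifun_comp_is_ifun)
qed

lemma icat_one_simps [simp]:
  "IOb (icat_one C) = One C" "IAr (icat_one C) = One C" "ICp (icat_one C) = One C"
  "ISrc (icat_one C) = Ide C (One C)" "ITgt (icat_one C) = Ide C (One C)" "IIde (icat_one C) = Ide C (One C)"
  "IFst (icat_one C) = Ide C (One C)" "ISnd (icat_one C) = Ide C (One C)" "ICmp (icat_one C) = Ide C (One C)"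
  by (simp_all add: icat_one_def)

lemma to_One_eq: "f \<in> Arr C \<Longrightarrow> g \<in> Arr C \<Longrightarrow> Dom C f = Dom C g \<Longrightarrow> Cod C f = One C \<Longrightarrow> Cod C g = One C \<Longrightarrow> f = g"
  using bang_eq[of f] bang_eq[of g] by simp

lemma is_icat_one [simp]: "is_icat C (icat_one C)"
proof (rule icatI)
  have pb: "is_pullback C (Ide C (One C)) (Ide C (One C)) (One C) (Ide C (One C)) (Ide C (One C))"
    by (rule pullbackI) auto
  then show "is_pullback C (ITgt (icat_one C)) (ISrc (icat_one C)) (ICp (icat_one C)) (IFst (icat_one C)) (ISnd (icat_one C))"
    by simp
  have c: "icomp C (icat_one C) f g = f" if "composable (icat_one C) f g" for f g
  proof -
    have "f \<in> Arr C" "Cod C f = One C" "g = f"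
      using that to_One_eq[of g f] by (simp_all add: composable_def)
    moreover have "ipair (icat_one C) f g = f"
      by (rule ipair_eqI[OF _ _ _ that]) (use calculation pb in simp_all)
    ultimately show ?thesis
      by (simp add: icomp_ipair)
  qed
  show "icomp C (icat_one C) (icomp C (icat_one C) f g) h = icomp C (icat_one C) f (icomp C (icat_one C) g h)"
    if "composable (icat_one C) f g" "composable (icat_one C) g h" for f g h
    using that c[of f g] c[of g h] c[of f h] by (simp add: composable_def)
  fix f g
  show "ISrc (icat_one C) \<cdot> icomp C (icat_one C) f g = ISrc (icat_one C) \<cdot> f"
    "ITgt (icat_one C) \<cdot> icomp C (icat_one C) f g = ITgt (icat_one C) \<cdot> g" if "composable (icat_one C) f g"
    using that c[of f g] by (simp_all add: composable_def)
  show "icomp C (icat_one C) (IIde (icat_one C) \<cdot> (ISrc (icat_one C) \<cdot> f)) f = f"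
    "icomp C (icat_one C) f (IIde (icat_one C) \<cdot> (ITgt (icat_one C) \<cdot> f)) = f"
    if "f \<in> Arr C" "Cod C f = IAr (icat_one C)"
    using that c[of f f] by (simp_all add: composable_def)
qed simp_all

lemma icomp_one:
  "f \<in> Arr C \<Longrightarrow> Cod C f = One C \<Longrightarrow> g \<in> Arr C \<Longrightarrow> Cod C g = One C \<Longrightarrow> Dom C f = Dom C g \<Longrightarrow>
    icomp C (icat_one C) f g = bang (Dom C f)"
  using to_One_eq[of g f] by (intro to_One_eq) simp_all

lemma functor_bang: "is_icat C X \<Longrightarrow> is_functor X (icat_one C) (bang (IOb X)) (bang (IAr X))"
  by (rule functorI) (simp_all add: icomp_one)

lemma functor_Pr1: "is_icat C X \<Longrightarrow> is_icat C Y \<Longrightarrow>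
  is_functor (icat_prod C X Y) X (Pr1 C (IOb X) (IOb Y)) (Pr1 C (IAr X) (IAr Y))"
  and functor_Pr2: "is_icat C X \<Longrightarrow> is_icat C Y \<Longrightarrow>
  is_functor (icat_prod C X Y) Y (Pr2 C (IOb X) (IOb Y)) (Pr2 C (IAr X) (IAr Y))"
proof -
  assume X: "is_icat C X" and Y: "is_icat C Y"
  have "Pr1 C (IAr X) (IAr Y) \<cdot> icomp C (icat_prod C X Y) f g =
        icomp C X (Pr1 C (IAr X) (IAr Y) \<cdot> f) (Pr1 C (IAr X) (IAr Y) \<cdot> g) \<and>
      Pr2 C (IAr X) (IAr Y) \<cdot> icomp C (icat_prod C X Y) f g =
        icomp C Y (Pr2 C (IAr X) (IAr Y) \<cdot> f) (Pr2 C (IAr X) (IAr Y) \<cdot> g)"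
    if fg: "f \<in> Arr C" "g \<in> Arr C" "Dom C f = Dom C g" "Cod C f = IAr (icat_prod C X Y)" "Cod C g = IAr (icat_prod C X Y)"
      "ITgt (icat_prod C X Y) \<cdot> f = ISrc (icat_prod C X Y) \<cdot> g" for f g
  proof -
    have "ITgt X \<cdot> (Pr1 C (IAr X) (IAr Y) \<cdot> f) = ISrc X \<cdot> (Pr1 C (IAr X) (IAr Y) \<cdot> g)"
      "ITgt Y \<cdot> (Pr2 C (IAr X) (IAr Y) \<cdot> f) = ISrc Y \<cdot> (Pr2 C (IAr X) (IAr Y) \<cdot> g)"
      using fg X Y by simp_all
    moreover from this have "icomp C (icat_prod C X Y) f g =
      pair C (icomp C X (Pr1 C (IAr X) (IAr Y) \<cdot> f) (Pr1 C (IAr X) (IAr Y) \<cdot> g))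
        (icomp C Y (Pr2 C (IAr X) (IAr Y) \<cdot> f) (Pr2 C (IAr X) (IAr Y) \<cdot> g))"
      using icomp_prod[OF X Y, of "Pr1 C (IAr X) (IAr Y) \<cdot> f" "Pr2 C (IAr X) (IAr Y) \<cdot> f"
          "Pr1 C (IAr X) (IAr Y) \<cdot> g" "Pr2 C (IAr X) (IAr Y) \<cdot> g"] fg(1-5) X Y
      by simp
    ultimately show ?thesis
      using fg(1-5) X Y by simp
  qed
  note * = this
  show "is_functor (icat_prod C X Y) X (Pr1 C (IOb X) (IOb Y)) (Pr1 C (IAr X) (IAr Y))"
    "is_functor (icat_prod C X Y) Y (Pr2 C (IOb X) (IOb Y)) (Pr2 C (IAr X) (IAr Y))"
    using * by (intro functorI; simp add: X Y)+
qed

lemma functor_pair: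
  assumes X: "is_icat C X" and Y: "is_icat C Y" and Z: "is_icat C Z"
    and f: "is_functor Z X f\<^sub>0 f\<^sub>1" and g: "is_functor Z Y g\<^sub>0 g\<^sub>1"
  shows "is_functor Z (icat_prod C X Y) (pair C f\<^sub>0 g\<^sub>0) (pair C f\<^sub>1 g\<^sub>1)"
  by (rule functorI) (simp_all add: X Y Z functor_simps[OF f] functor_simps[OF g] icomp_prod)

text \<open>Everything is computed separately on objects and on arrows, where it reduces to the
  terminal object and the products of \<open>C\<close>. With this lemma the locale applies to
  \<open>Cat C\<close> as well.\<close>

lemma cartesian_Cat: "cartesian (Cat C)"
proof -
  have "is_terminal (Cat C) (icat_one C)"
    unfolding is_terminal_def Cat_simps hom_def
  proof (intro conjI ballI)
    fix X assume "X \<in> {X. is_icat C X}"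
    then have X: "is_icat C X" by simp
    show "\<exists>!f. f \<in> {f \<in> {F. is_ifun C F}. FDom f = X \<and> FCod f = icat_one C}"
    proof (rule ex1I[of _ "\<lparr>FDom = X, FCod = icat_one C, FOb = bang (IOb X), FAr = bang (IAr X)\<rparr>"])
      fix F assume "F \<in> {f \<in> {F. is_ifun C F}. FDom f = X \<and> FCod f = icat_one C}"
      then have F: "is_ifun C F" "FDom F = X" "FCod F = icat_one C"
        by simp_all
      show "F = \<lparr>FDom = X, FCod = icat_one C, FOb = bang (IOb X), FAr = bang (IAr X)\<rparr>"
        using ifun_simps(1-6)[OF F(1)] X
        by (intro ifun_eqI) (auto simp: F(2,3) intro: to_One_eq)
    qed (use X functor_bang[OF X] in \<open>simp add: is_ifun_iff\<close>)
  qed simp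
  moreover have "is_product (Cat C) X Y (icat_prod C X Y) (Pr1 (Cat C) X Y) (Pr2 (Cat C) X Y)"
    if X: "is_icat C X" and Y: "is_icat C Y" for X Y
    unfolding is_product_def hom_def
  proof (intro conjI ballI)
    show "icat_prod C X Y \<in> Obj (Cat C)"
      using X Y by (simp add: Cat_simps)
    show "Pr1 (Cat C) X Y \<in> {f \<in> Arr (Cat C). Dom (Cat C) f = icat_prod C X Y \<and> Cod (Cat C) f = X}"
      "Pr2 (Cat C) X Y \<in> {f \<in> Arr (Cat C). Dom (Cat C) f = icat_prod C X Y \<and> Cod (Cat C) f = Y}"
      using X Y functor_Pr1[OF X Y] functor_Pr2[OF X Y] by (simp_all add: Cat_simps is_ifun_iff)
    fix Z F G
    assume "Z \<in> Obj (Cat C)" "F \<in> {f \<in> Arr (Cat C). Dom (Cat C) f = Z \<and> Cod (Cat C) f = X}"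
      "G \<in> {f \<in> Arr (Cat C). Dom (Cat C) f = Z \<and> Cod (Cat C) f = Y}"
    then have F: "is_ifun C F" "FDom F = Z" "FCod F = X" and G: "is_ifun C G" "FDom G = Z" "FCod G = Y"
      and Z: "is_icat C Z"
      by (simp_all add: Cat_simps)
    note f = ifun_simps[OF F(1), unfolded F(2,3)] and g = ifun_simps[OF G(1), unfolded G(2,3)]
    let ?H = "\<lparr>FDom = Z, FCod = icat_prod C X Y, FOb = pair C (FOb F) (FOb G), FAr = pair C (FAr F) (FAr G)\<rparr>"
    have H: "is_ifun C ?H"
      using functor_pair[OF X Y Z ifun_icat(3)[OF F(1), unfolded F(2,3)] ifun_icat(3)[OF G(1), unfolded G(2,3)]] X Y Z
      by (simp add: is_ifun_iff)
    have FG: "Comp (Cat C) (Pr1 (Cat C) X Y) ?H = F" "Comp (Cat C) (Pr2 (Cat C) X Y) ?H = G"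
      by (rule ifun_eqI; simp add: Cat_simps F G X Y Z f(1-6) g(1-6))+
    have un: "H = ?H" if H: "is_ifun C H" "FDom H = Z" "FCod H = icat_prod C X Y"
      "Comp (Cat C) (Pr1 (Cat C) X Y) H = F" "Comp (Cat C) (Pr2 (Cat C) X Y) H = G" for H
    proof -
      note h = ifun_simps[OF H(1), unfolded H(2,3)]
      have "FOb F = Pr1 C (IOb X) (IOb Y) \<cdot> FOb H" "FAr F = Pr1 C (IAr X) (IAr Y) \<cdot> FAr H"
        "FOb G = Pr2 C (IOb X) (IOb Y) \<cdot> FOb H" "FAr G = Pr2 C (IAr X) (IAr Y) \<cdot> FAr H"
        by (simp_all add: H(4,5)[symmetric] Cat_simps)
      then show ?thesis
        by (intro ifun_eqI) (simp_all add: H(2,3) h(1-6) X Y Z)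
    qed
    show "\<exists>!u. u \<in> {f \<in> Arr (Cat C). Dom (Cat C) f = Z \<and> Cod (Cat C) f = icat_prod C X Y} \<and>
        Comp (Cat C) (Pr1 (Cat C) X Y) u = F \<and> Comp (Cat C) (Pr2 (Cat C) X Y) u = G"
    proof (rule ex1I[of _ ?H])
      show "?H \<in> {f \<in> Arr (Cat C). Dom (Cat C) f = Z \<and> Cod (Cat C) f = icat_prod C X Y} \<and>
          Comp (Cat C) (Pr1 (Cat C) X Y) ?H = F \<and> Comp (Cat C) (Pr2 (Cat C) X Y) ?H = G"
        using H FG by (simp only: Cat_simps(2-4) mem_Collect_eq ifun.select_convs)
    next
      fix H assume "H \<in> {f \<in> Arr (Cat C). Dom (Cat C) f = Z \<and> Cod (Cat C) f = icat_prod C X Y} \<and>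
          Comp (Cat C) (Pr1 (Cat C) X Y) H = F \<and> Comp (Cat C) (Pr2 (Cat C) X Y) H = G"
      then show "H = ?H"
        by (intro un) (simp_all only: Cat_simps(2-4) mem_Collect_eq)
    qed
  qed
  ultimately show ?thesis
    using is_category_Cat by (simp add: cartesian_def Cat_simps(1,7,8))
qed

text \<open>\<open>pair\<close> is a definite description in \<open>Cat C\<close>; computing its
  value is what makes the components of a functor into a product visible.\<close>

lemma pair_Cat:
  assumes F: "is_ifun C F" and G: "is_ifun C G" and e: "FDom G = FDom F"
  shows "pair (Cat C) F G = \<lparr>FDom = FDom F, FCod = icat_prod C (FCod F) (FCod G),
    FOb = pair C (FOb F) (FOb G), FAr = pair C (FAr F) (FAr G)\<rparr>"
proof -
  interpret K: cart "Cat C"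
    by unfold_locales (rule cartesian_Cat)
  define H where "H = pair (Cat C) F G"
  have FG: "F \<in> Arr (Cat C)" "G \<in> Arr (Cat C)" "Dom (Cat C) F = Dom (Cat C) G"
    using assms by (simp_all add: Cat_simps)
  have H: "is_ifun C H" "FDom H = FDom F" "FCod H = icat_prod C (FCod F) (FCod G)"
    using K.pair_simps(1-3)[OF FG] by (simp_all add: Cat_simps H_def)
  note h = ifun_simps[OF H(1), unfolded H(2,3)]
  have "Comp (Cat C) (Pr1 (Cat C) (FCod F) (FCod G)) H = F" "Comp (Cat C) (Pr2 (Cat C) (FCod F) (FCod G)) H = G"
    using K.pair_simps(4,5)[OF FG] by (simp_all only: Cat_simps H_def)
  then have "FOb F = Pr1 C (IOb (FCod F)) (IOb (FCod G)) \<cdot> FOb H" "FAr F = Pr1 C (IAr (FCod F)) (IAr (FCod G)) \<cdot> FAr H"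
     "FOb G = Pr2 C (IOb (FCod F)) (IOb (FCod G)) \<cdot> FOb H" "FAr G = Pr2 C (IAr (FCod F)) (IAr (FCod G)) \<cdot> FAr H"
    by (metis Cat_simps(6,9,10) ifun.select_convs(3,4) ifun_comp_simps(3,4))+
  then show ?thesis
    unfolding H_def[symmetric]
    by (intro ifun_eqI) (simp_all add: H h(1-6) ifun_icat[OF F] ifun_icat[OF G])
qed

lemma prod_map_Cat:
  assumes F: "is_ifun C F" and G: "is_ifun C G"
  shows "prod_map (Cat C) F G = \<lparr>FDom = icat_prod C (FDom F) (FDom G), FCod = icat_prod C (FCod F) (FCod G),
    FOb = prod_map C (FOb F) (FOb G), FAr = prod_map C (FAr F) (FAr G)\<rparr>"
proof -
  note c = ifun_icat[OF F] ifun_icat[OF G]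
  let ?P = "Pr1 (Cat C) (FDom F) (FDom G)" and ?Q = "Pr2 (Cat C) (FDom F) (FDom G)"
  have "is_ifun C ?P" "is_ifun C ?Q"
    using functor_Pr1 functor_Pr2 c by (simp_all add: Cat_simps is_ifun_iff)
  then have "is_ifun C (ifun_comp C F ?P)" "is_ifun C (ifun_comp C G ?Q)"
    using F G by (simp_all add: ifun_comp_is_ifun Cat_simps)
  then show ?thesis
    using ifun_simps(1-6)[OF F] ifun_simps(1-6)[OF G]
    by (simp add: prod_map_def Cat_simps(3-6) pair_Cat Cat_simps(9,10))
qed

end

section \<open>Representable conditions and exponentials\<close>

text \<open>What is extracted from \<open>has_finite_limits\<close>. Products are already chosen,
  pullbacks follow from the two (\<open>pullback_ex\<close>), and the property passes to slices
  directly.\<close>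

definition has_equalizers :: "('o, 'a, 'm) category_scheme \<Rightarrow> bool" where
  "has_equalizers C \<longleftrightarrow> (\<forall>f\<in>Arr C. \<forall>g\<in>Arr C. Dom C f = Dom C g \<and> Cod C f = Cod C g \<longrightarrow>
    (\<exists>Q e. Q \<in> Obj C \<and> e \<in> hom C Q (Dom C f) \<and> f \<cdot>\<^bsub>C\<^esub> e = g \<cdot>\<^bsub>C\<^esub> e \<and>
      (\<forall>Z\<in>Obj C. \<forall>u\<in>hom C Z (Dom C f). f \<cdot>\<^bsub>C\<^esub> u = g \<cdot>\<^bsub>C\<^esub> u \<longrightarrow> (\<exists>!w. w \<in> hom C Z Q \<and> e \<cdot>\<^bsub>C\<^esub> w = u))))"

locale flc = cart C for C :: "('o, 'a) cart_category" (structure) +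
  assumes equalizers: "has_equalizers C"
begin

text \<open>The condition \<open>S\<close> on generalised elements of \<open>X\<close> defines a subobject of \<open>X\<close>.\<close>

definition subrep :: "'o \<Rightarrow> ('a \<Rightarrow> bool) \<Rightarrow> bool" where
  "subrep X S \<longleftrightarrow> (\<exists>X' e. X' \<in> Obj C \<and> e \<in> hom C X' X \<and>
    (\<forall>u v. u \<in> Arr C \<and> v \<in> Arr C \<and> Dom C u = Dom C v \<and> Cod C u = X' \<and> Cod C v = X' \<and> e \<cdot> u = e \<cdot> v \<longrightarrow> u = v) \<and>
    (\<forall>u. u \<in> Arr C \<and> Cod C u = X \<longrightarrow> (S u \<longleftrightarrow> (\<exists>w\<in>hom C (Dom C u) X'. e \<cdot> w = u))))"

lemma equalizer_subrep:
  assumes "f \<in> Arr C" "g \<in> Arr C" "Dom C f = X" "Dom C g = X" "Cod C f = Cod C g"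
  shows "subrep X (\<lambda>u. f \<cdot> u = g \<cdot> u)"
proof -
  have "Dom C f = Dom C g \<and> Cod C f = Cod C g"
    using assms by simp
  from equalizers[unfolded has_equalizers_def, rule_format, OF assms(1,2) this, unfolded assms(3)]
  obtain Q e where Q: "Q \<in> Obj C" "e \<in> hom C Q X" "f \<cdot> e = g \<cdot> e"
    and un: "\<And>Z u. Z \<in> Obj C \<Longrightarrow> u \<in> hom C Z X \<Longrightarrow> f \<cdot> u = g \<cdot> u \<Longrightarrow> \<exists>!w. w \<in> hom C Z Q \<and> e \<cdot> w = u"
    by blast
  have e: "f \<cdot> (e \<cdot> w) = g \<cdot> (e \<cdot> w)" if "w \<in> Arr C" "Cod C w = Q" for w
    using comp_eq_comp[OF Q(3), of w] Q assms that by simp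
  have "u = v" if "u \<in> Arr C" "v \<in> Arr C" "Dom C u = Dom C v" "Cod C u = Q" "Cod C v = Q" "e \<cdot> u = e \<cdot> v" for u v
  proof -
    have "\<exists>!w. w \<in> hom C (Dom C u) Q \<and> e \<cdot> w = e \<cdot> v"
      using that Q e assms by (intro un) simp_all
    moreover have "u \<in> hom C (Dom C u) Q \<and> e \<cdot> u = e \<cdot> v" "v \<in> hom C (Dom C u) Q \<and> e \<cdot> v = e \<cdot> v"
      using that by simp_all
    ultimately show ?thesis
      by blast
  qed
  moreover have "f \<cdot> u = g \<cdot> u \<longleftrightarrow> (\<exists>w\<in>hom C (Dom C u) Q. e \<cdot> w = u)" if "u \<in> Arr C" "Cod C u = X" for u
  proof
    assume "f \<cdot> u = g \<cdot> u"
    then show "\<exists>w\<in>hom C (Dom C u) Q. e \<cdot> w = u"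
      using un[of "Dom C u" u] that Obj_Dom[OF that(1)] in_hom_iff by blast
  next
    assume "\<exists>w\<in>hom C (Dom C u) Q. e \<cdot> w = u"
    then obtain w where "w \<in> hom C (Dom C u) Q" "e \<cdot> w = u"
      by blast
    then show "f \<cdot> u = g \<cdot> u"
      using e[of w] by simp
  qed
  ultimately show ?thesis
    unfolding subrep_def using Q(1,2) by blast
qed

text \<open>The second condition may be meaningful only where the first one holds, for instance an
  equation between composites whose factors match under \<open>S\<close>. So \<open>T\<close> is
  restricted to the subobject defined by \<open>S\<close> and represented there; the composite of
  the two monomorphisms represents the conjunction.\<close>

lemma subrep_comp:
  assumes "subrep X S"
    and "\<And>X' e. e \<in> hom C X' X \<Longrightarrow> (\<And>w. w \<in> Arr C \<Longrightarrow> Cod C w = X' \<Longrightarrow> S (e \<cdot> w)) \<Longrightarrow> subrep X' (\<lambda>w. T (e \<cdot> w))"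
  shows "subrep X (\<lambda>u. S u \<and> T u)"
proof -
  obtain X' e where e: "X' \<in> Obj C" "e \<in> hom C X' X"
    "\<And>u v. u \<in> Arr C \<Longrightarrow> v \<in> Arr C \<Longrightarrow> Dom C u = Dom C v \<Longrightarrow> Cod C u = X' \<Longrightarrow> Cod C v = X' \<Longrightarrow> e \<cdot> u = e \<cdot> v \<Longrightarrow> u = v"
    "\<And>u. u \<in> Arr C \<Longrightarrow> Cod C u = X \<Longrightarrow> S u \<longleftrightarrow> (\<exists>w\<in>hom C (Dom C u) X'. e \<cdot> w = u)"
    using assms(1) unfolding subrep_def by blast
  have Se: "S (e \<cdot> w)" if "w \<in> Arr C" "Cod C w = X'" for w
  proof -
    have "\<exists>v\<in>hom C (Dom C (e \<cdot> w)) X'. e \<cdot> v = e \<cdot> w"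
      using e(2) that by (intro bexI[of _ w]) simp_all
    then show ?thesis
      using e(4)[of "e \<cdot> w"] e(2) that by simp
  qed
  then obtain X'' e' where e': "X'' \<in> Obj C" "e' \<in> hom C X'' X'"
    "\<And>u v. u \<in> Arr C \<Longrightarrow> v \<in> Arr C \<Longrightarrow> Dom C u = Dom C v \<Longrightarrow> Cod C u = X'' \<Longrightarrow> Cod C v = X'' \<Longrightarrow> e' \<cdot> u = e' \<cdot> v \<Longrightarrow> u = v"
    "\<And>u. u \<in> Arr C \<Longrightarrow> Cod C u = X' \<Longrightarrow> T (e \<cdot> u) \<longleftrightarrow> (\<exists>w\<in>hom C (Dom C u) X''. e' \<cdot> w = u)"
    using assms(2)[OF e(2)] unfolding subrep_def by blast
  have "u = v" if "u \<in> Arr C" "v \<in> Arr C" "Dom C u = Dom C v" "Cod C u = X''" "Cod C v = X''"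
    "(e \<cdot> e') \<cdot> u = (e \<cdot> e') \<cdot> v" for u v
    using that e(2) e'(2) e'(3)[of u v] e(3)[of "e' \<cdot> u" "e' \<cdot> v"] by simp
  moreover have "S u \<and> T u \<longleftrightarrow> (\<exists>w\<in>hom C (Dom C u) X''. (e \<cdot> e') \<cdot> w = u)" if u: "u \<in> Arr C" "Cod C u = X" for u
  proof
    assume ST: "S u \<and> T u"
    then obtain w where w: "w \<in> hom C (Dom C u) X'" "e \<cdot> w = u"
      using e(4)[OF u] by blast
    then obtain w' where "w' \<in> hom C (Dom C w) X''" "e' \<cdot> w' = w"
      using e'(4)[of w] ST by auto
    then show "\<exists>w\<in>hom C (Dom C u) X''. (e \<cdot> e') \<cdot> w = u"
      using w e(2) e'(2) by (intro bexI[of _ w']) auto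
  next
    assume "\<exists>w\<in>hom C (Dom C u) X''. (e \<cdot> e') \<cdot> w = u"
    then obtain w where w: "w \<in> hom C (Dom C u) X''" "(e \<cdot> e') \<cdot> w = u"
      by blast
    then have w: "w \<in> hom C (Dom C u) X''" "e \<cdot> (e' \<cdot> w) = u"
      using e(2) e'(2) by simp_all
    have "S (e \<cdot> (e' \<cdot> w))"
      using e'(2) w(1) by (intro Se) simp_all
    moreover have "\<exists>v\<in>hom C (Dom C (e' \<cdot> w)) X''. e' \<cdot> v = e' \<cdot> w"
      using e'(2) w(1) by (intro bexI[of _ w]) simp_all
    then have "T (e \<cdot> (e' \<cdot> w))"
      using e'(4)[of "e' \<cdot> w"] e'(2) w(1) by simp
    ultimately show "S u \<and> T u"
      by (simp only: w(2))
  qed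
  moreover have "e \<cdot> e' \<in> hom C X'' X"
    using e(2) e'(2) by simp
  ultimately show ?thesis
    unfolding subrep_def using e'(1) by blast
qed

lemma subrep_cong:
  assumes "subrep X S" "\<And>u. u \<in> Arr C \<Longrightarrow> Cod C u = X \<Longrightarrow> S u \<longleftrightarrow> T u"
  shows "subrep X T"
  using assms(1) unfolding subrep_def by (simp add: assms(2) cong: conj_cong)

lemma pullback_ex:
  assumes f: "f \<in> hom C X Z" and g: "g \<in> hom C Y Z"
  shows "\<exists>P p q. is_pullback C f g P p q"
proof -
  have X: "X \<in> Obj C" and Y: "Y \<in> Obj C"
    using f g by auto
  note [simp] = f[simplified] g[simplified] X Y
  have "subrep (Prod C X Y) (\<lambda>u. (f \<cdot> Pr1 C X Y) \<cdot> u = (g \<cdot> Pr2 C X Y) \<cdot> u)"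
    by (rule equalizer_subrep) simp_all
  then obtain P e where P: "P \<in> Obj C" "e \<in> hom C P (Prod C X Y)"
    "\<And>u v. u \<in> Arr C \<Longrightarrow> v \<in> Arr C \<Longrightarrow> Dom C u = Dom C v \<Longrightarrow> Cod C u = P \<Longrightarrow> Cod C v = P \<Longrightarrow> e \<cdot> u = e \<cdot> v \<Longrightarrow> u = v"
    "\<And>u. u \<in> Arr C \<Longrightarrow> Cod C u = Prod C X Y \<Longrightarrow> (f \<cdot> Pr1 C X Y) \<cdot> u = (g \<cdot> Pr2 C X Y) \<cdot> u \<longleftrightarrow>
      (\<exists>w\<in>hom C (Dom C u) P. e \<cdot> w = u)"
    unfolding subrep_def by blast
  note [simp] = P(1) P(2)[simplified]
  \<comment> \<open>The inclusion \<open>e\<close> is the generic element of the subobject and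
    satisfies the defining condition, as witnessed by the identity. The same device yields the
    universal families further on.\<close>
  have "\<exists>w\<in>hom C (Dom C e) P. e \<cdot> w = e"
    by (rule bexI[of _ "Ide C P"]) simp_all
  then have e: "f \<cdot> (Pr1 C X Y \<cdot> e) = g \<cdot> (Pr2 C X Y \<cdot> e)"
    using P(4)[of e] by simp
  have "is_pullback C f g P (Pr1 C X Y \<cdot> e) (Pr2 C X Y \<cdot> e)"
  proof (rule pullbackI)
    fix h k assume hk: "h \<in> Arr C" "k \<in> Arr C" "Dom C h = Dom C k" "Cod C h = Dom C f" "Cod C k = Dom C g" "f \<cdot> h = g \<cdot> k"
    then obtain w where "w \<in> hom C (Dom C h) P" "e \<cdot> w = pair C h k"
      using P(4)[of "pair C h k"] by auto
    then show "\<exists>u. u \<in> hom C (Dom C h) P \<and> (Pr1 C X Y \<cdot> e) \<cdot> u = h \<and> (Pr2 C X Y \<cdot> e) \<cdot> u = k"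
      using hk by (intro exI[of _ w]) simp
  next
    fix u v assume uv: "u \<in> Arr C" "v \<in> Arr C" "Dom C u = Dom C v" "Cod C u = P" "Cod C v = P"
      "(Pr1 C X Y \<cdot> e) \<cdot> u = (Pr1 C X Y \<cdot> e) \<cdot> v" "(Pr2 C X Y \<cdot> e) \<cdot> u = (Pr2 C X Y \<cdot> e) \<cdot> v"
    have "e \<cdot> u = e \<cdot> v"
      by (rule Prod_ext[of _ _ X Y]) (use uv in simp_all)
    then show "u = v"
      by (rule P(3)[OF uv(1-5)])
  qed (use e in simp_all)
  then show ?thesis by blast
qed

end

locale ccc = flc C for C :: "('o, 'a) cart_category" (structure) +
  assumes closed: "cartesian_closed C"
begin

abbreviation el2 :: "'a \<Rightarrow> 'a \<Rightarrow> 'o \<Rightarrow> 'o \<Rightarrow> bool" where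
  "el2 t x Z D \<equiv> t \<in> Arr C \<and> x \<in> Arr C \<and> Dom C x = Dom C t \<and> Cod C t = Z \<and> Cod C x = D"

text \<open>An exponential in terms of elements. The product map of \<open>is_exponential\<close> is
  replaced by pairs \<open>(t, x)\<close>, and uniqueness of transposes by an extensionality rule,
  so that existence and uniqueness can be applied separately.\<close>

definition is_exp :: "'o \<Rightarrow> 'o \<Rightarrow> 'o \<Rightarrow> 'a \<Rightarrow> bool" where
  "is_exp D A X ev \<longleftrightarrow> X \<in> Obj C \<and> ev \<in> hom C (Prod C X D) A \<and>
    (\<forall>Z f. Z \<in> Obj C \<and> f \<in> hom C (Prod C Z D) A \<longrightarrow>
      (\<exists>u\<in>hom C Z X. \<forall>t x. el2 t x Z D \<longrightarrow> ev \<cdot> pair C (u \<cdot> t) x = f \<cdot> pair C t x)) \<and>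
    (\<forall>u v. u \<in> Arr C \<and> v \<in> Arr C \<and> Dom C v = Dom C u \<and> Cod C u = X \<and> Cod C v = X \<and>
      (\<forall>t x. el2 t x (Dom C u) D \<longrightarrow> ev \<cdot> pair C (u \<cdot> t) x = ev \<cdot> pair C (v \<cdot> t) x) \<longrightarrow> u = v)"

lemma is_expD:
  assumes "is_exp D A X ev"
  shows "X \<in> Obj C" "ev \<in> hom C (Prod C X D) A"
    "\<And>Z f. Z \<in> Obj C \<Longrightarrow> f \<in> hom C (Prod C Z D) A \<Longrightarrow>
      \<exists>u\<in>hom C Z X. \<forall>t x. el2 t x Z D \<longrightarrow> ev \<cdot> pair C (u \<cdot> t) x = f \<cdot> pair C t x"
    "\<And>u v. u \<in> Arr C \<Longrightarrow> v \<in> Arr C \<Longrightarrow> Dom C v = Dom C u \<Longrightarrow> Cod C u = X \<Longrightarrow> Cod C v = X \<Longrightarrow>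
      (\<And>t x. el2 t x (Dom C u) D \<Longrightarrow> ev \<cdot> pair C (u \<cdot> t) x = ev \<cdot> pair C (v \<cdot> t) x) \<Longrightarrow> u = v"
  using assms unfolding is_exp_def by blast+

text \<open>The product map of \<open>u\<close> with an identity is the pair of \<open>u\<close>
  after the first projection and the second projection; testing at all \<open>(t, x)\<close> is
  therefore the same as testing at the projections.\<close>

lemma exponential_ex:
  assumes D: "D \<in> Obj C" and A: "A \<in> Obj C"
  shows "\<exists>X ev. is_exp D A X ev"
proof -
  obtain X ev where "is_exponential C D A X ev"
    using closed D A unfolding cartesian_closed_def by blast
  then have X: "X \<in> Obj C" and ev: "ev \<in> hom C (Prod C X D) A"
    and un: "\<And>Z f. Z \<in> Obj C \<Longrightarrow> f \<in> hom C (Prod C Z D) A \<Longrightarrow>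
      \<exists>!u. u \<in> hom C Z X \<and> ev \<cdot> prod_map C u (Ide C D) = f"
    unfolding is_exponential_def by blast+
  have pm: "ev \<cdot> prod_map C u (Ide C D) = ev \<cdot> pair C (u \<cdot> Pr1 C Z D) (Pr2 C Z D)"
    if "u \<in> hom C Z X" for u Z
    using that D by auto
  have "\<exists>u\<in>hom C Z X. \<forall>t x. el2 t x Z D \<longrightarrow> ev \<cdot> pair C (u \<cdot> t) x = f \<cdot> pair C t x"
    if Z: "Z \<in> Obj C" and f: "f \<in> hom C (Prod C Z D) A" for Z f
  proof -
    obtain u where u: "u \<in> hom C Z X" "ev \<cdot> prod_map C u (Ide C D) = f"
      using un[OF Z f] by blast
    have "ev \<cdot> pair C (u \<cdot> t) x = f \<cdot> pair C t x" if "el2 t x Z D" for t x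
    proof -
      have "ev \<cdot> (pair C (u \<cdot> Pr1 C Z D) (Pr2 C Z D) \<cdot> pair C t x) = f \<cdot> pair C t x"
        using u(2) that u(1) ev Z D X by (intro comp_eq_comp) (simp_all add: pm)
      then show ?thesis
        using that u(1) ev Z D X by simp
    qed
    then show ?thesis
      using u(1) by blast
  qed
  moreover have "u = v" if uv: "u \<in> Arr C" "v \<in> Arr C" "Dom C v = Dom C u" "Cod C u = X" "Cod C v = X"
    and e: "\<And>t x. el2 t x (Dom C u) D \<Longrightarrow> ev \<cdot> pair C (u \<cdot> t) x = ev \<cdot> pair C (v \<cdot> t) x" for u v
  proof -
    let ?Z = "Dom C u"
    have "u \<in> hom C ?Z X" "v \<in> hom C ?Z X"
      using uv by auto
    moreover have "ev \<cdot> prod_map C v (Ide C D) = ev \<cdot> prod_map C u (Ide C D)"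
      using e[of "Pr1 C ?Z D" "Pr2 C ?Z D"] uv D by simp
    moreover have "ev \<cdot> prod_map C u (Ide C D) \<in> hom C (Prod C ?Z D) A"
      using uv D X ev by simp
    ultimately show ?thesis
      using un[of ?Z "ev \<cdot> prod_map C u (Ide C D)"] Obj_Dom[OF uv(1)] by blast
  qed
  ultimately show ?thesis
    unfolding is_exp_def using X ev by blast
qed

text \<open>Exponentials turn an equation with parameters in \<open>D\<close> into an equaliser.\<close>

lemma subrep_All:
  assumes f: "f \<in> hom C (Prod C X D) Y" and g: "g \<in> hom C (Prod C X D) Y" and X: "X \<in> Obj C" and D: "D \<in> Obj C"
  shows "subrep X (\<lambda>u. \<forall>t x. el2 t x (Dom C u) D \<longrightarrow> f \<cdot> pair C (u \<cdot> t) x = g \<cdot> pair C (u \<cdot> t) x)"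
proof -
  have Y: "Y \<in> Obj C" using f by auto
  obtain P ev where "is_exp D Y P ev"
    using exponential_ex[OF D Y] by blast
  note P = is_expD[OF this]
  obtain f' where f': "f' \<in> hom C X P" "\<And>t x. el2 t x X D \<Longrightarrow> ev \<cdot> pair C (f' \<cdot> t) x = f \<cdot> pair C t x"
    using P(3)[OF X f] by blast
  obtain g' where g': "g' \<in> hom C X P" "\<And>t x. el2 t x X D \<Longrightarrow> ev \<cdot> pair C (g' \<cdot> t) x = g \<cdot> pair C t x"
    using P(3)[OF X g] by blast
  have "subrep X (\<lambda>u. f' \<cdot> u = g' \<cdot> u)"
    using f' g' by (intro equalizer_subrep) simp_all
  moreover have "f' \<cdot> u = g' \<cdot> u \<longleftrightarrow>
      (\<forall>t x. el2 t x (Dom C u) D \<longrightarrow> f \<cdot> pair C (u \<cdot> t) x = g \<cdot> pair C (u \<cdot> t) x)"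
    if u: "u \<in> Arr C" "Cod C u = X" for u
  proof
    assume e: "f' \<cdot> u = g' \<cdot> u"
    show "\<forall>t x. el2 t x (Dom C u) D \<longrightarrow> f \<cdot> pair C (u \<cdot> t) x = g \<cdot> pair C (u \<cdot> t) x"
    proof (intro allI impI)
      fix t x assume tx: "el2 t x (Dom C u) D"
      have "f' \<cdot> (u \<cdot> t) = g' \<cdot> (u \<cdot> t)"
        using comp_eq_comp[OF e, of t] tx u f'(1) g'(1) by simp
      then show "f \<cdot> pair C (u \<cdot> t) x = g \<cdot> pair C (u \<cdot> t) x"
        using f'(2)[of "u \<cdot> t" x] g'(2)[of "u \<cdot> t" x] tx u by simp
    qed
  next
    assume e: "\<forall>t x. el2 t x (Dom C u) D \<longrightarrow> f \<cdot> pair C (u \<cdot> t) x = g \<cdot> pair C (u \<cdot> t) x"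
    show "f' \<cdot> u = g' \<cdot> u"
    proof (rule P(4))
      fix t x assume tx: "el2 t x (Dom C (f' \<cdot> u)) D"
      have "el2 (u \<cdot> t) x X D" "el2 t x (Dom C u) D"
        using tx u f'(1) by simp_all
      then have "ev \<cdot> pair C (f' \<cdot> (u \<cdot> t)) x = ev \<cdot> pair C (g' \<cdot> (u \<cdot> t)) x"
        using f'(2)[of "u \<cdot> t" x] g'(2)[of "u \<cdot> t" x] e by metis
      then show "ev \<cdot> pair C ((f' \<cdot> u) \<cdot> t) x = ev \<cdot> pair C ((g' \<cdot> u) \<cdot> t) x"
        using tx u f'(1) g'(1) by simp
    qed (use u f'(1) g'(1) in simp_all)
  qed
  ultimately show ?thesis
    by (rule subrep_cong)
qed

text \<open>\<open>subrep_comp\<close> joined with \<open>subrep_All\<close>. To add a condition it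
  is enough to display it, on the subobject where the earlier conditions hold, as an equation
  between two arrows with one parameter.\<close>

lemma subrep_step:
  assumes "subrep X S"
    and "\<And>X' e. X' \<in> Obj C \<Longrightarrow> e \<in> hom C X' X \<Longrightarrow> (\<And>w. w \<in> Arr C \<Longrightarrow> Cod C w = X' \<Longrightarrow> S (e \<cdot> w)) \<Longrightarrow>
      \<exists>D Y f g. D \<in> Obj C \<and> f \<in> hom C (Prod C X' D) Y \<and> g \<in> hom C (Prod C X' D) Y \<and>
        (\<forall>w. w \<in> Arr C \<and> Cod C w = X' \<longrightarrow> (T (e \<cdot> w) \<longleftrightarrow>
          (\<forall>t x. el2 t x (Dom C w) D \<longrightarrow> f \<cdot> pair C (w \<cdot> t) x = g \<cdot> pair C (w \<cdot> t) x)))"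
  shows "subrep X (\<lambda>u. S u \<and> T u)"
proof (rule subrep_comp[OF assms(1)])
  fix X' e assume e: "e \<in> hom C X' X" and S: "\<And>w. w \<in> Arr C \<Longrightarrow> Cod C w = X' \<Longrightarrow> S (e \<cdot> w)"
  have X': "X' \<in> Obj C" using e by auto
  obtain D Y f g where "D \<in> Obj C" "f \<in> hom C (Prod C X' D) Y" "g \<in> hom C (Prod C X' D) Y"
    and T: "\<And>w. w \<in> Arr C \<Longrightarrow> Cod C w = X' \<Longrightarrow> T (e \<cdot> w) \<longleftrightarrow>
          (\<forall>t x. el2 t x (Dom C w) D \<longrightarrow> f \<cdot> pair C (w \<cdot> t) x = g \<cdot> pair C (w \<cdot> t) x)"
    using assms(2)[OF X' e S] by blast
  then show "subrep X' (\<lambda>w. T (e \<cdot> w))"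
    using subrep_All[of f X' D Y g] X' by (intro subrep_cong[OF subrep_All[of f X' D Y g]]) simp_all
qed

section \<open>Families of functors and of natural transformations\<close>

text \<open>A functor to \<open>A\<close> from the product of \<open>D\<close> with the discrete
  category on \<open>Z\<close>, written out: arrows of that product are pairs of an element of
  \<open>Z\<close> and an arrow of \<open>D\<close>.\<close>

definition fam :: "('o, 'a) icat \<Rightarrow> ('o, 'a) icat \<Rightarrow> 'o \<Rightarrow> 'a \<Rightarrow> 'a \<Rightarrow> bool" where
  "fam D A Z f\<^sub>0 f\<^sub>1 \<longleftrightarrow> f\<^sub>0 \<in> hom C (Prod C Z (IOb D)) (IOb A) \<and> f\<^sub>1 \<in> hom C (Prod C Z (IAr D)) (IAr A) \<and>
    (\<forall>t d. el2 t d Z (IAr D) \<longrightarrow> ISrc A \<cdot> (f\<^sub>1 \<cdot> pair C t d) = f\<^sub>0 \<cdot> pair C t (ISrc D \<cdot> d)) \<and>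
    (\<forall>t d. el2 t d Z (IAr D) \<longrightarrow> ITgt A \<cdot> (f\<^sub>1 \<cdot> pair C t d) = f\<^sub>0 \<cdot> pair C t (ITgt D \<cdot> d)) \<and>
    (\<forall>t x. el2 t x Z (IOb D) \<longrightarrow> f\<^sub>1 \<cdot> pair C t (IIde D \<cdot> x) = IIde A \<cdot> (f\<^sub>0 \<cdot> pair C t x)) \<and>
    (\<forall>t d d'. el2 t d Z (IAr D) \<and> el2 t d' Z (IAr D) \<and> ITgt D \<cdot> d = ISrc D \<cdot> d' \<longrightarrow>
      f\<^sub>1 \<cdot> pair C t (icomp C D d d') = icomp C A (f\<^sub>1 \<cdot> pair C t d) (f\<^sub>1 \<cdot> pair C t d'))"

lemma fam_simps:
  assumes "fam D A Z f\<^sub>0 f\<^sub>1"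
  shows "f\<^sub>0 \<in> Arr C" "Dom C f\<^sub>0 = Prod C Z (IOb D)" "Cod C f\<^sub>0 = IOb A"
    "f\<^sub>1 \<in> Arr C" "Dom C f\<^sub>1 = Prod C Z (IAr D)" "Cod C f\<^sub>1 = IAr A"
    "\<And>t d. t \<in> Arr C \<Longrightarrow> d \<in> Arr C \<Longrightarrow> Dom C d = Dom C t \<Longrightarrow> Cod C t = Z \<Longrightarrow> Cod C d = IAr D \<Longrightarrow>
      ISrc A \<cdot> (f\<^sub>1 \<cdot> pair C t d) = f\<^sub>0 \<cdot> pair C t (ISrc D \<cdot> d)"
    "\<And>t d. t \<in> Arr C \<Longrightarrow> d \<in> Arr C \<Longrightarrow> Dom C d = Dom C t \<Longrightarrow> Cod C t = Z \<Longrightarrow> Cod C d = IAr D \<Longrightarrow>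
      ITgt A \<cdot> (f\<^sub>1 \<cdot> pair C t d) = f\<^sub>0 \<cdot> pair C t (ITgt D \<cdot> d)"
    "\<And>t x. t \<in> Arr C \<Longrightarrow> x \<in> Arr C \<Longrightarrow> Dom C x = Dom C t \<Longrightarrow> Cod C t = Z \<Longrightarrow> Cod C x = IOb D \<Longrightarrow>
      f\<^sub>1 \<cdot> pair C t (IIde D \<cdot> x) = IIde A \<cdot> (f\<^sub>0 \<cdot> pair C t x)"
    "\<And>t d d'. t \<in> Arr C \<Longrightarrow> d \<in> Arr C \<Longrightarrow> d' \<in> Arr C \<Longrightarrow> Dom C d = Dom C t \<Longrightarrow> Dom C d' = Dom C t \<Longrightarrow> Cod C t = Z \<Longrightarrow>
      Cod C d = IAr D \<Longrightarrow> Cod C d' = IAr D \<Longrightarrow> ITgt D \<cdot> d = ISrc D \<cdot> d' \<Longrightarrow>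
      f\<^sub>1 \<cdot> pair C t (icomp C D d d') = icomp C A (f\<^sub>1 \<cdot> pair C t d) (f\<^sub>1 \<cdot> pair C t d')"
  using assms unfolding fam_def by auto

text \<open>Both families live over the codomain of \<open>u\<close> and are substituted along
  \<open>u\<close>; \<open>a\<close> is a transformation between the results. Allowing two different
  families serves both uses: arrows of \<open>[D, A]\<close>, where one universal family is
  substituted twice, and cocones, where one family is constant at \<open>F\<close> and the other
  consists of constant functors.\<close>

definition natfam ::
  "('o, 'a) icat \<Rightarrow> ('o, 'a) icat \<Rightarrow> 'a \<Rightarrow> 'a \<Rightarrow> 'a \<Rightarrow> 'a \<Rightarrow> 'a \<Rightarrow> 'a \<Rightarrow> bool" where
  "natfam D A f\<^sub>0 f\<^sub>1 g\<^sub>0 g\<^sub>1 u a \<longleftrightarrow> a \<in> hom C (Prod C (Dom C u) (IOb D)) (IAr A) \<and>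
    (\<forall>t x. el2 t x (Dom C u) (IOb D) \<longrightarrow> ISrc A \<cdot> (a \<cdot> pair C t x) = f\<^sub>0 \<cdot> pair C (u \<cdot> t) x) \<and>
    (\<forall>t x. el2 t x (Dom C u) (IOb D) \<longrightarrow> ITgt A \<cdot> (a \<cdot> pair C t x) = g\<^sub>0 \<cdot> pair C (u \<cdot> t) x) \<and>
    (\<forall>t d. el2 t d (Dom C u) (IAr D) \<longrightarrow>
      icomp C A (f\<^sub>1 \<cdot> pair C (u \<cdot> t) d) (a \<cdot> pair C t (ITgt D \<cdot> d)) =
      icomp C A (a \<cdot> pair C t (ISrc D \<cdot> d)) (g\<^sub>1 \<cdot> pair C (u \<cdot> t) d))"

lemma natfam_simps:
  assumes "natfam D A f\<^sub>0 f\<^sub>1 g\<^sub>0 g\<^sub>1 u a"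
  shows "a \<in> Arr C" "Dom C a = Prod C (Dom C u) (IOb D)" "Cod C a = IAr A"
    "\<And>t x. t \<in> Arr C \<Longrightarrow> x \<in> Arr C \<Longrightarrow> Dom C x = Dom C t \<Longrightarrow> Cod C t = Dom C u \<Longrightarrow> Cod C x = IOb D \<Longrightarrow>
      ISrc A \<cdot> (a \<cdot> pair C t x) = f\<^sub>0 \<cdot> pair C (u \<cdot> t) x"
    "\<And>t x. t \<in> Arr C \<Longrightarrow> x \<in> Arr C \<Longrightarrow> Dom C x = Dom C t \<Longrightarrow> Cod C t = Dom C u \<Longrightarrow> Cod C x = IOb D \<Longrightarrow>
      ITgt A \<cdot> (a \<cdot> pair C t x) = g\<^sub>0 \<cdot> pair C (u \<cdot> t) x"
    "\<And>t d. t \<in> Arr C \<Longrightarrow> d \<in> Arr C \<Longrightarrow> Dom C d = Dom C t \<Longrightarrow> Cod C t = Dom C u \<Longrightarrow> Cod C d = IAr D \<Longrightarrow>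
      icomp C A (f\<^sub>1 \<cdot> pair C (u \<cdot> t) d) (a \<cdot> pair C t (ITgt D \<cdot> d)) =
      icomp C A (a \<cdot> pair C t (ISrc D \<cdot> d)) (g\<^sub>1 \<cdot> pair C (u \<cdot> t) d)"
  using assms unfolding natfam_def by auto

text \<open>A candidate is an element of \<open>X\<close> together with a map from the objects of
  \<open>D\<close> to the arrows of \<open>A\<close>, which is an element of a product with an
  exponential. The conditions on source and target and naturality are equations with a parameter in
  \<open>D\<close>, so they cut out a subobject.\<close>

lemma natfam_representable:
  assumes D: "is_icat C D" and A: "is_icat C A" and X: "X \<in> Obj C"
    and f: "fam D A X f\<^sub>0 f\<^sub>1" and g: "fam D A X g\<^sub>0 g\<^sub>1"
  obtains N p \<phi> where "N \<in> Obj C" "p \<in> hom C N X" "natfam D A f\<^sub>0 f\<^sub>1 g\<^sub>0 g\<^sub>1 p \<phi>"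
    "\<And>u a. u \<in> Arr C \<Longrightarrow> Cod C u = X \<Longrightarrow> natfam D A f\<^sub>0 f\<^sub>1 g\<^sub>0 g\<^sub>1 u a \<Longrightarrow>
      \<exists>w\<in>hom C (Dom C u) N. p \<cdot> w = u \<and> (\<forall>t x. el2 t x (Dom C u) (IOb D) \<longrightarrow> \<phi> \<cdot> pair C (w \<cdot> t) x = a \<cdot> pair C t x)"
    "\<And>w v. w \<in> Arr C \<Longrightarrow> v \<in> Arr C \<Longrightarrow> Dom C v = Dom C w \<Longrightarrow> Cod C w = N \<Longrightarrow> Cod C v = N \<Longrightarrow> p \<cdot> w = p \<cdot> v \<Longrightarrow>
      (\<And>t x. el2 t x (Dom C w) (IOb D) \<Longrightarrow> \<phi> \<cdot> pair C (w \<cdot> t) x = \<phi> \<cdot> pair C (v \<cdot> t) x) \<Longrightarrow> w = v"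
proof -
  note f = fam_simps[OF f] and g = fam_simps[OF g]
  obtain P ev where "is_exp (IOb D) (IAr A) P ev"
    using exponential_ex[OF icat_data(1)[OF D] icat_data(2)[OF A]] by blast
  note P = is_expD(1)[OF this] and ev = is_expD(2)[OF this] and curry = is_expD(3)[OF this] and ext = is_expD(4)[OF this]
  define M where "M = Prod C X P"
  let ?p = "Pr1 C X P" and ?q = "Pr2 C X P"
  note [simp] = P X D A ev[simplified] f(1-6) g(1-6)
  have M [simp]: "M \<in> Obj C" "Dom C ?p = M" "Dom C ?q = M"
    by (simp_all add: M_def)
  define S where "S m \<longleftrightarrow> (\<forall>t x. el2 t x (Dom C m) (IOb D) \<longrightarrow>
    ISrc A \<cdot> (ev \<cdot> pair C (?q \<cdot> (m \<cdot> t)) x) = f\<^sub>0 \<cdot> pair C (?p \<cdot> (m \<cdot> t)) x)" for m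
  define T where "T m \<longleftrightarrow> (\<forall>t x. el2 t x (Dom C m) (IOb D) \<longrightarrow>
    ITgt A \<cdot> (ev \<cdot> pair C (?q \<cdot> (m \<cdot> t)) x) = g\<^sub>0 \<cdot> pair C (?p \<cdot> (m \<cdot> t)) x)" for m
  define R where "R m \<longleftrightarrow> (\<forall>t d. el2 t d (Dom C m) (IAr D) \<longrightarrow>
    icomp C A (f\<^sub>1 \<cdot> pair C (?p \<cdot> (m \<cdot> t)) d) (ev \<cdot> pair C (?q \<cdot> (m \<cdot> t)) (ITgt D \<cdot> d)) =
      icomp C A (ev \<cdot> pair C (?q \<cdot> (m \<cdot> t)) (ISrc D \<cdot> d)) (g\<^sub>1 \<cdot> pair C (?p \<cdot> (m \<cdot> t)) d))" for m
  have "subrep M S"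
    unfolding S_def
    by (rule subrep_cong[OF subrep_All[of "ISrc A \<cdot> (ev \<cdot> pair C (?q \<cdot> Pr1 C M (IOb D)) (Pr2 C M (IOb D)))" M "IOb D" "IOb A"
        "f\<^sub>0 \<cdot> pair C (?p \<cdot> Pr1 C M (IOb D)) (Pr2 C M (IOb D))"]])
      (simp_all cong: conj_cong)
  then have "subrep M (\<lambda>m. S m \<and> T m)"
  proof (rule subrep_step)
    fix X' e assume X': "X' \<in> Obj C" and e: "e \<in> hom C X' M"
    show "\<exists>D Y f g. D \<in> Obj C \<and> f \<in> hom C (Prod C X' D) Y \<and> g \<in> hom C (Prod C X' D) Y \<and>
        (\<forall>w. w \<in> Arr C \<and> Cod C w = X' \<longrightarrow> (T (e \<cdot> w) \<longleftrightarrow>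
          (\<forall>t x. el2 t x (Dom C w) D \<longrightarrow> f \<cdot> pair C (w \<cdot> t) x = g \<cdot> pair C (w \<cdot> t) x)))"
      by (rule exI[of _ "IOb D"], rule exI[of _ "IOb A"],
          rule exI[of _ "ITgt A \<cdot> (ev \<cdot> pair C (?q \<cdot> (e \<cdot> Pr1 C X' (IOb D))) (Pr2 C X' (IOb D)))"],
          rule exI[of _ "g\<^sub>0 \<cdot> pair C (?p \<cdot> (e \<cdot> Pr1 C X' (IOb D))) (Pr2 C X' (IOb D))"])
        (use e X' in \<open>simp add: T_def cong: conj_cong\<close>)
  qed
  \<comment> \<open>Naturality comes last: the two composites in \<open>R\<close> consist of
    matching arrows of \<open>A\<close> only once \<open>S\<close> and \<open>T\<close> have fixed
    the endpoints, and only then are they arrows of \<open>C\<close> to be equalised.\<close>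
  then have "subrep M (\<lambda>m. (S m \<and> T m) \<and> R m)"
  proof (rule subrep_step)
    fix X' e assume X': "X' \<in> Obj C" and e: "e \<in> hom C X' M"
      and ST: "\<And>w. w \<in> Arr C \<Longrightarrow> Cod C w = X' \<Longrightarrow> S (e \<cdot> w) \<and> T (e \<cdot> w)"
    have [simp]: "ISrc A \<cdot> (ev \<cdot> pair C (?q \<cdot> (e \<cdot> t)) x) = f\<^sub>0 \<cdot> pair C (?p \<cdot> (e \<cdot> t)) x"
      "ITgt A \<cdot> (ev \<cdot> pair C (?q \<cdot> (e \<cdot> t)) x) = g\<^sub>0 \<cdot> pair C (?p \<cdot> (e \<cdot> t)) x"
      if "t \<in> Arr C" "x \<in> Arr C" "Dom C x = Dom C t" "Cod C t = X'" "Cod C x = IOb D" for t x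
      using ST[of "Ide C X'"] that e X' unfolding S_def T_def by simp_all
    let ?a = "Pr1 C X' (IAr D)" and ?b = "Pr2 C X' (IAr D)"
    show "\<exists>D Y f g. D \<in> Obj C \<and> f \<in> hom C (Prod C X' D) Y \<and> g \<in> hom C (Prod C X' D) Y \<and>
        (\<forall>w. w \<in> Arr C \<and> Cod C w = X' \<longrightarrow> (R (e \<cdot> w) \<longleftrightarrow>
          (\<forall>t x. el2 t x (Dom C w) D \<longrightarrow> f \<cdot> pair C (w \<cdot> t) x = g \<cdot> pair C (w \<cdot> t) x)))"
      by (rule exI[of _ "IAr D"], rule exI[of _ "IAr A"],
          rule exI[of _ "icomp C A (f\<^sub>1 \<cdot> pair C (?p \<cdot> (e \<cdot> ?a)) ?b) (ev \<cdot> pair C (?q \<cdot> (e \<cdot> ?a)) (ITgt D \<cdot> ?b))"],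
          rule exI[of _ "icomp C A (ev \<cdot> pair C (?q \<cdot> (e \<cdot> ?a)) (ISrc D \<cdot> ?b)) (g\<^sub>1 \<cdot> pair C (?p \<cdot> (e \<cdot> ?a)) ?b)"])
        (use e X' in \<open>simp add: R_def f(7,8) g(7,8) cong: conj_cong\<close>)
  qed
  then obtain N e where N: "N \<in> Obj C" "e \<in> hom C N M"
    "\<And>u v. u \<in> Arr C \<Longrightarrow> v \<in> Arr C \<Longrightarrow> Dom C u = Dom C v \<Longrightarrow> Cod C u = N \<Longrightarrow> Cod C v = N \<Longrightarrow> e \<cdot> u = e \<cdot> v \<Longrightarrow> u = v"
    "\<And>u. u \<in> Arr C \<Longrightarrow> Cod C u = M \<Longrightarrow> (S u \<and> T u) \<and> R u \<longleftrightarrow> (\<exists>w\<in>hom C (Dom C u) N. e \<cdot> w = u)"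
    unfolding subrep_def by blast
  define p where "p = ?p \<cdot> e"
  define \<phi> where "\<phi> = ev \<cdot> pair C (?q \<cdot> (e \<cdot> Pr1 C N (IOb D))) (Pr2 C N (IOb D))"
  note [simp] = N(1) N(2)[simplified]
  have p [simp]: "p \<in> Arr C" "Dom C p = N" "Cod C p = X"
    by (simp_all add: p_def)
  have p_el: "p \<cdot> t = ?p \<cdot> (e \<cdot> t)" if "t \<in> Arr C" "Cod C t = N" for t
    using that by (simp add: p_def)
  have \<phi> [simp]: "\<phi> \<in> Arr C" "Dom C \<phi> = Prod C N (IOb D)" "Cod C \<phi> = IAr A"
    by (simp_all add: \<phi>_def)
  have \<phi>_el: "\<phi> \<cdot> pair C t x = ev \<cdot> pair C (?q \<cdot> (e \<cdot> t)) x"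
    if "t \<in> Arr C" "x \<in> Arr C" "Dom C x = Dom C t" "Cod C t = N" "Cod C x = IOb D" for t x
    using that by (simp add: \<phi>_def)
  have STR: "S e" "T e" "R e"
    using N(4)[of e] by (auto intro: bexI[of _ "Ide C N"])
  show ?thesis
  proof (rule that[of N p \<phi>])
    show "natfam D A f\<^sub>0 f\<^sub>1 g\<^sub>0 g\<^sub>1 p \<phi>"
      using STR unfolding natfam_def S_def T_def R_def by (simp add: p_el \<phi>_el cong: conj_cong)
  next
    fix u a assume u: "u \<in> Arr C" "Cod C u = X" and a: "natfam D A f\<^sub>0 f\<^sub>1 g\<^sub>0 g\<^sub>1 u a"
    note n = natfam_simps[OF a]
    obtain k where k: "k \<in> hom C (Dom C u) P"
      "\<And>t x. el2 t x (Dom C u) (IOb D) \<Longrightarrow> ev \<cdot> pair C (k \<cdot> t) x = a \<cdot> pair C t x"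
      using curry[of "Dom C u" a] n(1-3) u by auto
    have k1: "k \<in> Arr C" "Dom C k = Dom C u" "Cod C k = P"
      using k(1) by simp_all
    let ?m = "pair C u k"
    have m: "?m \<in> Arr C" "Cod C ?m = M" "Dom C ?m = Dom C u"
      using u k1 by (simp_all add: M_def)
    have "S ?m" "T ?m" "R ?m"
      using u k1 by (simp_all add: S_def T_def R_def k(2) n(4-6) cong: conj_cong)
    then obtain w where w: "w \<in> hom C (Dom C u) N" "e \<cdot> w = ?m"
      using N(4)[of ?m] m by auto
    have "p \<cdot> w = u"
      using w u k1 by (simp add: p_el)
    moreover have "\<phi> \<cdot> pair C (w \<cdot> t) x = a \<cdot> pair C t x" if tx: "el2 t x (Dom C u) (IOb D)" for t x
    proof -
      have "e \<cdot> (w \<cdot> t) = ?m \<cdot> t"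
        using w tx by (intro comp_eq_comp) simp_all
      then show ?thesis
        using w tx u k1 k(2)[OF tx] by (simp add: \<phi>_el)
    qed
    ultimately show "\<exists>w\<in>hom C (Dom C u) N. p \<cdot> w = u \<and> (\<forall>t x. el2 t x (Dom C u) (IOb D) \<longrightarrow> \<phi> \<cdot> pair C (w \<cdot> t) x = a \<cdot> pair C t x)"
      using w(1) by blast
  next
    fix w v assume w: "w \<in> Arr C" "v \<in> Arr C" "Dom C v = Dom C w" "Cod C w = N" "Cod C v = N" "p \<cdot> w = p \<cdot> v"
      and e: "\<And>t x. el2 t x (Dom C w) (IOb D) \<Longrightarrow> \<phi> \<cdot> pair C (w \<cdot> t) x = \<phi> \<cdot> pair C (v \<cdot> t) x"
    have q: "?q \<cdot> (e \<cdot> w) = ?q \<cdot> (e \<cdot> v)"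
    proof (rule ext)
      fix t x assume tx: "el2 t x (Dom C (?q \<cdot> (e \<cdot> w))) (IOb D)"
      then show "ev \<cdot> pair C ((?q \<cdot> (e \<cdot> w)) \<cdot> t) x = ev \<cdot> pair C ((?q \<cdot> (e \<cdot> v)) \<cdot> t) x"
        using e[of t x] w(1-5) by (simp add: \<phi>_el)
    qed (use w(1-5) in simp_all)
    have "?p \<cdot> (e \<cdot> w) = ?p \<cdot> (e \<cdot> v)"
      using w(6) p_el[OF w(1,4)] p_el[OF w(2,5)] by simp
    then have "e \<cdot> w = e \<cdot> v"
      by (intro Prod_ext[OF _ _ _ _ _ X P(1) _ q]) (use w(1-5) in \<open>simp_all add: M_def[symmetric]\<close>)
    then show "w = v"
      using N(3)[of w v] w by simp
  qed simp_all
qed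


text \<open>A representing object of \<open>fam\<close> with its universal family; it becomes the
  object of objects of the exponential. Both components are needed in the uniqueness clause, since
  two functors may agree on objects only.\<close>

definition is_fam_object :: "('o, 'a) icat \<Rightarrow> ('o, 'a) icat \<Rightarrow> 'o \<Rightarrow> 'a \<Rightarrow> 'a \<Rightarrow> bool" where
  "is_fam_object D A X \<phi>\<^sub>0 \<phi>\<^sub>1 \<longleftrightarrow> X \<in> Obj C \<and> fam D A X \<phi>\<^sub>0 \<phi>\<^sub>1 \<and>
    (\<forall>Z f\<^sub>0 f\<^sub>1. Z \<in> Obj C \<and> fam D A Z f\<^sub>0 f\<^sub>1 \<longrightarrow>
      (\<exists>u\<in>hom C Z X. (\<forall>t x. el2 t x Z (IOb D) \<longrightarrow> \<phi>\<^sub>0 \<cdot> pair C (u \<cdot> t) x = f\<^sub>0 \<cdot> pair C t x) \<and>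
        (\<forall>t d. el2 t d Z (IAr D) \<longrightarrow> \<phi>\<^sub>1 \<cdot> pair C (u \<cdot> t) d = f\<^sub>1 \<cdot> pair C t d))) \<and>
    (\<forall>u v. u \<in> Arr C \<and> v \<in> Arr C \<and> Dom C v = Dom C u \<and> Cod C u = X \<and> Cod C v = X \<and>
      (\<forall>t x. el2 t x (Dom C u) (IOb D) \<longrightarrow> \<phi>\<^sub>0 \<cdot> pair C (u \<cdot> t) x = \<phi>\<^sub>0 \<cdot> pair C (v \<cdot> t) x) \<and>
      (\<forall>t d. el2 t d (Dom C u) (IAr D) \<longrightarrow> \<phi>\<^sub>1 \<cdot> pair C (u \<cdot> t) d = \<phi>\<^sub>1 \<cdot> pair C (v \<cdot> t) d) \<longrightarrow> u = v)"

lemma is_fam_objectD: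
  assumes "is_fam_object D A X \<phi>\<^sub>0 \<phi>\<^sub>1"
  shows "X \<in> Obj C" "fam D A X \<phi>\<^sub>0 \<phi>\<^sub>1"
    "\<And>Z f\<^sub>0 f\<^sub>1. Z \<in> Obj C \<Longrightarrow> fam D A Z f\<^sub>0 f\<^sub>1 \<Longrightarrow>
      \<exists>u\<in>hom C Z X. (\<forall>t x. el2 t x Z (IOb D) \<longrightarrow> \<phi>\<^sub>0 \<cdot> pair C (u \<cdot> t) x = f\<^sub>0 \<cdot> pair C t x) \<and>
        (\<forall>t d. el2 t d Z (IAr D) \<longrightarrow> \<phi>\<^sub>1 \<cdot> pair C (u \<cdot> t) d = f\<^sub>1 \<cdot> pair C t d)"
    "\<And>u v. u \<in> Arr C \<Longrightarrow> v \<in> Arr C \<Longrightarrow> Dom C v = Dom C u \<Longrightarrow> Cod C u = X \<Longrightarrow> Cod C v = X \<Longrightarrow>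
      (\<And>t x. el2 t x (Dom C u) (IOb D) \<Longrightarrow> \<phi>\<^sub>0 \<cdot> pair C (u \<cdot> t) x = \<phi>\<^sub>0 \<cdot> pair C (v \<cdot> t) x) \<Longrightarrow>
      (\<And>t d. el2 t d (Dom C u) (IAr D) \<Longrightarrow> \<phi>\<^sub>1 \<cdot> pair C (u \<cdot> t) d = \<phi>\<^sub>1 \<cdot> pair C (v \<cdot> t) d) \<Longrightarrow> u = v"
  using assms unfolding is_fam_object_def by blast+

text \<open>A pair of a map on objects and a map on arrows is an element of a product of two
  exponentials, and the functor axioms are imposed one after another. Preservation of composites is
  quantified over \<open>ICp D\<close>, the object of composable pairs, so that it too is an
  equation with a single parameter.\<close>

lemma fam_object_ex:
  assumes D: "is_icat C D" and A: "is_icat C A"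
  shows "\<exists>X \<phi>\<^sub>0 \<phi>\<^sub>1. is_fam_object D A X \<phi>\<^sub>0 \<phi>\<^sub>1"
proof -
  obtain P ev where "is_exp (IOb D) (IOb A) P ev"
    using exponential_ex[OF icat_data(1)[OF D] icat_data(1)[OF A]] by blast
  note P = is_expD(1)[OF this] and ev = is_expD(2)[OF this] and curryP = is_expD(3)[OF this] and extP = is_expD(4)[OF this]
  obtain Q ew where "is_exp (IAr D) (IAr A) Q ew"
    using exponential_ex[OF icat_data(2)[OF D] icat_data(2)[OF A]] by blast
  note Q = is_expD(1)[OF this] and ew = is_expD(2)[OF this] and curryQ = is_expD(3)[OF this] and extQ = is_expD(4)[OF this]
  define M where "M = Prod C P Q"
  let ?p = "Pr1 C P Q" and ?q = "Pr2 C P Q"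
  note [simp] = P Q D A ev[simplified] ew[simplified]
  have M [simp]: "M \<in> Obj C" "Dom C ?p = M" "Dom C ?q = M"
    by (simp_all add: M_def)
  define S where "S m \<longleftrightarrow> (\<forall>t d. el2 t d (Dom C m) (IAr D) \<longrightarrow>
    ISrc A \<cdot> (ew \<cdot> pair C (?q \<cdot> (m \<cdot> t)) d) = ev \<cdot> pair C (?p \<cdot> (m \<cdot> t)) (ISrc D \<cdot> d))" for m
  define T where "T m \<longleftrightarrow> (\<forall>t d. el2 t d (Dom C m) (IAr D) \<longrightarrow>
    ITgt A \<cdot> (ew \<cdot> pair C (?q \<cdot> (m \<cdot> t)) d) = ev \<cdot> pair C (?p \<cdot> (m \<cdot> t)) (ITgt D \<cdot> d))" for m
  define I where "I m \<longleftrightarrow> (\<forall>t x. el2 t x (Dom C m) (IOb D) \<longrightarrow>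
    ew \<cdot> pair C (?q \<cdot> (m \<cdot> t)) (IIde D \<cdot> x) = IIde A \<cdot> (ev \<cdot> pair C (?p \<cdot> (m \<cdot> t)) x))" for m
  define R where "R m \<longleftrightarrow> (\<forall>t d. el2 t d (Dom C m) (ICp D) \<longrightarrow>
    ew \<cdot> pair C (?q \<cdot> (m \<cdot> t)) (ICmp D \<cdot> d) =
      icomp C A (ew \<cdot> pair C (?q \<cdot> (m \<cdot> t)) (IFst D \<cdot> d)) (ew \<cdot> pair C (?q \<cdot> (m \<cdot> t)) (ISnd D \<cdot> d)))" for m
  have "subrep M S"
    unfolding S_def
    by (rule subrep_cong[OF subrep_All[of "ISrc A \<cdot> (ew \<cdot> pair C (?q \<cdot> Pr1 C M (IAr D)) (Pr2 C M (IAr D)))" M "IAr D" "IOb A"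
        "ev \<cdot> pair C (?p \<cdot> Pr1 C M (IAr D)) (ISrc D \<cdot> Pr2 C M (IAr D))"]])
      (simp_all cong: conj_cong)
  then have "subrep M (\<lambda>m. S m \<and> T m)"
  proof (rule subrep_step)
    fix X' e assume X': "X' \<in> Obj C" and e: "e \<in> hom C X' M"
    show "\<exists>D Y f g. D \<in> Obj C \<and> f \<in> hom C (Prod C X' D) Y \<and> g \<in> hom C (Prod C X' D) Y \<and>
        (\<forall>w. w \<in> Arr C \<and> Cod C w = X' \<longrightarrow> (T (e \<cdot> w) \<longleftrightarrow>
          (\<forall>t x. el2 t x (Dom C w) D \<longrightarrow> f \<cdot> pair C (w \<cdot> t) x = g \<cdot> pair C (w \<cdot> t) x)))"
      by (rule exI[of _ "IAr D"], rule exI[of _ "IOb A"],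
          rule exI[of _ "ITgt A \<cdot> (ew \<cdot> pair C (?q \<cdot> (e \<cdot> Pr1 C X' (IAr D))) (Pr2 C X' (IAr D)))"],
          rule exI[of _ "ev \<cdot> pair C (?p \<cdot> (e \<cdot> Pr1 C X' (IAr D))) (ITgt D \<cdot> Pr2 C X' (IAr D))"])
        (use e X' in \<open>simp add: T_def cong: conj_cong\<close>)
  qed
  then have "subrep M (\<lambda>m. (S m \<and> T m) \<and> I m)"
  proof (rule subrep_step)
    fix X' e assume X': "X' \<in> Obj C" and e: "e \<in> hom C X' M"
    show "\<exists>D Y f g. D \<in> Obj C \<and> f \<in> hom C (Prod C X' D) Y \<and> g \<in> hom C (Prod C X' D) Y \<and>
        (\<forall>w. w \<in> Arr C \<and> Cod C w = X' \<longrightarrow> (I (e \<cdot> w) \<longleftrightarrow>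
          (\<forall>t x. el2 t x (Dom C w) D \<longrightarrow> f \<cdot> pair C (w \<cdot> t) x = g \<cdot> pair C (w \<cdot> t) x)))"
      by (rule exI[of _ "IOb D"], rule exI[of _ "IAr A"],
          rule exI[of _ "ew \<cdot> pair C (?q \<cdot> (e \<cdot> Pr1 C X' (IOb D))) (IIde D \<cdot> Pr2 C X' (IOb D))"],
          rule exI[of _ "IIde A \<cdot> (ev \<cdot> pair C (?p \<cdot> (e \<cdot> Pr1 C X' (IOb D))) (Pr2 C X' (IOb D)))"])
        (use e X' in \<open>simp add: I_def cong: conj_cong\<close>)
  qed
  then have "subrep M (\<lambda>m. ((S m \<and> T m) \<and> I m) \<and> R m)"
  proof (rule subrep_step)
    fix X' e assume X': "X' \<in> Obj C" and e: "e \<in> hom C X' M"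
      and ST: "\<And>w. w \<in> Arr C \<Longrightarrow> Cod C w = X' \<Longrightarrow> (S (e \<cdot> w) \<and> T (e \<cdot> w)) \<and> I (e \<cdot> w)"
    have [simp]: "ISrc A \<cdot> (ew \<cdot> pair C (?q \<cdot> (e \<cdot> t)) x) = ev \<cdot> pair C (?p \<cdot> (e \<cdot> t)) (ISrc D \<cdot> x)"
      "ITgt A \<cdot> (ew \<cdot> pair C (?q \<cdot> (e \<cdot> t)) x) = ev \<cdot> pair C (?p \<cdot> (e \<cdot> t)) (ITgt D \<cdot> x)"
      if "t \<in> Arr C" "x \<in> Arr C" "Dom C x = Dom C t" "Cod C t = X'" "Cod C x = IAr D" for t x
      using ST[of "Ide C X'"] that e X' unfolding S_def T_def by simp_all
    have [simp]: "ITgt D \<cdot> (IFst D \<cdot> x) = ISrc D \<cdot> (ISnd D \<cdot> x)" if "x \<in> Arr C" "Cod C x = ICp D" for x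
      using composable_comp[OF D composable_Fst_Snd[OF D], of x] that by (simp add: composable_def)
    have [simp]: "ITgt D \<cdot> IFst D = ISrc D \<cdot> ISnd D"
      using composable_Fst_Snd[OF D] by (simp add: composable_def)
    let ?a = "Pr1 C X' (ICp D)" and ?b = "Pr2 C X' (ICp D)"
    show "\<exists>D Y f g. D \<in> Obj C \<and> f \<in> hom C (Prod C X' D) Y \<and> g \<in> hom C (Prod C X' D) Y \<and>
        (\<forall>w. w \<in> Arr C \<and> Cod C w = X' \<longrightarrow> (R (e \<cdot> w) \<longleftrightarrow>
          (\<forall>t x. el2 t x (Dom C w) D \<longrightarrow> f \<cdot> pair C (w \<cdot> t) x = g \<cdot> pair C (w \<cdot> t) x)))"
      by (rule exI[of _ "ICp D"], rule exI[of _ "IAr A"],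
          rule exI[of _ "ew \<cdot> pair C (?q \<cdot> (e \<cdot> ?a)) (ICmp D \<cdot> ?b)"],
          rule exI[of _ "icomp C A (ew \<cdot> pair C (?q \<cdot> (e \<cdot> ?a)) (IFst D \<cdot> ?b)) (ew \<cdot> pair C (?q \<cdot> (e \<cdot> ?a)) (ISnd D \<cdot> ?b))"])
        (use e X' in \<open>simp add: R_def cong: conj_cong\<close>)
  qed
  then obtain N e where N: "N \<in> Obj C" "e \<in> hom C N M"
    "\<And>u v. u \<in> Arr C \<Longrightarrow> v \<in> Arr C \<Longrightarrow> Dom C u = Dom C v \<Longrightarrow> Cod C u = N \<Longrightarrow> Cod C v = N \<Longrightarrow> e \<cdot> u = e \<cdot> v \<Longrightarrow> u = v"
    "\<And>u. u \<in> Arr C \<Longrightarrow> Cod C u = M \<Longrightarrow> ((S u \<and> T u) \<and> I u) \<and> R u \<longleftrightarrow> (\<exists>w\<in>hom C (Dom C u) N. e \<cdot> w = u)"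
    unfolding subrep_def by blast
  note [simp] = N(1) N(2)[simplified]
  define \<phi> where "\<phi> = ev \<cdot> pair C (?p \<cdot> (e \<cdot> Pr1 C N (IOb D))) (Pr2 C N (IOb D))"
  define \<psi> where "\<psi> = ew \<cdot> pair C (?q \<cdot> (e \<cdot> Pr1 C N (IAr D))) (Pr2 C N (IAr D))"
  have \<phi> [simp]: "\<phi> \<in> Arr C" "Dom C \<phi> = Prod C N (IOb D)" "Cod C \<phi> = IOb A"
    by (simp_all add: \<phi>_def)
  have \<psi> [simp]: "\<psi> \<in> Arr C" "Dom C \<psi> = Prod C N (IAr D)" "Cod C \<psi> = IAr A"
    by (simp_all add: \<psi>_def)
  have \<phi>_el: "\<phi> \<cdot> pair C t x = ev \<cdot> pair C (?p \<cdot> (e \<cdot> t)) x"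
    if "t \<in> Arr C" "x \<in> Arr C" "Dom C x = Dom C t" "Cod C t = N" "Cod C x = IOb D" for t x
    using that by (simp add: \<phi>_def)
  have \<psi>_el: "\<psi> \<cdot> pair C t x = ew \<cdot> pair C (?q \<cdot> (e \<cdot> t)) x"
    if "t \<in> Arr C" "x \<in> Arr C" "Dom C x = Dom C t" "Cod C t = N" "Cod C x = IAr D" for t x
    using that by (simp add: \<psi>_def)
  have "\<exists>w\<in>hom C (Dom C e) N. e \<cdot> w = e"
    by (rule bexI[of _ "Ide C N"]) simp_all
  then have STR: "S e" "T e" "I e" "R e"
    using N(4)[of e] by simp_all
  have "fam D A N \<phi> \<psi>"
    unfolding fam_def
  proof (intro conjI allI impI)
    fix t d d' assume d: "el2 t d N (IAr D) \<and> el2 t d' N (IAr D) \<and> ITgt D \<cdot> d = ISrc D \<cdot> d'"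
    then have c: "composable D d d'"
      by (simp add: composable_def)
    note i = ipair_typing[OF D c]
    show "\<psi> \<cdot> pair C t (icomp C D d d') = icomp C A (\<psi> \<cdot> pair C t d) (\<psi> \<cdot> pair C t d')"
      using STR(4)[unfolded R_def, rule_format, of t "ipair D d d'"] d i by (simp add: icomp_ipair \<psi>_el)
  qed (use STR(1-3) in \<open>simp_all add: S_def T_def I_def \<phi>_el \<psi>_el\<close>)
  moreover have "\<exists>u\<in>hom C Z N. (\<forall>t x. el2 t x Z (IOb D) \<longrightarrow> \<phi> \<cdot> pair C (u \<cdot> t) x = f\<^sub>0 \<cdot> pair C t x) \<and>
        (\<forall>t d. el2 t d Z (IAr D) \<longrightarrow> \<psi> \<cdot> pair C (u \<cdot> t) d = f\<^sub>1 \<cdot> pair C t d)"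
    if Z: "Z \<in> Obj C" and f: "fam D A Z f\<^sub>0 f\<^sub>1" for Z f\<^sub>0 f\<^sub>1
  proof -
    note f = fam_simps[OF f]
    obtain k where k: "k \<in> hom C Z P" "\<And>t x. el2 t x Z (IOb D) \<Longrightarrow> ev \<cdot> pair C (k \<cdot> t) x = f\<^sub>0 \<cdot> pair C t x"
      using curryP[of Z f\<^sub>0] f(1-6) Z in_hom_iff by blast
    obtain l where l: "l \<in> hom C Z Q" "\<And>t x. el2 t x Z (IAr D) \<Longrightarrow> ew \<cdot> pair C (l \<cdot> t) x = f\<^sub>1 \<cdot> pair C t x"
      using curryQ[of Z f\<^sub>1] f(1-6) Z in_hom_iff by blast
    let ?m = "pair C k l"
    have m: "?m \<in> Arr C" "Cod C ?m = M" "Dom C ?m = Z"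
      using k(1) l(1) by (simp_all add: M_def)
    have c: "composable D (IFst D \<cdot> d) (ISnd D \<cdot> d)" "ICmp D \<cdot> d = icomp C D (IFst D \<cdot> d) (ISnd D \<cdot> d)"
      if "d \<in> Arr C" "Cod C d = ICp D" for d
      using composable_comp[OF D composable_Fst_Snd[OF D], of d] icomp_comp[OF D composable_Fst_Snd[OF D], of d] that
      by (simp_all add: icomp_Fst_Snd)
    have "S ?m" "T ?m" "I ?m"
      using k(1) l(1) by (simp_all add: S_def T_def I_def k(2) l(2) f(7-9) cong: conj_cong)
    moreover have "R ?m"
      unfolding R_def
    proof (intro allI impI)
      fix t d assume td: "el2 t d (Dom C ?m) (ICp D)"
      then show "ew \<cdot> pair C (?q \<cdot> (?m \<cdot> t)) (ICmp D \<cdot> d) =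
        icomp C A (ew \<cdot> pair C (?q \<cdot> (?m \<cdot> t)) (IFst D \<cdot> d)) (ew \<cdot> pair C (?q \<cdot> (?m \<cdot> t)) (ISnd D \<cdot> d))"
        using k(1) l(1) c(1)[of d] f(10)[of t "IFst D \<cdot> d" "ISnd D \<cdot> d"] by (simp add: c(2) l(2) m(3) composable_def)
    qed
    ultimately obtain w where w: "w \<in> hom C Z N" "e \<cdot> w = ?m"
      using N(4)[of ?m] m by auto
    have e: "e \<cdot> (w \<cdot> t) = ?m \<cdot> t" if "t \<in> Arr C" "Cod C t = Z" for t
      using w that by (intro comp_eq_comp) simp_all
    have "\<phi> \<cdot> pair C (w \<cdot> t) x = f\<^sub>0 \<cdot> pair C t x" if tx: "el2 t x Z (IOb D)" for t x
      using w tx k l(1) k(2)[OF tx] by (simp add: \<phi>_el e)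
    moreover have "\<psi> \<cdot> pair C (w \<cdot> t) x = f\<^sub>1 \<cdot> pair C t x" if tx: "el2 t x Z (IAr D)" for t x
      using w tx k(1) l l(2)[OF tx] by (simp add: \<psi>_el e)
    ultimately show ?thesis
      using w(1) by blast
  qed
  moreover have "w = v" if w: "w \<in> Arr C" "v \<in> Arr C" "Dom C v = Dom C w" "Cod C w = N" "Cod C v = N"
      and e: "\<And>t x. el2 t x (Dom C w) (IOb D) \<Longrightarrow> \<phi> \<cdot> pair C (w \<cdot> t) x = \<phi> \<cdot> pair C (v \<cdot> t) x"
        "\<And>t x. el2 t x (Dom C w) (IAr D) \<Longrightarrow> \<psi> \<cdot> pair C (w \<cdot> t) x = \<psi> \<cdot> pair C (v \<cdot> t) x" for w v
  proof -
    have p: "?p \<cdot> (e \<cdot> w) = ?p \<cdot> (e \<cdot> v)"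
    proof (rule extP)
      fix t x assume tx: "el2 t x (Dom C (?p \<cdot> (e \<cdot> w))) (IOb D)"
      then show "ev \<cdot> pair C ((?p \<cdot> (e \<cdot> w)) \<cdot> t) x = ev \<cdot> pair C ((?p \<cdot> (e \<cdot> v)) \<cdot> t) x"
        using e(1)[of t x] w(1-5) by (simp add: \<phi>_el)
    qed (use w(1-5) in simp_all)
    have q: "?q \<cdot> (e \<cdot> w) = ?q \<cdot> (e \<cdot> v)"
    proof (rule extQ)
      fix t x assume tx: "el2 t x (Dom C (?q \<cdot> (e \<cdot> w))) (IAr D)"
      then show "ew \<cdot> pair C ((?q \<cdot> (e \<cdot> w)) \<cdot> t) x = ew \<cdot> pair C ((?q \<cdot> (e \<cdot> v)) \<cdot> t) x"
        using e(2)[of t x] w(1-5) by (simp add: \<psi>_el)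
    qed (use w(1-5) in simp_all)
    have "e \<cdot> w = e \<cdot> v"
      by (rule Prod_ext[OF _ _ _ _ _ P Q p q]) (use w(1-5) in \<open>simp_all add: M_def[symmetric]\<close>)
    then show "w = v"
      using N(3)[of w v] w by simp
  qed
  ultimately have "is_fam_object D A N \<phi> \<psi>"
    unfolding is_fam_object_def using N(1) by blast
  then show ?thesis
    by blast
qed

lemma fam_pull:
  assumes D: "is_icat C D" and A: "is_icat C A" and X: "X \<in> Obj C" and f: "fam D A X f\<^sub>0 f\<^sub>1" and u: "u \<in> hom C Z X"
  shows "fam D A Z (f\<^sub>0 \<cdot> pair C (u \<cdot> Pr1 C Z (IOb D)) (Pr2 C Z (IOb D))) (f\<^sub>1 \<cdot> pair C (u \<cdot> Pr1 C Z (IAr D)) (Pr2 C Z (IAr D)))"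
proof -
  have Z: "Z \<in> Obj C"
    using u by auto
  show ?thesis
    unfolding fam_def using u by (simp add: fam_simps[OF f] D A X Z cong: conj_cong)
qed

text \<open>The conditions on \<open>a\<close> making it a family, indexed by \<open>Z\<close>, of natural transformations from the
  functors named by \<open>p\<close> to those named by \<open>q\<close>.\<close>

definition natel ::
  "('o, 'a) icat \<Rightarrow> ('o, 'a) icat \<Rightarrow> 'a \<Rightarrow> 'a \<Rightarrow> 'o \<Rightarrow> 'a \<Rightarrow> 'a \<Rightarrow> 'a \<Rightarrow> bool" where
  "natel D A \<phi>\<^sub>0 \<phi>\<^sub>1 Z p q a \<longleftrightarrow> a \<in> hom C (Prod C Z (IOb D)) (IAr A) \<and>
    (\<forall>t x. el2 t x Z (IOb D) \<longrightarrow> ISrc A \<cdot> (a \<cdot> pair C t x) = \<phi>\<^sub>0 \<cdot> pair C (p \<cdot> t) x) \<and>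
    (\<forall>t x. el2 t x Z (IOb D) \<longrightarrow> ITgt A \<cdot> (a \<cdot> pair C t x) = \<phi>\<^sub>0 \<cdot> pair C (q \<cdot> t) x) \<and>
    (\<forall>t d. el2 t d Z (IAr D) \<longrightarrow>
      icomp C A (\<phi>\<^sub>1 \<cdot> pair C (p \<cdot> t) d) (a \<cdot> pair C t (ITgt D \<cdot> d)) =
      icomp C A (a \<cdot> pair C t (ISrc D \<cdot> d)) (\<phi>\<^sub>1 \<cdot> pair C (q \<cdot> t) d))"

lemma natel_simps:
  assumes "natel D A \<phi>\<^sub>0 \<phi>\<^sub>1 Z p q a"
  shows "a \<in> Arr C" "Dom C a = Prod C Z (IOb D)" "Cod C a = IAr A"
    "\<And>t x. t \<in> Arr C \<Longrightarrow> x \<in> Arr C \<Longrightarrow> Dom C x = Dom C t \<Longrightarrow> Cod C t = Z \<Longrightarrow> Cod C x = IOb D \<Longrightarrow>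
      ISrc A \<cdot> (a \<cdot> pair C t x) = \<phi>\<^sub>0 \<cdot> pair C (p \<cdot> t) x"
    "\<And>t x. t \<in> Arr C \<Longrightarrow> x \<in> Arr C \<Longrightarrow> Dom C x = Dom C t \<Longrightarrow> Cod C t = Z \<Longrightarrow> Cod C x = IOb D \<Longrightarrow>
      ITgt A \<cdot> (a \<cdot> pair C t x) = \<phi>\<^sub>0 \<cdot> pair C (q \<cdot> t) x"
    "\<And>t d. t \<in> Arr C \<Longrightarrow> d \<in> Arr C \<Longrightarrow> Dom C d = Dom C t \<Longrightarrow> Cod C t = Z \<Longrightarrow> Cod C d = IAr D \<Longrightarrow>
      icomp C A (\<phi>\<^sub>1 \<cdot> pair C (p \<cdot> t) d) (a \<cdot> pair C t (ITgt D \<cdot> d)) =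
      icomp C A (a \<cdot> pair C t (ISrc D \<cdot> d)) (\<phi>\<^sub>1 \<cdot> pair C (q \<cdot> t) d)"
  using assms unfolding natel_def by auto

definition is_nat_object ::
  "('o, 'a) icat \<Rightarrow> ('o, 'a) icat \<Rightarrow> 'o \<Rightarrow> 'a \<Rightarrow> 'a \<Rightarrow> 'o \<Rightarrow> 'a \<Rightarrow> 'a \<Rightarrow> 'a \<Rightarrow> bool" where
  "is_nat_object D A X \<phi>\<^sub>0 \<phi>\<^sub>1 N \<sigma> \<tau> \<phi> \<longleftrightarrow> N \<in> Obj C \<and> \<sigma> \<in> hom C N X \<and> \<tau> \<in> hom C N X \<and> natel D A \<phi>\<^sub>0 \<phi>\<^sub>1 N \<sigma> \<tau> \<phi> \<and>
    (\<forall>Z p q a. Z \<in> Obj C \<and> p \<in> hom C Z X \<and> q \<in> hom C Z X \<and> natel D A \<phi>\<^sub>0 \<phi>\<^sub>1 Z p q a \<longrightarrow>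
      (\<exists>w\<in>hom C Z N. \<sigma> \<cdot> w = p \<and> \<tau> \<cdot> w = q \<and>
        (\<forall>t x. el2 t x Z (IOb D) \<longrightarrow> \<phi> \<cdot> pair C (w \<cdot> t) x = a \<cdot> pair C t x))) \<and>
    (\<forall>w v. w \<in> Arr C \<and> v \<in> Arr C \<and> Dom C v = Dom C w \<and> Cod C w = N \<and> Cod C v = N \<and> \<sigma> \<cdot> w = \<sigma> \<cdot> v \<and> \<tau> \<cdot> w = \<tau> \<cdot> v \<and>
      (\<forall>t x. el2 t x (Dom C w) (IOb D) \<longrightarrow> \<phi> \<cdot> pair C (w \<cdot> t) x = \<phi> \<cdot> pair C (v \<cdot> t) x) \<longrightarrow> w = v)"

lemma is_nat_objectD:
  assumes "is_nat_object D A X \<phi>\<^sub>0 \<phi>\<^sub>1 N \<sigma> \<tau> \<phi>"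
  shows "N \<in> Obj C" "\<sigma> \<in> hom C N X" "\<tau> \<in> hom C N X" "natel D A \<phi>\<^sub>0 \<phi>\<^sub>1 N \<sigma> \<tau> \<phi>"
    "\<And>Z p q a. Z \<in> Obj C \<Longrightarrow> p \<in> hom C Z X \<Longrightarrow> q \<in> hom C Z X \<Longrightarrow> natel D A \<phi>\<^sub>0 \<phi>\<^sub>1 Z p q a \<Longrightarrow>
      \<exists>w\<in>hom C Z N. \<sigma> \<cdot> w = p \<and> \<tau> \<cdot> w = q \<and>
        (\<forall>t x. el2 t x Z (IOb D) \<longrightarrow> \<phi> \<cdot> pair C (w \<cdot> t) x = a \<cdot> pair C t x)"
    "\<And>w v. w \<in> Arr C \<Longrightarrow> v \<in> Arr C \<Longrightarrow> Dom C v = Dom C w \<Longrightarrow> Cod C w = N \<Longrightarrow> Cod C v = N \<Longrightarrow> \<sigma> \<cdot> w = \<sigma> \<cdot> v \<Longrightarrow>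
      \<tau> \<cdot> w = \<tau> \<cdot> v \<Longrightarrow>
      (\<And>t x. el2 t x (Dom C w) (IOb D) \<Longrightarrow> \<phi> \<cdot> pair C (w \<cdot> t) x = \<phi> \<cdot> pair C (v \<cdot> t) x) \<Longrightarrow> w = v"
  using assms unfolding is_nat_object_def by blast+

text \<open>An instance of \<open>natfam_representable\<close> over the product of \<open>X\<close>
  with itself: the universal family, substituted along the two projections, is the generic pair of
  functors.\<close>

lemma nat_object_ex:
  assumes D: "is_icat C D" and A: "is_icat C A" and X: "X \<in> Obj C" and f: "fam D A X \<phi>\<^sub>0 \<phi>\<^sub>1"
  shows "\<exists>N \<sigma> \<tau> \<phi>. is_nat_object D A X \<phi>\<^sub>0 \<phi>\<^sub>1 N \<sigma> \<tau> \<phi>"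
proof -
  let ?p = "Pr1 C X X" and ?q = "Pr2 C X X" and ?X = "Prod C X X"
  let ?f0 = "\<phi>\<^sub>0 \<cdot> pair C (?p \<cdot> Pr1 C ?X (IOb D)) (Pr2 C ?X (IOb D))"
  let ?f1 = "\<phi>\<^sub>1 \<cdot> pair C (?p \<cdot> Pr1 C ?X (IAr D)) (Pr2 C ?X (IAr D))"
  let ?g0 = "\<phi>\<^sub>0 \<cdot> pair C (?q \<cdot> Pr1 C ?X (IOb D)) (Pr2 C ?X (IOb D))"
  let ?g1 = "\<phi>\<^sub>1 \<cdot> pair C (?q \<cdot> Pr1 C ?X (IAr D)) (Pr2 C ?X (IAr D))"
  note [simp] = X D A fam_simps[OF f]
  have F: "fam D A ?X ?f0 ?f1" and G: "fam D A ?X ?g0 ?g1"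
    by (rule fam_pull[OF D A X f]; simp)+
  have nf: "natfam D A ?f0 ?f1 ?g0 ?g1 u a \<longleftrightarrow> natel D A \<phi>\<^sub>0 \<phi>\<^sub>1 (Dom C u) (?p \<cdot> u) (?q \<cdot> u) a"
    if "u \<in> Arr C" "Cod C u = ?X" for u a
    using that unfolding natfam_def natel_def by (simp cong: conj_cong)
  show ?thesis
  proof (rule natfam_representable[OF D A _ F G])
    fix N p \<phi> assume N: "N \<in> Obj C" "p \<in> hom C N ?X" "natfam D A ?f0 ?f1 ?g0 ?g1 p \<phi>"
      and ex: "\<And>u a. u \<in> Arr C \<Longrightarrow> Cod C u = ?X \<Longrightarrow> natfam D A ?f0 ?f1 ?g0 ?g1 u a \<Longrightarrow>
        \<exists>w\<in>hom C (Dom C u) N. p \<cdot> w = u \<and> (\<forall>t x. el2 t x (Dom C u) (IOb D) \<longrightarrow> \<phi> \<cdot> pair C (w \<cdot> t) x = a \<cdot> pair C t x)"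
      and un: "\<And>w v. w \<in> Arr C \<Longrightarrow> v \<in> Arr C \<Longrightarrow> Dom C v = Dom C w \<Longrightarrow> Cod C w = N \<Longrightarrow> Cod C v = N \<Longrightarrow> p \<cdot> w = p \<cdot> v \<Longrightarrow>
        (\<And>t x. el2 t x (Dom C w) (IOb D) \<Longrightarrow> \<phi> \<cdot> pair C (w \<cdot> t) x = \<phi> \<cdot> pair C (v \<cdot> t) x) \<Longrightarrow> w = v"
    note [simp] = N(1) N(2)[simplified]
    have "natel D A \<phi>\<^sub>0 \<phi>\<^sub>1 N (?p \<cdot> p) (?q \<cdot> p) \<phi>"
      using N(3) by (simp add: nf)
    moreover have "\<exists>w\<in>hom C Z N. (?p \<cdot> p) \<cdot> w = r \<and> (?q \<cdot> p) \<cdot> w = s \<and>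
        (\<forall>t x. el2 t x Z (IOb D) \<longrightarrow> \<phi> \<cdot> pair C (w \<cdot> t) x = a \<cdot> pair C t x)"
      if r: "r \<in> hom C Z X" "s \<in> hom C Z X" and a: "natel D A \<phi>\<^sub>0 \<phi>\<^sub>1 Z r s a" for Z r s a
    proof -
      have "natfam D A ?f0 ?f1 ?g0 ?g1 (pair C r s) a"
        using a r by (simp add: nf)
      then obtain w where w: "w\<in>hom C (Dom C (pair C r s)) N" "p \<cdot> w = pair C r s"
        "\<forall>t x. el2 t x (Dom C (pair C r s)) (IOb D) \<longrightarrow> \<phi> \<cdot> pair C (w \<cdot> t) x = a \<cdot> pair C t x"
        using ex[of "pair C r s" a] r by auto
      then show ?thesis
        using r by (intro bexI[of _ w]) simp_all
    qed
    moreover have "w = v" if w: "w \<in> Arr C" "v \<in> Arr C" "Dom C v = Dom C w" "Cod C w = N" "Cod C v = N"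
        "(?p \<cdot> p) \<cdot> w = (?p \<cdot> p) \<cdot> v" "(?q \<cdot> p) \<cdot> w = (?q \<cdot> p) \<cdot> v"
        and e: "\<And>t x. el2 t x (Dom C w) (IOb D) \<Longrightarrow> \<phi> \<cdot> pair C (w \<cdot> t) x = \<phi> \<cdot> pair C (v \<cdot> t) x" for w v
    proof (rule un[OF w(1-5) _ e])
      show "p \<cdot> w = p \<cdot> v"
        by (rule Prod_ext[of _ _ X X]) (use w in simp_all)
    qed
    moreover have "?p \<cdot> p \<in> hom C N X" "?q \<cdot> p \<in> hom C N X"
      by simp_all
    ultimately have "is_nat_object D A X \<phi>\<^sub>0 \<phi>\<^sub>1 N (?p \<cdot> p) (?q \<cdot> p) \<phi>"
      unfolding is_nat_object_def using N(1) by blast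
    then show ?thesis
      by blast
  qed simp
qed

end

context cart
begin

text \<open>By associativity the middle two factors of a fourfold composite may be replaced by
  another pair with the same composite. With a naturality square in the middle, this is why
  evaluation preserves composites.\<close>

lemma icomp_middle_exchange:
  assumes X: "is_icat C X"
    and arr: "a \<in> Arr C" "b \<in> Arr C" "c \<in> Arr C" "d \<in> Arr C" "b' \<in> Arr C" "c' \<in> Arr C"
    and dom: "Dom C a = W" "Dom C b = W" "Dom C c = W" "Dom C d = W" "Dom C b' = W" "Dom C c' = W"
    and cod: "Cod C a = IAr X" "Cod C b = IAr X" "Cod C c = IAr X" "Cod C d = IAr X" "Cod C b' = IAr X" "Cod C c' = IAr X"
    and st: "ITgt X \<cdot> a = ISrc X \<cdot> b" "ITgt X \<cdot> b = ISrc X \<cdot> c" "ITgt X \<cdot> c = ISrc X \<cdot> d"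
      "ISrc X \<cdot> c' = ISrc X \<cdot> b" "ITgt X \<cdot> c' = ISrc X \<cdot> b'" "ITgt X \<cdot> b' = ISrc X \<cdot> d"
    and e: "icomp C X b c = icomp C X c' b'"
  shows "icomp C X (icomp C X a b) (icomp C X c d) = icomp C X (icomp C X a c') (icomp C X b' d)"
proof -
  have "icomp C X b (icomp C X c d) = icomp C X (icomp C X b c) d"
    by (simp add: icomp_assoc X arr dom cod st)
  also have "\<dots> = icomp C X c' (icomp C X b' d)"
    unfolding e by (simp add: icomp_assoc X arr dom cod st)
  finally show ?thesis
    by (simp add: icomp_assoc X arr dom cod st)
qed

text \<open>Two naturality squares with the common side \<open>g\<close> are pasted; this is
  naturality of a vertical composite.\<close>

lemma icomp_square_paste:
  assumes X: "is_icat C X"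
    and arr: "f \<in> Arr C" "g \<in> Arr C" "h \<in> Arr C" "a \<in> Arr C" "b \<in> Arr C" "a' \<in> Arr C" "b' \<in> Arr C"
    and dom: "Dom C f = W" "Dom C g = W" "Dom C h = W" "Dom C a = W" "Dom C b = W" "Dom C a' = W" "Dom C b' = W"
    and cod: "Cod C f = IAr X" "Cod C g = IAr X" "Cod C h = IAr X" "Cod C a = IAr X" "Cod C b = IAr X"
      "Cod C a' = IAr X" "Cod C b' = IAr X"
    and st: "ITgt X \<cdot> f = ISrc X \<cdot> a" "ITgt X \<cdot> a = ISrc X \<cdot> b" "ITgt X \<cdot> a' = ISrc X \<cdot> g" "ITgt X \<cdot> g = ISrc X \<cdot> b"
      "ITgt X \<cdot> b' = ISrc X \<cdot> h" "ISrc X \<cdot> b' = ISrc X \<cdot> g"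
    and e: "icomp C X f a = icomp C X a' g" "icomp C X g b = icomp C X b' h"
  shows "icomp C X f (icomp C X a b) = icomp C X (icomp C X a' b') h"
proof -
  have "icomp C X f (icomp C X a b) = icomp C X (icomp C X f a) b"
    by (simp add: icomp_assoc X arr dom cod st)
  also have "\<dots> = icomp C X a' (icomp C X b' h)"
    unfolding e by (simp add: icomp_assoc X arr dom cod st e)
  also have "\<dots> = icomp C X (icomp C X a' b') h"
    by (simp add: icomp_assoc X arr dom cod st)
  finally show ?thesis .
qed

end

context ccc
begin

section \<open>Exponentials of internal categories\<close>

text \<open>An object at stage \<open>Z\<close> of the exponential is a family of functors and an arrow is a family of
  natural transformations. The last two clauses, describing the arrows, are not part of the universal
  property; they hold because of the construction, hence for every exponential.\<close>

definition is_exp_cat :: "('o, 'a) icat \<Rightarrow> ('o, 'a) icat \<Rightarrow> ('o, 'a) icat \<Rightarrow> 'a \<Rightarrow> 'a \<Rightarrow> bool" where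
  "is_exp_cat D A E e\<^sub>0 e\<^sub>1 \<longleftrightarrow> is_icat C E \<and> is_functor (icat_prod C E D) A e\<^sub>0 e\<^sub>1 \<and>
    (\<forall>Z f\<^sub>0 f\<^sub>1. is_icat C Z \<and> is_functor (icat_prod C Z D) A f\<^sub>0 f\<^sub>1 \<longrightarrow>
      (\<exists>u\<^sub>0 u\<^sub>1. is_functor Z E u\<^sub>0 u\<^sub>1 \<and>
        (\<forall>t x. el2 t x (IOb Z) (IOb D) \<longrightarrow> e\<^sub>0 \<cdot> pair C (u\<^sub>0 \<cdot> t) x = f\<^sub>0 \<cdot> pair C t x) \<and>
        (\<forall>t x. el2 t x (IAr Z) (IAr D) \<longrightarrow> e\<^sub>1 \<cdot> pair C (u\<^sub>1 \<cdot> t) x = f\<^sub>1 \<cdot> pair C t x))) \<and>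
    (\<forall>Z u\<^sub>0 u\<^sub>1 v\<^sub>0 v\<^sub>1. is_icat C Z \<and> is_functor Z E u\<^sub>0 u\<^sub>1 \<and> is_functor Z E v\<^sub>0 v\<^sub>1 \<and>
        (\<forall>t x. el2 t x (IOb Z) (IOb D) \<longrightarrow> e\<^sub>0 \<cdot> pair C (u\<^sub>0 \<cdot> t) x = e\<^sub>0 \<cdot> pair C (v\<^sub>0 \<cdot> t) x) \<and>
        (\<forall>t x. el2 t x (IAr Z) (IAr D) \<longrightarrow> e\<^sub>1 \<cdot> pair C (u\<^sub>1 \<cdot> t) x = e\<^sub>1 \<cdot> pair C (v\<^sub>1 \<cdot> t) x) \<longrightarrow>
        u\<^sub>0 = v\<^sub>0 \<and> u\<^sub>1 = v\<^sub>1) \<and>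
    (\<forall>Z p q a. Z \<in> Obj C \<and> p \<in> hom C Z (IOb E) \<and> q \<in> hom C Z (IOb E) \<and>
        natel D A e\<^sub>0 (e\<^sub>1 \<cdot> prod_map C (IIde E) (Ide C (IAr D))) Z p q a \<longrightarrow>
      (\<exists>w\<in>hom C Z (IAr E). ISrc E \<cdot> w = p \<and> ITgt E \<cdot> w = q \<and>
        (\<forall>t x. el2 t x Z (IOb D) \<longrightarrow> e\<^sub>1 \<cdot> pair C (w \<cdot> t) (IIde D \<cdot> x) = a \<cdot> pair C t x))) \<and>
    (\<forall>w v. w \<in> Arr C \<and> v \<in> Arr C \<and> Dom C v = Dom C w \<and> Cod C w = IAr E \<and> Cod C v = IAr E \<and>
        ISrc E \<cdot> w = ISrc E \<cdot> v \<and> ITgt E \<cdot> w = ITgt E \<cdot> v \<and>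
        (\<forall>t x. el2 t x (Dom C w) (IOb D) \<longrightarrow> e\<^sub>1 \<cdot> pair C (w \<cdot> t) (IIde D \<cdot> x) = e\<^sub>1 \<cdot> pair C (v \<cdot> t) (IIde D \<cdot> x)) \<longrightarrow>
        w = v)"

text \<open>The carriers are the representing objects of families of functors and of families of
  transformations. The structure maps \<open>i\<close> and \<open>m\<close> name, by
  representability, the identity and the composite transformations. The category laws are checked on
  components, where they become laws of \<open>A\<close>.\<close>

lemma exp_cat_ex:
  assumes D [simp]: "is_icat C D" and A [simp]: "is_icat C A"
  shows "\<exists>E e\<^sub>0 e\<^sub>1. is_exp_cat D A E e\<^sub>0 e\<^sub>1"
proof -
  obtain X \<phi>\<^sub>0 \<phi>\<^sub>1 where X\<phi>: "is_fam_object D A X \<phi>\<^sub>0 \<phi>\<^sub>1"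
    using fam_object_ex[OF D A] by blast
  note X = is_fam_objectD[OF X\<phi>]
  note famX = fam_simps[OF X(2)]
  obtain N \<sigma> \<tau> \<phi> where N\<phi>: "is_nat_object D A X \<phi>\<^sub>0 \<phi>\<^sub>1 N \<sigma> \<tau> \<phi>"
    using nat_object_ex[OF D A X(1,2)] by blast
  note N = is_nat_objectD[OF N\<phi>]
  note n = natel_simps[OF N(4)]
  note [simp] = X(1) N(1) N(2,3)[simplified] famX(1-9) n(1-5)
  \<comment> \<open>The identity transformation of the universal family; its name is the arrow of
    identities \<open>i\<close>.\<close>
  have "natel D A \<phi>\<^sub>0 \<phi>\<^sub>1 X (Ide C X) (Ide C X) (IIde A \<cdot> \<phi>\<^sub>0)"
    unfolding natel_def by (simp cong: conj_cong)
  then obtain i where i: "i \<in> hom C X N" "\<sigma> \<cdot> i = Ide C X" "\<tau> \<cdot> i = Ide C X"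
    and \<phi>_i': "\<And>t x. el2 t x X (IOb D) \<Longrightarrow> \<phi> \<cdot> pair C (i \<cdot> t) x = (IIde A \<cdot> \<phi>\<^sub>0) \<cdot> pair C t x"
    using N(5)[of X "Ide C X" "Ide C X" "IIde A \<cdot> \<phi>\<^sub>0"] by auto
  have [simp]: "i \<in> Arr C" "Dom C i = X" "Cod C i = N"
    using i(1) by simp_all
  have \<phi>_i: "\<phi> \<cdot> pair C (i \<cdot> t) x = IIde A \<cdot> (\<phi>\<^sub>0 \<cdot> pair C t x)"
    if "t \<in> Arr C" "x \<in> Arr C" "Dom C x = Dom C t" "Cod C t = X" "Cod C x = IOb D" for t x
    using \<phi>_i'[of t x] that by simp
  have i_el [simp]: "\<sigma> \<cdot> (i \<cdot> t) = t" "\<tau> \<cdot> (i \<cdot> t) = t" if "t \<in> Arr C" "Cod C t = X" for t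
    using that comp_eq_comp[OF i(2), of t] comp_eq_comp[OF i(3), of t] by simp_all

  \<comment> \<open>\<open>v\<close> names the vertical composite of \<open>w\<close> and
    \<open>w'\<close>. A name is selected by \<open>SOME\<close>; extensionality of \<open>N\<close>
    makes it the only one.\<close>
  define is_m where "is_m w w' v \<longleftrightarrow> v \<in> hom C (Dom C w) N \<and> \<sigma> \<cdot> v = \<sigma> \<cdot> w \<and> \<tau> \<cdot> v = \<tau> \<cdot> w' \<and>
    (\<forall>t x. el2 t x (Dom C w) (IOb D) \<longrightarrow>
      \<phi> \<cdot> pair C (v \<cdot> t) x = icomp C A (\<phi> \<cdot> pair C (w \<cdot> t) x) (\<phi> \<cdot> pair C (w' \<cdot> t) x))" for w w' v
  define m where "m w w' = (SOME v. is_m w w' v)" for w w'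
  have m: "is_m w w' (m w w')"
    if w: "w \<in> Arr C" "w' \<in> Arr C" "Cod C w = N" "Cod C w' = N" "Dom C w = Dom C w'" "\<tau> \<cdot> w = \<sigma> \<cdot> w'" for w w'
  proof -
    obtain W where W: "Dom C w = W" "Dom C w' = W" "W \<in> Obj C"
      using w(1,2,5) by auto
    note [simp] = w(1-4) W
    have tw [simp]: "\<tau> \<cdot> (w \<cdot> t) = \<sigma> \<cdot> (w' \<cdot> t)" if "t \<in> Arr C" "Cod C t = W" for t
      using comp_eq_comp[OF w(6), of t] that by simp
    let ?a = "icomp C A (\<phi> \<cdot> pair C (w \<cdot> Pr1 C W (IOb D)) (Pr2 C W (IOb D)))
      (\<phi> \<cdot> pair C (w' \<cdot> Pr1 C W (IOb D)) (Pr2 C W (IOb D)))"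
    have a: "?a \<cdot> pair C t x = icomp C A (\<phi> \<cdot> pair C (w \<cdot> t) x) (\<phi> \<cdot> pair C (w' \<cdot> t) x)"
      if "t \<in> Arr C" "x \<in> Arr C" "Dom C x = Dom C t" "Cod C t = W" "Cod C x = IOb D" for t x
      using that by simp
    have "natel D A \<phi>\<^sub>0 \<phi>\<^sub>1 W (\<sigma> \<cdot> w) (\<tau> \<cdot> w') ?a"
      unfolding natel_def
    proof (intro conjI allI impI)
      fix t d assume td: "el2 t d W (IAr D)"
      have nw: "icomp C A (\<phi>\<^sub>1 \<cdot> pair C (\<sigma> \<cdot> (w \<cdot> t)) d) (\<phi> \<cdot> pair C (w \<cdot> t) (ITgt D \<cdot> d)) =
        icomp C A (\<phi> \<cdot> pair C (w \<cdot> t) (ISrc D \<cdot> d)) (\<phi>\<^sub>1 \<cdot> pair C (\<tau> \<cdot> (w \<cdot> t)) d)"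
        "icomp C A (\<phi>\<^sub>1 \<cdot> pair C (\<sigma> \<cdot> (w' \<cdot> t)) d) (\<phi> \<cdot> pair C (w' \<cdot> t) (ITgt D \<cdot> d)) =
        icomp C A (\<phi> \<cdot> pair C (w' \<cdot> t) (ISrc D \<cdot> d)) (\<phi>\<^sub>1 \<cdot> pair C (\<tau> \<cdot> (w' \<cdot> t)) d)"
        using n(6)[of "w \<cdot> t" d] n(6)[of "w' \<cdot> t" d] td by simp_all
      have "icomp C A (\<phi>\<^sub>1 \<cdot> pair C (\<sigma> \<cdot> (w \<cdot> t)) d)
          (icomp C A (\<phi> \<cdot> pair C (w \<cdot> t) (ITgt D \<cdot> d)) (\<phi> \<cdot> pair C (w' \<cdot> t) (ITgt D \<cdot> d))) =
        icomp C A (icomp C A (\<phi> \<cdot> pair C (w \<cdot> t) (ISrc D \<cdot> d)) (\<phi> \<cdot> pair C (w' \<cdot> t) (ISrc D \<cdot> d)))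
          (\<phi>\<^sub>1 \<cdot> pair C (\<tau> \<cdot> (w' \<cdot> t)) d)"
        by (rule icomp_square_paste[OF A, of _ "\<phi>\<^sub>1 \<cdot> pair C (\<tau> \<cdot> (w \<cdot> t)) d" _ _ _ _ _ "Dom C t"])
          (use td nw in simp_all)
      then show "icomp C A (\<phi>\<^sub>1 \<cdot> pair C ((\<sigma> \<cdot> w) \<cdot> t) d) (?a \<cdot> pair C t (ITgt D \<cdot> d)) =
        icomp C A (?a \<cdot> pair C t (ISrc D \<cdot> d)) (\<phi>\<^sub>1 \<cdot> pair C ((\<tau> \<cdot> w') \<cdot> t) d)"
        using td by simp
    qed simp_all
    then obtain v where v: "v \<in> hom C W N" "\<sigma> \<cdot> v = \<sigma> \<cdot> w" "\<tau> \<cdot> v = \<tau> \<cdot> w'"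
        "\<And>t x. el2 t x W (IOb D) \<Longrightarrow> \<phi> \<cdot> pair C (v \<cdot> t) x = ?a \<cdot> pair C t x"
      using N(5)[of W "\<sigma> \<cdot> w" "\<tau> \<cdot> w'" ?a] by auto
    then have "is_m w w' v"
      unfolding is_m_def using a by simp
    then show ?thesis
      unfolding m_def by (rule someI)
  qed
  have m_typ [simp]: "m w w' \<in> Arr C" "Dom C (m w w') = Dom C w'" "Cod C (m w w') = N" "\<sigma> \<cdot> m w w' = \<sigma> \<cdot> w" "\<tau> \<cdot> m w w' = \<tau> \<cdot> w'"
    if w: "w \<in> Arr C" "w' \<in> Arr C" "Cod C w = N" "Cod C w' = N" "Dom C w = Dom C w'" "\<tau> \<cdot> w = \<sigma> \<cdot> w'" for w w'
    using m[OF w] w(5) unfolding is_m_def by simp_all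
  have m_el: "\<phi> \<cdot> pair C (m w w' \<cdot> t) x = icomp C A (\<phi> \<cdot> pair C (w \<cdot> t) x) (\<phi> \<cdot> pair C (w' \<cdot> t) x)"
    if w: "w \<in> Arr C" "w' \<in> Arr C" "Cod C w = N" "Cod C w' = N" "Dom C w = Dom C w'" "\<tau> \<cdot> w = \<sigma> \<cdot> w'"
      and "t \<in> Arr C" "x \<in> Arr C" "Dom C x = Dom C t" "Cod C t = Dom C w'" "Cod C x = IOb D" for w w' t x
    using m[OF w] that(7-) w(5) unfolding is_m_def by simp
  have \<sigma>_el: "\<sigma> \<cdot> (w \<cdot> t) = p \<cdot> t" if "\<sigma> \<cdot> w = p" "w \<in> Arr C" "Cod C w = N" "t \<in> Arr C" "Cod C t = Dom C w" for w t p
    using comp_eq_comp[OF that(1)] that by simp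
  have \<tau>_el: "\<tau> \<cdot> (w \<cdot> t) = p \<cdot> t" if "\<tau> \<cdot> w = p" "w \<in> Arr C" "Cod C w = N" "t \<in> Arr C" "Cod C t = Dom C w" for w t p
    using comp_eq_comp[OF that(1)] that by simp
  obtain P pp pq where pb: "is_pullback C \<tau> \<sigma> P pp pq"
    using pullback_ex[OF N(3,2)] by blast
  have "\<exists>E. is_icat C E \<and> IOb E = X \<and> IAr E = N \<and> ISrc E = \<sigma> \<and> ITgt E = \<tau> \<and> IIde E = i \<and>
    (\<forall>f g. composable E f g \<longrightarrow> icomp C E f g = m f g)"
  proof (rule icat_exists[OF _ _ _ _ _ pb])
    fix w w' assume w: "w \<in> Arr C" "w' \<in> Arr C" "Cod C w = N" "Cod C w' = N" "Dom C w = Dom C w'" "\<tau> \<cdot> w = \<sigma> \<cdot> w'"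
    obtain W where W: "Dom C w = W" "Dom C w' = W" "W \<in> Obj C"
      using w(1,2,5) by auto
    show "m w w' \<in> hom C (Dom C w) N \<and> \<sigma> \<cdot> m w w' = \<sigma> \<cdot> w \<and> \<tau> \<cdot> m w w' = \<tau> \<cdot> w'"
      using w by simp
    fix u assume u: "u \<in> Arr C" "Cod C u = Dom C w"
    note c = \<tau>_el[OF w(6)] \<sigma>_el[OF m_typ(4)[OF w]] \<tau>_el[OF m_typ(5)[OF w]]
    show "m w w' \<cdot> u = m (w \<cdot> u) (w' \<cdot> u)"
    proof (rule N(6))
      fix t x assume "el2 t x (Dom C (m w w' \<cdot> u)) (IOb D)"
      then show "\<phi> \<cdot> pair C ((m w w' \<cdot> u) \<cdot> t) x = \<phi> \<cdot> pair C (m (w \<cdot> u) (w' \<cdot> u) \<cdot> t) x"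
        using w(1-4) W u w(6) c by (simp add: m_el)
    qed (use w(1-4) W u w(6) c in simp_all)
  next
    fix w assume w: "w \<in> Arr C" "Cod C w = N"
    show "m (i \<cdot> (\<sigma> \<cdot> w)) w = w" "m w (i \<cdot> (\<tau> \<cdot> w)) = w"
      by (rule N(6); use w in \<open>simp add: m_el \<phi>_i\<close>)+
  next
    fix u v w assume uvw: "u \<in> Arr C" "v \<in> Arr C" "w \<in> Arr C" "Cod C u = N" "Cod C v = N" "Cod C w = N"
      and d: "Dom C u = Dom C v" "Dom C v = Dom C w" and st: "\<tau> \<cdot> u = \<sigma> \<cdot> v" "\<tau> \<cdot> v = \<sigma> \<cdot> w"
    obtain W where W: "Dom C u = W" "Dom C v = W" "Dom C w = W" "W \<in> Obj C"
      using uvw d by auto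
    note c = \<tau>_el[OF st(1)] \<tau>_el[OF st(2)]
    show "m (m u v) w = m u (m v w)"
    proof (rule N(6))
      fix t x assume "el2 t x (Dom C (m (m u v) w)) (IOb D)"
      then show "\<phi> \<cdot> pair C (m (m u v) w \<cdot> t) x = \<phi> \<cdot> pair C (m u (m v w) \<cdot> t) x"
        using uvw W st c by (simp add: m_el icomp_assoc)
    qed (use uvw W st in simp_all)
  qed (use i in simp_all)
  then obtain E where E [simp]: "is_icat C E" and E_simps: "IOb E = X" "IAr E = N" "ISrc E = \<sigma>" "ITgt E = \<tau>" "IIde E = i"
    and E_comp: "\<And>f g. composable E f g \<Longrightarrow> icomp C E f g = m f g"
    by blast
  have icomp_E: "icomp C E w w' = m w w'"
    if "w \<in> Arr C" "w' \<in> Arr C" "Cod C w = N" "Cod C w' = N" "Dom C w = Dom C w'" "\<tau> \<cdot> w = \<sigma> \<cdot> w'" for w w'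
    by (rule E_comp) (use that in \<open>simp add: composable_def E_simps\<close>)

  \<comment> \<open>The value of a transformation \<open>w\<close> at an arrow \<open>d\<close> of
    \<open>D\<close> is the diagonal of its naturality square, here the path through the functor at
    the source of \<open>w\<close>.\<close>
  define \<epsilon> where "\<epsilon> = icomp C A (\<phi>\<^sub>1 \<cdot> pair C (\<sigma> \<cdot> Pr1 C N (IAr D)) (Pr2 C N (IAr D)))
    (\<phi> \<cdot> pair C (Pr1 C N (IAr D)) (ITgt D \<cdot> Pr2 C N (IAr D)))"
  have \<epsilon> [simp]: "\<epsilon> \<in> Arr C" "Dom C \<epsilon> = Prod C N (IAr D)" "Cod C \<epsilon> = IAr A"
    by (simp_all add: \<epsilon>_def)
  have \<epsilon>_el: "\<epsilon> \<cdot> pair C w d = icomp C A (\<phi>\<^sub>1 \<cdot> pair C (\<sigma> \<cdot> w) d) (\<phi> \<cdot> pair C w (ITgt D \<cdot> d))"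
    if "w \<in> Arr C" "d \<in> Arr C" "Dom C d = Dom C w" "Cod C w = N" "Cod C d = IAr D" for w d
    using that by (simp add: \<epsilon>_def)
  have \<epsilon>_i: "\<epsilon> \<cdot> pair C (i \<cdot> p) d = \<phi>\<^sub>1 \<cdot> pair C p d"
    if "p \<in> Arr C" "d \<in> Arr C" "Dom C d = Dom C p" "Cod C p = X" "Cod C d = IAr D" for p d
    using that by (simp add: \<epsilon>_el \<phi>_i)
  have \<epsilon>_ide: "\<epsilon> \<cdot> pair C w (IIde D \<cdot> x) = \<phi> \<cdot> pair C w x"
    if "w \<in> Arr C" "x \<in> Arr C" "Dom C x = Dom C w" "Cod C w = N" "Cod C x = IOb D" for w x
    using that by (simp add: \<epsilon>_el)
  have ev: "is_functor (icat_prod C E D) A \<phi>\<^sub>0 \<epsilon>"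
  proof (rule functorI)
    fix f assume f: "f \<in> Arr C" "Cod C f = IAr (icat_prod C E D)"
    then have f': "Cod C f = Prod C N (IAr D)"
      by (simp add: E_simps)
    obtain W where W: "Dom C f = W"
      by simp
    obtain w d where wd: "f = pair C w d" "w \<in> Arr C" "d \<in> Arr C" "Dom C w = W" "Dom C d = W" "Cod C w = N" "Cod C d = IAr D"
      by (rule Prod_cases[OF f(1) W f' N(1) icat_data(2)[OF D]])
    show "ISrc A \<cdot> (\<epsilon> \<cdot> f) = \<phi>\<^sub>0 \<cdot> (ISrc (icat_prod C E D) \<cdot> f)" "ITgt A \<cdot> (\<epsilon> \<cdot> f) = \<phi>\<^sub>0 \<cdot> (ITgt (icat_prod C E D) \<cdot> f)"
      unfolding wd(1) using wd(2-) by (simp_all add: \<epsilon>_el E_simps)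
  next
    fix f assume f: "f \<in> Arr C" "Cod C f = IOb (icat_prod C E D)"
    then have f': "Cod C f = Prod C X (IOb D)"
      by (simp add: E_simps)
    obtain W where W: "Dom C f = W"
      by simp
    obtain w d where wd: "f = pair C w d" "w \<in> Arr C" "d \<in> Arr C" "Dom C w = W" "Dom C d = W" "Cod C w = X" "Cod C d = IOb D"
      by (rule Prod_cases[OF f(1) W f' X(1) icat_data(1)[OF D]])
    show "\<epsilon> \<cdot> (IIde (icat_prod C E D) \<cdot> f) = IIde A \<cdot> (\<phi>\<^sub>0 \<cdot> f)"
      unfolding wd(1) using wd(2-) by (simp add: \<epsilon>_i E_simps)
  next
    fix f g assume f: "f \<in> Arr C" and g: "g \<in> Arr C" and dfg: "Dom C f = Dom C g"
      and cf: "Cod C f = IAr (icat_prod C E D)" and cg: "Cod C g = IAr (icat_prod C E D)"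
      and st: "ITgt (icat_prod C E D) \<cdot> f = ISrc (icat_prod C E D) \<cdot> g"
    have cfg: "Cod C f = Prod C N (IAr D)" "Cod C g = Prod C N (IAr D)"
      using cf cg by (simp_all add: E_simps)
    obtain W where W: "Dom C f = W" "Dom C g = W"
      using dfg by simp
    obtain w d where wd: "f = pair C w d" "w \<in> Arr C" "d \<in> Arr C" "Dom C w = W" "Dom C d = W" "Cod C w = N" "Cod C d = IAr D"
      by (rule Prod_cases[OF f W(1) cfg(1) N(1) icat_data(2)[OF D]])
    obtain w' d' where wd': "g = pair C w' d'" "w' \<in> Arr C" "d' \<in> Arr C" "Dom C w' = W" "Dom C d' = W" "Cod C w' = N" "Cod C d' = IAr D"
      by (rule Prod_cases[OF g W(2) cfg(2) N(1) icat_data(2)[OF D]])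
    note [simp] = wd(2-) wd'(2-)
    have c: "\<tau> \<cdot> w = \<sigma> \<cdot> w'" "ITgt D \<cdot> d = ISrc D \<cdot> d'"
      using st unfolding wd(1) wd'(1) by (simp_all add: E_simps)
    have fg: "icomp C (icat_prod C E D) f g = pair C (m w w') (icomp C D d d')"
      unfolding wd(1) wd'(1) using c by (simp add: icomp_prod E_simps icomp_E)
    \<comment> \<open>Naturality of \<open>w\<close> at \<open>d'\<close> lets \<open>w\<close> and
      \<open>d'\<close> change places in the middle of the composite.\<close>
    have "icomp C A (icomp C A (\<phi>\<^sub>1 \<cdot> pair C (\<sigma> \<cdot> w) d) (\<phi>\<^sub>1 \<cdot> pair C (\<sigma> \<cdot> w) d'))
        (icomp C A (\<phi> \<cdot> pair C w (ITgt D \<cdot> d')) (\<phi> \<cdot> pair C w' (ITgt D \<cdot> d'))) =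
      icomp C A (icomp C A (\<phi>\<^sub>1 \<cdot> pair C (\<sigma> \<cdot> w) d) (\<phi> \<cdot> pair C w (ITgt D \<cdot> d)))
        (icomp C A (\<phi>\<^sub>1 \<cdot> pair C (\<sigma> \<cdot> w') d') (\<phi> \<cdot> pair C w' (ITgt D \<cdot> d')))"
      by (rule icomp_middle_exchange[OF A, of _ _ _ _ _ _ W])
        (use c n(6)[of w d'] in simp_all)
    moreover have "\<phi> \<cdot> pair C (m w w') (ITgt D \<cdot> d') = icomp C A (\<phi> \<cdot> pair C w (ITgt D \<cdot> d')) (\<phi> \<cdot> pair C w' (ITgt D \<cdot> d'))"
      using m_el[of w w' "Ide C W" "ITgt D \<cdot> d'"] c Obj_Dom[OF wd(2)] by simp
    ultimately show "\<epsilon> \<cdot> icomp C (icat_prod C E D) f g = icomp C A (\<epsilon> \<cdot> f) (\<epsilon> \<cdot> g)"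
      unfolding fg[unfolded wd(1) wd'(1)] wd(1) wd'(1) using c by (simp add: \<epsilon>_el famX(10))
  qed (simp_all add: E_simps)
  have univ: "\<exists>u\<^sub>0 u\<^sub>1. is_functor Z E u\<^sub>0 u\<^sub>1 \<and>
        (\<forall>t x. el2 t x (IOb Z) (IOb D) \<longrightarrow> \<phi>\<^sub>0 \<cdot> pair C (u\<^sub>0 \<cdot> t) x = f\<^sub>0 \<cdot> pair C t x) \<and>
        (\<forall>t x. el2 t x (IAr Z) (IAr D) \<longrightarrow> \<epsilon> \<cdot> pair C (u\<^sub>1 \<cdot> t) x = f\<^sub>1 \<cdot> pair C t x)"
    if Z: "is_icat C Z" and F: "is_functor (icat_prod C Z D) A f\<^sub>0 f\<^sub>1" for Z f\<^sub>0 f\<^sub>1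
  proof -
    note [simp] = Z
    note F = functor_simps[OF F, simplified]
    note [simp] = F(1-6)
    have src_F [simp]: "ISrc A \<cdot> (f\<^sub>1 \<cdot> pair C z d) = f\<^sub>0 \<cdot> pair C (ISrc Z \<cdot> z) (ISrc D \<cdot> d)"
      "ITgt A \<cdot> (f\<^sub>1 \<cdot> pair C z d) = f\<^sub>0 \<cdot> pair C (ITgt Z \<cdot> z) (ITgt D \<cdot> d)"
      if "z \<in> Arr C" "d \<in> Arr C" "Dom C d = Dom C z" "Cod C z = IAr Z" "Cod C d = IAr D" for z d
      using F(7,8)[of "pair C z d"] that by simp_all
    have ide_F: "f\<^sub>1 \<cdot> pair C (IIde Z \<cdot> z) (IIde D \<cdot> x) = IIde A \<cdot> (f\<^sub>0 \<cdot> pair C z x)"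
      if "z \<in> Arr C" "x \<in> Arr C" "Dom C x = Dom C z" "Cod C z = IOb Z" "Cod C x = IOb D" for z x
      using F(9)[of "pair C z x"] that by simp
    have comp_F: "f\<^sub>1 \<cdot> pair C (icomp C Z z z') (icomp C D d d') = icomp C A (f\<^sub>1 \<cdot> pair C z d) (f\<^sub>1 \<cdot> pair C z' d')"
      if "z \<in> Arr C" "z' \<in> Arr C" "d \<in> Arr C" "d' \<in> Arr C" "Dom C z' = Dom C z" "Dom C d = Dom C z" "Dom C d' = Dom C z"
        "Cod C z = IAr Z" "Cod C z' = IAr Z" "Cod C d = IAr D" "Cod C d' = IAr D"
        "ITgt Z \<cdot> z = ISrc Z \<cdot> z'" "ITgt D \<cdot> d = ISrc D \<cdot> d'" for z z' d d'
      using F(10)[of "pair C z d" "pair C z' d'"] that by (simp add: icomp_prod)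
    let ?p = "Pr1 C (IOb Z) (IAr D)" and ?q = "Pr2 C (IOb Z) (IAr D)"
    \<comment> \<open>Currying on objects: an object \<open>t\<close> of \<open>Z\<close> names the
      functor that sends an arrow \<open>d\<close> of \<open>D\<close> to the value at the identity
      of \<open>t\<close> and \<open>d\<close>.\<close>
    have fam: "fam D A (IOb Z) f\<^sub>0 (f\<^sub>1 \<cdot> pair C (IIde Z \<cdot> ?p) ?q)"
      unfolding fam_def
    proof (intro conjI allI impI)
      fix t d d' assume a: "el2 t d (IOb Z) (IAr D) \<and> el2 t d' (IOb Z) (IAr D) \<and> ITgt D \<cdot> d = ISrc D \<cdot> d'"
      have "f\<^sub>1 \<cdot> pair C (icomp C Z (IIde Z \<cdot> t) (IIde Z \<cdot> t)) (icomp C D d d') =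
        icomp C A (f\<^sub>1 \<cdot> pair C (IIde Z \<cdot> t) d) (f\<^sub>1 \<cdot> pair C (IIde Z \<cdot> t) d')"
        by (rule comp_F) (use a in simp_all)
      then show "(f\<^sub>1 \<cdot> pair C (IIde Z \<cdot> ?p) ?q) \<cdot> pair C t (icomp C D d d') =
        icomp C A ((f\<^sub>1 \<cdot> pair C (IIde Z \<cdot> ?p) ?q) \<cdot> pair C t d) ((f\<^sub>1 \<cdot> pair C (IIde Z \<cdot> ?p) ?q) \<cdot> pair C t d')"
        using a by simp
    qed (simp_all add: ide_F)
    have ex0: "\<exists>u\<in>hom C (IOb Z) X. (\<forall>t x. el2 t x (IOb Z) (IOb D) \<longrightarrow> \<phi>\<^sub>0 \<cdot> pair C (u \<cdot> t) x = f\<^sub>0 \<cdot> pair C t x) \<and>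
        (\<forall>t d. el2 t d (IOb Z) (IAr D) \<longrightarrow> \<phi>\<^sub>1 \<cdot> pair C (u \<cdot> t) d = (f\<^sub>1 \<cdot> pair C (IIde Z \<cdot> ?p) ?q) \<cdot> pair C t d)"
      by (rule X(3)[OF _ fam]) simp
    obtain u\<^sub>0 where u0: "u\<^sub>0 \<in> hom C (IOb Z) X"
      and \<phi>0_u: "\<And>t x. el2 t x (IOb Z) (IOb D) \<Longrightarrow> \<phi>\<^sub>0 \<cdot> pair C (u\<^sub>0 \<cdot> t) x = f\<^sub>0 \<cdot> pair C t x"
      and \<phi>1_u': "\<And>t d. el2 t d (IOb Z) (IAr D) \<Longrightarrow> \<phi>\<^sub>1 \<cdot> pair C (u\<^sub>0 \<cdot> t) d = (f\<^sub>1 \<cdot> pair C (IIde Z \<cdot> ?p) ?q) \<cdot> pair C t d"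
      using ex0 by blast
    note [simp] = u0[simplified]
    have \<phi>1_u: "\<phi>\<^sub>1 \<cdot> pair C (u\<^sub>0 \<cdot> t) d = f\<^sub>1 \<cdot> pair C (IIde Z \<cdot> t) d" if "el2 t d (IOb Z) (IAr D)" for t d
      using \<phi>1_u'[OF that] that by simp
    \<comment> \<open>Currying on arrows: the transformation named by an arrow \<open>t\<close> of
      \<open>Z\<close> has, at \<open>x\<close>, the value at \<open>t\<close> and the identity of
      \<open>x\<close> as its component. Its naturality compares the two ways of factoring
      \<open>(t, d)\<close> through identities.\<close>
    let ?a = "f\<^sub>1 \<cdot> pair C (Pr1 C (IAr Z) (IOb D)) (IIde D \<cdot> Pr2 C (IAr Z) (IOb D))"
    have a: "?a \<cdot> pair C t x = f\<^sub>1 \<cdot> pair C t (IIde D \<cdot> x)"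
      if "t \<in> Arr C" "x \<in> Arr C" "Dom C x = Dom C t" "Cod C t = IAr Z" "Cod C x = IOb D" for t x
      using that by simp
    have "natel D A \<phi>\<^sub>0 \<phi>\<^sub>1 (IAr Z) (u\<^sub>0 \<cdot> ISrc Z) (u\<^sub>0 \<cdot> ITgt Z) ?a"
      unfolding natel_def
    proof (intro conjI allI impI)
      fix t d assume td: "el2 t d (IAr Z) (IAr D)"
      have "icomp C A (f\<^sub>1 \<cdot> pair C (IIde Z \<cdot> (ISrc Z \<cdot> t)) d) (f\<^sub>1 \<cdot> pair C t (IIde D \<cdot> (ITgt D \<cdot> d))) = f\<^sub>1 \<cdot> pair C t d"
        "icomp C A (f\<^sub>1 \<cdot> pair C t (IIde D \<cdot> (ISrc D \<cdot> d))) (f\<^sub>1 \<cdot> pair C (IIde Z \<cdot> (ITgt Z \<cdot> t)) d) = f\<^sub>1 \<cdot> pair C t d"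
        using td by (simp_all add: comp_F[symmetric])
      then show "icomp C A (\<phi>\<^sub>1 \<cdot> pair C ((u\<^sub>0 \<cdot> ISrc Z) \<cdot> t) d) (?a \<cdot> pair C t (ITgt D \<cdot> d)) =
        icomp C A (?a \<cdot> pair C t (ISrc D \<cdot> d)) (\<phi>\<^sub>1 \<cdot> pair C ((u\<^sub>0 \<cdot> ITgt Z) \<cdot> t) d)"
        using td by (simp add: \<phi>1_u)
    qed (simp_all add: \<phi>0_u)
    then have ex1: "\<exists>w\<in>hom C (IAr Z) N. \<sigma> \<cdot> w = u\<^sub>0 \<cdot> ISrc Z \<and> \<tau> \<cdot> w = u\<^sub>0 \<cdot> ITgt Z \<and>
        (\<forall>t x. el2 t x (IAr Z) (IOb D) \<longrightarrow> \<phi> \<cdot> pair C (w \<cdot> t) x = ?a \<cdot> pair C t x)"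
      by (intro N(5)) simp_all
    then obtain u\<^sub>1 where u1: "u\<^sub>1 \<in> hom C (IAr Z) N" and st: "\<sigma> \<cdot> u\<^sub>1 = u\<^sub>0 \<cdot> ISrc Z" "\<tau> \<cdot> u\<^sub>1 = u\<^sub>0 \<cdot> ITgt Z"
      and \<phi>_u': "\<And>t x. el2 t x (IAr Z) (IOb D) \<Longrightarrow> \<phi> \<cdot> pair C (u\<^sub>1 \<cdot> t) x = ?a \<cdot> pair C t x"
      by blast
    note [simp] = u1[simplified]
    have \<phi>_u: "\<phi> \<cdot> pair C (u\<^sub>1 \<cdot> t) x = f\<^sub>1 \<cdot> pair C t (IIde D \<cdot> x)" if "el2 t x (IAr Z) (IOb D)" for t x
      using \<phi>_u'[OF that] that by simp
    have st_u [simp]: "\<sigma> \<cdot> (u\<^sub>1 \<cdot> z) = u\<^sub>0 \<cdot> (ISrc Z \<cdot> z)" "\<tau> \<cdot> (u\<^sub>1 \<cdot> z) = u\<^sub>0 \<cdot> (ITgt Z \<cdot> z)" if "z \<in> Arr C" "Cod C z = IAr Z" for z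
      using \<sigma>_el[OF st(1), of z] \<tau>_el[OF st(2), of z] that by simp_all
    have "is_functor Z E u\<^sub>0 u\<^sub>1"
    proof (rule functorI)
      fix z assume z: "z \<in> Arr C" "Cod C z = IOb Z"
      have "u\<^sub>1 \<cdot> (IIde Z \<cdot> z) = i \<cdot> (u\<^sub>0 \<cdot> z)"
      proof (rule N(6))
        fix t x assume "el2 t x (Dom C (u\<^sub>1 \<cdot> (IIde Z \<cdot> z))) (IOb D)"
        then show "\<phi> \<cdot> pair C ((u\<^sub>1 \<cdot> (IIde Z \<cdot> z)) \<cdot> t) x = \<phi> \<cdot> pair C ((i \<cdot> (u\<^sub>0 \<cdot> z)) \<cdot> t) x"
          using z by (simp add: \<phi>_u \<phi>_i ide_F \<phi>0_u)
      qed (use z in simp_all)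
      then show "u\<^sub>1 \<cdot> (IIde Z \<cdot> z) = IIde E \<cdot> (u\<^sub>0 \<cdot> z)"
        by (simp add: E_simps)
    next
      fix z z' assume zz: "z \<in> Arr C" "z' \<in> Arr C" and dz: "Dom C z = Dom C z'" and cz: "Cod C z = IAr Z" "Cod C z' = IAr Z"
        and sz: "ITgt Z \<cdot> z = ISrc Z \<cdot> z'"
      obtain W where W: "Dom C z = W" "Dom C z' = W" "W \<in> Obj C"
        using zz dz by auto
      have sz_el: "ITgt Z \<cdot> (z \<cdot> t) = ISrc Z \<cdot> (z' \<cdot> t)" if "t \<in> Arr C" "Cod C t = W" for t
        using comp_eq_comp[OF sz, of t] that zz cz W by simp
      have sm: "\<tau> \<cdot> (u\<^sub>1 \<cdot> z) = \<sigma> \<cdot> (u\<^sub>1 \<cdot> z')"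
        using zz cz sz by simp
      have "u\<^sub>1 \<cdot> icomp C Z z z' = m (u\<^sub>1 \<cdot> z) (u\<^sub>1 \<cdot> z')"
      proof (rule N(6))
        fix t x assume tx: "el2 t x (Dom C (u\<^sub>1 \<cdot> icomp C Z z z')) (IOb D)"
        have "f\<^sub>1 \<cdot> pair C (icomp C Z (z \<cdot> t) (z' \<cdot> t)) (icomp C D (IIde D \<cdot> x) (IIde D \<cdot> x)) =
          icomp C A (f\<^sub>1 \<cdot> pair C (z \<cdot> t) (IIde D \<cdot> x)) (f\<^sub>1 \<cdot> pair C (z' \<cdot> t) (IIde D \<cdot> x))"
          by (rule comp_F) (use tx zz cz W sz sz_el in simp_all)
        then show "\<phi> \<cdot> pair C ((u\<^sub>1 \<cdot> icomp C Z z z') \<cdot> t) x = \<phi> \<cdot> pair C (m (u\<^sub>1 \<cdot> z) (u\<^sub>1 \<cdot> z') \<cdot> t) x"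
          using tx zz cz W sz sz_el sm by (simp add: \<phi>_u m_el)
      qed (use zz cz W sz sm in simp_all)
      then show "u\<^sub>1 \<cdot> icomp C Z z z' = icomp C E (u\<^sub>1 \<cdot> z) (u\<^sub>1 \<cdot> z')"
        using zz cz W sm by (simp add: icomp_E)
    qed (simp_all add: E_simps)
    moreover have "\<epsilon> \<cdot> pair C (u\<^sub>1 \<cdot> t) x = f\<^sub>1 \<cdot> pair C t x" if tx: "el2 t x (IAr Z) (IAr D)" for t x
    proof -
      \<comment> \<open>The curried functor evaluates to the given one because \<open>(t, x)\<close>
        is the composite of an arrow that is an identity in \<open>Z\<close> and an arrow that is an
        identity in \<open>D\<close>.\<close>
      have "icomp C A (f\<^sub>1 \<cdot> pair C (IIde Z \<cdot> (ISrc Z \<cdot> t)) x) (f\<^sub>1 \<cdot> pair C t (IIde D \<cdot> (ITgt D \<cdot> x))) = f\<^sub>1 \<cdot> pair C t x"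
        using tx by (simp add: comp_F[symmetric])
      then show ?thesis
        using tx by (simp add: \<epsilon>_el \<phi>1_u \<phi>_u)
    qed
    ultimately show ?thesis
      using \<phi>0_u by blast
  qed
  have ext_E: "w = v" if w: "w \<in> Arr C" "v \<in> Arr C" "Dom C v = Dom C w" "Cod C w = N" "Cod C v = N"
      "\<sigma> \<cdot> w = \<sigma> \<cdot> v" "\<tau> \<cdot> w = \<tau> \<cdot> v"
      and e: "\<And>t x. el2 t x (Dom C w) (IOb D) \<Longrightarrow> \<epsilon> \<cdot> pair C (w \<cdot> t) (IIde D \<cdot> x) = \<epsilon> \<cdot> pair C (v \<cdot> t) (IIde D \<cdot> x)" for w v
  proof (rule N(6)[OF w])
    fix t x assume tx: "el2 t x (Dom C w) (IOb D)"
    then show "\<phi> \<cdot> pair C (w \<cdot> t) x = \<phi> \<cdot> pair C (v \<cdot> t) x"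
      using e[OF tx] w(1-5) by (simp add: \<epsilon>_ide)
  qed
  have uniq: "u\<^sub>0 = v\<^sub>0 \<and> u\<^sub>1 = v\<^sub>1" if Z: "is_icat C Z" and U: "is_functor Z E u\<^sub>0 u\<^sub>1" and V: "is_functor Z E v\<^sub>0 v\<^sub>1"
    and e0: "\<And>t x. el2 t x (IOb Z) (IOb D) \<Longrightarrow> \<phi>\<^sub>0 \<cdot> pair C (u\<^sub>0 \<cdot> t) x = \<phi>\<^sub>0 \<cdot> pair C (v\<^sub>0 \<cdot> t) x"
    and e1: "\<And>t x. el2 t x (IAr Z) (IAr D) \<Longrightarrow> \<epsilon> \<cdot> pair C (u\<^sub>1 \<cdot> t) x = \<epsilon> \<cdot> pair C (v\<^sub>1 \<cdot> t) x" for Z u\<^sub>0 u\<^sub>1 v\<^sub>0 v\<^sub>1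
  proof -
    note [simp] = Z
    note U = functor_simps[OF U, unfolded E_simps] and V = functor_simps[OF V, unfolded E_simps]
    note [simp] = U(1-6) V(1-6)
    \<comment> \<open>Extensionality of \<open>X\<close> also asks for agreement on arrows of
      \<open>D\<close>; the action of the functor named by an object on these is the value of
      \<open>\<epsilon>\<close> at the identity of that object.\<close>
    have u: "u\<^sub>0 = v\<^sub>0"
    proof (rule X(4))
      fix t d assume td: "el2 t d (Dom C u\<^sub>0) (IAr D)"
      then have "\<epsilon> \<cdot> pair C (i \<cdot> (u\<^sub>0 \<cdot> t)) d = \<epsilon> \<cdot> pair C (i \<cdot> (v\<^sub>0 \<cdot> t)) d"
        using e1[of "IIde Z \<cdot> t" d] by (simp add: U(9) V(9))
      then show "\<phi>\<^sub>1 \<cdot> pair C (u\<^sub>0 \<cdot> t) d = \<phi>\<^sub>1 \<cdot> pair C (v\<^sub>0 \<cdot> t) d"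
        using td by (simp add: \<epsilon>_i)
    qed (simp_all add: e0)
    have "u\<^sub>1 = v\<^sub>1"
      by (rule ext_E) (use U(7,8)[of "Ide C (IAr Z)"] V(7,8)[of "Ide C (IAr Z)"] e1 u in simp_all)
    then show ?thesis
      using u by simp
  qed
  have arr: "\<exists>w\<in>hom C Z N. \<sigma> \<cdot> w = p \<and> \<tau> \<cdot> w = q \<and>
        (\<forall>t x. el2 t x Z (IOb D) \<longrightarrow> \<epsilon> \<cdot> pair C (w \<cdot> t) (IIde D \<cdot> x) = a \<cdot> pair C t x)"
    if Z: "Z \<in> Obj C" and p: "p \<in> hom C Z X" and q: "q \<in> hom C Z X"
      and a: "natel D A \<phi>\<^sub>0 (\<epsilon> \<cdot> prod_map C i (Ide C (IAr D))) Z p q a" for Z p q a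
  proof -
    note [simp] = Z p[simplified] q[simplified]
    have "natel D A \<phi>\<^sub>0 \<phi>\<^sub>1 Z p q a"
      using a unfolding natel_def by (simp add: \<epsilon>_i cong: conj_cong)
    then obtain w where "w \<in> hom C Z N" "\<sigma> \<cdot> w = p" "\<tau> \<cdot> w = q"
      "\<And>t x. el2 t x Z (IOb D) \<Longrightarrow> \<phi> \<cdot> pair C (w \<cdot> t) x = a \<cdot> pair C t x"
      using N(5)[OF Z p q] by blast
    then show ?thesis
      by (intro bexI[of _ w]) (simp_all add: \<epsilon>_ide)
  qed
  have "is_exp_cat D A E \<phi>\<^sub>0 \<epsilon>"
    unfolding is_exp_cat_def E_simps using E ev univ uniq arr ext_E by blast
  then show ?thesis
    by blast
qed

end

context cart
begin

lemma prod_map_is_ifun: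
  assumes F: "is_ifun C F" and G: "is_ifun C G"
  shows "is_ifun C (prod_map (Cat C) F G)"
proof -
  note c = ifun_icat[OF F] ifun_icat[OF G]
  have "is_functor (icat_prod C (FDom F) (FDom G)) (icat_prod C (FCod F) (FCod G))
    (prod_map C (FOb F) (FOb G)) (prod_map C (FAr F) (FAr G))"
    using functor_pair[OF c(2,5) is_icat_prod[OF c(1,4)]
        functor_comp[OF is_icat_prod[OF c(1,4)] c(1,2) functor_Pr1[OF c(1,4)] c(3)]
        functor_comp[OF is_icat_prod[OF c(1,4)] c(4,5) functor_Pr2[OF c(1,4)] c(6)]]
      ifun_simps(1-6)[OF F] ifun_simps(1-6)[OF G]
    by simp
  then show ?thesis
    unfolding prod_map_Cat[OF F G] using c by (simp add: is_ifun_iff)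
qed

end

context ccc
begin

section \<open>Transfer of the description to an arbitrary exponential in \<open>Cat\<close>\<close>

lemma is_exp_catD:
  assumes "is_exp_cat D A E e\<^sub>0 e\<^sub>1"
  shows "is_icat C E" "is_functor (icat_prod C E D) A e\<^sub>0 e\<^sub>1"
    "\<And>Z f\<^sub>0 f\<^sub>1. is_icat C Z \<Longrightarrow> is_functor (icat_prod C Z D) A f\<^sub>0 f\<^sub>1 \<Longrightarrow>
      \<exists>u\<^sub>0 u\<^sub>1. is_functor Z E u\<^sub>0 u\<^sub>1 \<and>
        (\<forall>t x. el2 t x (IOb Z) (IOb D) \<longrightarrow> e\<^sub>0 \<cdot> pair C (u\<^sub>0 \<cdot> t) x = f\<^sub>0 \<cdot> pair C t x) \<and>
        (\<forall>t x. el2 t x (IAr Z) (IAr D) \<longrightarrow> e\<^sub>1 \<cdot> pair C (u\<^sub>1 \<cdot> t) x = f\<^sub>1 \<cdot> pair C t x)"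
    "\<And>Z u\<^sub>0 u\<^sub>1 v\<^sub>0 v\<^sub>1. is_icat C Z \<Longrightarrow> is_functor Z E u\<^sub>0 u\<^sub>1 \<Longrightarrow> is_functor Z E v\<^sub>0 v\<^sub>1 \<Longrightarrow>
        (\<And>t x. el2 t x (IOb Z) (IOb D) \<Longrightarrow> e\<^sub>0 \<cdot> pair C (u\<^sub>0 \<cdot> t) x = e\<^sub>0 \<cdot> pair C (v\<^sub>0 \<cdot> t) x) \<Longrightarrow>
        (\<And>t x. el2 t x (IAr Z) (IAr D) \<Longrightarrow> e\<^sub>1 \<cdot> pair C (u\<^sub>1 \<cdot> t) x = e\<^sub>1 \<cdot> pair C (v\<^sub>1 \<cdot> t) x) \<Longrightarrow>
        u\<^sub>0 = v\<^sub>0 \<and> u\<^sub>1 = v\<^sub>1"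
    "\<And>Z p q a. Z \<in> Obj C \<Longrightarrow> p \<in> hom C Z (IOb E) \<Longrightarrow> q \<in> hom C Z (IOb E) \<Longrightarrow>
        natel D A e\<^sub>0 (e\<^sub>1 \<cdot> prod_map C (IIde E) (Ide C (IAr D))) Z p q a \<Longrightarrow>
      \<exists>w\<in>hom C Z (IAr E). ISrc E \<cdot> w = p \<and> ITgt E \<cdot> w = q \<and>
        (\<forall>t x. el2 t x Z (IOb D) \<longrightarrow> e\<^sub>1 \<cdot> pair C (w \<cdot> t) (IIde D \<cdot> x) = a \<cdot> pair C t x)"
    "\<And>w v. w \<in> Arr C \<Longrightarrow> v \<in> Arr C \<Longrightarrow> Dom C v = Dom C w \<Longrightarrow> Cod C w = IAr E \<Longrightarrow> Cod C v = IAr E \<Longrightarrow>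
        ISrc E \<cdot> w = ISrc E \<cdot> v \<Longrightarrow> ITgt E \<cdot> w = ITgt E \<cdot> v \<Longrightarrow>
        (\<And>t x. el2 t x (Dom C w) (IOb D) \<Longrightarrow> e\<^sub>1 \<cdot> pair C (w \<cdot> t) (IIde D \<cdot> x) = e\<^sub>1 \<cdot> pair C (v \<cdot> t) (IIde D \<cdot> x)) \<Longrightarrow>
        w = v"
  using assms unfolding is_exp_cat_def by blast+

lemma is_exp_catI:
  assumes "is_icat C E" "is_functor (icat_prod C E D) A e\<^sub>0 e\<^sub>1"
    "\<And>Z f\<^sub>0 f\<^sub>1. is_icat C Z \<Longrightarrow> is_functor (icat_prod C Z D) A f\<^sub>0 f\<^sub>1 \<Longrightarrow>
      \<exists>u\<^sub>0 u\<^sub>1. is_functor Z E u\<^sub>0 u\<^sub>1 \<and>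
        (\<forall>t x. el2 t x (IOb Z) (IOb D) \<longrightarrow> e\<^sub>0 \<cdot> pair C (u\<^sub>0 \<cdot> t) x = f\<^sub>0 \<cdot> pair C t x) \<and>
        (\<forall>t x. el2 t x (IAr Z) (IAr D) \<longrightarrow> e\<^sub>1 \<cdot> pair C (u\<^sub>1 \<cdot> t) x = f\<^sub>1 \<cdot> pair C t x)"
    "\<And>Z u\<^sub>0 u\<^sub>1 v\<^sub>0 v\<^sub>1. is_icat C Z \<Longrightarrow> is_functor Z E u\<^sub>0 u\<^sub>1 \<Longrightarrow> is_functor Z E v\<^sub>0 v\<^sub>1 \<Longrightarrow>
        (\<And>t x. el2 t x (IOb Z) (IOb D) \<Longrightarrow> e\<^sub>0 \<cdot> pair C (u\<^sub>0 \<cdot> t) x = e\<^sub>0 \<cdot> pair C (v\<^sub>0 \<cdot> t) x) \<Longrightarrow>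
        (\<And>t x. el2 t x (IAr Z) (IAr D) \<Longrightarrow> e\<^sub>1 \<cdot> pair C (u\<^sub>1 \<cdot> t) x = e\<^sub>1 \<cdot> pair C (v\<^sub>1 \<cdot> t) x) \<Longrightarrow>
        u\<^sub>0 = v\<^sub>0 \<and> u\<^sub>1 = v\<^sub>1"
    "\<And>Z p q a. Z \<in> Obj C \<Longrightarrow> p \<in> hom C Z (IOb E) \<Longrightarrow> q \<in> hom C Z (IOb E) \<Longrightarrow>
        natel D A e\<^sub>0 (e\<^sub>1 \<cdot> prod_map C (IIde E) (Ide C (IAr D))) Z p q a \<Longrightarrow>
      \<exists>w\<in>hom C Z (IAr E). ISrc E \<cdot> w = p \<and> ITgt E \<cdot> w = q \<and>
        (\<forall>t x. el2 t x Z (IOb D) \<longrightarrow> e\<^sub>1 \<cdot> pair C (w \<cdot> t) (IIde D \<cdot> x) = a \<cdot> pair C t x)"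
    "\<And>w v. w \<in> Arr C \<Longrightarrow> v \<in> Arr C \<Longrightarrow> Dom C v = Dom C w \<Longrightarrow> Cod C w = IAr E \<Longrightarrow> Cod C v = IAr E \<Longrightarrow>
        ISrc E \<cdot> w = ISrc E \<cdot> v \<Longrightarrow> ITgt E \<cdot> w = ITgt E \<cdot> v \<Longrightarrow>
        (\<And>t x. el2 t x (Dom C w) (IOb D) \<Longrightarrow> e\<^sub>1 \<cdot> pair C (w \<cdot> t) (IIde D \<cdot> x) = e\<^sub>1 \<cdot> pair C (v \<cdot> t) (IIde D \<cdot> x)) \<Longrightarrow>
        w = v"
  shows "is_exp_cat D A E e\<^sub>0 e\<^sub>1"
  unfolding is_exp_cat_def
  apply (intro conjI)
       apply (rule assms(1))
      apply (rule assms(2))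
     apply (intro allI impI, elim conjE, rule assms(3); assumption)
    apply (intro allI impI, elim conjE, rule assms(4), assumption, assumption, assumption, blast, blast)
   apply (intro allI impI, elim conjE, rule assms(5); assumption)
  apply (intro allI impI, elim conjE, rule assms(6); (assumption | blast))
  done

text \<open>The equation characterising a transpose in \<open>Cat C\<close>, split into its object
  and arrow parts and tested on elements. The passage between \<open>is_exponential\<close> and
  \<open>is_exp_cat\<close> rests on it.\<close>

lemma ev_eq_iff:
  assumes X: "is_icat C X" and D: "is_icat C D" and ev: "is_ifun C ev" "FDom ev = icat_prod C X D" "FCod ev = A"
    and u: "is_ifun C u" "FDom u = Z" "FCod u = X"
    and F: "is_ifun C F" "FDom F = icat_prod C Z D" "FCod F = A"
  shows "Comp (Cat C) ev (prod_map (Cat C) u (Ide (Cat C) D)) = F \<longleftrightarrow>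
    (\<forall>t x. el2 t x (IOb Z) (IOb D) \<longrightarrow> FOb ev \<cdot> pair C (FOb u \<cdot> t) x = FOb F \<cdot> pair C t x) \<and>
    (\<forall>t x. el2 t x (IAr Z) (IAr D) \<longrightarrow> FAr ev \<cdot> pair C (FAr u \<cdot> t) x = FAr F \<cdot> pair C t x)"
proof -
  have Z: "is_icat C Z"
    using ifun_icat(1)[OF u(1)] u(2) by simp
  note [simp] = X D Z ev(2,3) u(2,3) F(2,3)
    ifun_simps(1-6)[OF ev(1), unfolded ev(2,3), simplified] ifun_simps(1-6)[OF u(1), unfolded u(2,3)]
    ifun_simps(1-6)[OF F(1), unfolded F(2,3), simplified]
  have I: "is_ifun C (ifun_id C D)"
    using functor_Ide[OF D] by (simp add: is_ifun_iff)
  have "prod_map (Cat C) u (Ide (Cat C) D) = \<lparr>FDom = icat_prod C Z D, FCod = icat_prod C X D,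
    FOb = pair C (FOb u \<cdot> Pr1 C (IOb Z) (IOb D)) (Pr2 C (IOb Z) (IOb D)),
    FAr = pair C (FAr u \<cdot> Pr1 C (IAr Z) (IAr D)) (Pr2 C (IAr Z) (IAr D))\<rparr>"
    using prod_map_Cat[OF u(1) I] by (simp add: Cat_simps)
  then have c: "Comp (Cat C) ev (prod_map (Cat C) u (Ide (Cat C) D)) = \<lparr>FDom = icat_prod C Z D, FCod = A,
    FOb = FOb ev \<cdot> pair C (FOb u \<cdot> Pr1 C (IOb Z) (IOb D)) (Pr2 C (IOb Z) (IOb D)),
    FAr = FAr ev \<cdot> pair C (FAr u \<cdot> Pr1 C (IAr Z) (IAr D)) (Pr2 C (IAr Z) (IAr D))\<rparr>"
    by (simp add: Cat_simps ifun_comp_def)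
  show ?thesis (is "?L \<longleftrightarrow> ?R0 \<and> ?R1")
  proof
    assume ?L
    then have e: "FOb ev \<cdot> pair C (FOb u \<cdot> Pr1 C (IOb Z) (IOb D)) (Pr2 C (IOb Z) (IOb D)) = FOb F"
        "FAr ev \<cdot> pair C (FAr u \<cdot> Pr1 C (IAr Z) (IAr D)) (Pr2 C (IAr Z) (IAr D)) = FAr F"
      unfolding c by auto
    have ?R0
      using e(1)[symmetric] by simp
    moreover have ?R1
      using e(2)[symmetric] by simp
    ultimately show "?R0 \<and> ?R1" ..
  next
    assume R: "?R0 \<and> ?R1"
    have "FOb ev \<cdot> pair C (FOb u \<cdot> Pr1 C (IOb Z) (IOb D)) (Pr2 C (IOb Z) (IOb D)) = FOb F"
      by (rule Prod_arr_ext[of _ "IOb Z" "IOb D" "IOb A"]) (use R in simp_all)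
    moreover have "FAr ev \<cdot> pair C (FAr u \<cdot> Pr1 C (IAr Z) (IAr D)) (Pr2 C (IAr Z) (IAr D)) = FAr F"
      by (rule Prod_arr_ext[of _ "IAr Z" "IAr D" "IAr A"]) (use R in simp_all)
    ultimately show ?L
      unfolding c by (intro ifun_eqI) simp_all
  qed
qed

lemma is_exponential_Cat:
  assumes D: "is_icat C D" and A: "is_icat C A" and E: "is_exp_cat D A E e\<^sub>0 e\<^sub>1"
  shows "is_exponential (Cat C) D A E \<lparr>FDom = icat_prod C E D, FCod = A, FOb = e\<^sub>0, FAr = e\<^sub>1\<rparr>"
proof -
  note e = is_exp_catD[OF E]
  let ?ev = "\<lparr>FDom = icat_prod C E D, FCod = A, FOb = e\<^sub>0, FAr = e\<^sub>1\<rparr>"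
  have ev: "is_ifun C ?ev" "FDom ?ev = icat_prod C E D" "FCod ?ev = A"
    using e(1,2) D A by (simp_all add: is_ifun_iff)
  note iff = ev_eq_iff[OF e(1) D ev, simplified]
  have "\<exists>!u. u \<in> hom (Cat C) Z E \<and> Comp (Cat C) ?ev (prod_map (Cat C) u (Ide (Cat C) D)) = F"
    if Z: "is_icat C Z" and F: "is_ifun C F" "FDom F = icat_prod C Z D" "FCod F = A" for Z F
  proof -
    obtain u\<^sub>0 u\<^sub>1 where u: "is_functor Z E u\<^sub>0 u\<^sub>1"
        "\<forall>t x. el2 t x (IOb Z) (IOb D) \<longrightarrow> e\<^sub>0 \<cdot> pair C (u\<^sub>0 \<cdot> t) x = FOb F \<cdot> pair C t x"
        "\<forall>t x. el2 t x (IAr Z) (IAr D) \<longrightarrow> e\<^sub>1 \<cdot> pair C (u\<^sub>1 \<cdot> t) x = FAr F \<cdot> pair C t x"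
      using e(3)[OF Z ifun_icat(3)[OF F(1), unfolded F(2,3)]] by blast
    let ?u = "\<lparr>FDom = Z, FCod = E, FOb = u\<^sub>0, FAr = u\<^sub>1\<rparr>"
    have u': "is_ifun C ?u" "FDom ?u = Z" "FCod ?u = E"
      using u(1) Z e(1) by (simp_all add: is_ifun_iff)
    show ?thesis
    proof (rule ex1I[of _ ?u])
      show "?u \<in> hom (Cat C) Z E \<and> Comp (Cat C) ?ev (prod_map (Cat C) ?u (Ide (Cat C) D)) = F"
        using iff[OF u' F] u(2,3) u' by (simp add: hom_def Cat_simps(2-4))
    next
      fix v assume "v \<in> hom (Cat C) Z E \<and> Comp (Cat C) ?ev (prod_map (Cat C) v (Ide (Cat C) D)) = F"
      then have v: "is_ifun C v" "FDom v = Z" "FCod v = E" and vF: "Comp (Cat C) ?ev (prod_map (Cat C) v (Ide (Cat C) D)) = F"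
        by (simp_all add: hom_def Cat_simps(2-4))
      have "FOb v = u\<^sub>0 \<and> FAr v = u\<^sub>1"
        by (rule e(4)[OF Z ifun_icat(3)[OF v(1), unfolded v(2,3)] u(1)]) (use iff[OF v F] vF u(2,3) in simp_all)
      then show "v = ?u"
        by (intro ifun_eqI) (simp_all add: v)
    qed
  qed
  then show ?thesis
    unfolding is_exponential_def
    using ev e(1) by (simp add: Cat_simps(1-4,8) hom_def)
qed

text \<open>The universal properties give comparison functors \<open>i\<close> from the given
  exponential to the constructed one and \<open>j\<close> back, and \<open>j\<close> after
  \<open>i\<close> is the identity. A question about arrows is sent to the constructed exponential
  by \<open>i\<close>, answered there on components, and brought back by \<open>j\<close>.\<close>

lemma is_exp_cat_of_is_exponential:
  assumes D: "is_icat C D" and A: "is_icat C A" and X: "is_exponential (Cat C) D A X ev"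
  shows "is_ifun C ev" "FDom ev = icat_prod C X D" "FCod ev = A" "is_exp_cat D A X (FOb ev) (FAr ev)"
proof -
  have Xc: "is_icat C X" and ev: "is_ifun C ev" "FDom ev = icat_prod C X D" "FCod ev = A"
    and un: "\<And>Z F. is_icat C Z \<Longrightarrow> is_ifun C F \<Longrightarrow> FDom F = icat_prod C Z D \<Longrightarrow> FCod F = A \<Longrightarrow>
      \<exists>!u. u \<in> hom (Cat C) Z X \<and> Comp (Cat C) ev (prod_map (Cat C) u (Ide (Cat C) D)) = F"
    using X unfolding is_exponential_def by (simp_all add: Cat_simps(1-4,8) hom_def)
  show "is_ifun C ev" "FDom ev = icat_prod C X D" "FCod ev = A"
    by fact+
  note iff = ev_eq_iff[OF Xc D ev]
  have evf: "is_functor (icat_prod C X D) A (FOb ev) (FAr ev)"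
    using ifun_icat(3)[OF ev(1)] ev(2,3) by simp
  have univ: "\<exists>u\<^sub>0 u\<^sub>1. is_functor Z X u\<^sub>0 u\<^sub>1 \<and>
        (\<forall>t x. el2 t x (IOb Z) (IOb D) \<longrightarrow> FOb ev \<cdot> pair C (u\<^sub>0 \<cdot> t) x = f\<^sub>0 \<cdot> pair C t x) \<and>
        (\<forall>t x. el2 t x (IAr Z) (IAr D) \<longrightarrow> FAr ev \<cdot> pair C (u\<^sub>1 \<cdot> t) x = f\<^sub>1 \<cdot> pair C t x)"
    if Z: "is_icat C Z" and f: "is_functor (icat_prod C Z D) A f\<^sub>0 f\<^sub>1" for Z f\<^sub>0 f\<^sub>1
  proof -
    let ?F = "\<lparr>FDom = icat_prod C Z D, FCod = A, FOb = f\<^sub>0, FAr = f\<^sub>1\<rparr>"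
    have F: "is_ifun C ?F" "FDom ?F = icat_prod C Z D" "FCod ?F = A"
      using f Z D A by (simp_all add: is_ifun_iff)
    obtain u where u: "u \<in> hom (Cat C) Z X" "Comp (Cat C) ev (prod_map (Cat C) u (Ide (Cat C) D)) = ?F"
      using un[OF Z F] by blast
    have u': "is_ifun C u" "FDom u = Z" "FCod u = X"
      using u(1) by (simp_all add: hom_def Cat_simps(2-4))
    show ?thesis
      using iff[OF u' F] u(2) ifun_icat(3)[OF u'(1), unfolded u'(2,3)] by (intro exI[of _ "FOb u"] exI[of _ "FAr u"]) simp
  qed
  have uniq: "u\<^sub>0 = v\<^sub>0 \<and> u\<^sub>1 = v\<^sub>1" if Z: "is_icat C Z" and U: "is_functor Z X u\<^sub>0 u\<^sub>1" and V: "is_functor Z X v\<^sub>0 v\<^sub>1"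
    and e0: "\<And>t x. el2 t x (IOb Z) (IOb D) \<Longrightarrow> FOb ev \<cdot> pair C (u\<^sub>0 \<cdot> t) x = FOb ev \<cdot> pair C (v\<^sub>0 \<cdot> t) x"
    and e1: "\<And>t x. el2 t x (IAr Z) (IAr D) \<Longrightarrow> FAr ev \<cdot> pair C (u\<^sub>1 \<cdot> t) x = FAr ev \<cdot> pair C (v\<^sub>1 \<cdot> t) x" for Z u\<^sub>0 u\<^sub>1 v\<^sub>0 v\<^sub>1
  proof -
    let ?u = "\<lparr>FDom = Z, FCod = X, FOb = u\<^sub>0, FAr = u\<^sub>1\<rparr>" and ?v = "\<lparr>FDom = Z, FCod = X, FOb = v\<^sub>0, FAr = v\<^sub>1\<rparr>"
    have u: "is_ifun C ?u" "FDom ?u = Z" "FCod ?u = X" and v: "is_ifun C ?v" "FDom ?v = Z" "FCod ?v = X"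
      using U V Z Xc by (simp_all add: is_ifun_iff)
    let ?F = "Comp (Cat C) ev (prod_map (Cat C) ?v (Ide (Cat C) D))"
    have Did: "is_ifun C (ifun_id C D)"
      using functor_Ide[OF D] D by (simp add: is_ifun_iff)
    have pm: "is_ifun C (prod_map (Cat C) ?v (Ide (Cat C) D))"
        "FDom (prod_map (Cat C) ?v (Ide (Cat C) D)) = icat_prod C Z D"
        "FCod (prod_map (Cat C) ?v (Ide (Cat C) D)) = icat_prod C X D"
      using prod_map_is_ifun[OF v(1) Did] prod_map_Cat[OF v(1) Did] by (simp_all add: Cat_simps(5))
    have F: "is_ifun C ?F" "FDom ?F = icat_prod C Z D" "FCod ?F = A"
      using ifun_comp_is_ifun[of "prod_map (Cat C) ?v (Ide (Cat C) D)" ev] pm ev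
      by (simp_all add: Cat_simps(2-4,6))
    have "Comp (Cat C) ev (prod_map (Cat C) ?u (Ide (Cat C) D)) = ?F"
      using iff[OF v F] iff[OF u F] e0 e1 by simp
    moreover have "?u \<in> hom (Cat C) Z X" "?v \<in> hom (Cat C) Z X"
      using u v by (simp_all add: hom_def Cat_simps(2-4))
    ultimately have "?u = ?v"
      using un[OF Z F] by blast
    then show ?thesis
      by simp
  qed
  obtain E e\<^sub>0 e\<^sub>1 where E: "is_exp_cat D A E e\<^sub>0 e\<^sub>1"
    using exp_cat_ex[OF D A] by blast
  note e = is_exp_catD[OF E]
  obtain i\<^sub>0 i\<^sub>1 where i: "is_functor X E i\<^sub>0 i\<^sub>1"
    and ei0: "\<And>t x. el2 t x (IOb X) (IOb D) \<Longrightarrow> e\<^sub>0 \<cdot> pair C (i\<^sub>0 \<cdot> t) x = FOb ev \<cdot> pair C t x"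
    and ei1: "\<And>t x. el2 t x (IAr X) (IAr D) \<Longrightarrow> e\<^sub>1 \<cdot> pair C (i\<^sub>1 \<cdot> t) x = FAr ev \<cdot> pair C t x"
    using e(3)[OF Xc evf] by blast
  obtain j\<^sub>0 j\<^sub>1 where j: "is_functor E X j\<^sub>0 j\<^sub>1"
    and ej0: "\<And>t x. el2 t x (IOb E) (IOb D) \<Longrightarrow> FOb ev \<cdot> pair C (j\<^sub>0 \<cdot> t) x = e\<^sub>0 \<cdot> pair C t x"
    and ej1: "\<And>t x. el2 t x (IAr E) (IAr D) \<Longrightarrow> FAr ev \<cdot> pair C (j\<^sub>1 \<cdot> t) x = e\<^sub>1 \<cdot> pair C t x"
    using univ[OF e(1,2)] by blast
  note i' = functor_simps[OF i] and j' = functor_simps[OF j]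
  note [simp] = Xc e(1) D A i'(1-6) j'(1-6) functor_simps(1-6)[OF evf, simplified] functor_simps(1-6)[OF e(2), simplified]
  have ji: "j\<^sub>0 \<cdot> i\<^sub>0 = Ide C (IOb X) \<and> j\<^sub>1 \<cdot> i\<^sub>1 = Ide C (IAr X)"
    by (rule uniq[OF Xc functor_comp[OF Xc e(1) Xc i j] functor_Ide[OF Xc]]) (simp_all add: ei0 ei1 ej0 ej1)
  have ji0: "j\<^sub>0 \<cdot> (i\<^sub>0 \<cdot> t) = t" if "t \<in> Arr C" "Cod C t = IOb X" for t
    using comp_eq_comp[OF conjunct1[OF ji], of t] that by simp
  have ji1: "j\<^sub>1 \<cdot> (i\<^sub>1 \<cdot> t) = t" if "t \<in> Arr C" "Cod C t = IAr X" for t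
    using comp_eq_comp[OF conjunct2[OF ji], of t] that by simp
  have e1_ide: "e\<^sub>1 \<cdot> pair C (IIde E \<cdot> (i\<^sub>0 \<cdot> t)) d = FAr ev \<cdot> pair C (IIde X \<cdot> t) d"
    if "t \<in> Arr C" "d \<in> Arr C" "Dom C d = Dom C t" "Cod C t = IOb X" "Cod C d = IAr D" for t d
    using ei1[of "IIde X \<cdot> t" d] that by (simp add: i'(9))
  have arr: "\<exists>w\<in>hom C Z (IAr X). ISrc X \<cdot> w = p \<and> ITgt X \<cdot> w = q \<and>
        (\<forall>t x. el2 t x Z (IOb D) \<longrightarrow> FAr ev \<cdot> pair C (w \<cdot> t) (IIde D \<cdot> x) = a \<cdot> pair C t x)"
    if Z: "Z \<in> Obj C" and p: "p \<in> hom C Z (IOb X)" and q: "q \<in> hom C Z (IOb X)"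
      and a: "natel D A (FOb ev) (FAr ev \<cdot> prod_map C (IIde X) (Ide C (IAr D))) Z p q a" for Z p q a
  proof -
    note [simp] = Z p[simplified] q[simplified]
    have "natel D A e\<^sub>0 (e\<^sub>1 \<cdot> prod_map C (IIde E) (Ide C (IAr D))) Z (i\<^sub>0 \<cdot> p) (i\<^sub>0 \<cdot> q) a"
      using a unfolding natel_def by (simp add: ei0 e1_ide cong: conj_cong)
    moreover have "i\<^sub>0 \<cdot> p \<in> hom C Z (IOb E)" "i\<^sub>0 \<cdot> q \<in> hom C Z (IOb E)"
      by simp_all
    ultimately obtain w where w: "w \<in> hom C Z (IAr E)" "ISrc E \<cdot> w = i\<^sub>0 \<cdot> p" "ITgt E \<cdot> w = i\<^sub>0 \<cdot> q"
      "\<And>t x. el2 t x Z (IOb D) \<Longrightarrow> e\<^sub>1 \<cdot> pair C (w \<cdot> t) (IIde D \<cdot> x) = a \<cdot> pair C t x"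
      using e(5)[OF Z, of "i\<^sub>0 \<cdot> p" "i\<^sub>0 \<cdot> q" a] by blast
    then show ?thesis
      by (intro bexI[of _ "j\<^sub>1 \<cdot> w"]) (simp_all add: ej1 j'(7,8) ji0)
  qed
  have ext: "w = v" if w: "w \<in> Arr C" "v \<in> Arr C" "Dom C v = Dom C w" "Cod C w = IAr X" "Cod C v = IAr X"
      "ISrc X \<cdot> w = ISrc X \<cdot> v" "ITgt X \<cdot> w = ITgt X \<cdot> v"
      and q: "\<And>t x. el2 t x (Dom C w) (IOb D) \<Longrightarrow> FAr ev \<cdot> pair C (w \<cdot> t) (IIde D \<cdot> x) = FAr ev \<cdot> pair C (v \<cdot> t) (IIde D \<cdot> x)"
      for w v
  proof -
    have "i\<^sub>1 \<cdot> w = i\<^sub>1 \<cdot> v"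
      by (rule e(6)) (use w(1-5) q in \<open>simp_all add: i'(7,8) w(6,7) ei1\<close>)
    then have "j\<^sub>1 \<cdot> (i\<^sub>1 \<cdot> w) = j\<^sub>1 \<cdot> (i\<^sub>1 \<cdot> v)"
      by simp
    then show ?thesis
      using w(1-5) by (simp add: ji1)
  qed
  show "is_exp_cat D A X (FOb ev) (FAr ev)"
    by (rule is_exp_catI[OF Xc evf univ uniq arr ext])
qed

text \<open>\<open>Exp\<close> and \<open>Ev\<close> are Hilbert choices; the exponential of
  \<open>exp_cat_ex\<close> is the witness that gives them meaning.\<close>

lemma Exp_Cat:
  assumes D: "is_icat C D" and A: "is_icat C A"
  shows "is_exponential (Cat C) D A (Exp (Cat C) D A) (Ev (Cat C) D A)"
proof -
  obtain E e\<^sub>0 e\<^sub>1 where "is_exp_cat D A E e\<^sub>0 e\<^sub>1"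
    using exp_cat_ex[OF D A] by blast
  note x = is_exponential_Cat[OF D A this]
  have "(\<lambda>(X, ev). is_exponential (Cat C) D A X ev) (SOME (X, ev). is_exponential (Cat C) D A X ev)"
    by (rule someI[of "\<lambda>(X, ev). is_exponential (Cat C) D A X ev" "(_, _)"]) (use x in simp)
  then show ?thesis
    by (simp add: exponential_def split_beta)
qed

section \<open>Transposes: the diagonal and the points of an exponential\<close>

lemma transpose_Cat:
  assumes D: "is_icat C D" and A: "is_icat C A" and Z: "is_icat C Z"
    and F: "is_ifun C F" "FDom F = icat_prod C Z D" "FCod F = A"
  defines "T \<equiv> transpose (Cat C) D A Z F"
  shows "is_ifun C T" "FDom T = Z" "FCod T = Exp (Cat C) D A"
    "\<And>t x. t \<in> Arr C \<Longrightarrow> x \<in> Arr C \<Longrightarrow> Dom C x = Dom C t \<Longrightarrow> Cod C t = IOb Z \<Longrightarrow> Cod C x = IOb D \<Longrightarrow>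
      FOb (Ev (Cat C) D A) \<cdot> pair C (FOb T \<cdot> t) x = FOb F \<cdot> pair C t x"
    "\<And>t x. t \<in> Arr C \<Longrightarrow> x \<in> Arr C \<Longrightarrow> Dom C x = Dom C t \<Longrightarrow> Cod C t = IAr Z \<Longrightarrow> Cod C x = IAr D \<Longrightarrow>
      FAr (Ev (Cat C) D A) \<cdot> pair C (FAr T \<cdot> t) x = FAr F \<cdot> pair C t x"
proof -
  let ?X = "Exp (Cat C) D A" and ?ev = "Ev (Cat C) D A"
  note E = Exp_Cat[OF D A]
  note ev = is_exp_cat_of_is_exponential[OF D A E]
  have "\<exists>!u. u \<in> hom (Cat C) Z ?X \<and> Comp (Cat C) ?ev (prod_map (Cat C) u (Ide (Cat C) D)) = F"
    using E Z F unfolding is_exponential_def by (simp add: Cat_simps(1-4,8) hom_def)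
  from theI'[OF this, folded transpose_def, folded T_def]
  have T: "is_ifun C T" "FDom T = Z" "FCod T = ?X" "Comp (Cat C) ?ev (prod_map (Cat C) T (Ide (Cat C) D)) = F"
    by (simp_all add: hom_def Cat_simps(2-4))
  then show "is_ifun C T" "FDom T = Z" "FCod T = Exp (Cat C) D A"
    by simp_all
  show "FOb (Ev (Cat C) D A) \<cdot> pair C (FOb T \<cdot> t) x = FOb F \<cdot> pair C t x"
    if "t \<in> Arr C" "x \<in> Arr C" "Dom C x = Dom C t" "Cod C t = IOb Z" "Cod C x = IOb D" for t x
    using ev_eq_iff[OF is_exp_catD(1)[OF ev(4)] D ev(1-3) T(1-3) F] T(4) that by simp
  show "FAr (Ev (Cat C) D A) \<cdot> pair C (FAr T \<cdot> t) x = FAr F \<cdot> pair C t x"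
    if "t \<in> Arr C" "x \<in> Arr C" "Dom C x = Dom C t" "Cod C t = IAr Z" "Cod C x = IAr D" for t x
    using ev_eq_iff[OF is_exp_catD(1)[OF ev(4)] D ev(1-3) T(1-3) F] T(4) that by simp
qed

text \<open>Functors into \<open>[D, A]\<close> are separated by evaluation, so the two evaluation
  rules determine the diagonal completely. The same holds for \<open>point_simps\<close>.\<close>

lemma diag_simps:
  assumes D: "is_icat C D" and A: "is_icat C A"
  shows "is_ifun C (diag C D A)" "FDom (diag C D A) = A" "FCod (diag C D A) = Exp (Cat C) D A"
    "\<And>t x. t \<in> Arr C \<Longrightarrow> x \<in> Arr C \<Longrightarrow> Dom C x = Dom C t \<Longrightarrow> Cod C t = IOb A \<Longrightarrow> Cod C x = IOb D \<Longrightarrow>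
      FOb (Ev (Cat C) D A) \<cdot> pair C (FOb (diag C D A) \<cdot> t) x = t"
    "\<And>t x. t \<in> Arr C \<Longrightarrow> x \<in> Arr C \<Longrightarrow> Dom C x = Dom C t \<Longrightarrow> Cod C t = IAr A \<Longrightarrow> Cod C x = IAr D \<Longrightarrow>
      FAr (Ev (Cat C) D A) \<cdot> pair C (FAr (diag C D A) \<cdot> t) x = t"
proof -
  have "is_ifun C (Pr1 (Cat C) A D)" "FDom (Pr1 (Cat C) A D) = icat_prod C A D" "FCod (Pr1 (Cat C) A D) = A"
    using functor_Pr1[OF A D] D A by (simp_all add: is_ifun_iff Cat_simps(9))
  note t = transpose_Cat[OF D A A this, folded diag_def]
  show "is_ifun C (diag C D A)" "FDom (diag C D A) = A" "FCod (diag C D A) = Exp (Cat C) D A"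
    by fact+
  show "FOb (Ev (Cat C) D A) \<cdot> pair C (FOb (diag C D A) \<cdot> t) x = t"
    if "t \<in> Arr C" "x \<in> Arr C" "Dom C x = Dom C t" "Cod C t = IOb A" "Cod C x = IOb D" for t x
    using t(4)[of t x] that by (simp add: Cat_simps(9))
  show "FAr (Ev (Cat C) D A) \<cdot> pair C (FAr (diag C D A) \<cdot> t) x = t"
    if "t \<in> Arr C" "x \<in> Arr C" "Dom C x = Dom C t" "Cod C t = IAr A" "Cod C x = IAr D" for t x
    using t(5)[of t x] that by (simp add: Cat_simps(9))
qed

lemma point_simps:
  assumes F: "is_ifun C F" "FDom F = D" "FCod F = A"
  shows "is_ifun C (point C F)" "FDom (point C F) = icat_one C" "FCod (point C F) = Exp (Cat C) D A"
    "\<And>t x. t \<in> Arr C \<Longrightarrow> x \<in> Arr C \<Longrightarrow> Dom C x = Dom C t \<Longrightarrow> Cod C t = One C \<Longrightarrow> Cod C x = IOb D \<Longrightarrow>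
      FOb (Ev (Cat C) D A) \<cdot> pair C (FOb (point C F) \<cdot> t) x = FOb F \<cdot> x"
    "\<And>t x. t \<in> Arr C \<Longrightarrow> x \<in> Arr C \<Longrightarrow> Dom C x = Dom C t \<Longrightarrow> Cod C t = One C \<Longrightarrow> Cod C x = IAr D \<Longrightarrow>
      FAr (Ev (Cat C) D A) \<cdot> pair C (FAr (point C F) \<cdot> t) x = FAr F \<cdot> x"
proof -
  have D: "is_icat C D" and A: "is_icat C A"
    using ifun_icat[OF F(1)] F by simp_all
  note [simp] = D A ifun_simps(1-6)[OF F(1), unfolded F(2,3)]
  have P: "is_ifun C (Pr2 (Cat C) (icat_one C) D)"
    using functor_Pr2[OF is_icat_one D] D by (simp add: is_ifun_iff Cat_simps(10))
  have "is_ifun C (Comp (Cat C) F (Pr2 (Cat C) (icat_one C) D))"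
    "FDom (Comp (Cat C) F (Pr2 (Cat C) (icat_one C) D)) = icat_prod C (icat_one C) D"
    "FCod (Comp (Cat C) F (Pr2 (Cat C) (icat_one C) D)) = A"
    using ifun_comp_is_ifun[OF P F(1)] F by (simp_all add: Cat_simps(6,10))
  note t = transpose_Cat[OF D A is_icat_one this]
  have e: "point C F = transpose (Cat C) D A (icat_one C) (Comp (Cat C) F (Pr2 (Cat C) (icat_one C) D))"
    by (simp add: point_def F Cat_simps(7))
  note t = t[folded e]
  show "is_ifun C (point C F)" "FDom (point C F) = icat_one C" "FCod (point C F) = Exp (Cat C) D A"
    by fact+
  show "FOb (Ev (Cat C) D A) \<cdot> pair C (FOb (point C F) \<cdot> t) x = FOb F \<cdot> x"
    if "t \<in> Arr C" "x \<in> Arr C" "Dom C x = Dom C t" "Cod C t = One C" "Cod C x = IOb D" for t x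
    using t(4)[of t x] that by (simp add: Cat_simps(6,10))
  show "FAr (Ev (Cat C) D A) \<cdot> pair C (FAr (point C F) \<cdot> t) x = FAr F \<cdot> x"
    if "t \<in> Arr C" "x \<in> Arr C" "Dom C x = Dom C t" "Cod C t = One C" "Cod C x = IAr D" for t x
    using t(5)[of t x] that by (simp add: Cat_simps(6,10))
qed

end

section \<open>Cones and cocones through generalised elements\<close>

text \<open>Arrows of slices and morphisms of cones are tuples that also store their endpoints. The
  injection \<open>g\<close> adds these to an underlying arrow, so that unique existence can be
  tested on underlying arrows.\<close>

lemma ex1_image_iff:
  assumes "\<And>k l. g k = g l \<Longrightarrow> k = l" "\<And>f. Q f \<longleftrightarrow> (\<exists>k. f = g k \<and> P k)"
  shows "(\<exists>!f. Q f) \<longleftrightarrow> (\<exists>!k. P k)"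
  unfolding assms(2) using assms(1) by metis

context cart
begin

lemma functor_one:
  assumes X: "is_icat C X" and f: "is_functor (icat_one C) X f\<^sub>0 f\<^sub>1"
  shows "f\<^sub>0 \<in> hom C (One C) (IOb X)" "f\<^sub>1 = IIde X \<cdot> f\<^sub>0"
  using functor_simps(1-6)[OF f] functor_simps(9)[OF f, of "Ide C (One C)"] X by simp_all

lemma functor_one_iff:
  assumes X: "is_icat C X"
  shows "is_functor (icat_one C) X f\<^sub>0 f\<^sub>1 \<longleftrightarrow> f\<^sub>0 \<in> hom C (One C) (IOb X) \<and> f\<^sub>1 = IIde X \<cdot> f\<^sub>0"
proof
  assume f: "f\<^sub>0 \<in> hom C (One C) (IOb X) \<and> f\<^sub>1 = IIde X \<cdot> f\<^sub>0"
  then have [simp]: "f\<^sub>0 \<in> Arr C" "Dom C f\<^sub>0 = One C" "Cod C f\<^sub>0 = IOb X" and f1: "f\<^sub>1 = IIde X \<cdot> f\<^sub>0"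
    by simp_all
  show "is_functor (icat_one C) X f\<^sub>0 f\<^sub>1"
    unfolding f1
  proof (rule functorI)
    fix f g assume fg: "f \<in> Arr C" "g \<in> Arr C" "Dom C f = Dom C g" "Cod C f = IAr (icat_one C)" "Cod C g = IAr (icat_one C)"
    then have "f = bang (Dom C g)" "g = bang (Dom C g)"
      using bang_eq[of f] bang_eq[of g] by simp_all
    then show "(IIde X \<cdot> f\<^sub>0) \<cdot> icomp C (icat_one C) f g = icomp C X ((IIde X \<cdot> f\<^sub>0) \<cdot> f) ((IIde X \<cdot> f\<^sub>0) \<cdot> g)"
      using fg icomp_one[of f g] X Obj_Dom[OF fg(2)] by simp
  qed (simp_all add: X)
qed (use functor_one[OF X] in simp)

text \<open>On the terminal category naturality is automatic, since its arrows are identities and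
  functors preserve them. A transformation between points is therefore an arrow with prescribed
  endpoints.\<close>

lemma inat_point_iff:
  assumes P: "is_ifun C (NDom \<alpha>)" "FDom (NDom \<alpha>) = icat_one C" "FCod (NDom \<alpha>) = X"
    and Q: "is_ifun C (NCod \<alpha>)" "FDom (NCod \<alpha>) = icat_one C" "FCod (NCod \<alpha>) = X"
  shows "is_inat C \<alpha> \<longleftrightarrow> NMap \<alpha> \<in> hom C (One C) (IAr X) \<and> ISrc X \<cdot> NMap \<alpha> = FOb (NDom \<alpha>) \<and> ITgt X \<cdot> NMap \<alpha> = FOb (NCod \<alpha>)"
proof -
  have X: "is_icat C X"
    using ifun_icat(2)[OF P(1)] P(3) by simp
  note p = functor_one[OF X ifun_icat(3)[OF P(1), unfolded P(2,3)]]
  note q = functor_one[OF X ifun_icat(3)[OF Q(1), unfolded Q(2,3)]]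
  show ?thesis
    using P Q X p q by (auto simp: is_inat_def Let_def)
qed

end

context ccc
begin

text \<open>A global element \<open>1 \<rightarrow> [D, A]\<close> of the object of arrows corresponds to an ordinary natural
  transformation, with components \<open>leg\<close>; this turns the cones over \<open>F\<close> into pairs \<open>(v, \<kappa>)\<close> of arrows
  of \<open>C\<close>.\<close>

definition econe :: "('o, 'a) ifun \<Rightarrow> 'a \<Rightarrow> 'a \<Rightarrow> bool" where
  "econe F v \<kappa> \<longleftrightarrow> v \<in> hom C (One C) (IOb (FCod F)) \<and> \<kappa> \<in> hom C (IOb (FDom F)) (IAr (FCod F)) \<and>
    (\<forall>x. x \<in> Arr C \<and> Cod C x = IOb (FDom F) \<longrightarrow>
      ISrc (FCod F) \<cdot> (\<kappa> \<cdot> x) = v \<cdot> bang (Dom C x) \<and> ITgt (FCod F) \<cdot> (\<kappa> \<cdot> x) = FOb F \<cdot> x) \<and>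
    (\<forall>d. d \<in> Arr C \<and> Cod C d = IAr (FDom F) \<longrightarrow>
      icomp C (FCod F) (\<kappa> \<cdot> (ISrc (FDom F) \<cdot> d)) (FAr F \<cdot> d) = \<kappa> \<cdot> (ITgt (FDom F) \<cdot> d))"

definition ecocone :: "('o, 'a) ifun \<Rightarrow> 'a \<Rightarrow> 'a \<Rightarrow> bool" where
  "ecocone F v \<kappa> \<longleftrightarrow> v \<in> hom C (One C) (IOb (FCod F)) \<and> \<kappa> \<in> hom C (IOb (FDom F)) (IAr (FCod F)) \<and>
    (\<forall>x. x \<in> Arr C \<and> Cod C x = IOb (FDom F) \<longrightarrow>
      ISrc (FCod F) \<cdot> (\<kappa> \<cdot> x) = FOb F \<cdot> x \<and> ITgt (FCod F) \<cdot> (\<kappa> \<cdot> x) = v \<cdot> bang (Dom C x)) \<and>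
    (\<forall>d. d \<in> Arr C \<and> Cod C d = IAr (FDom F) \<longrightarrow>
      icomp C (FCod F) (FAr F \<cdot> d) (\<kappa> \<cdot> (ITgt (FDom F) \<cdot> d)) = \<kappa> \<cdot> (ISrc (FDom F) \<cdot> d))"

text \<open>Evaluating an arrow of \<open>[D, A]\<close> at an identity of \<open>D\<close> gives
  its component there, and \<open>IIde (FDom F)\<close> is the generic identity.\<close>

definition leg :: "('o, 'a) ifun \<Rightarrow> ('o, 'a) inat \<Rightarrow> 'a" where
  "leg F \<gamma> = FAr (Ev (Cat C) (FDom F) (FCod F)) \<cdot> pair C (NMap \<gamma> \<cdot> bang (IOb (FDom F))) (IIde (FDom F))"

context
  fixes F :: "('o, 'a) ifun" and D A :: "('o, 'a) icat"
  assumes F: "is_ifun C F" and FD: "FDom F = D" and FA: "FCod F = A"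
begin

private abbreviation "X \<equiv> Exp (Cat C) D A"
private abbreviation "ev\<^sub>0 \<equiv> FOb (Ev (Cat C) D A)"
private abbreviation "ev\<^sub>1 \<equiv> FAr (Ev (Cat C) D A)"
private abbreviation "\<delta> \<equiv> diag C D A"
private abbreviation "pt \<equiv> point C F"

private lemma D: "is_icat C D" and A: "is_icat C A"
  using ifun_icat[OF F] FD FA by simp_all

private lemma E: "is_exp_cat D A X ev\<^sub>0 ev\<^sub>1"
  using is_exp_cat_of_is_exponential(4)[OF D A Exp_Cat[OF D A]] .

private lemma X: "is_icat C X"
  using is_exp_catD(1)[OF E] .

private lemmas ev = functor_simps[OF is_exp_catD(2)[OF E]]
private lemmas \<delta> = diag_simps[OF D A] and \<delta>f = functor_simps[OF ifun_icat(3)[OF diag_simps(1)[OF D A]], unfolded diag_simps(2,3)[OF D A]]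
private lemmas pt = point_simps[OF F FD FA]
  and ptf = functor_simps[OF ifun_icat(3)[OF point_simps(1)[OF F FD FA]], unfolded point_simps(2,3)[OF F FD FA]]
private lemmas Ff = functor_simps[OF ifun_icat(3)[OF F], unfolded FD FA]
private lemmas typs = D A X ev(1-6)[simplified icat_prod_simps] \<delta>f(1-6) ptf(1-6)[simplified icat_one_simps] Ff(1-6)

private lemma ev_src_tgt:
  assumes "w \<in> Arr C" "d \<in> Arr C" "Dom C d = Dom C w" "Cod C w = IAr X" "Cod C d = IAr D"
  shows "ISrc A \<cdot> (ev\<^sub>1 \<cdot> pair C w d) = ev\<^sub>0 \<cdot> pair C (ISrc X \<cdot> w) (ISrc D \<cdot> d)"
    "ITgt A \<cdot> (ev\<^sub>1 \<cdot> pair C w d) = ev\<^sub>0 \<cdot> pair C (ITgt X \<cdot> w) (ITgt D \<cdot> d)"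
  using ev(7,8)[of "pair C w d"] assms by (simp_all add: typs)

private lemma ev_comp:
  assumes "w \<in> Arr C" "w' \<in> Arr C" "d \<in> Arr C" "d' \<in> Arr C" "Dom C w' = Dom C w" "Dom C d = Dom C w" "Dom C d' = Dom C w"
    "Cod C w = IAr X" "Cod C w' = IAr X" "Cod C d = IAr D" "Cod C d' = IAr D"
    "ITgt X \<cdot> w = ISrc X \<cdot> w'" "ITgt D \<cdot> d = ISrc D \<cdot> d'"
  shows "ev\<^sub>1 \<cdot> pair C (icomp C X w w') (icomp C D d d') = icomp C A (ev\<^sub>1 \<cdot> pair C w d) (ev\<^sub>1 \<cdot> pair C w' d')"
  using ev(10)[of "pair C w d" "pair C w' d'"] assms by (simp add: icomp_prod typs)

private lemma ev_ide_diag: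
  assumes "a \<in> Arr C" "d \<in> Arr C" "Dom C d = Dom C a" "Cod C a = IOb A" "Cod C d = IAr D"
  shows "ev\<^sub>1 \<cdot> pair C (IIde X \<cdot> (FOb \<delta> \<cdot> a)) d = IIde A \<cdot> a"
  using \<delta>(5)[of "IIde A \<cdot> a" d] assms by (simp add: \<delta>f(9) typs)

private lemma ev_ide_point:
  assumes "t \<in> Arr C" "d \<in> Arr C" "Dom C d = Dom C t" "Cod C t = One C" "Cod C d = IAr D"
  shows "ev\<^sub>1 \<cdot> pair C (IIde X \<cdot> (FOb pt \<cdot> t)) d = FAr F \<cdot> d"
  using pt(5)[of t d] ptf(9)[of t] assms by (simp add: typs)

lemma leg_typ:
  assumes "NMap \<gamma> \<in> hom C (One C) (IAr X)"
  shows "leg F \<gamma> \<in> hom C (IOb D) (IAr A)"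
  using assms by (simp add: leg_def FD FA typs)

lemma leg_el:
  assumes "NMap \<gamma> \<in> hom C (One C) (IAr X)" "x \<in> Arr C" "Cod C x = IOb D"
  shows "leg F \<gamma> \<cdot> x = ev\<^sub>1 \<cdot> pair C (NMap \<gamma> \<cdot> bang (Dom C x)) (IIde D \<cdot> x)"
  using assms by (simp add: leg_def FD FA typs)

private lemma to_One: "t \<in> Arr C \<Longrightarrow> Cod C t = One C \<Longrightarrow> Dom C t = W \<Longrightarrow> t = bang W"
  using bang_eq by blast

text \<open>An arrow of \<open>[D, A]\<close> is determined by its endpoints and components. At the
  stage \<open>1\<close> the parameter \<open>t\<close> is forced to be the arrow to the terminal
  object, so the component at the generic object of \<open>D\<close> decides.\<close>

private lemma arrow_X_ext:
  assumes "w \<in> hom C (One C) (IAr X)" "v \<in> hom C (One C) (IAr X)" "ISrc X \<cdot> w = ISrc X \<cdot> v" "ITgt X \<cdot> w = ITgt X \<cdot> v"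
    and "ev\<^sub>1 \<cdot> pair C (w \<cdot> bang (IOb D)) (IIde D) = ev\<^sub>1 \<cdot> pair C (v \<cdot> bang (IOb D)) (IIde D)"
  shows "w = v"
proof (rule is_exp_catD(6)[OF E])
  fix t x assume tx: "el2 t x (Dom C w) (IOb D)"
  have t: "t = bang (Dom C x)"
    using tx assms(1) by (intro to_One) simp_all
  have "(ev\<^sub>1 \<cdot> pair C (w \<cdot> bang (IOb D)) (IIde D)) \<cdot> x = (ev\<^sub>1 \<cdot> pair C (v \<cdot> bang (IOb D)) (IIde D)) \<cdot> x"
    using assms(5) by simp
  then show "ev\<^sub>1 \<cdot> pair C (w \<cdot> t) (IIde D \<cdot> x) = ev\<^sub>1 \<cdot> pair C (v \<cdot> t) (IIde D \<cdot> x)"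
    using tx assms(1,2) unfolding t by (simp add: typs)
qed (use assms in simp_all)

private lemma vertex_iff: "V \<in> hom (Cat C) (One (Cat C)) A \<longleftrightarrow> is_ifun C V \<and> FDom V = icat_one C \<and> FCod V = A"
  by (simp add: hom_def Cat_simps(2-4,7))

private lemma vertex:
  assumes "is_ifun C V" "FDom V = icat_one C" "FCod V = A"
  shows "FOb V \<in> Arr C" "Dom C (FOb V) = One C" "Cod C (FOb V) = IOb A"
    "is_ifun C (ifun_comp C \<delta> V)"
  using functor_one(1)[OF A ifun_icat(3)[OF assms(1), unfolded assms(2,3)]] ifun_comp_is_ifun[OF assms(1) \<delta>(1)] \<delta>(2) assms(3)
  by simp_all

private lemma vertex_ex:
  assumes "v \<in> hom C (One C) (IOb A)"
  shows "\<exists>V. is_ifun C V \<and> FDom V = icat_one C \<and> FCod V = A \<and> FOb V = v"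
  using functor_one_iff[OF A, of v "IIde A \<cdot> v"] assms A
  by (intro exI[of _ "\<lparr>FDom = icat_one C, FCod = A, FOb = v, FAr = IIde A \<cdot> v\<rparr>"]) (simp add: is_ifun_iff)

lemma is_cone_iff:
  "is_cone C F (V, \<gamma>) \<longleftrightarrow> is_ifun C V \<and> FDom V = icat_one C \<and> FCod V = A \<and>
    NDom \<gamma> = ifun_comp C \<delta> V \<and> NCod \<gamma> = pt \<and> NMap \<gamma> \<in> hom C (One C) (IAr X) \<and>
    ISrc X \<cdot> NMap \<gamma> = FOb \<delta> \<cdot> FOb V \<and> ITgt X \<cdot> NMap \<gamma> = FOb pt"
proof (cases "is_ifun C V \<and> FDom V = icat_one C \<and> FCod V = A \<and> NDom \<gamma> = ifun_comp C \<delta> V \<and> NCod \<gamma> = pt")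
  case True
  then have V: "is_ifun C V" "FDom V = icat_one C" "FCod V = A" and n: "NDom \<gamma> = ifun_comp C \<delta> V" "NCod \<gamma> = pt"
    by simp_all
  have "is_inat C \<gamma> \<longleftrightarrow> NMap \<gamma> \<in> hom C (One C) (IAr X) \<and> ISrc X \<cdot> NMap \<gamma> = FOb (NDom \<gamma>) \<and>
      ITgt X \<cdot> NMap \<gamma> = FOb (NCod \<gamma>)"
    by (rule inat_point_iff) (use V n vertex[OF V] \<delta>(2,3) pt(1-3) in simp_all)
  then show ?thesis
    using V n by (simp add: is_cone_def FD FA vertex_iff Cat_simps(6))
next
  case False
  then show ?thesis
    by (auto simp: is_cone_def FD FA vertex_iff Cat_simps(6))
qed

lemma econe_of_cone:
  assumes c: "is_cone C F (V, \<gamma>)"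
  shows "econe F (FOb V) (leg F \<gamma>)"
proof -
  have V: "is_ifun C V" "FDom V = icat_one C" "FCod V = A"
    and g: "NMap \<gamma> \<in> hom C (One C) (IAr X)" "ISrc X \<cdot> NMap \<gamma> = FOb \<delta> \<cdot> FOb V" "ITgt X \<cdot> NMap \<gamma> = FOb pt"
    using c by (simp_all add: is_cone_iff)
  note [simp] = vertex(1-3)[OF V] typs g(1)[simplified]
  have gt: "ISrc X \<cdot> (NMap \<gamma> \<cdot> t) = FOb \<delta> \<cdot> (FOb V \<cdot> t)" "ITgt X \<cdot> (NMap \<gamma> \<cdot> t) = FOb pt \<cdot> t" if "t \<in> Arr C" "Cod C t = One C" for t
    using comp_eq_comp[OF g(2), of t] comp_eq_comp[OF g(3), of t] that by simp_all
  show ?thesis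
    unfolding econe_def FD FA
  proof (intro conjI allI impI)
    show "leg F \<gamma> \<in> hom C (IOb D) (IAr A)"
      by (rule leg_typ[OF g(1)])
    fix x assume x: "x \<in> Arr C \<and> Cod C x = IOb D"
    then have "Dom C x \<in> Obj C" by simp
    with x show "ISrc A \<cdot> (leg F \<gamma> \<cdot> x) = FOb V \<cdot> bang (Dom C x)" "ITgt A \<cdot> (leg F \<gamma> \<cdot> x) = FOb F \<cdot> x"
      by (simp_all add: leg_el[OF g(1)] ev_src_tgt gt \<delta>(4) pt(4))
  next
    fix d assume d: "d \<in> Arr C \<and> Cod C d = IAr D"
    obtain W where W: "Dom C d = W" "W \<in> Obj C"
      using d by auto
    let ?g = "NMap \<gamma> \<cdot> bang W"
    \<comment> \<open>Both sides are the value of evaluation at \<open>?g\<close> and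
      \<open>d\<close>: this arrow of the product factors through identities in two ways, and the
      two factorisations are the sides of the naturality square.\<close>
    have e: "icomp C A (ev\<^sub>1 \<cdot> pair C ?g (IIde D \<cdot> (ISrc D \<cdot> d))) (ev\<^sub>1 \<cdot> pair C (IIde X \<cdot> (ITgt X \<cdot> ?g)) d) =
      icomp C A (ev\<^sub>1 \<cdot> pair C (IIde X \<cdot> (ISrc X \<cdot> ?g)) d) (ev\<^sub>1 \<cdot> pair C ?g (IIde D \<cdot> (ITgt D \<cdot> d)))"
      using d W by (simp add: ev_comp[symmetric])
    have s: "ISrc A \<cdot> (ev\<^sub>1 \<cdot> pair C ?g (IIde D \<cdot> x)) = FOb V \<cdot> bang W" "ITgt A \<cdot> (ev\<^sub>1 \<cdot> pair C ?g (IIde D \<cdot> x)) = FOb F \<cdot> x"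
      if "x \<in> Arr C" "Cod C x = IOb D" "Dom C x = W" for x
      using that W by (simp_all add: ev_src_tgt gt \<delta>(4) pt(4))
    show "icomp C A (leg F \<gamma> \<cdot> (ISrc D \<cdot> d)) (FAr F \<cdot> d) = leg F \<gamma> \<cdot> (ITgt D \<cdot> d)"
      using e d W s by (simp add: leg_el[OF g(1)] gt ev_ide_diag ev_ide_point)
  qed simp_all
qed

text \<open>Regarded as a family over \<open>1\<close>, the components form a transformation from a
  constant functor to \<open>F\<close>. The description of the arrows of \<open>[D, A]\<close>
  returns the global element that names it.\<close>

lemma cone_of_econe:
  assumes e: "econe F v \<kappa>"
  shows "\<exists>V \<gamma>. is_cone C F (V, \<gamma>) \<and> FOb V = v \<and> leg F \<gamma> = \<kappa>"
proof -
  have v: "v \<in> hom C (One C) (IOb A)" and l: "\<kappa> \<in> hom C (IOb D) (IAr A)"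
    and st: "\<And>x. x \<in> Arr C \<Longrightarrow> Cod C x = IOb D \<Longrightarrow> ISrc A \<cdot> (\<kappa> \<cdot> x) = v \<cdot> bang (Dom C x)"
      "\<And>x. x \<in> Arr C \<Longrightarrow> Cod C x = IOb D \<Longrightarrow> ITgt A \<cdot> (\<kappa> \<cdot> x) = FOb F \<cdot> x"
    and nat: "\<And>d. d \<in> Arr C \<Longrightarrow> Cod C d = IAr D \<Longrightarrow> icomp C A (\<kappa> \<cdot> (ISrc D \<cdot> d)) (FAr F \<cdot> d) = \<kappa> \<cdot> (ITgt D \<cdot> d)"
    using e unfolding econe_def FD FA by blast+
  obtain V where V: "is_ifun C V" "FDom V = icat_one C" "FCod V = A" "FOb V = v"
    using vertex_ex[OF v] by blast
  note [simp] = typs v[simplified] l[simplified]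
  have "natel D A ev\<^sub>0 (ev\<^sub>1 \<cdot> prod_map C (IIde X) (Ide C (IAr D))) (One C) (FOb \<delta> \<cdot> v) (FOb pt)
    (\<kappa> \<cdot> Pr2 C (One C) (IOb D))"
    unfolding natel_def
  proof (intro conjI allI impI)
    fix t x assume tx: "el2 t x (One C) (IOb D)"
    have t: "t = bang (Dom C x)"
      using tx by (intro to_One) simp_all
    have W: "Dom C x \<in> Obj C"
      using tx by simp
    show "ISrc A \<cdot> ((\<kappa> \<cdot> Pr2 C (One C) (IOb D)) \<cdot> pair C t x) = ev\<^sub>0 \<cdot> pair C ((FOb \<delta> \<cdot> v) \<cdot> t) x"
      "ITgt A \<cdot> ((\<kappa> \<cdot> Pr2 C (One C) (IOb D)) \<cdot> pair C t x) = ev\<^sub>0 \<cdot> pair C ((FOb pt) \<cdot> t) x"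
      unfolding t using tx W by (simp_all add: st \<delta>(4) pt(4))
  next
    fix t d assume td: "el2 t d (One C) (IAr D)"
    have t: "t = bang (Dom C d)"
      using td by (intro to_One) simp_all
    have W: "Dom C d \<in> Obj C"
      using td by simp
    show "icomp C A ((ev\<^sub>1 \<cdot> prod_map C (IIde X) (Ide C (IAr D))) \<cdot> pair C ((FOb \<delta> \<cdot> v) \<cdot> t) d)
        ((\<kappa> \<cdot> Pr2 C (One C) (IOb D)) \<cdot> pair C t (ITgt D \<cdot> d)) =
      icomp C A ((\<kappa> \<cdot> Pr2 C (One C) (IOb D)) \<cdot> pair C t (ISrc D \<cdot> d))
        ((ev\<^sub>1 \<cdot> prod_map C (IIde X) (Ide C (IAr D))) \<cdot> pair C ((FOb pt) \<cdot> t) d)"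
      unfolding t using td W nat[of d] by (simp add: st ev_ide_diag ev_ide_point)
  qed simp_all
  then have "\<exists>w\<in>hom C (One C) (IAr X). ISrc X \<cdot> w = FOb \<delta> \<cdot> v \<and> ITgt X \<cdot> w = FOb pt \<and>
    (\<forall>t x. el2 t x (One C) (IOb D) \<longrightarrow> ev\<^sub>1 \<cdot> pair C (w \<cdot> t) (IIde D \<cdot> x) = (\<kappa> \<cdot> Pr2 C (One C) (IOb D)) \<cdot> pair C t x)"
    by (intro is_exp_catD(5)[OF E]) simp_all
  then obtain w where w: "w \<in> hom C (One C) (IAr X)" "ISrc X \<cdot> w = FOb \<delta> \<cdot> v" "ITgt X \<cdot> w = FOb pt"
    and w_el: "\<And>t x. el2 t x (One C) (IOb D) \<Longrightarrow>
      ev\<^sub>1 \<cdot> pair C (w \<cdot> t) (IIde D \<cdot> x) = (\<kappa> \<cdot> Pr2 C (One C) (IOb D)) \<cdot> pair C t x"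
    by blast
  let ?g = "\<lparr>NDom = ifun_comp C \<delta> V, NCod = pt, NMap = w\<rparr>"
  have "is_cone C F (V, ?g)"
    using V w by (simp add: is_cone_iff)
  moreover have "leg F ?g = \<kappa>"
    using w_el[of "bang (IOb D)" "Ide C (IOb D)"] w(1) by (simp add: leg_def FD FA)
  ultimately show ?thesis
    using V(4) by blast
qed

text \<open>Cocones are treated by separate proofs instead of duality: the exponential of the
  opposite categories is chosen on its own, so that \<open>diag\<close> and \<open>point\<close>
  there have no immediate relation to those here. Duality becomes easy only for \<open>econe\<close>
  and \<open>ecocone\<close>.\<close>

lemma is_cocone_iff:
  "is_cocone C F (V, \<gamma>) \<longleftrightarrow> is_ifun C V \<and> FDom V = icat_one C \<and> FCod V = A \<and>
    NDom \<gamma> = pt \<and> NCod \<gamma> = ifun_comp C \<delta> V \<and> NMap \<gamma> \<in> hom C (One C) (IAr X) \<and>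
    ISrc X \<cdot> NMap \<gamma> = FOb pt \<and> ITgt X \<cdot> NMap \<gamma> = FOb \<delta> \<cdot> FOb V"
proof (cases "is_ifun C V \<and> FDom V = icat_one C \<and> FCod V = A \<and> NDom \<gamma> = pt \<and> NCod \<gamma> = ifun_comp C \<delta> V")
  case True
  then have V: "is_ifun C V" "FDom V = icat_one C" "FCod V = A" and n: "NDom \<gamma> = pt" "NCod \<gamma> = ifun_comp C \<delta> V"
    by simp_all
  have "is_inat C \<gamma> \<longleftrightarrow> NMap \<gamma> \<in> hom C (One C) (IAr X) \<and> ISrc X \<cdot> NMap \<gamma> = FOb (NDom \<gamma>) \<and>
      ITgt X \<cdot> NMap \<gamma> = FOb (NCod \<gamma>)"
    by (rule inat_point_iff) (use V n vertex[OF V] \<delta>(2,3) pt(1-3) in simp_all)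
  then show ?thesis
    using V n by (simp add: is_cocone_def FD FA vertex_iff Cat_simps(6))
next
  case False
  then show ?thesis
    by (auto simp: is_cocone_def FD FA vertex_iff Cat_simps(6))
qed

lemma econe_of_cocone:
  assumes c: "is_cocone C F (V, \<gamma>)"
  shows "ecocone F (FOb V) (leg F \<gamma>)"
proof -
  have V: "is_ifun C V" "FDom V = icat_one C" "FCod V = A"
    and g: "NMap \<gamma> \<in> hom C (One C) (IAr X)" "ISrc X \<cdot> NMap \<gamma> = FOb pt" "ITgt X \<cdot> NMap \<gamma> = FOb \<delta> \<cdot> FOb V"
    using c by (simp_all add: is_cocone_iff)
  note [simp] = vertex(1-3)[OF V] typs g(1)[simplified]
  have gt: "ISrc X \<cdot> (NMap \<gamma> \<cdot> t) = FOb pt \<cdot> t" "ITgt X \<cdot> (NMap \<gamma> \<cdot> t) = FOb \<delta> \<cdot> (FOb V \<cdot> t)" if "t \<in> Arr C" "Cod C t = One C" for t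
    using comp_eq_comp[OF g(2), of t] comp_eq_comp[OF g(3), of t] that by simp_all
  show ?thesis
    unfolding ecocone_def FD FA
  proof (intro conjI allI impI)
    show "leg F \<gamma> \<in> hom C (IOb D) (IAr A)"
      by (rule leg_typ[OF g(1)])
    fix x assume x: "x \<in> Arr C \<and> Cod C x = IOb D"
    then have "Dom C x \<in> Obj C" by simp
    with x show "ISrc A \<cdot> (leg F \<gamma> \<cdot> x) = FOb F \<cdot> x" "ITgt A \<cdot> (leg F \<gamma> \<cdot> x) = FOb V \<cdot> bang (Dom C x)"
      by (simp_all add: leg_el[OF g(1)] ev_src_tgt gt \<delta>(4) pt(4))
  next
    fix d assume d: "d \<in> Arr C \<and> Cod C d = IAr D"
    obtain W where W: "Dom C d = W" "W \<in> Obj C"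
      using d by auto
    let ?g = "NMap \<gamma> \<cdot> bang W"
    have e: "icomp C A (ev\<^sub>1 \<cdot> pair C ?g (IIde D \<cdot> (ISrc D \<cdot> d))) (ev\<^sub>1 \<cdot> pair C (IIde X \<cdot> (ITgt X \<cdot> ?g)) d) =
      icomp C A (ev\<^sub>1 \<cdot> pair C (IIde X \<cdot> (ISrc X \<cdot> ?g)) d) (ev\<^sub>1 \<cdot> pair C ?g (IIde D \<cdot> (ITgt D \<cdot> d)))"
      using d W by (simp add: ev_comp[symmetric])
    have s: "ISrc A \<cdot> (ev\<^sub>1 \<cdot> pair C ?g (IIde D \<cdot> x)) = FOb F \<cdot> x" "ITgt A \<cdot> (ev\<^sub>1 \<cdot> pair C ?g (IIde D \<cdot> x)) = FOb V \<cdot> bang W"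
      if "x \<in> Arr C" "Cod C x = IOb D" "Dom C x = W" for x
      using that W by (simp_all add: ev_src_tgt gt \<delta>(4) pt(4))
    show "icomp C A (FAr F \<cdot> d) (leg F \<gamma> \<cdot> (ITgt D \<cdot> d)) = leg F \<gamma> \<cdot> (ISrc D \<cdot> d)"
      using e d W s by (simp add: leg_el[OF g(1)] gt ev_ide_diag ev_ide_point)
  qed simp_all
qed

lemma cocone_of_econe:
  assumes e: "ecocone F v \<kappa>"
  shows "\<exists>V \<gamma>. is_cocone C F (V, \<gamma>) \<and> FOb V = v \<and> leg F \<gamma> = \<kappa>"
proof -
  have v: "v \<in> hom C (One C) (IOb A)" and l: "\<kappa> \<in> hom C (IOb D) (IAr A)"
    and st: "\<And>x. x \<in> Arr C \<Longrightarrow> Cod C x = IOb D \<Longrightarrow> ISrc A \<cdot> (\<kappa> \<cdot> x) = FOb F \<cdot> x"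
      "\<And>x. x \<in> Arr C \<Longrightarrow> Cod C x = IOb D \<Longrightarrow> ITgt A \<cdot> (\<kappa> \<cdot> x) = v \<cdot> bang (Dom C x)"
    and nat: "\<And>d. d \<in> Arr C \<Longrightarrow> Cod C d = IAr D \<Longrightarrow> icomp C A (FAr F \<cdot> d) (\<kappa> \<cdot> (ITgt D \<cdot> d)) = \<kappa> \<cdot> (ISrc D \<cdot> d)"
    using e unfolding ecocone_def FD FA by blast+
  obtain V where V: "is_ifun C V" "FDom V = icat_one C" "FCod V = A" "FOb V = v"
    using vertex_ex[OF v] by blast
  note [simp] = typs v[simplified] l[simplified]
  have "natel D A ev\<^sub>0 (ev\<^sub>1 \<cdot> prod_map C (IIde X) (Ide C (IAr D))) (One C) (FOb pt) (FOb \<delta> \<cdot> v)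
    (\<kappa> \<cdot> Pr2 C (One C) (IOb D))"
    unfolding natel_def
  proof (intro conjI allI impI)
    fix t x assume tx: "el2 t x (One C) (IOb D)"
    have t: "t = bang (Dom C x)"
      using tx by (intro to_One) simp_all
    have W: "Dom C x \<in> Obj C"
      using tx by simp
    show "ISrc A \<cdot> ((\<kappa> \<cdot> Pr2 C (One C) (IOb D)) \<cdot> pair C t x) = ev\<^sub>0 \<cdot> pair C ((FOb pt) \<cdot> t) x"
      "ITgt A \<cdot> ((\<kappa> \<cdot> Pr2 C (One C) (IOb D)) \<cdot> pair C t x) = ev\<^sub>0 \<cdot> pair C ((FOb \<delta> \<cdot> v) \<cdot> t) x"
      unfolding t using tx W by (simp_all add: st \<delta>(4) pt(4))
  next
    fix t d assume td: "el2 t d (One C) (IAr D)"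
    have t: "t = bang (Dom C d)"
      using td by (intro to_One) simp_all
    have W: "Dom C d \<in> Obj C"
      using td by simp
    show "icomp C A ((ev\<^sub>1 \<cdot> prod_map C (IIde X) (Ide C (IAr D))) \<cdot> pair C ((FOb pt) \<cdot> t) d)
        ((\<kappa> \<cdot> Pr2 C (One C) (IOb D)) \<cdot> pair C t (ITgt D \<cdot> d)) =
      icomp C A ((\<kappa> \<cdot> Pr2 C (One C) (IOb D)) \<cdot> pair C t (ISrc D \<cdot> d))
        ((ev\<^sub>1 \<cdot> prod_map C (IIde X) (Ide C (IAr D))) \<cdot> pair C ((FOb \<delta> \<cdot> v) \<cdot> t) d)"
      unfolding t using td W nat[of d] by (simp add: st ev_ide_diag ev_ide_point)
  qed simp_all
  then have "\<exists>w\<in>hom C (One C) (IAr X). ISrc X \<cdot> w = FOb pt \<and> ITgt X \<cdot> w = FOb \<delta> \<cdot> v \<and>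
    (\<forall>t x. el2 t x (One C) (IOb D) \<longrightarrow> ev\<^sub>1 \<cdot> pair C (w \<cdot> t) (IIde D \<cdot> x) = (\<kappa> \<cdot> Pr2 C (One C) (IOb D)) \<cdot> pair C t x)"
    by (intro is_exp_catD(5)[OF E]) simp_all
  then obtain w where w: "w \<in> hom C (One C) (IAr X)" "ISrc X \<cdot> w = FOb pt" "ITgt X \<cdot> w = FOb \<delta> \<cdot> v"
    and w_el: "\<And>t x. el2 t x (One C) (IOb D) \<Longrightarrow>
      ev\<^sub>1 \<cdot> pair C (w \<cdot> t) (IIde D \<cdot> x) = (\<kappa> \<cdot> Pr2 C (One C) (IOb D)) \<cdot> pair C t x"
    by blast
  let ?g = "\<lparr>NDom = pt, NCod = ifun_comp C \<delta> V, NMap = w\<rparr>"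
  have "is_cocone C F (V, ?g)"
    using V w by (simp add: is_cocone_iff)
  moreover have "leg F ?g = \<kappa>"
    using w_el[of "bang (IOb D)" "Ide C (IOb D)"] w(1) by (simp add: leg_def FD FA)
  ultimately show ?thesis
    using V(4) by blast
qed

text \<open>The equation between transformations may be checked on components
  (\<open>arrow_X_ext\<close>). Whiskering with the diagonal turns \<open>h\<close> into the
  transformation whose components are all equal to \<open>NMap h\<close>, which explains the arrow
  to the terminal object in the result.\<close>

private lemma cone_map_iff:
  assumes c: "is_cone C F (V, \<gamma>)" and c': "is_cone C F (V', \<gamma>')"
  shows "cone_map C F (V', \<gamma>') h (V, \<gamma>) \<longleftrightarrow> NDom h = V' \<and> NCod h = V \<and> NMap h \<in> hom C (One C) (IAr A) \<and>
    ISrc A \<cdot> NMap h = FOb V' \<and> ITgt A \<cdot> NMap h = FOb V \<and> icomp C A (NMap h \<cdot> bang (IOb D)) (leg F \<gamma>) = leg F \<gamma>'"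
proof (cases "NDom h = V' \<and> NCod h = V \<and> NMap h \<in> hom C (One C) (IAr A) \<and> ISrc A \<cdot> NMap h = FOb V' \<and> ITgt A \<cdot> NMap h = FOb V")
  case True
  then have h: "NDom h = V'" "NCod h = V" "NMap h \<in> hom C (One C) (IAr A)" "ISrc A \<cdot> NMap h = FOb V'" "ITgt A \<cdot> NMap h = FOb V"
    by simp_all
  have V: "is_ifun C V" "FDom V = icat_one C" "FCod V = A" and nd: "NDom \<gamma> = ifun_comp C \<delta> V" "NCod \<gamma> = pt"
    and g: "NMap \<gamma> \<in> hom C (One C) (IAr X)" "ISrc X \<cdot> NMap \<gamma> = FOb \<delta> \<cdot> FOb V" "ITgt X \<cdot> NMap \<gamma> = FOb pt"
    using c by (simp_all add: is_cone_iff)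
  have V': "is_ifun C V'" "FDom V' = icat_one C" "FCod V' = A" and nd': "NDom \<gamma>' = ifun_comp C \<delta> V'" "NCod \<gamma>' = pt"
    and g': "NMap \<gamma>' \<in> hom C (One C) (IAr X)" "ISrc X \<cdot> NMap \<gamma>' = FOb \<delta> \<cdot> FOb V'" "ITgt X \<cdot> NMap \<gamma>' = FOb pt"
    using c' by (simp_all add: is_cone_iff)
  note [simp] = typs vertex(1-3)[OF V] vertex(1-3)[OF V'] g(1)[simplified] g'(1)[simplified] h(3)[simplified]
  have hi: "is_inat C h"
    using inat_point_iff[of h A] V V' h by simp
  let ?w = "icomp C X (FAr \<delta> \<cdot> NMap h) (NMap \<gamma>)"
  have w: "?w \<in> hom C (One C) (IAr X)" "ISrc X \<cdot> ?w = ISrc X \<cdot> NMap \<gamma>'" "ITgt X \<cdot> ?w = ITgt X \<cdot> NMap \<gamma>'"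
    using h g g' by (simp_all add: \<delta>f(7,8))
  have "inat_comp C \<gamma> (whisker_left C \<delta> h) = \<gamma>' \<longleftrightarrow> ?w = NMap \<gamma>'"
    using nd nd' h \<delta>(3) pt(3) by (cases \<gamma>'; cases \<gamma>) (auto simp: inat_comp_def whisker_left_def)
  also have "\<dots> \<longleftrightarrow> ev\<^sub>1 \<cdot> pair C (?w \<cdot> bang (IOb D)) (IIde D) = ev\<^sub>1 \<cdot> pair C (NMap \<gamma>' \<cdot> bang (IOb D)) (IIde D)"
    using arrow_X_ext[OF w(1) g'(1) w(2,3)] by auto
  also have "ev\<^sub>1 \<cdot> pair C (?w \<cdot> bang (IOb D)) (IIde D) = icomp C A (NMap h \<cdot> bang (IOb D)) (leg F \<gamma>)"
  proof -
    let ?b = "bang (IOb D)"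
    have hb: "ITgt A \<cdot> (NMap h \<cdot> ?b) = FOb V \<cdot> ?b" "ISrc X \<cdot> (NMap \<gamma> \<cdot> ?b) = FOb \<delta> \<cdot> (FOb V \<cdot> ?b)"
      using comp_eq_comp[OF h(5), of ?b] comp_eq_comp[OF g(2), of ?b] by simp_all
    have "ev\<^sub>1 \<cdot> pair C (icomp C X (FAr \<delta> \<cdot> (NMap h \<cdot> ?b)) (NMap \<gamma> \<cdot> ?b))
        (icomp C D (IIde D) (IIde D)) =
      icomp C A (ev\<^sub>1 \<cdot> pair C (FAr \<delta> \<cdot> (NMap h \<cdot> ?b)) (IIde D)) (ev\<^sub>1 \<cdot> pair C (NMap \<gamma> \<cdot> ?b) (IIde D))"
      by (rule ev_comp) (simp_all add: \<delta>f(8) hb)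
    moreover have "icomp C D (IIde D) (IIde D) = IIde D"
      using icomp_Ide(1)[OF D, of "IIde D" "Ide C (IOb D)"] by simp
    moreover have "?w \<cdot> ?b = icomp C X (FAr \<delta> \<cdot> (NMap h \<cdot> ?b)) (NMap \<gamma> \<cdot> ?b)"
      using h g by (simp add: \<delta>f(8))
    ultimately show ?thesis
      by (simp add: \<delta>(5) leg_def FD FA)
  qed
  finally show ?thesis
    using h hi by (simp add: cone_map_def FD FA leg_def)
next
  case False
  moreover have "\<not> cone_map C F (V', \<gamma>') h (V, \<gamma>)"
  proof
    assume m: "cone_map C F (V', \<gamma>') h (V, \<gamma>)"
    then have h: "is_inat C h" "NDom h = V'" "NCod h = V"
      by (simp_all add: cone_map_def)
    have "is_ifun C V" "FDom V = icat_one C" "FCod V = A" "is_ifun C V'" "FDom V' = icat_one C" "FCod V' = A"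
      using c c' by (simp_all add: is_cone_iff)
    then show False
      using False h inat_point_iff[of h A] by simp
  qed
  ultimately show ?thesis
    by blast
qed

text \<open>Every \<open>econe\<close> arises from a cone, so it is enough to let \<open>v\<close>
  and \<open>\<mu>\<close> vary; and a morphism of cones with given ends is determined by its
  \<open>NMap\<close>.\<close>

lemma terminal_cone_iff:
  assumes c: "is_cone C F (V, \<gamma>)"
  shows "is_terminal (Cones C F) (V, \<gamma>) \<longleftrightarrow> (\<forall>v \<mu>. econe F v \<mu> \<longrightarrow>
    (\<exists>!h. h \<in> hom C (One C) (IAr A) \<and> ISrc A \<cdot> h = v \<and> ITgt A \<cdot> h = FOb V \<and>
      icomp C A (h \<cdot> bang (IOb D)) (leg F \<gamma>) = \<mu>))"
proof -
  have hom_Cones: "f \<in> hom (Cones C F) c' (V, \<gamma>) \<longleftrightarrow> (\<exists>h. f = (c', h, (V, \<gamma>)) \<and> cone_map C F c' h (V, \<gamma>))"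
    if "is_cone C F c'" for f c'
    using that c by (auto simp: hom_def Cones_def)
  have ex1: "(\<exists>!f. f \<in> hom (Cones C F) (V', \<gamma>') (V, \<gamma>)) \<longleftrightarrow>
    (\<exists>!h. h \<in> hom C (One C) (IAr A) \<and> ISrc A \<cdot> h = FOb V' \<and> ITgt A \<cdot> h = FOb V \<and>
      icomp C A (h \<cdot> bang (IOb D)) (leg F \<gamma>) = leg F \<gamma>')" (is "_ \<longleftrightarrow> (\<exists>!h. ?P h)")
    if c': "is_cone C F (V', \<gamma>')" for V' \<gamma>'
  proof -
    have m: "cone_map C F (V', \<gamma>') h (V, \<gamma>) \<longleftrightarrow> (\<exists>k. h = \<lparr>NDom = V', NCod = V, NMap = k\<rparr> \<and> ?P k)" for h
      unfolding cone_map_iff[OF c c'] by (cases h) auto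
    show ?thesis
      by (rule ex1_image_iff[where g = "\<lambda>k. ((V', \<gamma>'), \<lparr>NDom = V', NCod = V, NMap = k\<rparr>, (V, \<gamma>))"])
        (simp, unfold hom_Cones[OF c'] m, blast)
  qed
  have cones: "is_terminal (Cones C F) (V, \<gamma>) \<longleftrightarrow>
    (\<forall>V' \<gamma>'. is_cone C F (V', \<gamma>') \<longrightarrow> (\<exists>!f. f \<in> hom (Cones C F) (V', \<gamma>') (V, \<gamma>)))"
    using c by (simp add: is_terminal_def Cones_def)
  show ?thesis
    unfolding cones
  proof (intro iffI allI impI)
    fix v \<mu> assume a: "\<forall>V' \<gamma>'. is_cone C F (V', \<gamma>') \<longrightarrow> (\<exists>!f. f \<in> hom (Cones C F) (V', \<gamma>') (V, \<gamma>))" and "econe F v \<mu>"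
    then obtain V' \<gamma>' where c': "is_cone C F (V', \<gamma>')" and e: "FOb V' = v" "leg F \<gamma>' = \<mu>"
      using cone_of_econe by blast
    show "\<exists>!h. h \<in> hom C (One C) (IAr A) \<and> ISrc A \<cdot> h = v \<and> ITgt A \<cdot> h = FOb V \<and>
      icomp C A (h \<cdot> bang (IOb D)) (leg F \<gamma>) = \<mu>"
      using a c' ex1[OF c'] unfolding e by blast
  next
    fix V' \<gamma>' assume a: "\<forall>v \<mu>. econe F v \<mu> \<longrightarrow>
      (\<exists>!h. h \<in> hom C (One C) (IAr A) \<and> ISrc A \<cdot> h = v \<and> ITgt A \<cdot> h = FOb V \<and> icomp C A (h \<cdot> bang (IOb D)) (leg F \<gamma>) = \<mu>)"
      and c': "is_cone C F (V', \<gamma>')"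
    show "\<exists>!f. f \<in> hom (Cones C F) (V', \<gamma>') (V, \<gamma>)"
      unfolding ex1[OF c'] using a econe_of_cone[OF c'] by blast
  qed
qed

private lemma cocone_map_iff:
  assumes c: "is_cocone C F (V, \<gamma>)" and c': "is_cocone C F (V', \<gamma>')"
  shows "cocone_map C F (V, \<gamma>) h (V', \<gamma>') \<longleftrightarrow> NDom h = V \<and> NCod h = V' \<and> NMap h \<in> hom C (One C) (IAr A) \<and>
    ISrc A \<cdot> NMap h = FOb V \<and> ITgt A \<cdot> NMap h = FOb V' \<and> icomp C A (leg F \<gamma>) (NMap h \<cdot> bang (IOb D)) = leg F \<gamma>'"
proof (cases "NDom h = V \<and> NCod h = V' \<and> NMap h \<in> hom C (One C) (IAr A) \<and> ISrc A \<cdot> NMap h = FOb V \<and> ITgt A \<cdot> NMap h = FOb V'")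
  case True
  then have h: "NDom h = V" "NCod h = V'" "NMap h \<in> hom C (One C) (IAr A)" "ISrc A \<cdot> NMap h = FOb V" "ITgt A \<cdot> NMap h = FOb V'"
    by simp_all
  have V: "is_ifun C V" "FDom V = icat_one C" "FCod V = A" and nd: "NDom \<gamma> = pt" "NCod \<gamma> = ifun_comp C \<delta> V"
    and g: "NMap \<gamma> \<in> hom C (One C) (IAr X)" "ISrc X \<cdot> NMap \<gamma> = FOb pt" "ITgt X \<cdot> NMap \<gamma> = FOb \<delta> \<cdot> FOb V"
    using c by (simp_all add: is_cocone_iff)
  have V': "is_ifun C V'" "FDom V' = icat_one C" "FCod V' = A" and nd': "NDom \<gamma>' = pt" "NCod \<gamma>' = ifun_comp C \<delta> V'"
    and g': "NMap \<gamma>' \<in> hom C (One C) (IAr X)" "ISrc X \<cdot> NMap \<gamma>' = FOb pt" "ITgt X \<cdot> NMap \<gamma>' = FOb \<delta> \<cdot> FOb V'"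
    using c' by (simp_all add: is_cocone_iff)
  note [simp] = typs vertex(1-3)[OF V] vertex(1-3)[OF V'] g(1)[simplified] g'(1)[simplified] h(3)[simplified]
  have hi: "is_inat C h"
    using inat_point_iff[of h A] V V' h by simp
  let ?w = "icomp C X (NMap \<gamma>) (FAr \<delta> \<cdot> NMap h)"
  have w: "?w \<in> hom C (One C) (IAr X)" "ISrc X \<cdot> ?w = ISrc X \<cdot> NMap \<gamma>'" "ITgt X \<cdot> ?w = ITgt X \<cdot> NMap \<gamma>'"
    using h g g' by (simp_all add: \<delta>f(7,8))
  have "inat_comp C (whisker_left C \<delta> h) \<gamma> = \<gamma>' \<longleftrightarrow> ?w = NMap \<gamma>'"
    using nd nd' h \<delta>(3) pt(3) by (cases \<gamma>'; cases \<gamma>) (auto simp: inat_comp_def whisker_left_def)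
  also have "\<dots> \<longleftrightarrow> ev\<^sub>1 \<cdot> pair C (?w \<cdot> bang (IOb D)) (IIde D) = ev\<^sub>1 \<cdot> pair C (NMap \<gamma>' \<cdot> bang (IOb D)) (IIde D)"
    using arrow_X_ext[OF w(1) g'(1) w(2,3)] by auto
  also have "ev\<^sub>1 \<cdot> pair C (?w \<cdot> bang (IOb D)) (IIde D) = icomp C A (leg F \<gamma>) (NMap h \<cdot> bang (IOb D))"
  proof -
    let ?b = "bang (IOb D)"
    have hb: "ISrc A \<cdot> (NMap h \<cdot> ?b) = FOb V \<cdot> ?b" "ITgt X \<cdot> (NMap \<gamma> \<cdot> ?b) = FOb \<delta> \<cdot> (FOb V \<cdot> ?b)"
      using comp_eq_comp[OF h(4), of ?b] comp_eq_comp[OF g(3), of ?b] by simp_all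
    have "ev\<^sub>1 \<cdot> pair C (icomp C X (NMap \<gamma> \<cdot> ?b) (FAr \<delta> \<cdot> (NMap h \<cdot> ?b)))
        (icomp C D (IIde D) (IIde D)) =
      icomp C A (ev\<^sub>1 \<cdot> pair C (NMap \<gamma> \<cdot> ?b) (IIde D)) (ev\<^sub>1 \<cdot> pair C (FAr \<delta> \<cdot> (NMap h \<cdot> ?b)) (IIde D))"
      by (rule ev_comp) (simp_all add: \<delta>f(7) hb)
    moreover have "icomp C D (IIde D) (IIde D) = IIde D"
      using icomp_Ide(1)[OF D, of "IIde D" "Ide C (IOb D)"] by simp
    moreover have "?w \<cdot> ?b = icomp C X (NMap \<gamma> \<cdot> ?b) (FAr \<delta> \<cdot> (NMap h \<cdot> ?b))"
      using h g by (simp add: \<delta>f(7))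
    ultimately show ?thesis
      by (simp add: \<delta>(5) leg_def FD FA)
  qed
  finally show ?thesis
    using h hi by (simp add: cocone_map_def FD FA leg_def)
next
  case False
  moreover have "\<not> cocone_map C F (V, \<gamma>) h (V', \<gamma>')"
  proof
    assume m: "cocone_map C F (V, \<gamma>) h (V', \<gamma>')"
    then have h: "is_inat C h" "NDom h = V" "NCod h = V'"
      by (simp_all add: cocone_map_def)
    have "is_ifun C V" "FDom V = icat_one C" "FCod V = A" "is_ifun C V'" "FDom V' = icat_one C" "FCod V' = A"
      using c c' by (simp_all add: is_cocone_iff)
    then show False
      using False h inat_point_iff[of h A] by simp
  qed
  ultimately show ?thesis
    by blast
qed

lemma initial_cocone_iff:
  assumes c: "is_cocone C F (V, \<gamma>)"
  shows "is_initial (Cocones C F) (V, \<gamma>) \<longleftrightarrow> (\<forall>v \<mu>. ecocone F v \<mu> \<longrightarrow>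
    (\<exists>!h. h \<in> hom C (One C) (IAr A) \<and> ISrc A \<cdot> h = FOb V \<and> ITgt A \<cdot> h = v \<and>
      icomp C A (leg F \<gamma>) (h \<cdot> bang (IOb D)) = \<mu>))"
proof -
  have hom_Cocones: "f \<in> hom (Cocones C F) (V, \<gamma>) c' \<longleftrightarrow> (\<exists>h. f = ((V, \<gamma>), h, c') \<and> cocone_map C F (V, \<gamma>) h c')"
    if "is_cocone C F c'" for f c'
    using that c by (auto simp: hom_def Cocones_def)
  have ex1: "(\<exists>!f. f \<in> hom (Cocones C F) (V, \<gamma>) (V', \<gamma>')) \<longleftrightarrow>
    (\<exists>!h. h \<in> hom C (One C) (IAr A) \<and> ISrc A \<cdot> h = FOb V \<and> ITgt A \<cdot> h = FOb V' \<and>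
      icomp C A (leg F \<gamma>) (h \<cdot> bang (IOb D)) = leg F \<gamma>')" (is "_ \<longleftrightarrow> (\<exists>!h. ?P h)")
    if c': "is_cocone C F (V', \<gamma>')" for V' \<gamma>'
  proof -
    have m: "cocone_map C F (V, \<gamma>) h (V', \<gamma>') \<longleftrightarrow> (\<exists>k. h = \<lparr>NDom = V, NCod = V', NMap = k\<rparr> \<and> ?P k)" for h
      unfolding cocone_map_iff[OF c c'] by (cases h) auto
    show ?thesis
      by (rule ex1_image_iff[where g = "\<lambda>k. ((V, \<gamma>), \<lparr>NDom = V, NCod = V', NMap = k\<rparr>, (V', \<gamma>'))"])
        (simp, unfold hom_Cocones[OF c'] m, blast)
  qed
  have cones: "is_initial (Cocones C F) (V, \<gamma>) \<longleftrightarrow>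
    (\<forall>V' \<gamma>'. is_cocone C F (V', \<gamma>') \<longrightarrow> (\<exists>!f. f \<in> hom (Cocones C F) (V, \<gamma>) (V', \<gamma>')))"
    using c by (simp add: is_initial_def Cocones_def)
  show ?thesis
    unfolding cones
  proof (intro iffI allI impI)
    fix v \<mu> assume a: "\<forall>V' \<gamma>'. is_cocone C F (V', \<gamma>') \<longrightarrow> (\<exists>!f. f \<in> hom (Cocones C F) (V, \<gamma>) (V', \<gamma>'))" and "ecocone F v \<mu>"
    then obtain V' \<gamma>' where c': "is_cocone C F (V', \<gamma>')" and e: "FOb V' = v" "leg F \<gamma>' = \<mu>"
      using cocone_of_econe by blast
    show "\<exists>!h. h \<in> hom C (One C) (IAr A) \<and> ISrc A \<cdot> h = FOb V \<and> ITgt A \<cdot> h = v \<and>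
      icomp C A (leg F \<gamma>) (h \<cdot> bang (IOb D)) = \<mu>"
      using a c' ex1[OF c'] unfolding e by blast
  next
    fix V' \<gamma>' assume a: "\<forall>v \<mu>. ecocone F v \<mu> \<longrightarrow>
      (\<exists>!h. h \<in> hom C (One C) (IAr A) \<and> ISrc A \<cdot> h = FOb V \<and> ITgt A \<cdot> h = v \<and> icomp C A (leg F \<gamma>) (h \<cdot> bang (IOb D)) = \<mu>)"
      and c': "is_cocone C F (V', \<gamma>')"
    show "\<exists>!f. f \<in> hom (Cocones C F) (V, \<gamma>) (V', \<gamma>')"
      unfolding ex1[OF c'] using a econe_of_cocone[OF c'] by blast
  qed
qed

end

end

section \<open>Equalizers from finite limits\<close>

lemma has_equalizers_of_finite_limits:
  assumes C: "is_category C" and lim: "has_finite_limits C"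
  shows "has_equalizers C"
  unfolding has_equalizers_def
proof (intro ballI impI)
  fix f g assume f: "f \<in> Arr C" and g: "g \<in> Arr C" and fg: "Dom C f = Dom C g \<and> Cod C f = Cod C g"
  \<comment> \<open>The shape of a parallel pair, coded by numbers: the arrows 0 and 1 are the
    identities of the objects 0 and 1, while 2 and 3 are the two arrows from 0 to 1.
    \<open>Comp\<close> has to be right on composable pairs only.\<close>
  define J :: "(nat, nat) category" where
    "J = \<lparr>Obj = {0, 1}, Arr = {0, 1, 2, 3}, Dom = (\<lambda>a. if a = 1 then 1 else 0), Cod = (\<lambda>a. if a = 0 then 0 else 1),
      Ide = (\<lambda>j. j), Comp = (\<lambda>b a. if b = 0 \<or> b = 1 then a else b)\<rparr>"
  define fo where "fo j = (if j = 0 then Dom C f else Cod C f)" for j :: nat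
  define fa where "fa a = (if a = 0 then Ide C (Dom C f) else if a = 1 then Ide C (Cod C f) else if a = 2 then f else g)"
    for a :: nat
  have objs: "Dom C f \<in> Obj C" "Cod C f \<in> Obj C"
    using C f unfolding is_category_def by blast+
  have ide: "Ide C X \<in> hom C X X" if "X \<in> Obj C" for X
    using C that unfolding is_category_def by blast
  have unit: "a \<cdot>\<^bsub>C\<^esub> Ide C (Dom C a) = a" "Ide C (Cod C a) \<cdot>\<^bsub>C\<^esub> a = a" if "a \<in> Arr C" for a
    using C that unfolding is_category_def by blast+
  have ii: "Ide C X \<cdot>\<^bsub>C\<^esub> Ide C X = Ide C X" if "X \<in> Obj C" for X
    using unit(1)[of "Ide C X"] ide[OF that] by (auto simp: hom_def)
  have "is_category J"
    by (simp add: is_category_def J_def hom_def)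
  moreover have "ext_functor J C fo fa"
    using f g fg objs ide[of "Dom C f"] ide[of "Cod C f"] unit[OF f] unit[OF g] ii[of "Dom C f"] ii[of "Cod C f"]
    by (auto simp: ext_functor_def J_def fo_def fa_def hom_def)
  moreover have "finite (Obj J)" "finite (Arr J)"
    by (simp_all add: J_def)
  ultimately obtain L \<pi> where L: "ext_limit J C fo fa L \<pi>"
    using lim unfolding has_finite_limits_def by blast
  have cone_iff: "ext_cone J C fo fa Z \<zeta> \<longleftrightarrow> Z \<in> Obj C \<and> \<zeta> 0 \<in> hom C Z (Dom C f) \<and> \<zeta> 1 \<in> hom C Z (Cod C f) \<and>
    f \<cdot>\<^bsub>C\<^esub> \<zeta> 0 = \<zeta> 1 \<and> g \<cdot>\<^bsub>C\<^esub> \<zeta> 0 = \<zeta> 1" for Z \<zeta>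
    using unit[of "\<zeta> 0"] unit[of "\<zeta> 1"] by (auto simp: ext_cone_def J_def fo_def fa_def hom_def)
  have c: "L \<in> Obj C" "\<pi> 0 \<in> hom C L (Dom C f)" "f \<cdot>\<^bsub>C\<^esub> \<pi> 0 = g \<cdot>\<^bsub>C\<^esub> \<pi> 0" "f \<cdot>\<^bsub>C\<^esub> \<pi> 0 = \<pi> 1"
    using L cone_iff[of L \<pi>] unfolding ext_limit_def by simp_all
  have un: "\<exists>!w. w \<in> hom C Z L \<and> \<pi> 0 \<cdot>\<^bsub>C\<^esub> w = u"
    if Z: "Z \<in> Obj C" and u: "u \<in> hom C Z (Dom C f)" and e: "f \<cdot>\<^bsub>C\<^esub> u = g \<cdot>\<^bsub>C\<^esub> u" for Z u
  proof -
    let ?z = "\<lambda>j :: nat. if j = 0 then u else f \<cdot>\<^bsub>C\<^esub> u"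
    have "f \<in> hom C (Dom C f) (Cod C f)"
      using f by (simp add: hom_def)
    then have fu: "f \<cdot>\<^bsub>C\<^esub> u \<in> hom C Z (Cod C f)"
      using C objs Z u unfolding is_category_def by blast
    have "ext_cone J C fo fa Z ?z"
      unfolding cone_iff using Z u fu e by simp
    then have ex: "\<exists>!w. w \<in> hom C Z L \<and> (\<forall>j\<in>Obj J. \<pi> j \<cdot>\<^bsub>C\<^esub> w = ?z j)"
      using L unfolding ext_limit_def by blast
    \<comment> \<open>The component of a cone at the object 1 is forced by the one at 0, so the
      limit is determined by \<open>\<pi> 0\<close> alone and is an equaliser.\<close>
    have "(\<forall>j\<in>Obj J. \<pi> j \<cdot>\<^bsub>C\<^esub> w = ?z j) \<longleftrightarrow> \<pi> 0 \<cdot>\<^bsub>C\<^esub> w = u" if w: "w \<in> hom C Z L" for w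
    proof -
      have "f \<cdot>\<^bsub>C\<^esub> (\<pi> 0 \<cdot>\<^bsub>C\<^esub> w) = \<pi> 1 \<cdot>\<^bsub>C\<^esub> w"
      proof -
        have "\<forall>f\<in>Arr C. \<forall>g\<in>Arr C. \<forall>h\<in>Arr C. Cod C f = Dom C g \<and> Cod C g = Dom C h \<longrightarrow>
          h \<cdot>\<^bsub>C\<^esub> (g \<cdot>\<^bsub>C\<^esub> f) = (h \<cdot>\<^bsub>C\<^esub> g) \<cdot>\<^bsub>C\<^esub> f"
          using C unfolding is_category_def by blast
        then show ?thesis
          using w c f by (auto simp: hom_def)
      qed
      then show ?thesis
        by (auto simp: J_def)
    qed
    then show ?thesis
      using ex by (metis (no_types, lifting))
  qed
  show "\<exists>Q e. Q \<in> Obj C \<and> e \<in> hom C Q (Dom C f) \<and> f \<cdot>\<^bsub>C\<^esub> e = g \<cdot>\<^bsub>C\<^esub> e \<and>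
      (\<forall>Z\<in>Obj C. \<forall>u\<in>hom C Z (Dom C f). f \<cdot>\<^bsub>C\<^esub> u = g \<cdot>\<^bsub>C\<^esub> u \<longrightarrow> (\<exists>!w. w \<in> hom C Z Q \<and> e \<cdot>\<^bsub>C\<^esub> w = u))"
    using c un by blast
qed

section \<open>Slices\<close>

lemma slice_simps:
  "Obj (slice E I) = {f \<in> Arr E. Cod E f = I}"
  "Arr (slice E I) = {(f, h, g). f \<in> Arr E \<and> Cod E f = I \<and> g \<in> Arr E \<and> Cod E g = I \<and>
                        h \<in> hom E (Dom E f) (Dom E g) \<and> g \<cdot>\<^bsub>E\<^esub> h = f}"
  "Dom (slice E I) = (\<lambda>(f, h, g). f)" "Cod (slice E I) = (\<lambda>(f, h, g). g)"
  "Ide (slice E I) = (\<lambda>f. (f, Ide E (Dom E f), f))"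
  "Comp (slice E I) = (\<lambda>(f', h', g') (f, h, g). (f, h' \<cdot>\<^bsub>E\<^esub> h, g'))"
  "One (slice E I) = Ide E I"
  "Prod (slice E I) = (\<lambda>f g. fst (slice_product E I f g))"
  "Pr1 (slice E I) = (\<lambda>f g. fst (snd (slice_product E I f g)))"
  "Pr2 (slice E I) = (\<lambda>f g. snd (snd (slice_product E I f g)))"
  by (simp_all add: slice_def slice_base_def category.extend_def)

text \<open>\<open>slice_product\<close> chooses products in \<open>slice_base\<close>, since
  \<open>slice\<close> is only being defined by means of that choice. Being a product depends on the
  fields which the two records share.\<close>

lemma is_product_slice_base: "is_product (slice_base E I) = is_product (slice E I)"
proof -
  have "Obj (slice_base E I) = Obj (slice E I)" "Comp (slice_base E I) = Comp (slice E I)" "hom (slice_base E I) = hom (slice E I)"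
    by (simp_all add: slice_def slice_base_def category.extend_def hom_def fun_eq_iff)
  note eqs = this
  show ?thesis
    by (intro ext) (simp only: is_product_def eqs)
qed

context cart
begin

lemma slice_hom_iff:
  "a \<in> hom (slice C I) z f \<longleftrightarrow> (\<exists>h. a = (z, h, f) \<and> z \<in> Arr C \<and> Cod C z = I \<and> f \<in> Arr C \<and> Cod C f = I \<and>
    h \<in> Arr C \<and> Dom C h = Dom C z \<and> Cod C h = Dom C f \<and> f \<cdot> h = z)"
  by (auto simp: hom_def[of "slice C I"] slice_simps)

lemma slice_Arr_iff:
  "a \<in> Arr (slice C I) \<longleftrightarrow> (\<exists>f h g. a = (f, h, g) \<and> f \<in> Arr C \<and> Cod C f = I \<and> g \<in> Arr C \<and> Cod C g = I \<and>
    h \<in> Arr C \<and> Dom C h = Dom C f \<and> Cod C h = Dom C g \<and> g \<cdot> h = f)"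
  by (auto simp: slice_simps)

lemma is_category_slice:
  assumes I: "I \<in> Obj C"
  shows "is_category (slice C I)"
  unfolding is_category_def
proof (intro conjI ballI impI)
  fix a assume "a \<in> Arr (slice C I)"
  then obtain f h g where a: "a = (f, h, g)" "f \<in> Arr C" "Cod C f = I" "g \<in> Arr C" "Cod C g = I" "h \<in> Arr C"
    "Dom C h = Dom C f" "Cod C h = Dom C g"
    unfolding slice_Arr_iff by blast
  then show "Dom (slice C I) a \<in> Obj (slice C I)" "Cod (slice C I) a \<in> Obj (slice C I)"
    "Comp (slice C I) a (Ide (slice C I) (Dom (slice C I) a)) = a"
    "Comp (slice C I) (Ide (slice C I) (Cod (slice C I) a)) a = a"
    by (simp_all add: slice_simps)
next
  fix X assume "X \<in> Obj (slice C I)"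
  then show "Ide (slice C I) X \<in> hom (slice C I) X X"
    by (simp add: slice_hom_iff slice_simps)
next
  fix X Y Z a b assume "a \<in> hom (slice C I) X Y" "b \<in> hom (slice C I) Y Z"
  then obtain h k where a: "a = (X, h, Y)" "X \<in> Arr C" "Cod C X = I" "h \<in> Arr C" "Dom C h = Dom C X" "Cod C h = Dom C Y" "Y \<cdot> h = X"
    and b: "b = (Y, k, Z)" "Y \<in> Arr C" "Cod C Y = I" "Z \<in> Arr C" "Cod C Z = I" "k \<in> Arr C" "Dom C k = Dom C Y" "Cod C k = Dom C Z" "Z \<cdot> k = Y"
    unfolding slice_hom_iff by blast
  have "Z \<cdot> (k \<cdot> h) = X"
    using comp_eq_comp[OF b(9), of h] a(4-7) b(2-8) by simp
  then show "Comp (slice C I) b a \<in> hom (slice C I) X Z"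
    using a(2-6) b(2-8) by (simp add: slice_hom_iff slice_simps a(1) b(1))
next
  fix a b c assume "a \<in> Arr (slice C I)" "b \<in> Arr (slice C I)" "c \<in> Arr (slice C I)"
    and e: "Cod (slice C I) a = Dom (slice C I) b \<and> Cod (slice C I) b = Dom (slice C I) c"
  then obtain f h g f' h' g' f'' h'' g'' where a: "a = (f, h, g)" "h \<in> Arr C" "Dom C h = Dom C f" "Cod C h = Dom C g"
    and b: "b = (f', h', g')" "h' \<in> Arr C" "Dom C h' = Dom C f'" "Cod C h' = Dom C g'"
    and c: "c = (f'', h'', g'')" "h'' \<in> Arr C" "Dom C h'' = Dom C f''" "Cod C h'' = Dom C g''"
    unfolding slice_Arr_iff by blast
  then show "Comp (slice C I) c (Comp (slice C I) b a) = Comp (slice C I) (Comp (slice C I) c b) a"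
    using e by (simp add: slice_simps)
qed

lemma is_terminal_slice:
  assumes "I \<in> Obj C"
  shows "is_terminal (slice C I) (Ide C I)"
proof -
  have "\<exists>!f. f \<in> hom (slice C I) X (Ide C I)" if "X \<in> Arr C" "Cod C X = I" for X
    by (rule ex1I[of _ "(X, X, Ide C I)"]) (use that assms in \<open>auto simp: slice_hom_iff\<close>)
  then show ?thesis
    using assms by (simp add: is_terminal_def slice_simps)
qed

text \<open>A pair of arrows over \<open>I\<close> from \<open>z\<close> to \<open>f\<close> and to
  \<open>g\<close> consists of \<open>h\<close> and \<open>k\<close> with
  \<open>f \<cdot> h = z\<close> and \<open>g \<cdot> k = z\<close>, so it is a competitor for the
  pullback whose common composite is recorded as \<open>z\<close>.\<close>

lemma is_product_slice:
  assumes pb: "is_pullback C f g P p q" and f: "f \<in> Arr C" "Cod C f = I" and g: "g \<in> Arr C" "Cod C g = I"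
  shows "is_product (slice C I) f g (f \<cdot> p) (f \<cdot> p, p, f) (f \<cdot> p, q, g)"
proof -
  note s = pullback_simps[OF pb]
  note [simp] = f g s(1) s(2,3)[simplified]
  have gq: "g \<cdot> q = f \<cdot> p"
    using s(4) by simp
  have "\<exists>!u. u \<in> hom (slice C I) z (f \<cdot> p) \<and> Comp (slice C I) (f \<cdot> p, p, f) u = a \<and> Comp (slice C I) (f \<cdot> p, q, g) u = b"
    if a: "a \<in> hom (slice C I) z f" and b: "b \<in> hom (slice C I) z g" for z a b
  proof -
    obtain h where h: "a = (z, h, f)" "z \<in> Arr C" "Cod C z = I" "h \<in> Arr C" "Dom C h = Dom C z" "Cod C h = Dom C f" "f \<cdot> h = z"
      using a unfolding slice_hom_iff by blast
    obtain k where k: "b = (z, k, g)" "k \<in> Arr C" "Dom C k = Dom C z" "Cod C k = Dom C g" "g \<cdot> k = z"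
      using b unfolding slice_hom_iff by blast
    have ex1: "\<exists>!u. u \<in> hom C (Dom C h) P \<and> p \<cdot> u = h \<and> q \<cdot> u = k"
      using h k by (intro pullback_unique[OF pb]) simp_all
    have "v \<in> hom (slice C I) z (f \<cdot> p) \<and> Comp (slice C I) (f \<cdot> p, p, f) v = a \<and> Comp (slice C I) (f \<cdot> p, q, g) v = b \<longleftrightarrow>
      (\<exists>u. v = (z, u, f \<cdot> p) \<and> u \<in> hom C (Dom C h) P \<and> p \<cdot> u = h \<and> q \<cdot> u = k)" (is "?L \<longleftrightarrow> ?R") for v
    proof
      assume L: ?L
      then obtain u where u: "v = (z, u, f \<cdot> p)" "u \<in> Arr C" "Dom C u = Dom C z" "Cod C u = Dom C (f \<cdot> p)"
        unfolding slice_hom_iff by blast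
      with L show ?R
        unfolding u(1) using h(5) by (simp add: slice_simps h(1) k(1))
    next
      assume ?R
      then obtain u where u: "v = (z, u, f \<cdot> p)" "u \<in> hom C (Dom C h) P" "p \<cdot> u = h" "q \<cdot> u = k"
        by blast
      have "(f \<cdot> p) \<cdot> u = z"
        using u(2,3) h(7) by simp
      then show ?L
        unfolding u(1) using u(2-4) h(2-5) by (simp add: slice_hom_iff slice_simps h(1) k(1))
    qed
    then show ?thesis
      using ex1 by (intro iffD2[OF ex1_image_iff[where g = "\<lambda>u. (z, u, f \<cdot> p)"]]) blast+
  qed
  moreover have "(f \<cdot> p, p, f) \<in> hom (slice C I) (f \<cdot> p) f" "(f \<cdot> p, q, g) \<in> hom (slice C I) (f \<cdot> p) g" "f \<cdot> p \<in> Obj (slice C I)"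
    using gq by (auto simp: slice_hom_iff slice_simps)
  ultimately show ?thesis
    unfolding is_product_def by blast
qed

end

context flc
begin

lemma cartesian_slice:
  assumes I: "I \<in> Obj C"
  shows "cartesian (slice C I)"
proof -
  have "is_product (slice C I) f g (Prod (slice C I) f g) (Pr1 (slice C I) f g) (Pr2 (slice C I) f g)"
    if f: "f \<in> Arr C" "Cod C f = I" and g: "g \<in> Arr C" "Cod C g = I" for f g
  proof -
    obtain P p q where "is_pullback C f g P p q"
      using pullback_ex[of f "Dom C f" I g "Dom C g"] f g by auto
    note pr = is_product_slice[OF this f g]
    have "(\<lambda>(P, p, q). is_product (slice C I) f g P p q) (SOME (P, p, q). is_product (slice C I) f g P p q)"
      by (rule someI[of "\<lambda>(P, p, q). is_product (slice C I) f g P p q" "(_, _, _)"]) (use pr in simp)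
    then show ?thesis
      by (simp add: slice_simps slice_product_def is_product_slice_base split_beta)
  qed
  then show ?thesis
    using is_category_slice[OF I] is_terminal_slice[OF I] unfolding cartesian_def by (simp add: slice_simps(1,7))
qed

text \<open>The equaliser is the one of the underlying arrows, regarded as an object over
  \<open>I\<close> by composing with \<open>f\<close>; arrows over \<open>I\<close> that factor
  through it do so over \<open>I\<close>.\<close>

lemma has_equalizers_slice:
  assumes I: "I \<in> Obj C"
  shows "has_equalizers (slice C I)"
  unfolding has_equalizers_def
proof (intro ballI impI)
  fix a b assume "a \<in> Arr (slice C I)" "b \<in> Arr (slice C I)"
    "Dom (slice C I) a = Dom (slice C I) b \<and> Cod (slice C I) a = Cod (slice C I) b"
  then obtain f h g k where a: "a = (f, h, g)" and b: "b = (f, k, g)" and f: "f \<in> Arr C" "Cod C f = I" and g: "g \<in> Arr C" "Cod C g = I"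
    and h: "h \<in> hom C (Dom C f) (Dom C g)" "g \<cdot> h = f" and k: "k \<in> hom C (Dom C f) (Dom C g)" "g \<cdot> k = f"
    by (auto simp: slice_simps)
  have hk: "Dom C h = Dom C k \<and> Cod C h = Cod C k" "h \<in> Arr C" "k \<in> Arr C" and dh: "Dom C h = Dom C f"
    using h k by simp_all
  from equalizers[unfolded has_equalizers_def, rule_format, OF hk(2,3,1), unfolded dh]
  obtain Q e where Q: "Q \<in> Obj C" "e \<in> hom C Q (Dom C f)" "h \<cdot> e = k \<cdot> e"
    and un: "\<And>Z u. Z \<in> Obj C \<Longrightarrow> u \<in> hom C Z (Dom C f) \<Longrightarrow> h \<cdot> u = k \<cdot> u \<Longrightarrow> \<exists>!w. w \<in> hom C Z Q \<and> e \<cdot> w = u"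
    by blast
  note [simp] = f g Q(1) Q(2)[simplified] h(1)[simplified] k(1)[simplified]
  have he: "(f \<cdot> e, e, f) \<in> hom (slice C I) (f \<cdot> e) f" "f \<cdot> e \<in> Obj (slice C I)"
    by (simp_all add: slice_hom_iff slice_simps)
  have "\<exists>!w. w \<in> hom (slice C I) z (f \<cdot> e) \<and> Comp (slice C I) (f \<cdot> e, e, f) w = u"
    if u: "u \<in> hom (slice C I) z f" and e: "Comp (slice C I) a u = Comp (slice C I) b u" for z u
  proof -
    obtain x where x: "u = (z, x, f)" "z \<in> Arr C" "Cod C z = I" "x \<in> Arr C" "Dom C x = Dom C z" "Cod C x = Dom C f" "f \<cdot> x = z"
      using u unfolding slice_hom_iff by blast
    have "h \<cdot> x = k \<cdot> x"
      using e by (simp add: a b x(1) slice_simps)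
    then have ex1: "\<exists>!w. w \<in> hom C (Dom C z) Q \<and> e \<cdot> w = x"
      using x by (intro un) simp_all
    have "v \<in> hom (slice C I) z (f \<cdot> e) \<and> Comp (slice C I) (f \<cdot> e, e, f) v = u \<longleftrightarrow>
      (\<exists>w. v = (z, w, f \<cdot> e) \<and> w \<in> hom C (Dom C z) Q \<and> e \<cdot> w = x)" (is "?L \<longleftrightarrow> ?R") for v
    proof
      assume L: ?L
      then obtain w where w: "v = (z, w, f \<cdot> e)" "w \<in> Arr C" "Dom C w = Dom C z" "Cod C w = Dom C (f \<cdot> e)"
        unfolding slice_hom_iff by blast
      with L show ?R
        unfolding w(1) by (simp add: slice_simps x(1))
    next
      assume ?R
      then obtain w where w: "v = (z, w, f \<cdot> e)" "w \<in> hom C (Dom C z) Q" "e \<cdot> w = x"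
        by blast
      have "(f \<cdot> e) \<cdot> w = z"
        using w(2,3) x(7) by simp
      then show ?L
        unfolding w(1) using w(2,3) x(2-5) by (simp add: slice_hom_iff slice_simps x(1))
    qed
    then show ?thesis
      using ex1 by (intro iffD2[OF ex1_image_iff[where g = "\<lambda>w. (z, w, f \<cdot> e)"]]) blast+
  qed
  moreover have "Dom (slice C I) a = f" "Comp (slice C I) a (f \<cdot> e, e, f) = Comp (slice C I) b (f \<cdot> e, e, f)"
    using Q(3) by (simp_all add: a b slice_simps)
  ultimately show "\<exists>Q e. Q \<in> Obj (slice C I) \<and> e \<in> hom (slice C I) Q (Dom (slice C I) a) \<and>
      Comp (slice C I) a e = Comp (slice C I) b e \<and>
      (\<forall>Z\<in>Obj (slice C I). \<forall>u\<in>hom (slice C I) Z (Dom (slice C I) a). Comp (slice C I) a u = Comp (slice C I) b u \<longrightarrow>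
        (\<exists>!w. w \<in> hom (slice C I) Z Q \<and> Comp (slice C I) e w = u))"
    using he by (intro exI[of _ "f \<cdot> e"] exI[of _ "(f \<cdot> e, e, f)"]) simp
qed

lemma flc_slice: "I \<in> Obj C \<Longrightarrow> flc (slice C I)"
  by unfold_locales (simp_all add: cartesian_slice has_equalizers_slice)

end

section \<open>Exponentials without products\<close>

text \<open>An exponential described by its action on generalised elements; no products are involved, so
  that the description is invariant under isomorphism of categories.\<close>

definition natop :: "('o, 'a, 'm) category_scheme \<Rightarrow> 'o \<Rightarrow> 'o \<Rightarrow> 'o \<Rightarrow> ('a \<Rightarrow> 'a \<Rightarrow> 'a) \<Rightarrow> bool" where
  "natop C Z D A f \<longleftrightarrow> (\<forall>t d. t \<in> Arr C \<and> d \<in> Arr C \<and> Dom C d = Dom C t \<and> Cod C t = Z \<and> Cod C d = D \<longrightarrow>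
    f t d \<in> hom C (Dom C t) A \<and> (\<forall>s\<in>Arr C. Cod C s = Dom C t \<longrightarrow> f (t \<cdot>\<^bsub>C\<^esub> s) (d \<cdot>\<^bsub>C\<^esub> s) = f t d \<cdot>\<^bsub>C\<^esub> s))"

definition app_exp :: "('o, 'a, 'm) category_scheme \<Rightarrow> 'o \<Rightarrow> 'o \<Rightarrow> 'o \<Rightarrow> ('a \<Rightarrow> 'a \<Rightarrow> 'a) \<Rightarrow> bool" where
  "app_exp C D A X app \<longleftrightarrow> X \<in> Obj C \<and> natop C X D A app \<and>
    (\<forall>Z f. Z \<in> Obj C \<and> natop C Z D A f \<longrightarrow>
      (\<exists>u\<in>hom C Z X. \<forall>t d. t \<in> Arr C \<and> d \<in> Arr C \<and> Dom C d = Dom C t \<and> Cod C t = Z \<and> Cod C d = D \<longrightarrow>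
        app (u \<cdot>\<^bsub>C\<^esub> t) d = f t d)) \<and>
    (\<forall>Z u v. u \<in> hom C Z X \<and> v \<in> hom C Z X \<and>
      (\<forall>t d. t \<in> Arr C \<and> d \<in> Arr C \<and> Dom C d = Dom C t \<and> Cod C t = Z \<and> Cod C d = D \<longrightarrow>
        app (u \<cdot>\<^bsub>C\<^esub> t) d = app (v \<cdot>\<^bsub>C\<^esub> t) d) \<longrightarrow> u = v)"

text \<open>By naturality an operation on pairs of elements is determined by its value at the two
  projections. That value is an arrow out of a product and can be transposed.\<close>

lemma (in ccc) app_exp_ex:
  assumes D: "D \<in> Obj C" and A: "A \<in> Obj C"
  shows "\<exists>X app. app_exp C D A X app"
proof -
  obtain X ev where "is_exp D A X ev"
    using exponential_ex[OF D A] by blast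
  note X = is_expD[OF this]
  note [simp] = D A X(1) X(2)[simplified]
  let ?app = "\<lambda>t d. ev \<cdot> pair C t d"
  have "natop C X D A ?app"
    by (simp add: natop_def)
  moreover have "\<exists>u\<in>hom C Z X. \<forall>t d. t \<in> Arr C \<and> d \<in> Arr C \<and> Dom C d = Dom C t \<and> Cod C t = Z \<and> Cod C d = D \<longrightarrow>
        ?app (u \<cdot> t) d = f t d" if Z: "Z \<in> Obj C" and f: "natop C Z D A f" for Z f
  proof -
    let ?f = "f (Pr1 C Z D) (Pr2 C Z D)"
    have f1: "?f \<in> hom C (Prod C Z D) A" and
      f2: "\<And>s. s \<in> Arr C \<Longrightarrow> Cod C s = Prod C Z D \<Longrightarrow> f (Pr1 C Z D \<cdot> s) (Pr2 C Z D \<cdot> s) = ?f \<cdot> s"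
      using f[unfolded natop_def, rule_format, of "Pr1 C Z D" "Pr2 C Z D"] Z by simp_all
    have f3: "?f \<cdot> pair C t d = f t d" if "t \<in> Arr C \<and> d \<in> Arr C \<and> Dom C d = Dom C t \<and> Cod C t = Z \<and> Cod C d = D" for t d
      using f2[of "pair C t d"] that by simp
    show ?thesis
      using X(3)[OF Z f1] f3 by simp
  qed
  moreover have "u = v" if "u \<in> hom C Z X \<and> v \<in> hom C Z X \<and>
      (\<forall>t d. t \<in> Arr C \<and> d \<in> Arr C \<and> Dom C d = Dom C t \<and> Cod C t = Z \<and> Cod C d = D \<longrightarrow>
        ?app (u \<cdot> t) d = ?app (v \<cdot> t) d)" for Z u v
    by (rule X(4)) (use that in simp_all)
  ultimately show ?thesis
    unfolding app_exp_def using X(1) by blast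
qed

text \<open>The evaluation arrow is the operation applied to the generic pair, the two projections
  of whatever products the category has chosen.\<close>

lemma (in cart) cartesian_closedI:
  assumes ex: "\<And>D A. D \<in> Obj C \<Longrightarrow> A \<in> Obj C \<Longrightarrow> \<exists>X app. app_exp C D A X app"
  shows "cartesian_closed C"
proof -
  have "\<exists>X ev. is_exponential C D A X ev" if D: "D \<in> Obj C" and A: "A \<in> Obj C" for D A
  proof -
    obtain X app where x: "app_exp C D A X app"
      using ex[OF D A] by blast
    have X: "X \<in> Obj C" and n: "natop C X D A app"
      and c: "\<And>Z f. Z \<in> Obj C \<Longrightarrow> natop C Z D A f \<Longrightarrow>
      \<exists>u\<in>hom C Z X. \<forall>t d. t \<in> Arr C \<and> d \<in> Arr C \<and> Dom C d = Dom C t \<and> Cod C t = Z \<and> Cod C d = D \<longrightarrow>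
        app (u \<cdot> t) d = f t d"
      and un: "\<And>Z u v. u \<in> hom C Z X \<Longrightarrow> v \<in> hom C Z X \<Longrightarrow>
      \<forall>t d. t \<in> Arr C \<and> d \<in> Arr C \<and> Dom C d = Dom C t \<and> Cod C t = Z \<and> Cod C d = D \<longrightarrow>
        app (u \<cdot> t) d = app (v \<cdot> t) d \<Longrightarrow> u = v"
      using x unfolding app_exp_def by blast+
    note [simp] = D A X
    let ?ev = "app (Pr1 C X D) (Pr2 C X D)"
    have ev: "?ev \<in> hom C (Prod C X D) A" and
      ev': "\<And>s. s \<in> Arr C \<Longrightarrow> Cod C s = Prod C X D \<Longrightarrow> app (Pr1 C X D \<cdot> s) (Pr2 C X D \<cdot> s) = ?ev \<cdot> s"
      using n[unfolded natop_def, rule_format, of "Pr1 C X D" "Pr2 C X D"] by simp_all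
    note [simp] = ev[simplified]
    have ev_el: "?ev \<cdot> pair C t d = app t d" if "t \<in> Arr C \<and> d \<in> Arr C \<and> Dom C d = Dom C t \<and> Cod C t = X \<and> Cod C d = D" for t d
      using ev'[of "pair C t d"] that by simp
    have "\<exists>!u. u \<in> hom C Z X \<and> ?ev \<cdot> prod_map C u (Ide C D) = f" if Z: "Z \<in> Obj C" and f: "f \<in> hom C (Prod C Z D) A" for Z f
    proof -
      note [simp] = Z f[simplified]
      have iff: "?ev \<cdot> prod_map C u (Ide C D) = f \<longleftrightarrow>
        (\<forall>t d. t \<in> Arr C \<and> d \<in> Arr C \<and> Dom C d = Dom C t \<and> Cod C t = Z \<and> Cod C d = D \<longrightarrow> app (u \<cdot> t) d = f \<cdot> pair C t d)"
        if u: "u \<in> hom C Z X" for u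
      proof
        assume e: "?ev \<cdot> prod_map C u (Ide C D) = f"
        show "\<forall>t d. t \<in> Arr C \<and> d \<in> Arr C \<and> Dom C d = Dom C t \<and> Cod C t = Z \<and> Cod C d = D \<longrightarrow> app (u \<cdot> t) d = f \<cdot> pair C t d"
        proof (intro allI impI)
          fix t d assume td: "t \<in> Arr C \<and> d \<in> Arr C \<and> Dom C d = Dom C t \<and> Cod C t = Z \<and> Cod C d = D"
          have "?ev \<cdot> (prod_map C u (Ide C D) \<cdot> pair C t d) = f \<cdot> pair C t d"
            by (rule comp_eq_comp[OF e]) (use u td in simp_all)
          moreover have "prod_map C u (Ide C D) \<cdot> pair C t d = pair C (u \<cdot> t) d"
            using u td by simp
          ultimately show "app (u \<cdot> t) d = f \<cdot> pair C t d"
            using ev_el[of "u \<cdot> t" d] u td by simp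
        qed
      next
        assume a: "\<forall>t d. t \<in> Arr C \<and> d \<in> Arr C \<and> Dom C d = Dom C t \<and> Cod C t = Z \<and> Cod C d = D \<longrightarrow> app (u \<cdot> t) d = f \<cdot> pair C t d"
        show "?ev \<cdot> prod_map C u (Ide C D) = f"
          using a[rule_format, of "Pr1 C Z D" "Pr2 C Z D"] u by (simp add: ev_el)
      qed
      have "natop C Z D A (\<lambda>t d. f \<cdot> pair C t d)"
        by (simp add: natop_def)
      then obtain u where u: "u \<in> hom C Z X"
        "\<forall>t d. t \<in> Arr C \<and> d \<in> Arr C \<and> Dom C d = Dom C t \<and> Cod C t = Z \<and> Cod C d = D \<longrightarrow> app (u \<cdot> t) d = f \<cdot> pair C t d"
        using c[OF Z] by blast
      show ?thesis
      proof (rule ex1I[of _ u])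
        show "u \<in> hom C Z X \<and> ?ev \<cdot> prod_map C u (Ide C D) = f"
          using u iff[OF u(1)] by blast
        fix v assume v: "v \<in> hom C Z X \<and> ?ev \<cdot> prod_map C v (Ide C D) = f"
        then have "\<forall>t d. t \<in> Arr C \<and> d \<in> Arr C \<and> Dom C d = Dom C t \<and> Cod C t = Z \<and> Cod C d = D \<longrightarrow> app (v \<cdot> t) d = f \<cdot> pair C t d"
          using iff[of v] by blast
        then show "v = u"
          using un[of v Z u] u v by simp
      qed
    qed
    then have "is_exponential C D A X ?ev"
      unfolding is_exponential_def using X ev by blast
    then show ?thesis by blast
  qed
  then show ?thesis
    unfolding cartesian_closed_def using cartesian by blast
qed

text \<open>The hypotheses spell out a pair of mutually inverse functors, \<open>fo\<close> with
  \<open>fa\<close> and \<open>go\<close> with \<open>ga\<close>, as plain maps, since the lemma is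
  applied to categories of different types.\<close>

lemma app_exp_iso:
  assumes fa: "\<And>f. f \<in> Arr C' \<Longrightarrow> fa f \<in> Arr C \<and> Dom C (fa f) = fo (Dom C' f) \<and> Cod C (fa f) = fo (Cod C' f)"
    and ga: "\<And>f. f \<in> Arr C \<Longrightarrow> ga f \<in> Arr C' \<and> Dom C' (ga f) = go (Dom C f) \<and> Cod C' (ga f) = go (Cod C f)"
    and fo: "\<And>X. X \<in> Obj C' \<Longrightarrow> fo X \<in> Obj C \<and> go (fo X) = X"
    and go: "\<And>X. X \<in> Obj C \<Longrightarrow> go X \<in> Obj C' \<and> fo (go X) = X"
    and gf: "\<And>f. f \<in> Arr C' \<Longrightarrow> ga (fa f) = f" and fg: "\<And>f. f \<in> Arr C \<Longrightarrow> fa (ga f) = f"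
    and fcomp: "\<And>f g. f \<in> Arr C' \<Longrightarrow> g \<in> Arr C' \<Longrightarrow> Cod C' f = Dom C' g \<Longrightarrow> fa (g \<cdot>\<^bsub>C'\<^esub> f) = fa g \<cdot>\<^bsub>C\<^esub> fa f"
    and gcomp: "\<And>f g. f \<in> Arr C \<Longrightarrow> g \<in> Arr C \<Longrightarrow> Cod C f = Dom C g \<Longrightarrow> ga (g \<cdot>\<^bsub>C\<^esub> f) = ga g \<cdot>\<^bsub>C'\<^esub> ga f"
    and ccomp: "\<And>f g. f \<in> Arr C \<Longrightarrow> g \<in> Arr C \<Longrightarrow> Cod C f = Dom C g \<Longrightarrow>
      g \<cdot>\<^bsub>C\<^esub> f \<in> Arr C \<and> Dom C (g \<cdot>\<^bsub>C\<^esub> f) = Dom C f \<and> Cod C (g \<cdot>\<^bsub>C\<^esub> f) = Cod C g"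
    and obj: "\<And>f. f \<in> Arr C \<Longrightarrow> Dom C f \<in> Obj C \<and> Cod C f \<in> Obj C" "\<And>f. f \<in> Arr C' \<Longrightarrow> Dom C' f \<in> Obj C' \<and> Cod C' f \<in> Obj C'"
    and D: "D \<in> Obj C'" and A: "A \<in> Obj C'"
    and X: "app_exp C (fo D) (fo A) X app"
  shows "app_exp C' D A (go X) (\<lambda>t d. ga (app (fa t) (fa d)))"
proof -
  have XO: "X \<in> Obj C" and n: "natop C X (fo D) (fo A) app"
      and c: "\<And>Z f. Z \<in> Obj C \<Longrightarrow> natop C Z (fo D) (fo A) f \<Longrightarrow>
      \<exists>u\<in>hom C Z X. \<forall>t d. t \<in> Arr C \<and> d \<in> Arr C \<and> Dom C d = Dom C t \<and> Cod C t = Z \<and> Cod C d = fo D \<longrightarrow>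
        app (u \<cdot>\<^bsub>C\<^esub> t) d = f t d"
      and un: "\<And>Z u v. u \<in> hom C Z X \<Longrightarrow> v \<in> hom C Z X \<Longrightarrow>
      \<forall>t d. t \<in> Arr C \<and> d \<in> Arr C \<and> Dom C d = Dom C t \<and> Cod C t = Z \<and> Cod C d = fo D \<longrightarrow>
        app (u \<cdot>\<^bsub>C\<^esub> t) d = app (v \<cdot>\<^bsub>C\<^esub> t) d \<Longrightarrow> u = v"
    using X unfolding app_exp_def by blast+
  have n1: "app t d \<in> Arr C" "Dom C (app t d) = Dom C t" "Cod C (app t d) = fo A"
    if "t \<in> Arr C" "d \<in> Arr C" "Dom C d = Dom C t" "Cod C t = X" "Cod C d = fo D" for t d
    using n that unfolding natop_def hom_def by blast+
  have n2: "app (t \<cdot>\<^bsub>C\<^esub> s) (d \<cdot>\<^bsub>C\<^esub> s) = app t d \<cdot>\<^bsub>C\<^esub> s"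
    if "t \<in> Arr C" "d \<in> Arr C" "Dom C d = Dom C t" "Cod C t = X" "Cod C d = fo D" "s \<in> Arr C" "Cod C s = Dom C t" for t d s
    using n that unfolding natop_def by blast
  have fo_eq: "fo Y = fo Z \<longleftrightarrow> Y = Z" if "Y \<in> Obj C'" "Z \<in> Obj C'" for Y Z
    using that fo by metis
  have fgo: "fo (go X) = X"
    using go[OF XO] by blast
  show ?thesis
    unfolding app_exp_def
  proof (intro conjI allI impI)
    show "go X \<in> Obj C'"
      using go[OF XO] by blast
    show "natop C' (go X) D A (\<lambda>t d. ga (app (fa t) (fa d)))"
      unfolding natop_def
    proof (intro allI impI conjI ballI)
      fix t d assume td: "t \<in> Arr C' \<and> d \<in> Arr C' \<and> Dom C' d = Dom C' t \<and> Cod C' t = go X \<and> Cod C' d = D"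
      have td': "fa t \<in> Arr C" "fa d \<in> Arr C" "Dom C (fa d) = Dom C (fa t)" "Cod C (fa t) = X" "Cod C (fa d) = fo D"
        "Dom C (fa t) = fo (Dom C' t)"
        using td fa[of t] fa[of d] fgo by simp_all
      note a = n1[OF td'(1-5)]
      show "ga (app (fa t) (fa d)) \<in> hom C' (Dom C' t) A"
        using ga[OF a(1)] a td'(6) fo[OF A] fo[of "Dom C' t"] obj(2)[of t] td by (simp add: hom_def)
      fix s assume s: "s \<in> Arr C'" "Cod C' s = Dom C' t"
      have s': "fa s \<in> Arr C" "Cod C (fa s) = Dom C (fa t)"
        using s fa[OF s(1)] td'(6) by simp_all
      have "ga (app (fa (t \<cdot>\<^bsub>C'\<^esub> s)) (fa (d \<cdot>\<^bsub>C'\<^esub> s))) = ga (app (fa t \<cdot>\<^bsub>C\<^esub> fa s) (fa d \<cdot>\<^bsub>C\<^esub> fa s))"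
        using fcomp[of s t] fcomp[of s d] s td by simp
      also have "\<dots> = ga (app (fa t) (fa d)) \<cdot>\<^bsub>C'\<^esub> ga (fa s)"
        using n2[OF td'(1-5) s'] gcomp[of "fa s" "app (fa t) (fa d)"] s' a by simp
      finally show "ga (app (fa (t \<cdot>\<^bsub>C'\<^esub> s)) (fa (d \<cdot>\<^bsub>C'\<^esub> s))) = ga (app (fa t) (fa d)) \<cdot>\<^bsub>C'\<^esub> s"
        using gf[OF s(1)] by simp
    qed
  next
    fix Z f assume Zf: "Z \<in> Obj C' \<and> natop C' Z D A f"
    have f1: "f t d \<in> Arr C'" "Dom C' (f t d) = Dom C' t" "Cod C' (f t d) = A"
      if "t \<in> Arr C'" "d \<in> Arr C'" "Dom C' d = Dom C' t" "Cod C' t = Z" "Cod C' d = D" for t d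
      using Zf that unfolding natop_def hom_def by blast+
    have f2: "f (t \<cdot>\<^bsub>C'\<^esub> s) (d \<cdot>\<^bsub>C'\<^esub> s) = f t d \<cdot>\<^bsub>C'\<^esub> s"
      if "t \<in> Arr C'" "d \<in> Arr C'" "Dom C' d = Dom C' t" "Cod C' t = Z" "Cod C' d = D" "s \<in> Arr C'" "Cod C' s = Dom C' t" for t d s
      using Zf that unfolding natop_def by blast
    have "natop C (fo Z) (fo D) (fo A) (\<lambda>t d. fa (f (ga t) (ga d)))"
      unfolding natop_def
    proof (intro allI impI conjI ballI)
      fix t d assume td: "t \<in> Arr C \<and> d \<in> Arr C \<and> Dom C d = Dom C t \<and> Cod C t = fo Z \<and> Cod C d = fo D"
      have td': "ga t \<in> Arr C'" "ga d \<in> Arr C'" "Dom C' (ga d) = Dom C' (ga t)" "Cod C' (ga t) = Z" "Cod C' (ga d) = D"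
        "Dom C' (ga t) = go (Dom C t)"
        using td ga[of t] ga[of d] fo[OF D] fo[of Z] Zf by simp_all
      note a = f1[OF td'(1-5)]
      show "fa (f (ga t) (ga d)) \<in> hom C (Dom C t) (fo A)"
        using fa[OF a(1)] a td'(6) go[of "Dom C t"] obj(1)[of t] td by (simp add: hom_def)
      fix s assume s: "s \<in> Arr C" "Cod C s = Dom C t"
      have s': "ga s \<in> Arr C'" "Cod C' (ga s) = Dom C' (ga t)"
        using s ga[OF s(1)] td'(6) by simp_all
      have "fa (f (ga (t \<cdot>\<^bsub>C\<^esub> s)) (ga (d \<cdot>\<^bsub>C\<^esub> s))) = fa (f (ga t \<cdot>\<^bsub>C'\<^esub> ga s) (ga d \<cdot>\<^bsub>C'\<^esub> ga s))"
        using gcomp[of s t] gcomp[of s d] s td by simp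
      also have "\<dots> = fa (f (ga t) (ga d)) \<cdot>\<^bsub>C\<^esub> fa (ga s)"
        using f2[OF td'(1-5) s'] fcomp[of "ga s" "f (ga t) (ga d)"] s' a by simp
      finally show "fa (f (ga (t \<cdot>\<^bsub>C\<^esub> s)) (ga (d \<cdot>\<^bsub>C\<^esub> s))) = fa (f (ga t) (ga d)) \<cdot>\<^bsub>C\<^esub> s"
        using fg[OF s(1)] by simp
    qed
    then obtain u where u: "u \<in> hom C (fo Z) X" and e: "\<And>t d. t \<in> Arr C \<Longrightarrow> d \<in> Arr C \<Longrightarrow> Dom C d = Dom C t \<Longrightarrow>
        Cod C t = fo Z \<Longrightarrow> Cod C d = fo D \<Longrightarrow> app (u \<cdot>\<^bsub>C\<^esub> t) d = fa (f (ga t) (ga d))"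
      using c[of "fo Z"] fo[of Z] Zf by blast
    have u': "u \<in> Arr C" "Dom C u = fo Z" "Cod C u = X"
      using u by (simp_all add: hom_def)
    show "\<exists>u\<in>hom C' Z (go X). \<forall>t d. t \<in> Arr C' \<and> d \<in> Arr C' \<and> Dom C' d = Dom C' t \<and> Cod C' t = Z \<and> Cod C' d = D \<longrightarrow>
      ga (app (fa (u \<cdot>\<^bsub>C'\<^esub> t)) (fa d)) = f t d"
    proof (intro bexI[of _ "ga u"] allI impI)
      show "ga u \<in> hom C' Z (go X)"
        using ga[OF u'(1)] u' fo[of Z] Zf by (simp add: hom_def)
      fix t d assume td: "t \<in> Arr C' \<and> d \<in> Arr C' \<and> Dom C' d = Dom C' t \<and> Cod C' t = Z \<and> Cod C' d = D"
      have td': "fa t \<in> Arr C" "fa d \<in> Arr C" "Dom C (fa d) = Dom C (fa t)" "Cod C (fa t) = fo Z" "Cod C (fa d) = fo D"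
        using td fa[of t] fa[of d] by simp_all
      have "fa (ga u \<cdot>\<^bsub>C'\<^esub> t) = u \<cdot>\<^bsub>C\<^esub> fa t"
        using fcomp[of t "ga u"] ga[OF u'(1)] u' fo[of Z] Zf td fg[OF u'(1)] by simp
      then show "ga (app (fa (ga u \<cdot>\<^bsub>C'\<^esub> t)) (fa d)) = f t d"
        using e[OF td'] f1[of t d] gf[of t] gf[of d] gf[of "f t d"] td by simp
    qed
  next
    fix Z u v assume a: "u \<in> hom C' Z (go X) \<and> v \<in> hom C' Z (go X) \<and>
      (\<forall>t d. t \<in> Arr C' \<and> d \<in> Arr C' \<and> Dom C' d = Dom C' t \<and> Cod C' t = Z \<and> Cod C' d = D \<longrightarrow>
        ga (app (fa (u \<cdot>\<^bsub>C'\<^esub> t)) (fa d)) = ga (app (fa (v \<cdot>\<^bsub>C'\<^esub> t)) (fa d)))"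
    then have u: "u \<in> Arr C'" "Dom C' u = Z" "Cod C' u = go X" and v: "v \<in> Arr C'" "Dom C' v = Z" "Cod C' v = go X"
      by (simp_all add: hom_def)
    have uv: "fa u \<in> hom C (fo Z) X" "fa v \<in> hom C (fo Z) X"
      using fa[OF u(1)] fa[OF v(1)] u v fgo by (simp_all add: hom_def)
    have Z: "Z \<in> Obj C'"
      using obj(2)[OF u(1)] u(2) by simp
    have "fa u = fa v"
    proof (rule un[OF uv], intro allI impI)
      fix t d assume td: "t \<in> Arr C \<and> d \<in> Arr C \<and> Dom C d = Dom C t \<and> Cod C t = fo Z \<and> Cod C d = fo D"
      have td': "ga t \<in> Arr C'" "ga d \<in> Arr C'" "Dom C' (ga d) = Dom C' (ga t)" "Cod C' (ga t) = Z" "Cod C' (ga d) = D"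
        using td ga[of t] ga[of d] fo[OF D] fo[OF Z] by simp_all
      have e: "ga (app (fa (u \<cdot>\<^bsub>C'\<^esub> ga t)) (fa (ga d))) = ga (app (fa (v \<cdot>\<^bsub>C'\<^esub> ga t)) (fa (ga d)))"
        using a td' by blast
      have uv': "fa (u \<cdot>\<^bsub>C'\<^esub> ga t) = fa u \<cdot>\<^bsub>C\<^esub> t" "fa (v \<cdot>\<^bsub>C'\<^esub> ga t) = fa v \<cdot>\<^bsub>C\<^esub> t"
        using fcomp[of "ga t" u] fcomp[of "ga t" v] u v td' td fg[of t] by simp_all
      have "app (fa u \<cdot>\<^bsub>C\<^esub> t) d \<in> Arr C" "app (fa v \<cdot>\<^bsub>C\<^esub> t) d \<in> Arr C"
        using uv td ccomp[of t "fa u"] ccomp[of t "fa v"] by (auto simp: hom_def intro!: n1(1))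
      moreover have "ga (app (fa u \<cdot>\<^bsub>C\<^esub> t) d) = ga (app (fa v \<cdot>\<^bsub>C\<^esub> t) d)"
        using e uv' fg[of d] td by simp
      ultimately show "app (fa u \<cdot>\<^bsub>C\<^esub> t) d = app (fa v \<cdot>\<^bsub>C\<^esub> t) d"
        using fg by metis
    qed
    then show "u = v"
      using gf[OF u(1)] gf[OF v(1)] by metis
  qed
qed

text \<open>The iterated slice over \<open>K\<close> is compared with the slice of \<open>C\<close>
  over the domain of \<open>K\<close>. Both carry products picked by choice, which the isomorphism
  need not respect; this is the reason for passing through \<open>app_exp\<close>.\<close>

lemma (in flc) ccc_slice_slice:
  assumes I: "I \<in> Obj C" and K: "K \<in> Obj (slice C I)" and cc: "cartesian_closed (slice C (Dom C K))"
  shows "ccc (slice (slice C I) K)"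
proof -
  let ?S = "slice C I" and ?T = "slice C (Dom C K)"
  interpret S: flc ?S
    by (rule flc_slice[OF I])
  interpret S': flc "slice ?S K"
    by (rule S.flc_slice[OF K])
  have Ka [simp]: "K \<in> Arr C" "Cod C K = I"
    using K by (simp_all add: slice_simps)
  interpret T: ccc ?T
    by unfold_locales (simp_all add: cartesian_slice has_equalizers_slice cc)
  \<comment> \<open>An object of the iterated slice is an arrow \<open>h\<close> into the domain of
    \<open>K\<close>, stored together with \<open>K\<close> and the composite
    \<open>K \<cdot> h\<close>. \<open>fo\<close> forgets the stored data and \<open>go\<close>
    restores them; \<open>fa\<close> and \<open>ga\<close> do the same for arrows.\<close>
  define go :: "'a \<Rightarrow> 'a \<times> 'a \<times> 'a" where "go h = (K \<cdot> h, h, K)" for h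
  define fo :: "'a \<times> 'a \<times> 'a \<Rightarrow> 'a" where "fo x = fst (snd x)" for x
  define ga :: "'a \<times> 'a \<times> 'a \<Rightarrow> ('a \<times> 'a \<times> 'a) \<times> ('a \<times> 'a \<times> 'a) \<times> ('a \<times> 'a \<times> 'a)"
    where "ga = (\<lambda>(h, m, h'). (go h, (K \<cdot> h, m, K \<cdot> h'), go h'))"
  define fa :: "('a \<times> 'a \<times> 'a) \<times> ('a \<times> 'a \<times> 'a) \<times> ('a \<times> 'a \<times> 'a) \<Rightarrow> 'a \<times> 'a \<times> 'a"
    where "fa x = (fo (fst x), fo (fst (snd x)), fo (snd (snd x)))" for x
  have objS: "x \<in> Obj (slice ?S K) \<longleftrightarrow> (\<exists>h. x = go h \<and> h \<in> Arr C \<and> Cod C h = Dom C K)" for x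
  proof
    assume "x \<in> Obj (slice ?S K)"
    then have "x \<in> Arr ?S" "Cod ?S x = K"
      by (simp_all add: slice_simps(1)[of ?S])
    then obtain f h where "x = (f, h, K)" "h \<in> Arr C" "Cod C h = Dom C K" "K \<cdot> h = f"
      unfolding slice_Arr_iff by (auto simp: slice_simps)
    then show "\<exists>h. x = go h \<and> h \<in> Arr C \<and> Cod C h = Dom C K"
      unfolding go_def by blast
  next
    assume "\<exists>h. x = go h \<and> h \<in> Arr C \<and> Cod C h = Dom C K"
    then show "x \<in> Obj (slice ?S K)"
      by (auto simp: slice_simps go_def)
  qed
  have objT: "h \<in> Obj ?T \<longleftrightarrow> h \<in> Arr C \<and> Cod C h = Dom C K" for h
    by (simp add: slice_simps)
  have arrT: "x \<in> Arr ?T \<longleftrightarrow> (\<exists>h m h'. x = (h, m, h') \<and> h \<in> Arr C \<and> Cod C h = Dom C K \<and> h' \<in> Arr C \<and> Cod C h' = Dom C K \<and>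
    m \<in> Arr C \<and> Dom C m = Dom C h \<and> Cod C m = Dom C h' \<and> h' \<cdot> m = h)" for x
    by (rule slice_Arr_iff)
  have arrS: "x \<in> Arr (slice ?S K) \<longleftrightarrow> (\<exists>h m h'. x = (go h, (K \<cdot> h, m, K \<cdot> h'), go h') \<and> h \<in> Arr C \<and> Cod C h = Dom C K \<and>
    h' \<in> Arr C \<and> Cod C h' = Dom C K \<and> m \<in> Arr C \<and> Dom C m = Dom C h \<and> Cod C m = Dom C h' \<and> h' \<cdot> m = h)" (is "_ \<longleftrightarrow> ?R") for x
  proof
    assume x: "x \<in> Arr (slice ?S K)"
    then obtain u a v where xe: "x = (u, a, v)" and u: "u \<in> Obj (slice ?S K)" and v: "v \<in> Obj (slice ?S K)"
      and a: "a \<in> hom ?S (Dom ?S u) (Dom ?S v)" and c: "Comp ?S v a = u"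
      unfolding S.slice_Arr_iff by (auto simp: slice_simps(1)[of ?S])
    obtain h where h: "u = go h" "h \<in> Arr C" "Cod C h = Dom C K"
      using u unfolding objS by blast
    obtain h' where h': "v = go h'" "h' \<in> Arr C" "Cod C h' = Dom C K"
      using v unfolding objS by blast
    have "Dom ?S u = K \<cdot> h" "Dom ?S v = K \<cdot> h'"
      by (simp_all add: h(1) h'(1) go_def slice_simps)
    then obtain m where m: "a = (K \<cdot> h, m, K \<cdot> h')" "m \<in> Arr C" "Dom C m = Dom C (K \<cdot> h)" "Cod C m = Dom C (K \<cdot> h')"
      using a unfolding slice_hom_iff by auto
    have "h' \<cdot> m = h"
      using c unfolding h(1) h'(1) m(1) go_def by (simp add: slice_simps)
    then show ?R
      using xe h h' m by auto
  next
    assume ?R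
    then obtain h m h' where x: "x = (go h, (K \<cdot> h, m, K \<cdot> h'), go h')" and h: "h \<in> Arr C" "Cod C h = Dom C K"
      "h' \<in> Arr C" "Cod C h' = Dom C K" "m \<in> Arr C" "Dom C m = Dom C h" "Cod C m = Dom C h'" "h' \<cdot> m = h"
      by blast
    have "(K \<cdot> h, m, K \<cdot> h') \<in> Arr ?S"
      unfolding slice_Arr_iff using h by simp
    moreover have "go h \<in> Arr ?S" "go h' \<in> Arr ?S"
      unfolding slice_Arr_iff go_def using h by simp_all
    ultimately show "x \<in> Arr (slice ?S K)"
      unfolding x S.slice_Arr_iff using h by (simp add: slice_simps(3,4,6)[of C] go_def)
  qed
  have obj_T: "Dom ?T f \<in> Obj ?T \<and> Cod ?T f \<in> Obj ?T" if "f \<in> Arr ?T" for f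
    using that by simp
  have "cartesian_closed (slice ?S K)"
  proof (rule S'.cartesian_closedI)
    fix D A assume D: "D \<in> Obj (slice ?S K)" and A: "A \<in> Obj (slice ?S K)"
    have "fo D \<in> Obj ?T" "fo A \<in> Obj ?T"
      using D A unfolding objS objT by (auto simp: fo_def go_def)
    then obtain X app where X: "app_exp ?T (fo D) (fo A) X app"
      using T.app_exp_ex by blast
    have "app_exp (slice ?S K) D A (go X) (\<lambda>t d. ga (app (fa t) (fa d)))"
    proof (rule app_exp_iso[OF _ _ _ _ _ _ _ _ _ _ _ D A X])
      show "fa f \<in> Arr ?T \<and> Dom ?T (fa f) = fo (Dom (slice ?S K) f) \<and> Cod ?T (fa f) = fo (Cod (slice ?S K) f)"
        "ga (fa f) = f"
        if "f \<in> Arr (slice ?S K)" for f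
        using that unfolding arrS arrT by (auto simp: fa_def ga_def fo_def go_def slice_simps(3,4))
      show "ga f \<in> Arr (slice ?S K) \<and> Dom (slice ?S K) (ga f) = go (Dom ?T f) \<and> Cod (slice ?S K) (ga f) = go (Cod ?T f)"
        "fa (ga f) = f"
        if "f \<in> Arr ?T" for f
        using that unfolding arrS arrT by (auto simp: fa_def ga_def fo_def go_def slice_simps(3,4))
      show "fo Y \<in> Obj ?T \<and> go (fo Y) = Y" if "Y \<in> Obj (slice ?S K)" for Y
        using that unfolding objS objT by (auto simp: fo_def go_def)
      show "go Y \<in> Obj (slice ?S K) \<and> fo (go Y) = Y" if "Y \<in> Obj ?T" for Y
        using that unfolding objS objT by (auto simp: fo_def go_def)
      show "fa (Comp (slice ?S K) g f) = Comp ?T (fa g) (fa f)"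
        if "f \<in> Arr (slice ?S K)" "g \<in> Arr (slice ?S K)" for f g
        using that unfolding arrS by (auto simp: fa_def fo_def go_def slice_simps(6))
      show "ga (Comp ?T g f) = Comp (slice ?S K) (ga g) (ga f)"
        if "f \<in> Arr ?T" "g \<in> Arr ?T" for f g
        using that unfolding arrT by (auto simp: ga_def go_def slice_simps(6))
    qed (use obj_T in simp_all)
    then show "\<exists>X app. app_exp (slice ?S K) D A X app"
      by blast
  qed
  then show ?thesis
    by unfold_locales
qed

section \<open>Pulling back to a slice\<close>

locale slice_pull = flc C for C :: "('o, 'a) cart_category" (structure) +
  fixes I :: 'o
  assumes I [simp]: "I \<in> Obj C"
begin

abbreviation "\<S> \<equiv> slice C I"

sublocale S: flc \<S>
  by (rule flc_slice[OF I])

text \<open>The generalised elements of \<open>I\<^sup>*Y\<close> at \<open>z : Z \<rightarrow> I\<close> are the arrows \<open>y : Z \<rightarrow> Y\<close>.\<close>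

definition lift :: "'a \<Rightarrow> 'a \<Rightarrow> 'a \<times> 'a \<times> 'a" where
  "lift z y = (z, pair C z y, Pr1 C I (Cod C y))"

abbreviation base :: "'a \<Rightarrow> 'a \<Rightarrow> bool" where
  "base z y \<equiv> z \<in> Arr C \<and> y \<in> Arr C \<and> Dom C y = Dom C z \<and> Cod C z = I"

lemma Obj_S [simp]: "z \<in> Obj \<S> \<longleftrightarrow> z \<in> Arr C \<and> Cod C z = I"
  by (simp add: slice_simps)

lemma lift_simps [simp]:
  assumes "z \<in> Arr C" "y \<in> Arr C" "Dom C y = Dom C z" "Cod C z = I"
  shows "lift z y \<in> Arr \<S>" "Dom \<S> (lift z y) = z" "Cod \<S> (lift z y) = Pr1 C I (Cod C y)" "fst (snd (lift z y)) = pair C z y"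
  using assms by (simp_all add: lift_def slice_simps)

lemma lift_inject [simp]:
  assumes "z \<in> Arr C" "y \<in> Arr C" "Dom C y = Dom C z" "y' \<in> Arr C" "Dom C y' = Dom C z" "Cod C y' = Cod C y"
  shows "lift z y = lift z y' \<longleftrightarrow> y = y'"
  using assms by (simp add: lift_def)

lemma S_arr_cases:
  assumes "w \<in> Arr \<S>" "Dom \<S> w = z" "Cod \<S> w = g"
  obtains h where "w = (z, h, g)" "z \<in> Arr C" "Cod C z = I" "h \<in> Arr C" "Dom C h = Dom C z" "Cod C h = Dom C g" "g \<cdot> h = z"
proof -
  have "w \<in> hom \<S> z g"
    using assms by simp
  then show ?thesis
    unfolding slice_hom_iff using that by blast
qed

text \<open>For an arrow over \<open>I\<close> into the product of \<open>I\<close> and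
  \<open>Y\<close> the first component is forced to be \<open>z\<close>; only the second one carries
  information.\<close>

lemma lift_cases:
  assumes w: "w \<in> Arr \<S>" "Cod \<S> w = Pr1 C I Y" and Y: "Y \<in> Obj C" and z: "Dom \<S> w = z"
  obtains y where "w = lift z y" "y \<in> Arr C" "Dom C y = Dom C z" "Cod C y = Y" "z \<in> Arr C" "Cod C z = I"
proof -
  obtain h where h: "w = (z, h, Pr1 C I Y)" "z \<in> Arr C" "Cod C z = I" "h \<in> Arr C" "Dom C h = Dom C z" "Cod C h = Dom C (Pr1 C I Y)"
    "Pr1 C I Y \<cdot> h = z"
    by (rule S_arr_cases[OF w(1) z w(2)])
  have "pair C z (Pr2 C I Y \<cdot> h) = h"
    using h(4-6) Y unfolding h(7)[symmetric] by simp
  then show ?thesis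
    using that[of "Pr2 C I Y \<cdot> h"] h(2-6) Y unfolding h(1) lift_def by simp
qed

text \<open>\<open>fst (snd u)\<close> is the arrow of the base that underlies \<open>u\<close>.
  Elements of \<open>I\<^sup>*Y\<close> are thus reindexed by plain composition in the base.\<close>

lemma Comp_lift:
  assumes "base z y" "u \<in> Arr \<S>" "Cod \<S> u = z"
  shows "Comp \<S> (lift z y) u = lift (Dom \<S> u) (y \<cdot> fst (snd u))"
proof -
  obtain h where h: "u = (Dom \<S> u, h, z)" "Dom \<S> u \<in> Arr C" "Cod C (Dom \<S> u) = I" "h \<in> Arr C"
    "Dom C h = Dom C (Dom \<S> u)" "Cod C h = Dom C z" "z \<cdot> h = Dom \<S> u"
    by (rule S_arr_cases[OF assms(2) refl assms(3)])
  have "Comp \<S> (lift z y) (Dom \<S> u, h, z) = lift (Dom \<S> u) (y \<cdot> h)"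
    using h(2-7) assms(1) unfolding lift_def by (simp add: slice_simps(6))
  moreover have "fst (snd u) = h"
    using arg_cong[OF h(1), of "\<lambda>u. fst (snd u)"] by simp
  ultimately show ?thesis
    using h(1) by simp
qed

lemma lift_lift [simp]:
  assumes "z \<in> Arr C" "Cod C z = I" "x \<in> Arr C" "Dom C x = Dom C z" "Cod C x = X" "y \<in> Arr C" "Dom C y = Prod C I X"
  shows "Comp \<S> (lift (Pr1 C I X) y) (lift z x) = lift z (y \<cdot> pair C z x)"
proof -
  have X: "X \<in> Obj C"
    using assms(3,5) by auto
  show ?thesis
    using Comp_lift[of "Pr1 C I X" y "lift z x"] assms X by simp
qed

lemma bang_S [simp]: "z \<in> Arr C \<Longrightarrow> Cod C z = I \<Longrightarrow> S.bang z = (z, z, Ide C I)"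
  by (rule sym, rule S.bang_eq[of "(z, z, Ide C I)", THEN trans]) (simp_all add: slice_simps)

lemma One_S [simp]: "One \<S> = Ide C I"
  by (simp add: slice_simps)

lemma lift_bang [simp]:
  assumes "z \<in> Arr C" "Cod C z = I" "v \<in> Arr C" "Dom C v = I"
  shows "Comp \<S> (lift (Ide C I) v) (z, z, Ide C I) = lift z (v \<cdot> z)"
  using Comp_lift[of "Ide C I" v "(z, z, Ide C I)"] assms by (simp add: slice_simps(2-4))

lemma pull_ob_eq [simp]: "pull_ob C I Y = Pr1 C I Y"
  by (simp add: pull_ob_def)

lemma pull_ar_lift:
  assumes "f \<in> Arr C" "Dom C f = X"
  shows "pull_ar C I f = lift (Pr1 C I X) (f \<cdot> Pr2 C I X)"
proof -
  have X: "X \<in> Obj C"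
    using assms by auto
  show ?thesis
    using assms X by (simp add: pull_ar_def lift_def)
qed

lemma pull_ar_simps [simp]:
  assumes "f \<in> Arr C"
  shows "pull_ar C I f \<in> Arr \<S>" "Dom \<S> (pull_ar C I f) = Pr1 C I (Dom C f)" "Cod \<S> (pull_ar C I f) = Pr1 C I (Cod C f)"
  using assms by (simp_all add: pull_ar_lift[OF assms refl])

lemma pull_ar_el [simp]:
  assumes "f \<in> Arr C" "z \<in> Arr C" "x \<in> Arr C" "Dom C x = Dom C z" "Cod C z = I" "Cod C x = Dom C f"
  shows "Comp \<S> (pull_ar C I f) (lift z x) = lift z (f \<cdot> x)"
proof -
  have "Dom C f \<in> Obj C"
    using assms(1) by simp
  then show ?thesis
    using assms by (simp add: pull_ar_lift[OF assms(1) refl])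
qed

lemma pull_ar_Ide:
  assumes "X \<in> Obj C"
  shows "pull_ar C I (Ide C X) = Ide \<S> (Pr1 C I X)"
  using assms by (simp add: pull_ar_def slice_simps)

lemma pull_ar_comp:
  assumes "f \<in> Arr C" "g \<in> Arr C" "Cod C f = Dom C g"
  shows "pull_ar C I (g \<cdot> f) = Comp \<S> (pull_ar C I g) (pull_ar C I f)"
proof -
  have "Dom C f \<in> Obj C" "Dom C g \<in> Obj C"
    using assms by simp_all
  then show ?thesis
    using assms pull_ar_el[of g "Pr1 C I (Dom C f)" "f \<cdot> Pr2 C I (Dom C f)"]
    by (simp add: pull_ar_lift[OF assms(1) refl] pull_ar_lift[of "g \<cdot> f" "Dom C f"])
qed

lemma pull_icat_simps [simp]:
  "IOb (pull_icat C I X) = Pr1 C I (IOb X)" "IAr (pull_icat C I X) = Pr1 C I (IAr X)" "ICp (pull_icat C I X) = Pr1 C I (ICp X)"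
  "ISrc (pull_icat C I X) = pull_ar C I (ISrc X)" "ITgt (pull_icat C I X) = pull_ar C I (ITgt X)"
  "IIde (pull_icat C I X) = pull_ar C I (IIde X)" "IFst (pull_icat C I X) = pull_ar C I (IFst X)"
  "ISnd (pull_icat C I X) = pull_ar C I (ISnd X)" "ICmp (pull_icat C I X) = pull_ar C I (ICmp X)"
  by (simp_all add: pull_icat_def)

text \<open>A test of the square in the slice consists of lifts with a common first component
  \<open>z\<close>, hence is a test of the original square at the stage
  \<open>Dom C z\<close>.\<close>

lemma pull_pullback:
  assumes pb: "is_pullback C f g P p q"
  shows "is_pullback \<S> (pull_ar C I f) (pull_ar C I g) (Pr1 C I P) (pull_ar C I p) (pull_ar C I q)"
proof -
  note s = pullback_simps[OF pb]
  have fg: "f \<in> Arr C" "g \<in> Arr C" "Cod C f = Cod C g"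
    using pb unfolding is_pullback_def by blast+
  have pq: "p \<in> Arr C" "Dom C p = P" "Cod C p = Dom C f" "q \<in> Arr C" "Dom C q = P" "Cod C q = Dom C g"
    using s(2,3) by simp_all
  note [simp] = s(1) fg pq
  show ?thesis
  proof (rule S.pullbackI)
    show "Comp \<S> (pull_ar C I f) (pull_ar C I p) = Comp \<S> (pull_ar C I g) (pull_ar C I q)"
      using s(4) by (simp add: pull_ar_comp[symmetric])
  next
    fix h k assume hk: "h \<in> Arr \<S>" "k \<in> Arr \<S>" "Dom \<S> h = Dom \<S> k" "Cod \<S> h = Dom \<S> (pull_ar C I f)"
      "Cod \<S> k = Dom \<S> (pull_ar C I g)" and e: "Comp \<S> (pull_ar C I f) h = Comp \<S> (pull_ar C I g) k"
    obtain z where z: "Dom \<S> h = z" "Dom \<S> k = z"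
      using hk(3) by simp
    have c: "Cod \<S> h = Pr1 C I (Dom C f)" "Cod \<S> k = Pr1 C I (Dom C g)"
      using hk(4,5) by simp_all
    obtain x where x: "h = lift z x" "x \<in> Arr C" "Dom C x = Dom C z" "Cod C x = Dom C f" and zz: "z \<in> Arr C" "Cod C z = I"
      by (rule lift_cases[OF hk(1) c(1) Obj_Dom[OF fg(1)] z(1)])
    obtain y where y: "k = lift z y" "y \<in> Arr C" "Dom C y = Dom C z" "Cod C y = Dom C g"
      by (rule lift_cases[OF hk(2) c(2) Obj_Dom[OF fg(2)] z(2)])
    have "f \<cdot> x = g \<cdot> y"
      using e x(2-) y(2-) zz unfolding x(1) y(1) by simp
    then have "\<exists>!u. u \<in> hom C (Dom C x) P \<and> p \<cdot> u = x \<and> q \<cdot> u = y"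
      using x(2-) y(2-) by (intro pullback_unique[OF pb]) simp_all
    then obtain u where u: "u \<in> hom C (Dom C x) P" "p \<cdot> u = x" "q \<cdot> u = y"
      by blast
    then show "\<exists>u. u \<in> hom \<S> (Dom \<S> h) (Pr1 C I P) \<and> Comp \<S> (pull_ar C I p) u = h \<and> Comp \<S> (pull_ar C I q) u = k"
      using x(2-) y(2-) zz unfolding x(1) y(1) by (intro exI[of _ "lift z u"]) simp
  next
    fix u v assume uv: "u \<in> Arr \<S>" "v \<in> Arr \<S>" "Dom \<S> u = Dom \<S> v" "Cod \<S> u = Pr1 C I P" "Cod \<S> v = Pr1 C I P"
      and e: "Comp \<S> (pull_ar C I p) u = Comp \<S> (pull_ar C I p) v" "Comp \<S> (pull_ar C I q) u = Comp \<S> (pull_ar C I q) v"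
    obtain z where z: "Dom \<S> u = z" "Dom \<S> v = z"
      using uv(3) by simp
    obtain x where x: "u = lift z x" "x \<in> Arr C" "Dom C x = Dom C z" "Cod C x = P" and zz: "z \<in> Arr C" "Cod C z = I"
      by (rule lift_cases[OF uv(1,4) s(1) z(1)])
    obtain y where y: "v = lift z y" "y \<in> Arr C" "Dom C y = Dom C z" "Cod C y = P"
      by (rule lift_cases[OF uv(2,5) s(1) z(2)])
    have "x = y"
      by (rule pullback_ext[OF pb]) (use e x(2-) y(2-) zz in \<open>simp_all add: x(1) y(1)\<close>)
    then show "u = v"
      by (simp add: x(1) y(1))
  qed simp_all
qed

lemma composable_lift:
  assumes X: "is_icat C X" and c: "S.composable (pull_icat C I X) a b"
  obtains z f g where "a = lift z f" "b = lift z g" "z \<in> Arr C" "Cod C z = I" "composable X f g" "Dom C f = Dom C z" "Dom C g = Dom C z"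
proof -
  have ab: "a \<in> Arr \<S>" "b \<in> Arr \<S>" "Dom \<S> a = Dom \<S> b" "Cod \<S> a = Pr1 C I (IAr X)" "Cod \<S> b = Pr1 C I (IAr X)"
    and e: "Comp \<S> (pull_ar C I (ITgt X)) a = Comp \<S> (pull_ar C I (ISrc X)) b"
    using c by (simp_all add: S.composable_def)
  obtain z where z: "Dom \<S> a = z" "Dom \<S> b = z"
    using ab(3) by simp
  obtain f where f: "a = lift z f" "f \<in> Arr C" "Dom C f = Dom C z" "Cod C f = IAr X" and zz: "z \<in> Arr C" "Cod C z = I"
    by (rule lift_cases[OF ab(1,4) icat_data(2)[OF X] z(1)])
  obtain g where g: "b = lift z g" "g \<in> Arr C" "Dom C g = Dom C z" "Cod C g = IAr X"
    by (rule lift_cases[OF ab(2,5) icat_data(2)[OF X] z(2)])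
  have "ITgt X \<cdot> f = ISrc X \<cdot> g"
    using e f(2-) g(2-) zz X unfolding f(1) g(1) by simp
  then have "composable X f g"
    using f(2-) g(2-) by (simp add: composable_def)
  then show ?thesis
    using that[OF f(1) g(1) zz] f(3) g(3) by blast
qed

text \<open>Since \<open>I\<^sup>*\<close> preserves the pullback of composable pairs, composition
  in \<open>I\<^sup>*X\<close> is composition in \<open>X\<close> on underlying elements. The
  category laws of \<open>I\<^sup>*X\<close> are those of \<open>X\<close> through this
  rule.\<close>

lemma icomp_pull:
  assumes X: "is_icat C X" and c: "composable X f g" and z: "z \<in> Arr C" "Cod C z = I" "Dom C f = Dom C z"
  shows "icomp \<S> (pull_icat C I X) (lift z f) (lift z g) = lift z (icomp C X f g)"
proof -
  note i = ipair_typing[OF X c]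
  have fg: "f \<in> Arr C" "g \<in> Arr C" "Dom C g = Dom C f" "Cod C f = IAr X" "Cod C g = IAr X" "ITgt X \<cdot> f = ISrc X \<cdot> g"
    using c by (simp_all add: composable_def)
  have pb: "is_pullback \<S> (ITgt (pull_icat C I X)) (ISrc (pull_icat C I X)) (ICp (pull_icat C I X)) (IFst (pull_icat C I X)) (ISnd (pull_icat C I X))"
    "Dom \<S> (ITgt (pull_icat C I X)) = IAr (pull_icat C I X)" "Dom \<S> (ISrc (pull_icat C I X)) = IAr (pull_icat C I X)"
    using pull_pullback[OF icat_pb(1)[OF X]] X by simp_all
  have c': "S.composable (pull_icat C I X) (lift z f) (lift z g)"
    using fg z X by (simp add: S.composable_def)
  have "S.ipair (pull_icat C I X) (lift z f) (lift z g) = lift z (ipair X f g)"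
    by (rule S.ipair_eqI[OF pb c']) (use fg z X i in simp_all)
  then show ?thesis
    using i z X by (simp add: S.icomp_ipair icomp_ipair)
qed

lemma is_icat_pull [simp]:
  assumes X: "is_icat C X"
  shows "is_icat \<S> (pull_icat C I X)"
proof (rule S.icatI)
  show "is_pullback \<S> (ITgt (pull_icat C I X)) (ISrc (pull_icat C I X)) (ICp (pull_icat C I X)) (IFst (pull_icat C I X)) (ISnd (pull_icat C I X))"
    using pull_pullback[OF icat_pb(1)[OF X]] by simp
  show "Comp \<S> (ISrc (pull_icat C I X)) (IIde (pull_icat C I X)) = Ide \<S> (IOb (pull_icat C I X))"
    "Comp \<S> (ITgt (pull_icat C I X)) (IIde (pull_icat C I X)) = Ide \<S> (IOb (pull_icat C I X))"
    using X by (simp_all add: pull_ar_comp[symmetric] pull_ar_Ide)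
next
  fix a b assume c: "S.composable (pull_icat C I X) a b"
  obtain z f g where z: "a = lift z f" "b = lift z g" "z \<in> Arr C" "Cod C z = I" "composable X f g" "Dom C f = Dom C z" "Dom C g = Dom C z"
    by (rule composable_lift[OF X c])
  note i = icomp_typing[OF X z(5)]
  show "Comp \<S> (ISrc (pull_icat C I X)) (icomp \<S> (pull_icat C I X) a b) = Comp \<S> (ISrc (pull_icat C I X)) a"
    "Comp \<S> (ITgt (pull_icat C I X)) (icomp \<S> (pull_icat C I X) a b) = Comp \<S> (ITgt (pull_icat C I X)) b"
    using i X z(3-7) unfolding z(1,2) by (simp_all add: icomp_pull composable_def)
next
  fix a assume a: "a \<in> Arr \<S>" "Cod \<S> a = IAr (pull_icat C I X)"
  then have a': "Cod \<S> a = Pr1 C I (IAr X)"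
    by simp
  obtain z where z: "Dom \<S> a = z"
    by simp
  obtain f where f: "a = lift z f" "f \<in> Arr C" "Dom C f = Dom C z" "Cod C f = IAr X" and zz: "z \<in> Arr C" "Cod C z = I"
    by (rule lift_cases[OF a(1) a' icat_data(2)[OF X] z])
  show "icomp \<S> (pull_icat C I X) (Comp \<S> (IIde (pull_icat C I X)) (Comp \<S> (ISrc (pull_icat C I X)) a)) a = a"
    "icomp \<S> (pull_icat C I X) a (Comp \<S> (IIde (pull_icat C I X)) (Comp \<S> (ITgt (pull_icat C I X)) a)) = a"
    using f(2-) zz X unfolding f(1) by (simp_all add: icomp_pull composable_def)
next
  fix a b c assume ab: "S.composable (pull_icat C I X) a b" and bc: "S.composable (pull_icat C I X) b c"
  obtain z f g where z: "a = lift z f" "b = lift z g" "z \<in> Arr C" "Cod C z = I" "composable X f g" "Dom C f = Dom C z" "Dom C g = Dom C z"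
    by (rule composable_lift[OF X ab])
  obtain z' g' h where z': "b = lift z' g'" "c = lift z' h" "z' \<in> Arr C" "Cod C z' = I" "composable X g' h" "Dom C g' = Dom C z'" "Dom C h = Dom C z'"
    by (rule composable_lift[OF X bc])
  have zz: "z' = z"
  proof -
    have "Dom \<S> b = z"
      unfolding z(2) using z(3-7) by (simp add: composable_def)
    moreover have "Dom \<S> b = z'"
      unfolding z'(1) using z'(3-7) by (simp add: composable_def)
    ultimately show ?thesis
      by simp
  qed
  have gg: "g' = g"
  proof -
    have "lift z g' = lift z g"
      using z(2) z'(1) unfolding zz by simp
    then show ?thesis
      using z(3-7) z'(3-7) unfolding zz by (simp add: composable_def)
  qed
  show "icomp \<S> (pull_icat C I X) (icomp \<S> (pull_icat C I X) a b) c = icomp \<S> (pull_icat C I X) a (icomp \<S> (pull_icat C I X) b c)"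
    using z(3-7) z'(5,7) X unfolding z(1,2) z'(2) zz gg
    by (simp add: icomp_pull composable_def icomp_assoc)
qed (use X in simp_all)

lemma functor_pull:
  assumes X: "is_icat C X" and Y: "is_icat C Y" and f: "is_functor X Y f\<^sub>0 f\<^sub>1"
  shows "S.is_functor (pull_icat C I X) (pull_icat C I Y) (pull_ar C I f\<^sub>0) (pull_ar C I f\<^sub>1)"
proof -
  note s = functor_simps[OF f]
  note [simp] = X Y s(1-6)
  show ?thesis
  proof (rule S.functorI)
    fix a assume a: "a \<in> Arr \<S>" "Cod \<S> a = IAr (pull_icat C I X)"
    then have a': "Cod \<S> a = Pr1 C I (IAr X)"
      by simp
    obtain z where z: "Dom \<S> a = z"
      by simp
    obtain x where x: "a = lift z x" "x \<in> Arr C" "Dom C x = Dom C z" "Cod C x = IAr X" and zz: "z \<in> Arr C" "Cod C z = I"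
      by (rule lift_cases[OF a(1) a' icat_data(2)[OF X] z])
    show "Comp \<S> (ISrc (pull_icat C I Y)) (Comp \<S> (pull_ar C I f\<^sub>1) a) = Comp \<S> (pull_ar C I f\<^sub>0) (Comp \<S> (ISrc (pull_icat C I X)) a)"
      "Comp \<S> (ITgt (pull_icat C I Y)) (Comp \<S> (pull_ar C I f\<^sub>1) a) = Comp \<S> (pull_ar C I f\<^sub>0) (Comp \<S> (ITgt (pull_icat C I X)) a)"
      using x(2-) zz unfolding x(1) by (simp_all add: s(7,8))
  next
    fix a assume a: "a \<in> Arr \<S>" "Cod \<S> a = IOb (pull_icat C I X)"
    then have a': "Cod \<S> a = Pr1 C I (IOb X)"
      by simp
    obtain z where z: "Dom \<S> a = z"
      by simp
    obtain x where x: "a = lift z x" "x \<in> Arr C" "Dom C x = Dom C z" "Cod C x = IOb X" and zz: "z \<in> Arr C" "Cod C z = I"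
      by (rule lift_cases[OF a(1) a' icat_data(1)[OF X] z])
    show "Comp \<S> (pull_ar C I f\<^sub>1) (Comp \<S> (IIde (pull_icat C I X)) a) = Comp \<S> (IIde (pull_icat C I Y)) (Comp \<S> (pull_ar C I f\<^sub>0) a)"
      using x(2-) zz unfolding x(1) by (simp add: s(9))
  next
    fix a b assume "a \<in> Arr \<S>" "b \<in> Arr \<S>" "Dom \<S> a = Dom \<S> b" "Cod \<S> a = IAr (pull_icat C I X)" "Cod \<S> b = IAr (pull_icat C I X)"
      "Comp \<S> (ITgt (pull_icat C I X)) a = Comp \<S> (ISrc (pull_icat C I X)) b"
    then have c: "S.composable (pull_icat C I X) a b"
      unfolding S.composable_def by blast
    obtain z f g where z: "a = lift z f" "b = lift z g" "z \<in> Arr C" "Cod C z = I" "composable X f g" "Dom C f = Dom C z" "Dom C g = Dom C z"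
      by (rule composable_lift[OF X c])
    note fg = z(5)[unfolded composable_def]
    have "composable Y (f\<^sub>1 \<cdot> f) (f\<^sub>1 \<cdot> g)"
      using fg by (simp add: composable_def s(7,8))
    then show "Comp \<S> (pull_ar C I f\<^sub>1) (icomp \<S> (pull_icat C I X) a b) =
      icomp \<S> (pull_icat C I Y) (Comp \<S> (pull_ar C I f\<^sub>1) a) (Comp \<S> (pull_ar C I f\<^sub>1) b)"
      using fg z(3-7) unfolding z(1,2) by (simp add: icomp_pull s(10))
  qed simp_all
qed

lemma pull_ifun_simps [simp]:
  "FDom (pull_ifun C I F) = pull_icat C I (FDom F)" "FCod (pull_ifun C I F) = pull_icat C I (FCod F)"
  "FOb (pull_ifun C I F) = pull_ar C I (FOb F)" "FAr (pull_ifun C I F) = pull_ar C I (FAr F)"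
  by (simp_all add: pull_ifun_def)

lemma is_ifun_pull [simp]:
  assumes "is_ifun C F"
  shows "is_ifun \<S> (pull_ifun C I F)"
  using functor_pull[OF ifun_icat[OF assms]] ifun_icat[OF assms] by (simp add: S.is_ifun_iff)


section \<open>Products and the terminal object under \<open>I\<^sup>*\<close>\<close>

lemma prod_lift_cases:
  assumes "a \<in> Arr \<S>" "Dom \<S> a = z" "Cod \<S> a = Prod \<S> (Pr1 C I X) (Pr1 C I Y)" "X \<in> Obj C" "Y \<in> Obj C"
  obtains x y where "a = pair \<S> (lift z x) (lift z y)" "x \<in> Arr C" "y \<in> Arr C" "Dom C x = Dom C z" "Dom C y = Dom C z"
    "Cod C x = X" "Cod C y = Y" "z \<in> Arr C" "Cod C z = I"
proof -
  have XY: "Pr1 C I X \<in> Obj \<S>" "Pr1 C I Y \<in> Obj \<S>"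
    using assms(4,5) by simp_all
  obtain f g where f: "a = pair \<S> f g" "f \<in> Arr \<S>" "g \<in> Arr \<S>" "Dom \<S> f = z" "Dom \<S> g = z" "Cod \<S> f = Pr1 C I X" "Cod \<S> g = Pr1 C I Y"
    by (rule S.Prod_cases[OF assms(1-3) XY])
  obtain x where x: "f = lift z x" "x \<in> Arr C" "Dom C x = Dom C z" "Cod C x = X" "z \<in> Arr C" "Cod C z = I"
    by (rule lift_cases[OF f(2,6) assms(4) f(4)])
  obtain y where y: "g = lift z y" "y \<in> Arr C" "Dom C y = Dom C z" "Cod C y = Y"
    by (rule lift_cases[OF f(3,7) assms(5) f(5)])
  show ?thesis
    using that[of x y] f(1) x y by blast
qed

text \<open>The product in the slice is known through its projections only. These are lifts of
  arrows \<open>x\<close> and \<open>y\<close> out of a common object, and the lift of the pairing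
  of \<open>x\<close> and \<open>y\<close> in the base is the arrow sought.\<close>

lemma theta_ex:
  assumes X: "X \<in> Obj C" and Y: "Y \<in> Obj C"
  shows "\<exists>\<theta>. \<theta> \<in> hom \<S> (Prod \<S> (Pr1 C I X) (Pr1 C I Y)) (Pr1 C I (Prod C X Y)) \<and>
    (\<forall>z x y. z \<in> Arr C \<and> Cod C z = I \<and> x \<in> Arr C \<and> y \<in> Arr C \<and> Dom C x = Dom C z \<and> Dom C y = Dom C z \<and> Cod C x = X \<and> Cod C y = Y \<longrightarrow>
      Comp \<S> \<theta> (pair \<S> (lift z x) (lift z y)) = lift z (pair C x y))"
proof -
  let ?X = "Pr1 C I X" and ?Y = "Pr1 C I Y"
  have XY [simp]: "?X \<in> Obj \<S>" "?Y \<in> Obj \<S>"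
    using X Y by simp_all
  obtain q where q: "Prod \<S> ?X ?Y = q"
    by simp
  note P = S.Prod_simps[OF XY, unfolded q]
  obtain x where x: "Pr1 \<S> ?X ?Y = lift q x" "x \<in> Arr C" "Dom C x = Dom C q" "Cod C x = X" "q \<in> Arr C" "Cod C q = I"
    by (rule lift_cases[OF P(2,4) X P(3)])
  obtain y where y: "Pr2 \<S> ?X ?Y = lift q y" "y \<in> Arr C" "Dom C y = Dom C q" "Cod C y = Y"
    by (rule lift_cases[OF P(5,7) Y P(6)])
  show ?thesis
    unfolding q
  proof (intro exI[of _ "lift q (pair C x y)"] conjI allI impI)
    show "lift q (pair C x y) \<in> hom \<S> q (Pr1 C I (Prod C X Y))"
      using x(2-) y(2-) by simp
    fix z a b assume ab: "z \<in> Arr C \<and> Cod C z = I \<and> a \<in> Arr C \<and> b \<in> Arr C \<and> Dom C a = Dom C z \<and> Dom C b = Dom C z \<and> Cod C a = X \<and> Cod C b = Y"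
    let ?u = "pair \<S> (lift z a) (lift z b)"
    have u: "?u \<in> Arr \<S>" "Dom \<S> ?u = z" "Cod \<S> ?u = q"
      and pu: "Comp \<S> (lift q x) ?u = lift z a" "Comp \<S> (lift q y) ?u = lift z b"
      using ab q by (simp_all add: x(1)[symmetric] y(1)[symmetric])
    obtain h where h: "?u = (z, h, q)" "h \<in> Arr C" "Dom C h = Dom C z" "Cod C h = Dom C q"
      by (rule S_arr_cases[OF u])
    have m: "fst (snd ?u) = h"
      using h(1) by simp
    have "lift z (x \<cdot> h) = lift z a" "lift z (y \<cdot> h) = lift z b"
      using pu Comp_lift[of q x ?u] Comp_lift[of q y ?u] x(2-) y(2-) u m by simp_all
    then have "x \<cdot> h = a" "y \<cdot> h = b"
      using ab x(2-) y(2-) h(2-) by simp_all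
    then show "Comp \<S> (lift q (pair C x y)) ?u = lift z (pair C a b)"
      using Comp_lift[of q "pair C x y" ?u] x(2-) y(2-) u m h(2-) by simp
  qed
qed

text \<open>The canonical isomorphism \<open>I\<^sup>*X \<times> I\<^sup>*Y \<cong> I\<^sup>*(X \<times> Y)\<close>.\<close>

definition theta :: "'o \<Rightarrow> 'o \<Rightarrow> 'a \<times> 'a \<times> 'a" where
  "theta X Y = (SOME \<theta>. \<theta> \<in> hom \<S> (Prod \<S> (Pr1 C I X) (Pr1 C I Y)) (Pr1 C I (Prod C X Y)) \<and>
    (\<forall>z x y. z \<in> Arr C \<and> Cod C z = I \<and> x \<in> Arr C \<and> y \<in> Arr C \<and> Dom C x = Dom C z \<and> Dom C y = Dom C z \<and> Cod C x = X \<and> Cod C y = Y \<longrightarrow>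
      Comp \<S> \<theta> (pair \<S> (lift z x) (lift z y)) = lift z (pair C x y)))"

lemma theta [simp]:
  assumes "X \<in> Obj C" "Y \<in> Obj C"
  shows "theta X Y \<in> Arr \<S>" "Dom \<S> (theta X Y) = Prod \<S> (Pr1 C I X) (Pr1 C I Y)" "Cod \<S> (theta X Y) = Pr1 C I (Prod C X Y)"
    "z \<in> Arr C \<Longrightarrow> Cod C z = I \<Longrightarrow> x \<in> Arr C \<Longrightarrow> y \<in> Arr C \<Longrightarrow> Dom C x = Dom C z \<Longrightarrow> Dom C y = Dom C z \<Longrightarrow>
      Cod C x = X \<Longrightarrow> Cod C y = Y \<Longrightarrow> Comp \<S> (theta X Y) (pair \<S> (lift z x) (lift z y)) = lift z (pair C x y)"
  using someI_ex[OF theta_ex[OF assms], folded theta_def] by simp_all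

lemma functor_theta:
  assumes X: "is_icat C X" and Y: "is_icat C Y"
  shows "S.is_functor (icat_prod \<S> (pull_icat C I X) (pull_icat C I Y)) (pull_icat C I (icat_prod C X Y))
    (theta (IOb X) (IOb Y)) (theta (IAr X) (IAr Y))" (is "S.is_functor ?P ?Q _ _")
proof -
  note [simp] = X Y
  show ?thesis
  proof (rule S.functorI)
    fix a assume a: "a \<in> Arr \<S>" "Cod \<S> a = IAr ?P"
    have a': "Cod \<S> a = Prod \<S> (Pr1 C I (IAr X)) (Pr1 C I (IAr Y))"
      using a(2) by simp
    obtain z x y where x: "a = pair \<S> (lift z x) (lift z y)" "x \<in> Arr C" "y \<in> Arr C" "Dom C x = Dom C z" "Dom C y = Dom C z"
      "Cod C x = IAr X" "Cod C y = IAr Y" "z \<in> Arr C" "Cod C z = I"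
      by (rule prod_lift_cases[OF a(1) refl a' icat_data(2)[OF X] icat_data(2)[OF Y]])
    show "Comp \<S> (ISrc ?Q) (Comp \<S> (theta (IAr X) (IAr Y)) a) = Comp \<S> (theta (IOb X) (IOb Y)) (Comp \<S> (ISrc ?P) a)"
      "Comp \<S> (ITgt ?Q) (Comp \<S> (theta (IAr X) (IAr Y)) a) = Comp \<S> (theta (IOb X) (IOb Y)) (Comp \<S> (ITgt ?P) a)"
      using x(2-) unfolding x(1) by simp_all
  next
    fix a assume a: "a \<in> Arr \<S>" "Cod \<S> a = IOb ?P"
    have a': "Cod \<S> a = Prod \<S> (Pr1 C I (IOb X)) (Pr1 C I (IOb Y))"
      using a(2) by simp
    obtain z x y where x: "a = pair \<S> (lift z x) (lift z y)" "x \<in> Arr C" "y \<in> Arr C" "Dom C x = Dom C z" "Dom C y = Dom C z"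
      "Cod C x = IOb X" "Cod C y = IOb Y" "z \<in> Arr C" "Cod C z = I"
      by (rule prod_lift_cases[OF a(1) refl a' icat_data(1)[OF X] icat_data(1)[OF Y]])
    show "Comp \<S> (theta (IAr X) (IAr Y)) (Comp \<S> (IIde ?P) a) = Comp \<S> (IIde ?Q) (Comp \<S> (theta (IOb X) (IOb Y)) a)"
      using x(2-) unfolding x(1) by simp
  next
    fix a b assume a: "a \<in> Arr \<S>" and b: "b \<in> Arr \<S>" and ab: "Dom \<S> a = Dom \<S> b" and ca: "Cod \<S> a = IAr ?P" and cb: "Cod \<S> b = IAr ?P"
      and e: "Comp \<S> (ITgt ?P) a = Comp \<S> (ISrc ?P) b"
    have c: "Cod \<S> a = Prod \<S> (Pr1 C I (IAr X)) (Pr1 C I (IAr Y))" "Cod \<S> b = Prod \<S> (Pr1 C I (IAr X)) (Pr1 C I (IAr Y))"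
      using ca cb by simp_all
    obtain z where z: "Dom \<S> a = z" "Dom \<S> b = z"
      using ab by simp
    obtain x y where x: "a = pair \<S> (lift z x) (lift z y)" "x \<in> Arr C" "y \<in> Arr C" "Dom C x = Dom C z" "Dom C y = Dom C z"
      "Cod C x = IAr X" "Cod C y = IAr Y" "z \<in> Arr C" "Cod C z = I"
      by (rule prod_lift_cases[OF a z(1) c(1) icat_data(2)[OF X] icat_data(2)[OF Y]])
    obtain x' y' where x': "b = pair \<S> (lift z x') (lift z y')" "x' \<in> Arr C" "y' \<in> Arr C" "Dom C x' = Dom C z" "Dom C y' = Dom C z"
      "Cod C x' = IAr X" "Cod C y' = IAr Y"
      by (rule prod_lift_cases[OF b z(2) c(2) icat_data(2)[OF X] icat_data(2)[OF Y]])
    note [simp] = x(2-) x'(2-)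
    have e': "ITgt X \<cdot> x = ISrc X \<cdot> x'" "ITgt Y \<cdot> y = ISrc Y \<cdot> y'"
      using e unfolding x(1) x'(1) by simp_all
    have cc: "composable X x x'" "composable Y y y'"
      using e' by (simp_all add: composable_def)
    have "icomp \<S> ?P a b = pair \<S> (icomp \<S> (pull_icat C I X) (lift z x) (lift z x')) (icomp \<S> (pull_icat C I Y) (lift z y) (lift z y'))"
      unfolding x(1) x'(1) using e' by (intro S.icomp_prod) simp_all
    also have "\<dots> = pair \<S> (lift z (icomp C X x x')) (lift z (icomp C Y y y'))"
      using cc by (simp add: icomp_pull)
    finally have 1: "icomp \<S> ?P a b = pair \<S> (lift z (icomp C X x x')) (lift z (icomp C Y y y'))" .
    have 2: "Comp \<S> (theta (IAr X) (IAr Y)) a = lift z (pair C x y)" "Comp \<S> (theta (IAr X) (IAr Y)) b = lift z (pair C x' y')"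
      unfolding x(1) x'(1) by simp_all
    have "icomp \<S> ?Q (lift z (pair C x y)) (lift z (pair C x' y')) = lift z (icomp C (icat_prod C X Y) (pair C x y) (pair C x' y'))"
      using e' by (intro icomp_pull) (simp_all add: composable_def)
    also have "\<dots> = lift z (pair C (icomp C X x x') (icomp C Y y y'))"
      using e' by (simp add: icomp_prod)
    finally show "Comp \<S> (theta (IAr X) (IAr Y)) (icomp \<S> ?P a b) =
      icomp \<S> ?Q (Comp \<S> (theta (IAr X) (IAr Y)) a) (Comp \<S> (theta (IAr X) (IAr Y)) b)"
      unfolding 1 2 using e' by simp
  qed simp_all
qed

lemma S_arr_ext:
  assumes "f \<in> hom \<S> (Pr1 C I X) Y" "g \<in> hom \<S> (Pr1 C I X) Y" "X \<in> Obj C"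
    and "\<And>z x. z \<in> Arr C \<Longrightarrow> Cod C z = I \<Longrightarrow> x \<in> Arr C \<Longrightarrow> Dom C x = Dom C z \<Longrightarrow> Cod C x = X \<Longrightarrow>
      Comp \<S> f (lift z x) = Comp \<S> g (lift z x)"
  shows "f = g"
proof (rule S.arr_ext[of f g "Pr1 C I X"])
  fix a assume a: "a \<in> Arr \<S>" "Cod \<S> a = Pr1 C I X"
  obtain z x where x: "a = lift z x" "x \<in> Arr C" "Dom C x = Dom C z" "Cod C x = X" "z \<in> Arr C" "Cod C z = I"
    by (rule lift_cases[OF a assms(3) refl])
  then show "Comp \<S> f a = Comp \<S> g a"
    using assms(4)[of z x] by simp
qed (use assms(1,2) in simp_all)

text \<open>A functor out of the terminal category is determined by its value on the object, and an
  element of \<open>I\<^sup>*1\<close> is the lift of an arrow into \<open>1\<close>. So the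
  definite description has exactly one candidate, which is computed here.\<close>

lemma pull_one_iso:
  shows "is_ifun \<S> (pull_one_iso C I)" "FDom (pull_one_iso C I) = icat_one \<S>" "FCod (pull_one_iso C I) = pull_icat C I (icat_one C)"
    "FOb (pull_one_iso C I) = lift (Ide C I) (bang I)"
proof -
  let ?u = "lift (Ide C I) (bang I)"
  let ?U = "\<lparr>FDom = icat_one \<S>, FCod = pull_icat C I (icat_one C), FOb = ?u, FAr = Comp \<S> (IIde (pull_icat C I (icat_one C))) ?u\<rparr>"
  have one: "is_icat \<S> (pull_icat C I (icat_one C))"
    by simp
  have U: "is_ifun \<S> ?U"
    using S.functor_one_iff[OF one, of ?u "Comp \<S> (IIde (pull_icat C I (icat_one C))) ?u"] by (simp add: S.is_ifun_iff)
  have un: "W = ?U" if W: "is_ifun \<S> W" "FDom W = icat_one \<S>" "FCod W = pull_icat C I (icat_one C)" for W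
  proof -
    note w = S.functor_one[OF one S.ifun_icat(3)[OF W(1), unfolded W(2,3)]]
    have w0: "FOb W \<in> Arr \<S>" "Cod \<S> (FOb W) = Pr1 C I (One C)" "Dom \<S> (FOb W) = Ide C I"
      using w(1) by simp_all
    obtain y where y: "FOb W = lift (Ide C I) y" "y \<in> Arr C" "Dom C y = Dom C (Ide C I)" "Cod C y = One C"
      by (rule lift_cases[OF w0(1,2) One_Obj w0(3)])
    have "y = bang I"
      using bang_eq[OF y(2,4)] y(3) by simp
    then show ?thesis
      using w(2) y(1) W by (intro ifun_eqI) simp_all
  qed
  have "(THE u. u \<in> hom (Cat \<S>) (One (Cat \<S>)) (pull_icat C I (One (Cat C)))) = ?U"
  proof (rule the_equality)
    show "?U \<in> hom (Cat \<S>) (One (Cat \<S>)) (pull_icat C I (One (Cat C)))"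
      using U by (simp add: hom_def[of "Cat \<S>"] S.Cat_simps(2-4,7) Cat_simps(7))
    show "W = ?U" if "W \<in> hom (Cat \<S>) (One (Cat \<S>)) (pull_icat C I (One (Cat C)))" for W
      using that by (intro un) (simp_all add: hom_def[of "Cat \<S>"] S.Cat_simps(2-4,7) Cat_simps(7))
  qed
  then have e: "pull_one_iso C I = ?U"
    by (simp add: pull_one_iso_def)
  show "is_ifun \<S> (pull_one_iso C I)" "FDom (pull_one_iso C I) = icat_one \<S>" "FCod (pull_one_iso C I) = pull_icat C I (icat_one C)"
    "FOb (pull_one_iso C I) = lift (Ide C I) (bang I)"
    unfolding e using U by simp_all
qed

end

section \<open>Comparison of \<open>I\<^sup>*[D, A]\<close> with the exponential of the
  slice\<close>

locale ccc_pull = ccc C + slice_pull C I for C :: "('o, 'a) cart_category" (structure) and I +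
  assumes closed_S: "cartesian_closed (slice C I)"
begin

sublocale S: ccc \<S>
  by unfold_locales (rule closed_S)

context
  fixes D A :: "('o, 'a) icat"
  assumes D [simp]: "is_icat C D" and A [simp]: "is_icat C A"
begin

private abbreviation "\<X> \<equiv> Exp (Cat C) D A"
private abbreviation "\<E> \<equiv> Ev (Cat C) D A"
private abbreviation "\<X>' \<equiv> Exp (Cat \<S>) (pull_icat C I D) (pull_icat C I A)"
private abbreviation "\<E>' \<equiv> Ev (Cat \<S>) (pull_icat C I D) (pull_icat C I A)"

private lemmas evP = is_exp_cat_of_is_exponential[OF D A Exp_Cat[OF D A]]
private lemmas evS = S.is_exp_cat_of_is_exponential[OF is_icat_pull[OF D] is_icat_pull[OF A] S.Exp_Cat[OF is_icat_pull[OF D] is_icat_pull[OF A]]]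
private lemmas evPD = is_exp_catD[OF evP(4)] and evSD = S.is_exp_catD[OF evS(4)]
private lemmas evPf = functor_simps(1-6)[OF evPD(2), simplified icat_prod_simps]
private lemmas evSf = S.functor_simps(1-6)[OF evSD(2), simplified S.icat_prod_simps pull_icat_simps]

text \<open>The equation that defines \<open>pull_exp_iso\<close>, tested on elements: evaluation in
  the slice after \<open>k\<close> is the lift of evaluation in the base. \<open>k_condition\<close>
  relates the two forms.\<close>

private definition "is_k k \<longleftrightarrow> is_ifun \<S> k \<and> FDom k = pull_icat C I \<X> \<and> FCod k = \<X>' \<and>
  (\<forall>z x d. z \<in> Arr C \<and> Cod C z = I \<and> el2 x d (IOb \<X>) (IOb D) \<and> Dom C x = Dom C z \<longrightarrow>
    Comp \<S> (FOb \<E>') (pair \<S> (Comp \<S> (FOb k) (lift z x)) (lift z d)) = lift z (FOb \<E> \<cdot> pair C x d)) \<and>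
  (\<forall>z x d. z \<in> Arr C \<and> Cod C z = I \<and> el2 x d (IAr \<X>) (IAr D) \<and> Dom C x = Dom C z \<longrightarrow>
    Comp \<S> (FAr \<E>') (pair \<S> (Comp \<S> (FAr k) (lift z x)) (lift z d)) = lift z (FAr \<E> \<cdot> pair C x d))"

private lemma k_condition:
  assumes k: "is_ifun \<S> k" "FDom k = pull_icat C I \<X>" "FCod k = \<X>'"
  shows "Comp (Cat \<S>) \<E>' (pair (Cat \<S>) (Comp (Cat \<S>) k (pull_ifun C I (Pr1 (Cat C) \<X> D))) (pull_ifun C I (Pr2 (Cat C) \<X> D)))
    = pull_ifun C I \<E> \<longleftrightarrow> is_k k"
proof -
  note [simp] = evPD(1) evSD(1) evPf evSf S.ifun_simps(1-6)[OF k(1), unfolded k(2,3), simplified pull_icat_simps]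
  have P: "is_ifun C (Pr1 (Cat C) \<X> D)" "is_ifun C (Pr2 (Cat C) \<X> D)"
    using functor_Pr1[OF evPD(1) D] functor_Pr2[OF evPD(1) D] by (simp_all add: is_ifun_iff Cat_simps(9,10))
  have kP: "is_ifun \<S> (ifun_comp \<S> k (pull_ifun C I (Pr1 (Cat C) \<X> D)))"
    using P k by (intro S.ifun_comp_is_ifun) (simp_all add: Cat_simps(9))
  have pr: "pair (Cat \<S>) (Comp (Cat \<S>) k (pull_ifun C I (Pr1 (Cat C) \<X> D))) (pull_ifun C I (Pr2 (Cat C) \<X> D)) =
    \<lparr>FDom = pull_icat C I (icat_prod C \<X> D), FCod = icat_prod \<S> \<X>' (pull_icat C I D),
     FOb = pair \<S> (Comp \<S> (FOb k) (pull_ar C I (Pr1 C (IOb \<X>) (IOb D)))) (pull_ar C I (Pr2 C (IOb \<X>) (IOb D))),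
     FAr = pair \<S> (Comp \<S> (FAr k) (pull_ar C I (Pr1 C (IAr \<X>) (IAr D)))) (pull_ar C I (Pr2 C (IAr \<X>) (IAr D)))\<rparr>"
    using S.pair_Cat[OF kP is_ifun_pull[OF P(2)]] k P by (simp add: S.Cat_simps(6) Cat_simps(9,10))
  have 0: "Comp \<S> (FOb \<E>') (pair \<S> (Comp \<S> (FOb k) (pull_ar C I (Pr1 C (IOb \<X>) (IOb D)))) (pull_ar C I (Pr2 C (IOb \<X>) (IOb D)))) = pull_ar C I (FOb \<E>)
    \<longleftrightarrow> (\<forall>z x d. z \<in> Arr C \<and> Cod C z = I \<and> el2 x d (IOb \<X>) (IOb D) \<and> Dom C x = Dom C z \<longrightarrow>
    Comp \<S> (FOb \<E>') (pair \<S> (Comp \<S> (FOb k) (lift z x)) (lift z d)) = lift z (FOb \<E> \<cdot> pair C x d))" (is "?f = ?g \<longleftrightarrow> ?R")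
  proof
    assume e: "?f = ?g"
    show ?R
    proof (intro allI impI)
      fix z x d assume a: "z \<in> Arr C \<and> Cod C z = I \<and> el2 x d (IOb \<X>) (IOb D) \<and> Dom C x = Dom C z"
      have "Comp \<S> ?f (lift z (pair C x d)) = Comp \<S> ?g (lift z (pair C x d))"
        using e by simp
      then show "Comp \<S> (FOb \<E>') (pair \<S> (Comp \<S> (FOb k) (lift z x)) (lift z d)) = lift z (FOb \<E> \<cdot> pair C x d)"
        using a by simp
    qed
  next
    assume R: ?R
    show "?f = ?g"
    proof (rule S_arr_ext)
      fix z x assume x: "z \<in> Arr C" "Cod C z = I" "x \<in> Arr C" "Dom C x = Dom C z" "Cod C x = Prod C (IOb \<X>) (IOb D)"
      show "Comp \<S> ?f (lift z x) = Comp \<S> ?g (lift z x)"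
        using R[rule_format, of z "Pr1 C (IOb \<X>) (IOb D) \<cdot> x" "Pr2 C (IOb \<X>) (IOb D) \<cdot> x"] x by simp
    qed simp_all
  qed
  have 1: "Comp \<S> (FAr \<E>') (pair \<S> (Comp \<S> (FAr k) (pull_ar C I (Pr1 C (IAr \<X>) (IAr D)))) (pull_ar C I (Pr2 C (IAr \<X>) (IAr D)))) = pull_ar C I (FAr \<E>)
    \<longleftrightarrow> (\<forall>z x d. z \<in> Arr C \<and> Cod C z = I \<and> el2 x d (IAr \<X>) (IAr D) \<and> Dom C x = Dom C z \<longrightarrow>
    Comp \<S> (FAr \<E>') (pair \<S> (Comp \<S> (FAr k) (lift z x)) (lift z d)) = lift z (FAr \<E> \<cdot> pair C x d))" (is "?f = ?g \<longleftrightarrow> ?R")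
  proof
    assume e: "?f = ?g"
    show ?R
    proof (intro allI impI)
      fix z x d assume a: "z \<in> Arr C \<and> Cod C z = I \<and> el2 x d (IAr \<X>) (IAr D) \<and> Dom C x = Dom C z"
      have "Comp \<S> ?f (lift z (pair C x d)) = Comp \<S> ?g (lift z (pair C x d))"
        using e by simp
      then show "Comp \<S> (FAr \<E>') (pair \<S> (Comp \<S> (FAr k) (lift z x)) (lift z d)) = lift z (FAr \<E> \<cdot> pair C x d)"
        using a by simp
    qed
  next
    assume R: ?R
    show "?f = ?g"
    proof (rule S_arr_ext)
      fix z x assume x: "z \<in> Arr C" "Cod C z = I" "x \<in> Arr C" "Dom C x = Dom C z" "Cod C x = Prod C (IAr \<X>) (IAr D)"
      show "Comp \<S> ?f (lift z x) = Comp \<S> ?g (lift z x)"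
        using R[rule_format, of z "Pr1 C (IAr \<X>) (IAr D) \<cdot> x" "Pr2 C (IAr \<X>) (IAr D) \<cdot> x"] x by simp
    qed simp_all
  qed
  have "Comp (Cat \<S>) \<E>' (pair (Cat \<S>) (Comp (Cat \<S>) k (pull_ifun C I (Pr1 (Cat C) \<X> D))) (pull_ifun C I (Pr2 (Cat C) \<X> D))) =
    pull_ifun C I \<E> \<longleftrightarrow>
    Comp \<S> (FOb \<E>') (pair \<S> (Comp \<S> (FOb k) (pull_ar C I (Pr1 C (IOb \<X>) (IOb D)))) (pull_ar C I (Pr2 C (IOb \<X>) (IOb D)))) = pull_ar C I (FOb \<E>) \<and>
    Comp \<S> (FAr \<E>') (pair \<S> (Comp \<S> (FAr k) (pull_ar C I (Pr1 C (IAr \<X>) (IAr D)))) (pull_ar C I (Pr2 C (IAr \<X>) (IAr D)))) = pull_ar C I (FAr \<E>)"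
    unfolding pr unfolding S.Cat_simps(6) ifun_comp_def pull_ifun_def by (simp add: evP(2,3) evS(2,3))
  then show ?thesis
    unfolding 0 1 is_k_def using k by simp
qed

text \<open>Existence: transpose the pulled back evaluation after \<open>theta\<close>. Uniqueness:
  functors into the exponential of the slice are separated by evaluation, and the elements to be
  tested are all lifts.\<close>

private lemma k_ex: "\<exists>!k. is_k k"
proof -
  note [simp] = evPD(1) evSD(1) evPf evSf
  let ?f\<^sub>0 = "Comp \<S> (pull_ar C I (FOb \<E>)) (theta (IOb \<X>) (IOb D))"
  let ?f\<^sub>1 = "Comp \<S> (pull_ar C I (FAr \<E>)) (theta (IAr \<X>) (IAr D))"
  have "S.is_functor (icat_prod \<S> (pull_icat C I \<X>) (pull_icat C I D)) (pull_icat C I A) ?f\<^sub>0 ?f\<^sub>1"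
    by (rule S.functor_comp[OF _ _ _ functor_theta[OF evPD(1) D] functor_pull[OF _ A evPD(2)]]) simp_all
  then obtain k\<^sub>0 k\<^sub>1 where k: "S.is_functor (pull_icat C I \<X>) \<X>' k\<^sub>0 k\<^sub>1"
    and k0: "\<And>t x. S.el2 t x (IOb (pull_icat C I \<X>)) (IOb (pull_icat C I D)) \<Longrightarrow> Comp \<S> (FOb \<E>') (pair \<S> (Comp \<S> k\<^sub>0 t) x) = Comp \<S> ?f\<^sub>0 (pair \<S> t x)"
    and k1: "\<And>t x. S.el2 t x (IAr (pull_icat C I \<X>)) (IAr (pull_icat C I D)) \<Longrightarrow> Comp \<S> (FAr \<E>') (pair \<S> (Comp \<S> k\<^sub>1 t) x) = Comp \<S> ?f\<^sub>1 (pair \<S> t x)"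
    using evSD(3)[of "pull_icat C I \<X>" ?f\<^sub>0 ?f\<^sub>1] is_icat_pull[OF evPD(1)] by blast
  let ?k = "\<lparr>FDom = pull_icat C I \<X>, FCod = \<X>', FOb = k\<^sub>0, FAr = k\<^sub>1\<rparr>"
  have "is_k ?k"
    unfolding is_k_def using k by (simp add: S.is_ifun_iff k0 k1)
  moreover have "l = m" if l: "is_k l" and m: "is_k m" for l m
  proof -
    have L: "is_ifun \<S> l" "FDom l = pull_icat C I \<X>" "FCod l = \<X>'" and M: "is_ifun \<S> m" "FDom m = pull_icat C I \<X>" "FCod m = \<X>'"
      using l m by (simp_all add: is_k_def)
    have "FOb l = FOb m \<and> FAr l = FAr m"
    proof (rule evSD(4)[OF is_icat_pull[OF evPD(1)] S.ifun_icat(3)[OF L(1), unfolded L(2,3)] S.ifun_icat(3)[OF M(1), unfolded M(2,3)]])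
      fix t x assume a: "S.el2 t x (IOb (pull_icat C I \<X>)) (IOb (pull_icat C I D))"
      have b: "t \<in> Arr \<S>" "Cod \<S> t = Pr1 C I (IOb \<X>)" "x \<in> Arr \<S>" "Cod \<S> x = Pr1 C I (IOb D)" "Dom \<S> x = Dom \<S> t"
        using a by simp_all
      obtain u where u: "t = lift (Dom \<S> t) u" "u \<in> Arr C" "Dom C u = Dom C (Dom \<S> t)" "Cod C u = IOb \<X>" "Dom \<S> t \<in> Arr C" "Cod C (Dom \<S> t) = I"
        by (rule lift_cases[OF b(1,2) icat_data(1)[OF evPD(1)] refl])
      obtain v where v: "x = lift (Dom \<S> t) v" "v \<in> Arr C" "Dom C v = Dom C (Dom \<S> t)" "Cod C v = IOb D"
        by (rule lift_cases[OF b(3,4) icat_data(1)[OF D] b(5)])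
      have "Comp \<S> (FOb \<E>') (pair \<S> (Comp \<S> (FOb l) (lift (Dom \<S> t) u)) (lift (Dom \<S> t) v)) =
        Comp \<S> (FOb \<E>') (pair \<S> (Comp \<S> (FOb m) (lift (Dom \<S> t) u)) (lift (Dom \<S> t) v))"
        using l m u(2-) v(2-) unfolding is_k_def by simp
      then show "Comp \<S> (FOb \<E>') (pair \<S> (Comp \<S> (FOb l) t) x) = Comp \<S> (FOb \<E>') (pair \<S> (Comp \<S> (FOb m) t) x)"
        using u(1) v(1) by simp
    next
      fix t x assume a: "S.el2 t x (IAr (pull_icat C I \<X>)) (IAr (pull_icat C I D))"
      have b: "t \<in> Arr \<S>" "Cod \<S> t = Pr1 C I (IAr \<X>)" "x \<in> Arr \<S>" "Cod \<S> x = Pr1 C I (IAr D)" "Dom \<S> x = Dom \<S> t"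
        using a by simp_all
      obtain u where u: "t = lift (Dom \<S> t) u" "u \<in> Arr C" "Dom C u = Dom C (Dom \<S> t)" "Cod C u = IAr \<X>" "Dom \<S> t \<in> Arr C" "Cod C (Dom \<S> t) = I"
        by (rule lift_cases[OF b(1,2) icat_data(2)[OF evPD(1)] refl])
      obtain v where v: "x = lift (Dom \<S> t) v" "v \<in> Arr C" "Dom C v = Dom C (Dom \<S> t)" "Cod C v = IAr D"
        by (rule lift_cases[OF b(3,4) icat_data(2)[OF D] b(5)])
      have "Comp \<S> (FAr \<E>') (pair \<S> (Comp \<S> (FAr l) (lift (Dom \<S> t) u)) (lift (Dom \<S> t) v)) =
        Comp \<S> (FAr \<E>') (pair \<S> (Comp \<S> (FAr m) (lift (Dom \<S> t) u)) (lift (Dom \<S> t) v))"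
        using l m u(2-) v(2-) unfolding is_k_def by simp
      then show "Comp \<S> (FAr \<E>') (pair \<S> (Comp \<S> (FAr l) t) x) = Comp \<S> (FAr \<E>') (pair \<S> (Comp \<S> (FAr m) t) x)"
        using u(1) v(1) by simp
    qed
    then show ?thesis
      using L M by (intro ifun_eqI) simp_all
  qed
  ultimately show ?thesis
    by blast
qed

lemma pull_exp_iso:
  defines "k \<equiv> pull_exp_iso C I D A"
  shows "is_ifun \<S> k" "FDom k = pull_icat C I (Exp (Cat C) D A)"
    "FCod k = Exp (Cat \<S>) (pull_icat C I D) (pull_icat C I A)"
    "\<And>z x d. z \<in> Arr C \<Longrightarrow> Cod C z = I \<Longrightarrow> x \<in> Arr C \<Longrightarrow> d \<in> Arr C \<Longrightarrow> Dom C x = Dom C z \<Longrightarrow> Dom C d = Dom C z \<Longrightarrow>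
      Cod C x = IOb (Exp (Cat C) D A) \<Longrightarrow> Cod C d = IOb D \<Longrightarrow>
      Comp \<S> (FOb (Ev (Cat \<S>) (pull_icat C I D) (pull_icat C I A))) (pair \<S> (Comp \<S> (FOb k) (lift z x)) (lift z d)) =
        lift z (FOb (Ev (Cat C) D A) \<cdot> pair C x d)"
    "\<And>z x d. z \<in> Arr C \<Longrightarrow> Cod C z = I \<Longrightarrow> x \<in> Arr C \<Longrightarrow> d \<in> Arr C \<Longrightarrow> Dom C x = Dom C z \<Longrightarrow> Dom C d = Dom C z \<Longrightarrow>
      Cod C x = IAr (Exp (Cat C) D A) \<Longrightarrow> Cod C d = IAr D \<Longrightarrow>
      Comp \<S> (FAr (Ev (Cat \<S>) (pull_icat C I D) (pull_icat C I A))) (pair \<S> (Comp \<S> (FAr k) (lift z x)) (lift z d)) =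
        lift z (FAr (Ev (Cat C) D A) \<cdot> pair C x d)"
proof -
  have h: "l \<in> hom (Cat \<S>) (pull_icat C I \<X>) \<X>' \<longleftrightarrow> is_ifun \<S> l \<and> FDom l = pull_icat C I \<X> \<and> FCod l = \<X>'" for l
    by (simp add: hom_def[of "Cat \<S>"] S.Cat_simps(2-4))
  have "l \<in> hom (Cat \<S>) (pull_icat C I \<X>) \<X>' \<and>
      Comp (Cat \<S>) \<E>' (pair (Cat \<S>) (Comp (Cat \<S>) l (pull_ifun C I (Pr1 (Cat C) \<X> D))) (pull_ifun C I (Pr2 (Cat C) \<X> D))) = pull_ifun C I \<E>
      \<longleftrightarrow> is_k l" for l
    unfolding h using k_condition[of l] by (auto simp: is_k_def)
  then have "k = (THE l. is_k l)"
    by (simp add: k_def pull_exp_iso_def Let_def)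
  then have "is_k k"
    using theI'[OF k_ex] by simp
  then show "is_ifun \<S> k" "FDom k = pull_icat C I \<X>" "FCod k = \<X>'"
    "\<And>z x d. z \<in> Arr C \<Longrightarrow> Cod C z = I \<Longrightarrow> x \<in> Arr C \<Longrightarrow> d \<in> Arr C \<Longrightarrow> Dom C x = Dom C z \<Longrightarrow> Dom C d = Dom C z \<Longrightarrow>
      Cod C x = IOb \<X> \<Longrightarrow> Cod C d = IOb D \<Longrightarrow>
      Comp \<S> (FOb \<E>') (pair \<S> (Comp \<S> (FOb k) (lift z x)) (lift z d)) = lift z (FOb \<E> \<cdot> pair C x d)"
    "\<And>z x d. z \<in> Arr C \<Longrightarrow> Cod C z = I \<Longrightarrow> x \<in> Arr C \<Longrightarrow> d \<in> Arr C \<Longrightarrow> Dom C x = Dom C z \<Longrightarrow> Dom C d = Dom C z \<Longrightarrow>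
      Cod C x = IAr \<X> \<Longrightarrow> Cod C d = IAr D \<Longrightarrow>
      Comp \<S> (FAr \<E>') (pair \<S> (Comp \<S> (FAr k) (lift z x)) (lift z d)) = lift z (FAr \<E> \<cdot> pair C x d)"
    unfolding is_k_def by simp_all
qed

end

end

context ccc
begin

section \<open>Universal cones and cocones through generalised elements\<close>

text \<open>A cone over \<open>Z\<^sup>*F\<close> in the slice over \<open>Z\<close> is a \<open>Z\<close>-indexed family of cones over \<open>F\<close>.\<close>

definition gcone :: "('o, 'a) ifun \<Rightarrow> 'o \<Rightarrow> 'a \<Rightarrow> 'a \<Rightarrow> bool" where
  "gcone F Z v \<mu> \<longleftrightarrow> v \<in> hom C Z (IOb (FCod F)) \<and> \<mu> \<in> hom C (Prod C Z (IOb (FDom F))) (IAr (FCod F)) \<and>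
    (\<forall>t x. el2 t x Z (IOb (FDom F)) \<longrightarrow>
      ISrc (FCod F) \<cdot> (\<mu> \<cdot> pair C t x) = v \<cdot> t \<and> ITgt (FCod F) \<cdot> (\<mu> \<cdot> pair C t x) = FOb F \<cdot> x) \<and>
    (\<forall>t d. el2 t d Z (IAr (FDom F)) \<longrightarrow>
      icomp C (FCod F) (\<mu> \<cdot> pair C t (ISrc (FDom F) \<cdot> d)) (FAr F \<cdot> d) = \<mu> \<cdot> pair C t (ITgt (FDom F) \<cdot> d))"

definition gcocone :: "('o, 'a) ifun \<Rightarrow> 'o \<Rightarrow> 'a \<Rightarrow> 'a \<Rightarrow> bool" where
  "gcocone F Z v \<mu> \<longleftrightarrow> v \<in> hom C Z (IOb (FCod F)) \<and> \<mu> \<in> hom C (Prod C Z (IOb (FDom F))) (IAr (FCod F)) \<and>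
    (\<forall>t x. el2 t x Z (IOb (FDom F)) \<longrightarrow>
      ISrc (FCod F) \<cdot> (\<mu> \<cdot> pair C t x) = FOb F \<cdot> x \<and> ITgt (FCod F) \<cdot> (\<mu> \<cdot> pair C t x) = v \<cdot> t) \<and>
    (\<forall>t d. el2 t d Z (IAr (FDom F)) \<longrightarrow>
      icomp C (FCod F) (FAr F \<cdot> d) (\<mu> \<cdot> pair C t (ITgt (FDom F) \<cdot> d)) = \<mu> \<cdot> pair C t (ISrc (FDom F) \<cdot> d))"

text \<open>The cone is global, an \<open>econe\<close>, whereas its competitors live at an
  arbitrary stage \<open>Z\<close>. By \<open>econe_pull_iff\<close> the latter are the cones over
  \<open>Z\<^sup>*F\<close>, so the quantifier over \<open>Z\<close> is the quantifier over slices
  in \<open>universal_cone\<close>; the vertex at stage \<open>Z\<close> is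
  \<open>v \<cdot> bang Z\<close>.\<close>

definition euniv :: "('o, 'a) ifun \<Rightarrow> 'a \<Rightarrow> 'a \<Rightarrow> bool" where
  "euniv F v \<kappa> \<longleftrightarrow> econe F v \<kappa> \<and> (\<forall>Z\<in>Obj C. \<forall>u \<mu>. gcone F Z u \<mu> \<longrightarrow>
    (\<exists>!h. h \<in> hom C Z (IAr (FCod F)) \<and> ISrc (FCod F) \<cdot> h = u \<and> ITgt (FCod F) \<cdot> h = v \<cdot> bang Z \<and>
      icomp C (FCod F) (h \<cdot> Pr1 C Z (IOb (FDom F))) (\<kappa> \<cdot> Pr2 C Z (IOb (FDom F))) = \<mu>))"

definition ecouniv :: "('o, 'a) ifun \<Rightarrow> 'a \<Rightarrow> 'a \<Rightarrow> bool" where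
  "ecouniv F v \<kappa> \<longleftrightarrow> ecocone F v \<kappa> \<and> (\<forall>Z\<in>Obj C. \<forall>u \<mu>. gcocone F Z u \<mu> \<longrightarrow>
    (\<exists>!h. h \<in> hom C Z (IAr (FCod F)) \<and> ISrc (FCod F) \<cdot> h = v \<cdot> bang Z \<and> ITgt (FCod F) \<cdot> h = u \<and>
      icomp C (FCod F) (\<kappa> \<cdot> Pr2 C Z (IOb (FDom F))) (h \<cdot> Pr1 C Z (IOb (FDom F))) = \<mu>))"

end

context ccc_pull
begin

section \<open>Cones and cocones over a pulled back diagram\<close>

context
  fixes F :: "('o, 'a) ifun" and D A :: "('o, 'a) icat"
  assumes F: "is_ifun C F" and FD: "FDom F = D" and FA: "FCod F = A"
begin

private abbreviation "\<Y> \<equiv> Exp (Cat C) D A"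
private abbreviation "\<V> \<equiv> Ev (Cat C) D A"
private abbreviation "D' \<equiv> pull_icat C I D"
private abbreviation "A' \<equiv> pull_icat C I A"
private abbreviation "F' \<equiv> pull_ifun C I F"
private abbreviation "\<Y>' \<equiv> Exp (Cat \<S>) D' A'"
private abbreviation "\<V>' \<equiv> Ev (Cat \<S>) D' A'"
private abbreviation "k \<equiv> pull_exp_iso C I D A"
private abbreviation "one \<equiv> pull_one_iso C I"

private lemma cD: "is_icat C D" and cA: "is_icat C A"
  using ifun_icat[OF F] FD FA by simp_all

private lemma F': "is_ifun \<S> F'" "FDom F' = D'" "FCod F' = A'"
  using F FD FA by simp_all

private lemmas kk = pull_exp_iso[OF cD cA]
private lemmas XE = is_exp_cat_of_is_exponential(4)[OF cD cA Exp_Cat[OF cD cA]]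
private lemmas XE' = S.is_exp_cat_of_is_exponential(4)[OF is_icat_pull[OF cD] is_icat_pull[OF cA] S.Exp_Cat[OF is_icat_pull[OF cD] is_icat_pull[OF cA]]]
private lemmas cX = is_exp_catD(1)[OF XE]
private lemmas cX' = S.is_exp_catD(1)[OF XE']
private lemmas kf = S.functor_simps[OF S.ifun_icat(3)[OF kk(1)], unfolded kk(2,3), simplified pull_icat_simps]
private lemmas dg = diag_simps[OF cD cA]
private lemmas dg' = S.diag_simps[OF is_icat_pull[OF cD] is_icat_pull[OF cA]]
private lemmas dgf = functor_simps(1-6)[OF ifun_icat(3)[OF dg(1)], unfolded dg(2,3)]
private lemmas dgf' = S.functor_simps(1-6)[OF S.ifun_icat(3)[OF dg'(1)], unfolded dg'(2,3), simplified pull_icat_simps]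
private lemmas ptt = point_simps[OF F FD FA]
private lemmas ptt' = S.point_simps[OF F']
private lemmas ptf = functor_simps(1-6)[OF ifun_icat(3)[OF ptt(1)], unfolded ptt(2,3), simplified icat_one_simps]
private lemmas Ff = functor_simps(1-6)[OF ifun_icat(3)[OF F], unfolded FD FA]
private lemmas evf = functor_simps(1-6)[OF is_exp_catD(2)[OF XE], simplified icat_prod_simps]
private lemmas evf' = S.functor_simps(1-6)[OF S.is_exp_catD(2)[OF XE'], simplified S.icat_prod_simps pull_icat_simps]
private lemmas tys = cD cA cX cX' kf(1-6) dgf dgf' ptf Ff evf evf'

private lemma one_arr: "FAr one = lift (Ide C I) (bang I)"
proof -
  have "FAr one = Comp \<S> (IIde (pull_icat C I (icat_one C))) (FOb one)"
    by (rule S.functor_one(2)[OF is_icat_pull[OF is_icat_one] S.ifun_icat(3)[OF pull_one_iso(1), unfolded pull_one_iso(2,3)]])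
  then show ?thesis
    by (simp add: pull_one_iso(4))
qed

text \<open>Both sides are functors into an exponential of the slice, hence are compared by
  evaluation: at an element \<open>a\<close> of \<open>I\<^sup>*A\<close> and any \<open>x\<close>
  both give \<open>a\<close>.\<close>

private lemma k_diag: "ifun_comp \<S> k (pull_ifun C I (diag C D A)) = diag \<S> D' A'"
proof -
  let ?k = "ifun_comp \<S> k (pull_ifun C I (diag C D A))"
  have k: "is_ifun \<S> ?k" "FDom ?k = A'" "FCod ?k = \<Y>'"
    using kk(1-3) dg(1-3) by (simp_all add: S.ifun_comp_is_ifun)
  have "FOb ?k = FOb (diag \<S> D' A') \<and> FAr ?k = FAr (diag \<S> D' A')"
  proof (rule S.is_exp_catD(4)[OF XE' is_icat_pull[OF cA] S.ifun_icat(3)[OF k(1), unfolded k(2,3)] S.ifun_icat(3)[OF dg'(1), unfolded dg'(2,3)]])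
    fix t x assume a: "S.el2 t x (IOb A') (IOb D')"
    have b: "t \<in> Arr \<S>" "Cod \<S> t = Pr1 C I (IOb A)" "x \<in> Arr \<S>" "Cod \<S> x = Pr1 C I (IOb D)"
      using a by simp_all
    obtain z where z: "Dom \<S> t = z" "Dom \<S> x = z"
      using a by simp
    obtain u where u: "t = lift z u" "u \<in> Arr C" "Dom C u = Dom C z" "Cod C u = IOb A" "z \<in> Arr C" "Cod C z = I"
      by (rule lift_cases[OF b(1,2) icat_data(1)[OF cA] z(1)])
    obtain v where v: "x = lift z v" "v \<in> Arr C" "Dom C v = Dom C z" "Cod C v = IOb D"
      by (rule lift_cases[OF b(3,4) icat_data(1)[OF cD] z(2)])
    show "Comp \<S> (FOb \<V>') (pair \<S> (Comp \<S> (FOb ?k) t) x) = Comp \<S> (FOb \<V>') (pair \<S> (Comp \<S> (FOb (diag \<S> D' A')) t) x)"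
      using u(2-) v(2-) unfolding u(1) v(1) by (simp add: tys kk(4) dg(4) dg'(4))
  next
    fix t x assume a: "S.el2 t x (IAr A') (IAr D')"
    have b: "t \<in> Arr \<S>" "Cod \<S> t = Pr1 C I (IAr A)" "x \<in> Arr \<S>" "Cod \<S> x = Pr1 C I (IAr D)"
      using a by simp_all
    obtain z where z: "Dom \<S> t = z" "Dom \<S> x = z"
      using a by simp
    obtain u where u: "t = lift z u" "u \<in> Arr C" "Dom C u = Dom C z" "Cod C u = IAr A" "z \<in> Arr C" "Cod C z = I"
      by (rule lift_cases[OF b(1,2) icat_data(2)[OF cA] z(1)])
    obtain v where v: "x = lift z v" "v \<in> Arr C" "Dom C v = Dom C z" "Cod C v = IAr D"
      by (rule lift_cases[OF b(3,4) icat_data(2)[OF cD] z(2)])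
    show "Comp \<S> (FAr \<V>') (pair \<S> (Comp \<S> (FAr ?k) t) x) = Comp \<S> (FAr \<V>') (pair \<S> (Comp \<S> (FAr (diag \<S> D' A')) t) x)"
      using u(2-) v(2-) unfolding u(1) v(1) by (simp add: tys kk(5) dg(5) dg'(5))
  qed
  then show ?thesis
    using k dg'(2,3) by (intro ifun_eqI) simp_all
qed

private lemma S_to_One: "t \<in> Arr \<S> \<Longrightarrow> Cod \<S> t = Ide C I \<Longrightarrow> Dom \<S> t = z \<Longrightarrow> z \<in> Arr C \<Longrightarrow> Cod C z = I \<Longrightarrow> t = (z, z, Ide C I)"
  using S.bang_eq[of t] by simp

text \<open>As for the diagonal, by evaluation: at \<open>x\<close> both sides give the value of
  \<open>I\<^sup>*F\<close> at \<open>x\<close>. An element of the terminal object of the slice at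
  \<open>z\<close> is the triple of \<open>z\<close>, \<open>z\<close> and the identity of
  \<open>I\<close>.\<close>

private lemma k_point: "ifun_comp \<S> k (ifun_comp \<S> (pull_ifun C I (point C F)) one) = point \<S> F'"
proof -
  let ?k = "ifun_comp \<S> k (ifun_comp \<S> (pull_ifun C I (point C F)) one)"
  have k: "is_ifun \<S> ?k" "FDom ?k = icat_one \<S>" "FCod ?k = \<Y>'"
    using kk(1-3) ptt(1-3) pull_one_iso(1-3) by (simp_all add: S.ifun_comp_is_ifun)
  have "FOb ?k = FOb (point \<S> F') \<and> FAr ?k = FAr (point \<S> F')"
  proof (rule S.is_exp_catD(4)[OF XE' S.is_icat_one S.ifun_icat(3)[OF k(1), unfolded k(2,3)] S.ifun_icat(3)[OF ptt'(1), unfolded ptt'(2,3)]])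
    fix t x assume a: "S.el2 t x (IOb (icat_one \<S>)) (IOb D')"
    have b: "t \<in> Arr \<S>" "Cod \<S> t = Ide C I" "x \<in> Arr \<S>" "Cod \<S> x = Pr1 C I (IOb D)"
      using a by simp_all
    obtain z where z: "Dom \<S> t = z" "Dom \<S> x = z"
      using a by simp
    obtain v where v: "x = lift z v" "v \<in> Arr C" "Dom C v = Dom C z" "Cod C v = IOb D" "z \<in> Arr C" "Cod C z = I"
      by (rule lift_cases[OF b(3,4) icat_data(1)[OF cD] z(2)])
    have t: "t = (z, z, Ide C I)"
      by (rule S_to_One[OF b(1,2) z(1) v(5,6)])
    have ta: "(z, z, Ide C I) \<in> Arr \<S>" "Dom \<S> (z, z, Ide C I) = z" "Cod \<S> (z, z, Ide C I) = Ide C I"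
      using b(1,2) z(1) unfolding t by simp_all
    show "Comp \<S> (FOb \<V>') (pair \<S> (Comp \<S> (FOb ?k) t) x) = Comp \<S> (FOb \<V>') (pair \<S> (Comp \<S> (FOb (point \<S> F')) t) x)"
      using v(2-) ta unfolding t v(1) by (simp add: tys kk(4) ptt(4) ptt'(4) pull_one_iso(4))
  next
    fix t x assume a: "S.el2 t x (IAr (icat_one \<S>)) (IAr D')"
    have b: "t \<in> Arr \<S>" "Cod \<S> t = Ide C I" "x \<in> Arr \<S>" "Cod \<S> x = Pr1 C I (IAr D)"
      using a by simp_all
    obtain z where z: "Dom \<S> t = z" "Dom \<S> x = z"
      using a by simp
    obtain v where v: "x = lift z v" "v \<in> Arr C" "Dom C v = Dom C z" "Cod C v = IAr D" "z \<in> Arr C" "Cod C z = I"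
      by (rule lift_cases[OF b(3,4) icat_data(2)[OF cD] z(2)])
    have t: "t = (z, z, Ide C I)"
      by (rule S_to_One[OF b(1,2) z(1) v(5,6)])
    have ta: "(z, z, Ide C I) \<in> Arr \<S>" "Dom \<S> (z, z, Ide C I) = z" "Cod \<S> (z, z, Ide C I) = Ide C I"
      using b(1,2) z(1) unfolding t by simp_all
    show "Comp \<S> (FAr \<V>') (pair \<S> (Comp \<S> (FAr ?k) t) x) = Comp \<S> (FAr \<V>') (pair \<S> (Comp \<S> (FAr (point \<S> F')) t) x)"
      using v(2-) ta unfolding t v(1) by (simp add: tys kk(5) ptt(5) ptt'(5) one_arr)
  qed
  then show ?thesis
    using k ptt'(2,3) by (intro ifun_eqI) simp_all
qed

private lemma k_vertex:
  assumes V: "is_ifun C V" "FDom V = icat_one C" "FCod V = A"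
  shows "ifun_comp \<S> k (ifun_comp \<S> (pull_ifun C I (ifun_comp C (diag C D A) V)) one) =
    ifun_comp \<S> (diag \<S> D' A') (ifun_comp \<S> (pull_ifun C I V) one)"
  unfolding k_diag[symmetric]
  by (rule ifun_eqI)
    (use V ifun_simps(1-6)[OF V(1), unfolded V(2,3), simplified icat_one_simps] pull_one_iso(1-3) one_arr in
      \<open>simp_all add: tys pull_one_iso(4) pull_ar_comp dg(2)\<close>)

private lemma vertex_pull:
  assumes V: "is_ifun C V" "FDom V = icat_one C" "FCod V = A"
  shows "is_ifun \<S> (ifun_comp \<S> (pull_ifun C I V) one)" "FDom (ifun_comp \<S> (pull_ifun C I V) one) = icat_one \<S>"
    "FCod (ifun_comp \<S> (pull_ifun C I V) one) = A'" "FOb (ifun_comp \<S> (pull_ifun C I V) one) = lift (Ide C I) (FOb V \<cdot> bang I)"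
  using S.ifun_comp_is_ifun[OF pull_one_iso(1) is_ifun_pull[OF V(1)]] V pull_one_iso(2-4)
    ifun_simps(1-6)[OF V(1), unfolded V(2,3), simplified icat_one_simps]
  by simp_all

private lemma arrow_pull:
  assumes g: "g \<in> hom C (One C) (IAr \<Y>)" and p: "ISrc \<Y> \<cdot> g = p" "ITgt \<Y> \<cdot> g = q"
  shows "Comp \<S> (FAr k) (Comp \<S> (pull_ar C I g) (FOb one)) \<in> hom \<S> (One \<S>) (IAr \<Y>')"
    "Comp \<S> (ISrc \<Y>') (Comp \<S> (FAr k) (Comp \<S> (pull_ar C I g) (FOb one))) = Comp \<S> (FOb k) (Comp \<S> (pull_ar C I p) (FOb one))"
    "Comp \<S> (ITgt \<Y>') (Comp \<S> (FAr k) (Comp \<S> (pull_ar C I g) (FOb one))) = Comp \<S> (FOb k) (Comp \<S> (pull_ar C I q) (FOb one))"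
  using g unfolding p[symmetric] by (simp_all add: tys kf(7,8) pull_one_iso(4))

text \<open>The comparison \<open>k\<close> commutes with evaluation, so the component of the pulled
  back transformation at a lift is the lift of the original component.\<close>

private lemma leg_pull:
  assumes g: "NMap \<gamma> \<in> hom C (One C) (IAr \<Y>)" and g': "NMap \<gamma>' = Comp \<S> (FAr k) (Comp \<S> (pull_ar C I (NMap \<gamma>)) (FOb one))"
  shows "S.leg F' \<gamma>' = pull_ar C I (leg F \<gamma>)"
proof -
  note w = arrow_pull(1)[OF g refl refl, folded g']
  note l = leg_typ[OF F FD FA g]
  show ?thesis
  proof (rule S_arr_ext)
    show "S.leg F' \<gamma>' \<in> hom \<S> (Pr1 C I (IOb D)) (Pr1 C I (IAr A))"
      using S.leg_typ[OF F' w] by simp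
    show "pull_ar C I (leg F \<gamma>) \<in> hom \<S> (Pr1 C I (IOb D)) (Pr1 C I (IAr A))"
      using l by simp
    fix z x assume x: "z \<in> Arr C" "Cod C z = I" "x \<in> Arr C" "Dom C x = Dom C z" "Cod C x = IOb D"
    have "Comp \<S> (S.leg F' \<gamma>') (lift z x) =
      Comp \<S> (FAr \<V>') (pair \<S> (Comp \<S> (NMap \<gamma>') (S.bang z)) (Comp \<S> (IIde D') (lift z x)))"
      using S.leg_el[OF F' w, of "lift z x"] x by simp
    also have "Comp \<S> (NMap \<gamma>') (S.bang z) = Comp \<S> (FAr k) (lift z (NMap \<gamma> \<cdot> bang (Dom C z)))"
    proof -
      have "(z, z, Ide C I) \<in> Arr \<S>" "Dom \<S> (z, z, Ide C I) = z" "Cod \<S> (z, z, Ide C I) = Ide C I"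
        using x by (simp_all add: slice_simps)
      then show ?thesis
        unfolding g' using x g by (simp add: tys pull_one_iso(4))
    qed
    also have "Comp \<S> (FAr \<V>') (pair \<S> (Comp \<S> (FAr k) (lift z (NMap \<gamma> \<cdot> bang (Dom C z)))) (Comp \<S> (IIde D') (lift z x))) =
      Comp \<S> (pull_ar C I (leg F \<gamma>)) (lift z x)"
      using x g l leg_el[OF F FD FA g, of x] by (simp add: tys kk(5))
    finally show "Comp \<S> (S.leg F' \<gamma>') (lift z x) = Comp \<S> (pull_ar C I (leg F \<gamma>)) (lift z x)" .
  qed (simp add: cD)
qed

private lemma pull_icone_eq:
  "pull_icone C I F (V, \<gamma>) = (ifun_comp \<S> (pull_ifun C I V) one,
    \<lparr>NDom = ifun_comp \<S> k (ifun_comp \<S> (pull_ifun C I (NDom \<gamma>)) one),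
     NCod = ifun_comp \<S> k (ifun_comp \<S> (pull_ifun C I (NCod \<gamma>)) one),
     NMap = Comp \<S> (FAr k) (Comp \<S> (pull_ar C I (NMap \<gamma>)) (FOb one))\<rparr>)"
  by (simp add: pull_icone_def S.Cat_simps(6) whisker_left_def whisker_right_def pull_inat_def FD FA)

private lemmas Ff2 = functor_simps(7,8)[OF ifun_icat(3)[OF F], unfolded FD FA]

text \<open>\<open>is_cone\<close> demands equality of functors and not just isomorphism, so the
  pulled back transformation must literally start at the diagonal and end at the point of the slice.
  This is what \<open>k_vertex\<close>, which rests on \<open>k_diag\<close>, and
  \<open>k_point\<close> provide.\<close>

lemma pull_cone:
  assumes c: "is_cone C F (V, \<gamma>)"
  obtains V' \<gamma>' where "pull_icone C I F (V, \<gamma>) = (V', \<gamma>')" "is_cone \<S> F' (V', \<gamma>')"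
    "FOb V' = lift (Ide C I) (FOb V \<cdot> bang I)" "S.leg F' \<gamma>' = pull_ar C I (leg F \<gamma>)"
proof -
  have V: "is_ifun C V" "FDom V = icat_one C" "FCod V = A" and n: "NDom \<gamma> = (ifun_comp C (diag C D A) V)" "NCod \<gamma> = (point C F)"
    and g: "NMap \<gamma> \<in> hom C (One C) (IAr \<Y>)" "ISrc \<Y> \<cdot> NMap \<gamma> = FOb (diag C D A) \<cdot> FOb V" "ITgt \<Y> \<cdot> NMap \<gamma> = FOb (point C F)"
    using c unfolding is_cone_iff[OF F FD FA] by simp_all
  let ?V = "ifun_comp \<S> (pull_ifun C I V) one"
  let ?g = "\<lparr>NDom = ifun_comp \<S> k (ifun_comp \<S> (pull_ifun C I (NDom \<gamma>)) one),
     NCod = ifun_comp \<S> k (ifun_comp \<S> (pull_ifun C I (NCod \<gamma>)) one),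
     NMap = Comp \<S> (FAr k) (Comp \<S> (pull_ar C I (NMap \<gamma>)) (FOb one))\<rparr>"
  note a = arrow_pull[OF g]
  note e = k_vertex[OF V] k_point
  have fe: "FOb (ifun_comp \<S> k (ifun_comp \<S> (pull_ifun C I (ifun_comp C (diag C D A) V)) one)) = FOb (ifun_comp \<S> (diag \<S> D' A') (ifun_comp \<S> (pull_ifun C I V) one))"
    "FOb (ifun_comp \<S> k (ifun_comp \<S> (pull_ifun C I (point C F)) one)) = FOb (point \<S> F')"
    by (simp_all only: e)
  have nd: "NDom ?g = ifun_comp \<S> (diag \<S> D' A') (ifun_comp \<S> (pull_ifun C I V) one)" "NCod ?g = point \<S> F'"
    by (simp_all only: n e inat.select_convs)
  have st: "Comp \<S> (ISrc \<Y>') (NMap ?g) = FOb (diag \<S> D' A') \<cdot>\<^bsub>\<S>\<^esub> FOb (ifun_comp \<S> (pull_ifun C I V) one)" "Comp \<S> (ITgt \<Y>') (NMap ?g) = FOb (point \<S> F')"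
    using a(2,3) fe by simp_all
  have "NMap ?g \<in> hom \<S> (One \<S>) (IAr \<Y>')"
    using a(1) by simp
  then have "is_cone \<S> F' (?V, ?g)"
    unfolding S.is_cone_iff[OF F'] using vertex_pull(1-3)[OF V] nd st by blast
  moreover have "S.leg F' ?g = pull_ar C I (leg F \<gamma>)"
    by (rule leg_pull[OF g(1)]) simp
  ultimately show ?thesis
    using that[OF pull_icone_eq] vertex_pull(4)[OF V] by blast
qed

text \<open>An element of \<open>I\<^sup>*D\<close> is the lift of an element \<open>x\<close> of
  \<open>D\<close> along some \<open>t\<close> into \<open>I\<close>; the conditions over the slice
  therefore become conditions at all pairs \<open>(t, x)\<close>.\<close>

lemma econe_pull_iff:
  assumes v: "v \<in> hom C I (IOb A)" and m: "\<mu> \<in> hom C (Prod C I (IOb D)) (IAr A)"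
  shows "S.econe F' (lift (Ide C I) v) (lift (Pr1 C I (IOb D)) \<mu>) \<longleftrightarrow> gcone F I v \<mu>"
proof
  note [simp] = tys v[simplified] m[simplified]
  assume S: "S.econe F' (lift (Ide C I) v) (lift (Pr1 C I (IOb D)) \<mu>)"
  show "gcone F I v \<mu>"
    unfolding gcone_def FD FA
  proof (intro conjI allI impI)
    fix t x assume tx: "el2 t x I (IOb D)"
    have "Comp \<S> (ISrc A') (Comp \<S> (lift (Pr1 C I (IOb D)) \<mu>) (lift t x)) = Comp \<S> (lift (Ide C I) v) (S.bang (Dom \<S> (lift t x))) \<and>
        Comp \<S> (ITgt A') (Comp \<S> (lift (Pr1 C I (IOb D)) \<mu>) (lift t x)) = Comp \<S> (FOb F') (lift t x)"
      using S[unfolded S.econe_def F'(2,3), THEN conjunct2, THEN conjunct2, THEN conjunct1, rule_format, of "lift t x"] tx by simp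
    then show "ISrc A \<cdot> (\<mu> \<cdot> pair C t x) = v \<cdot> t" "ITgt A \<cdot> (\<mu> \<cdot> pair C t x) = FOb F \<cdot> x"
      using tx by (simp_all add: FD FA)
  next
    fix t d assume td: "el2 t d I (IAr D)"
    have s: "ISrc A \<cdot> (\<mu> \<cdot> pair C t x) = v \<cdot> t" "ITgt A \<cdot> (\<mu> \<cdot> pair C t x) = FOb F \<cdot> x" if "el2 t x I (IOb D)" for x
    proof -
      have "Comp \<S> (ISrc A') (Comp \<S> (lift (Pr1 C I (IOb D)) \<mu>) (lift t x)) = Comp \<S> (lift (Ide C I) v) (S.bang (Dom \<S> (lift t x))) \<and>
        Comp \<S> (ITgt A') (Comp \<S> (lift (Pr1 C I (IOb D)) \<mu>) (lift t x)) = Comp \<S> (FOb F') (lift t x)"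
        using S[unfolded S.econe_def F'(2,3), THEN conjunct2, THEN conjunct2, THEN conjunct1, rule_format, of "lift t x"] that by simp
      then show "ISrc A \<cdot> (\<mu> \<cdot> pair C t x) = v \<cdot> t" "ITgt A \<cdot> (\<mu> \<cdot> pair C t x) = FOb F \<cdot> x"
        using that by (simp_all add: FD FA)
    qed
    have c: "composable A (\<mu> \<cdot> pair C t (ISrc D \<cdot> d)) (FAr F \<cdot> d)"
      using td s Ff2 by (simp add: composable_def)
    have "icomp \<S> A' (Comp \<S> (lift (Pr1 C I (IOb D)) \<mu>) (Comp \<S> (ISrc D') (lift t d))) (Comp \<S> (FAr F') (lift t d)) = Comp \<S> (lift (Pr1 C I (IOb D)) \<mu>) (Comp \<S> (ITgt D') (lift t d))"
      using S[unfolded S.econe_def F'(2,3), THEN conjunct2, THEN conjunct2, THEN conjunct2, rule_format, of "lift t d"] td by simp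
    then show "icomp C A (\<mu> \<cdot> pair C t (ISrc D \<cdot> d)) (FAr F \<cdot> d) = \<mu> \<cdot> pair C t (ITgt D \<cdot> d)"
      using td c s Ff2 by (simp add: icomp_pull FD FA)
  qed simp_all
next
  note [simp] = tys v[simplified] m[simplified]
  assume G: "gcone F I v \<mu>"
  have s: "ISrc A \<cdot> (\<mu> \<cdot> pair C t x) = v \<cdot> t" "ITgt A \<cdot> (\<mu> \<cdot> pair C t x) = FOb F \<cdot> x" if "el2 t x I (IOb D)" for t x
    using G that unfolding gcone_def FD FA by blast+
  have nat: "icomp C A (\<mu> \<cdot> pair C t (ISrc D \<cdot> d)) (FAr F \<cdot> d) = \<mu> \<cdot> pair C t (ITgt D \<cdot> d)" if "el2 t d I (IAr D)" for t d
    using G that unfolding gcone_def FD FA by blast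
  show "S.econe F' (lift (Ide C I) v) (lift (Pr1 C I (IOb D)) \<mu>)"
    unfolding S.econe_def F'(2,3)
  proof (intro conjI allI impI)
    fix a assume a: "a \<in> Arr \<S> \<and> Cod \<S> a = IOb D'"
    have a': "a \<in> Arr \<S>" "Cod \<S> a = Pr1 C I (IOb D)"
      using a by simp_all
    obtain z where z: "Dom \<S> a = z"
      by simp
    obtain x where x: "a = lift z x" "x \<in> Arr C" "Dom C x = Dom C z" "Cod C x = IOb D" "z \<in> Arr C" "Cod C z = I"
      by (rule lift_cases[OF a' icat_data(1)[OF cD] z])
    show "Comp \<S> (ISrc A') (Comp \<S> (lift (Pr1 C I (IOb D)) \<mu>) a) = Comp \<S> (lift (Ide C I) v) (S.bang (Dom \<S> a))"
      "Comp \<S> (ITgt A') (Comp \<S> (lift (Pr1 C I (IOb D)) \<mu>) a) = Comp \<S> (FOb F') a"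
      using x(2-) s[of z x] unfolding x(1) by (simp_all add: FD FA)
  next
    fix a assume a: "a \<in> Arr \<S> \<and> Cod \<S> a = IAr D'"
    have a': "a \<in> Arr \<S>" "Cod \<S> a = Pr1 C I (IAr D)"
      using a by simp_all
    obtain t where z: "Dom \<S> a = t"
      by simp
    obtain d where x: "a = lift t d" "d \<in> Arr C" "Dom C d = Dom C t" "Cod C d = IAr D" "t \<in> Arr C" "Cod C t = I"
      by (rule lift_cases[OF a' icat_data(2)[OF cD] z])
    have c: "composable A (\<mu> \<cdot> pair C t (ISrc D \<cdot> d)) (FAr F \<cdot> d)"
      using x(2-) s Ff2 by (simp add: composable_def)
    show "icomp \<S> A' (Comp \<S> (lift (Pr1 C I (IOb D)) \<mu>) (Comp \<S> (ISrc D') a)) (Comp \<S> (FAr F') a) = Comp \<S> (lift (Pr1 C I (IOb D)) \<mu>) (Comp \<S> (ITgt D') a)"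
      using x(2-) nat[of t d] c unfolding x(1) by (simp add: icomp_pull FD FA)
  qed simp_all
qed

lemma econe_pull_cases:
  assumes S: "S.econe F' v' \<mu>'"
  obtains v \<mu> where "v' = lift (Ide C I) v" "\<mu>' = lift (Pr1 C I (IOb D)) \<mu>" "v \<in> hom C I (IOb A)"
    "\<mu> \<in> hom C (Prod C I (IOb D)) (IAr A)"
proof -
  have v': "v' \<in> Arr \<S>" "Cod \<S> v' = Pr1 C I (IOb A)" "Dom \<S> v' = Ide C I"
    and m': "\<mu>' \<in> Arr \<S>" "Cod \<S> \<mu>' = Pr1 C I (IAr A)" "Dom \<S> \<mu>' = Pr1 C I (IOb D)"
    using S unfolding S.econe_def F'(2,3) by simp_all
  obtain v where v: "v' = lift (Ide C I) v" "v \<in> Arr C" "Dom C v = Dom C (Ide C I)" "Cod C v = IOb A"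
    by (rule lift_cases[OF v'(1,2) icat_data(1)[OF cA] v'(3)])
  obtain m where m: "\<mu>' = lift (Pr1 C I (IOb D)) m" "m \<in> Arr C" "Dom C m = Dom C (Pr1 C I (IOb D))" "Cod C m = IAr A"
    by (rule lift_cases[OF m'(1,2) icat_data(2)[OF cA] m'(3)])
  show ?thesis
    by (rule that[OF v(1) m(1)]) (use v m cD in simp_all)
qed

text \<open>\<open>terminal_cone_iff\<close> is applied in the slice and then translated: global
  elements of \<open>I\<^sup>*A\<close> in the slice are lifts along the identity of
  \<open>I\<close>, that is, arrows from \<open>I\<close> into the base data.\<close>

lemma pull_cone_terminal_iff:
  assumes c: "is_cone C F (V, \<gamma>)"
  shows "is_terminal (Cones \<S> F') (pull_icone C I F (V, \<gamma>)) \<longleftrightarrow> (\<forall>u \<mu>. gcone F I u \<mu> \<longrightarrow>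
    (\<exists>!h. h \<in> hom C I (IAr A) \<and> ISrc A \<cdot> h = u \<and> ITgt A \<cdot> h = FOb V \<cdot> bang I \<and>
      icomp C A (h \<cdot> Pr1 C I (IOb D)) (leg F \<gamma> \<cdot> Pr2 C I (IOb D)) = \<mu>))"
proof -
  obtain V' \<gamma>' where p: "pull_icone C I F (V, \<gamma>) = (V', \<gamma>')" and c': "is_cone \<S> F' (V', \<gamma>')"
    and V': "FOb V' = lift (Ide C I) (FOb V \<cdot> bang I)" and l': "S.leg F' \<gamma>' = pull_ar C I (leg F \<gamma>)"
    by (rule pull_cone[OF c])
  have V: "is_ifun C V" "FDom V = icat_one C" "FCod V = A" and g: "NMap \<gamma> \<in> hom C (One C) (IAr \<Y>)"
    using c unfolding is_cone_iff[OF F FD FA] by simp_all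
  note l = leg_typ[OF F FD FA g]
  have ec: "econe F (FOb V) (leg F \<gamma>)"
    by (rule econe_of_cone[OF F FD FA c])
  note [simp] = tys l[simplified] ifun_simps(1-6)[OF V(1), unfolded V(2,3), simplified icat_one_simps]
  have lst: "ISrc A \<cdot> (leg F \<gamma> \<cdot> x) = FOb V \<cdot> bang (Dom C x)" if "x \<in> Arr C" "Cod C x = IOb D" for x
    using ec that unfolding econe_def FD FA by blast
  let ?Q = "\<lambda>v' \<mu>' h'. h' \<in> hom \<S> (One \<S>) (IAr A') \<and> Comp \<S> (ISrc A') h' = v' \<and> Comp \<S> (ITgt A') h' = lift (Ide C I) (FOb V \<cdot> bang I) \<and>
      icomp \<S> A' (Comp \<S> h' (S.bang (IOb D'))) (pull_ar C I (leg F \<gamma>)) = \<mu>'"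
  let ?P = "\<lambda>u \<mu> h. h \<in> hom C I (IAr A) \<and> ISrc A \<cdot> h = u \<and> ITgt A \<cdot> h = FOb V \<cdot> bang I \<and>
      icomp C A (h \<cdot> Pr1 C I (IOb D)) (leg F \<gamma> \<cdot> Pr2 C I (IOb D)) = \<mu>"
  have ex1: "(\<exists>!h'. ?Q (lift (Ide C I) u) (lift (Pr1 C I (IOb D)) \<mu>) h') \<longleftrightarrow> (\<exists>!h. ?P u \<mu> h)"
    if u: "u \<in> hom C I (IOb A)" and m: "\<mu> \<in> hom C (Prod C I (IOb D)) (IAr A)" for u \<mu>
  proof -
    note [simp] = u[simplified] m[simplified]
    have Q: "?Q (lift (Ide C I) u) (lift (Pr1 C I (IOb D)) \<mu>) (lift (Ide C I) h) \<longleftrightarrow> ?P u \<mu> h"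
      if h: "h \<in> hom C I (IAr A)" for h
    proof -
      note [simp] = h[simplified]
      have st: "(Comp \<S> (ISrc A') (lift (Ide C I) h) = lift (Ide C I) u \<and> Comp \<S> (ITgt A') (lift (Ide C I) h) = lift (Ide C I) (FOb V \<cdot> bang I)) \<longleftrightarrow> ISrc A \<cdot> h = u \<and> ITgt A \<cdot> h = FOb V \<cdot> bang I"
        by simp
      \<comment> \<open>\<open>icomp\<close> is a definite description without a known value at a
        pair that does not compose, so the composites are compared only under the endpoint equations
        \<open>s\<close>.\<close>
      have "icomp \<S> A' (Comp \<S> (lift (Ide C I) h) (S.bang (IOb D'))) (pull_ar C I (leg F \<gamma>)) = lift (Pr1 C I (IOb D)) (icomp C A (h \<cdot> Pr1 C I (IOb D)) (leg F \<gamma> \<cdot> Pr2 C I (IOb D)))"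
        if s: "ISrc A \<cdot> h = u \<and> ITgt A \<cdot> h = FOb V \<cdot> bang I"
      proof -
        have hc: "ITgt A \<cdot> (h \<cdot> Pr1 C I (IOb D)) = FOb V \<cdot> bang (Prod C I (IOb D))"
          using comp_eq_comp[of "ITgt A" h _ "Pr1 C I (IOb D)"] s by simp
        have c: "composable A (h \<cdot> Pr1 C I (IOb D)) (leg F \<gamma> \<cdot> Pr2 C I (IOb D))"
          using hc lst[of "Pr2 C I (IOb D)"] by (simp add: composable_def)
        have "Comp \<S> (lift (Ide C I) h) (S.bang (Pr1 C I (IOb D))) = lift (Pr1 C I (IOb D)) (h \<cdot> Pr1 C I (IOb D))"
          "pull_ar C I (leg F \<gamma>) = lift (Pr1 C I (IOb D)) (leg F \<gamma> \<cdot> Pr2 C I (IOb D))"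
          by (simp_all add: pull_ar_lift)
        then show ?thesis
          using c by (simp add: icomp_pull)
      qed
      moreover have "icomp C A (h \<cdot> Pr1 C I (IOb D)) (leg F \<gamma> \<cdot> Pr2 C I (IOb D)) \<in> Arr C \<and> Dom C (icomp C A (h \<cdot> Pr1 C I (IOb D)) (leg F \<gamma> \<cdot> Pr2 C I (IOb D))) = Prod C I (IOb D) \<and> Cod C (icomp C A (h \<cdot> Pr1 C I (IOb D)) (leg F \<gamma> \<cdot> Pr2 C I (IOb D))) = IAr A"
        if s: "ISrc A \<cdot> h = u \<and> ITgt A \<cdot> h = FOb V \<cdot> bang I"
      proof -
        have hc: "ITgt A \<cdot> (h \<cdot> Pr1 C I (IOb D)) = FOb V \<cdot> bang (Prod C I (IOb D))"
          using comp_eq_comp[of "ITgt A" h _ "Pr1 C I (IOb D)"] s by simp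
        then show ?thesis
          using lst[of "Pr2 C I (IOb D)"] by simp
      qed
      ultimately show ?thesis
        using st by auto
    qed
    have "?Q (lift (Ide C I) u) (lift (Pr1 C I (IOb D)) \<mu>) h' \<longleftrightarrow> (\<exists>h. h' = lift (Ide C I) h \<and> ?P u \<mu> h)" for h'
    proof
      assume Q': "?Q (lift (Ide C I) u) (lift (Pr1 C I (IOb D)) \<mu>) h'"
      then have h': "h' \<in> Arr \<S>" "Cod \<S> h' = Pr1 C I (IAr A)" "Dom \<S> h' = Ide C I"
        by simp_all
      obtain h where h: "h' = lift (Ide C I) h" "h \<in> Arr C" "Dom C h = Dom C (Ide C I)" "Cod C h = IAr A"
        by (rule lift_cases[OF h'(1,2) icat_data(2)[OF cA] h'(3)])
      have "?P u \<mu> h"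
        using Q[of h] Q' h by simp
      then show "\<exists>h. h' = lift (Ide C I) h \<and> ?P u \<mu> h"
        using h(1) by blast
    next
      assume "\<exists>h. h' = lift (Ide C I) h \<and> ?P u \<mu> h"
      then obtain h where h: "h' = lift (Ide C I) h" "?P u \<mu> h"
        by blast
      then show "?Q (lift (Ide C I) u) (lift (Pr1 C I (IOb D)) \<mu>) h'"
        using Q[of h] by blast
    qed
    note Q_iff = this
    have inj: "h = h'" if "?P u \<mu> h" "?P u \<mu> h'" "lift (Ide C I) h = lift (Ide C I) h'" for h h'
      using that by simp
    show ?thesis
      unfolding Q_iff using inj by blast
  qed
  have t: "is_terminal (Cones \<S> F') (V', \<gamma>') \<longleftrightarrow> (\<forall>v' \<mu>'. S.econe F' v' \<mu>' \<longrightarrow> (\<exists>!h'. ?Q v' \<mu>' h'))"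
    unfolding S.terminal_cone_iff[OF F' c'] V' l' by simp
  show ?thesis
    unfolding p t
  proof (intro iffI allI impI)
    fix u \<mu> assume a: "\<forall>v' \<mu>'. S.econe F' v' \<mu>' \<longrightarrow> (\<exists>!h'. ?Q v' \<mu>' h')" and G: "gcone F I u \<mu>"
    have u: "u \<in> hom C I (IOb A)" and m: "\<mu> \<in> hom C (Prod C I (IOb D)) (IAr A)"
      using G unfolding gcone_def FD FA by blast+
    show "\<exists>!h. ?P u \<mu> h"
      using a econe_pull_iff[OF u m] G ex1[OF u m] by blast
  next
    fix v' \<mu>' assume a: "\<forall>u \<mu>. gcone F I u \<mu> \<longrightarrow> (\<exists>!h. ?P u \<mu> h)" and E: "S.econe F' v' \<mu>'"
    obtain u \<mu> where um: "v' = lift (Ide C I) u" "\<mu>' = lift (Pr1 C I (IOb D)) \<mu>" "u \<in> hom C I (IOb A)"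
      "\<mu> \<in> hom C (Prod C I (IOb D)) (IAr A)"
      by (rule econe_pull_cases[OF E])
    show "\<exists>!h'. ?Q v' \<mu>' h'"
      unfolding um(1,2) ex1[OF um(3,4)] using a E econe_pull_iff[OF um(3,4)] unfolding um(1,2) by blast
  qed
qed

lemma pull_cocone:
  assumes c: "is_cocone C F (V, \<gamma>)"
  obtains V' \<gamma>' where "pull_icone C I F (V, \<gamma>) = (V', \<gamma>')" "is_cocone \<S> F' (V', \<gamma>')"
    "FOb V' = lift (Ide C I) (FOb V \<cdot> bang I)" "S.leg F' \<gamma>' = pull_ar C I (leg F \<gamma>)"
proof -
  have V: "is_ifun C V" "FDom V = icat_one C" "FCod V = A" and n: "NDom \<gamma> = (point C F)" "NCod \<gamma> = (ifun_comp C (diag C D A) V)"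
    and g: "NMap \<gamma> \<in> hom C (One C) (IAr \<Y>)" "ISrc \<Y> \<cdot> NMap \<gamma> = FOb (point C F)" "ITgt \<Y> \<cdot> NMap \<gamma> = FOb (diag C D A) \<cdot> FOb V"
    using c unfolding is_cocone_iff[OF F FD FA] by simp_all
  let ?V = "ifun_comp \<S> (pull_ifun C I V) one"
  let ?g = "\<lparr>NDom = ifun_comp \<S> k (ifun_comp \<S> (pull_ifun C I (NDom \<gamma>)) one),
     NCod = ifun_comp \<S> k (ifun_comp \<S> (pull_ifun C I (NCod \<gamma>)) one),
     NMap = Comp \<S> (FAr k) (Comp \<S> (pull_ar C I (NMap \<gamma>)) (FOb one))\<rparr>"
  note a = arrow_pull[OF g]
  note e = k_vertex[OF V] k_point
  have fe: "FOb (ifun_comp \<S> k (ifun_comp \<S> (pull_ifun C I (point C F)) one)) = FOb (point \<S> F')"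
    "FOb (ifun_comp \<S> k (ifun_comp \<S> (pull_ifun C I (ifun_comp C (diag C D A) V)) one)) = FOb (ifun_comp \<S> (diag \<S> D' A') (ifun_comp \<S> (pull_ifun C I V) one))"
    by (simp_all only: e)
  have nd: "NDom ?g = point \<S> F'" "NCod ?g = ifun_comp \<S> (diag \<S> D' A') (ifun_comp \<S> (pull_ifun C I V) one)"
    by (simp_all only: n e inat.select_convs)
  have st: "Comp \<S> (ISrc \<Y>') (NMap ?g) = FOb (point \<S> F')" "Comp \<S> (ITgt \<Y>') (NMap ?g) = FOb (diag \<S> D' A') \<cdot>\<^bsub>\<S>\<^esub> FOb (ifun_comp \<S> (pull_ifun C I V) one)"
    using a(2,3) fe by simp_all
  have "NMap ?g \<in> hom \<S> (One \<S>) (IAr \<Y>')"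
    using a(1) by simp
  then have "is_cocone \<S> F' (?V, ?g)"
    unfolding S.is_cocone_iff[OF F'] using vertex_pull(1-3)[OF V] nd st by blast
  moreover have "S.leg F' ?g = pull_ar C I (leg F \<gamma>)"
    by (rule leg_pull[OF g(1)]) simp
  ultimately show ?thesis
    using that[OF pull_icone_eq] vertex_pull(4)[OF V] by blast
qed

lemma ecocone_pull_iff:
  assumes v: "v \<in> hom C I (IOb A)" and m: "\<mu> \<in> hom C (Prod C I (IOb D)) (IAr A)"
  shows "S.ecocone F' (lift (Ide C I) v) (lift (Pr1 C I (IOb D)) \<mu>) \<longleftrightarrow> gcocone F I v \<mu>"
proof
  note [simp] = tys v[simplified] m[simplified]
  assume S: "S.ecocone F' (lift (Ide C I) v) (lift (Pr1 C I (IOb D)) \<mu>)"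
  show "gcocone F I v \<mu>"
    unfolding gcocone_def FD FA
  proof (intro conjI allI impI)
    fix t x assume tx: "el2 t x I (IOb D)"
    have "Comp \<S> (ISrc A') (Comp \<S> (lift (Pr1 C I (IOb D)) \<mu>) (lift t x)) = Comp \<S> (FOb F') (lift t x) \<and>
        Comp \<S> (ITgt A') (Comp \<S> (lift (Pr1 C I (IOb D)) \<mu>) (lift t x)) = Comp \<S> (lift (Ide C I) v) (S.bang (Dom \<S> (lift t x)))"
      using S[unfolded S.ecocone_def F'(2,3), THEN conjunct2, THEN conjunct2, THEN conjunct1, rule_format, of "lift t x"] tx by simp
    then show "ISrc A \<cdot> (\<mu> \<cdot> pair C t x) = FOb F \<cdot> x" "ITgt A \<cdot> (\<mu> \<cdot> pair C t x) = v \<cdot> t"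
      using tx by (simp_all add: FD FA)
  next
    fix t d assume td: "el2 t d I (IAr D)"
    have s: "ISrc A \<cdot> (\<mu> \<cdot> pair C t x) = FOb F \<cdot> x" "ITgt A \<cdot> (\<mu> \<cdot> pair C t x) = v \<cdot> t" if "el2 t x I (IOb D)" for x
    proof -
      have "Comp \<S> (ISrc A') (Comp \<S> (lift (Pr1 C I (IOb D)) \<mu>) (lift t x)) = Comp \<S> (FOb F') (lift t x) \<and>
        Comp \<S> (ITgt A') (Comp \<S> (lift (Pr1 C I (IOb D)) \<mu>) (lift t x)) = Comp \<S> (lift (Ide C I) v) (S.bang (Dom \<S> (lift t x)))"
        using S[unfolded S.ecocone_def F'(2,3), THEN conjunct2, THEN conjunct2, THEN conjunct1, rule_format, of "lift t x"] that by simp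
      then show "ISrc A \<cdot> (\<mu> \<cdot> pair C t x) = FOb F \<cdot> x" "ITgt A \<cdot> (\<mu> \<cdot> pair C t x) = v \<cdot> t"
        using that by (simp_all add: FD FA)
    qed
    have c: "composable A (FAr F \<cdot> d) (\<mu> \<cdot> pair C t (ITgt D \<cdot> d))"
      using td s Ff2 by (simp add: composable_def)
    have "icomp \<S> A' (Comp \<S> (FAr F') (lift t d)) (Comp \<S> (lift (Pr1 C I (IOb D)) \<mu>) (Comp \<S> (ITgt D') (lift t d))) = Comp \<S> (lift (Pr1 C I (IOb D)) \<mu>) (Comp \<S> (ISrc D') (lift t d))"
      using S[unfolded S.ecocone_def F'(2,3), THEN conjunct2, THEN conjunct2, THEN conjunct2, rule_format, of "lift t d"] td by simp
    then show "icomp C A (FAr F \<cdot> d) (\<mu> \<cdot> pair C t (ITgt D \<cdot> d)) = \<mu> \<cdot> pair C t (ISrc D \<cdot> d)"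
      using td c s Ff2 by (simp add: icomp_pull FD FA)
  qed simp_all
next
  note [simp] = tys v[simplified] m[simplified]
  assume G: "gcocone F I v \<mu>"
  have s: "ISrc A \<cdot> (\<mu> \<cdot> pair C t x) = FOb F \<cdot> x" "ITgt A \<cdot> (\<mu> \<cdot> pair C t x) = v \<cdot> t" if "el2 t x I (IOb D)" for t x
    using G that unfolding gcocone_def FD FA by blast+
  have nat: "icomp C A (FAr F \<cdot> d) (\<mu> \<cdot> pair C t (ITgt D \<cdot> d)) = \<mu> \<cdot> pair C t (ISrc D \<cdot> d)" if "el2 t d I (IAr D)" for t d
    using G that unfolding gcocone_def FD FA by blast
  show "S.ecocone F' (lift (Ide C I) v) (lift (Pr1 C I (IOb D)) \<mu>)"
    unfolding S.ecocone_def F'(2,3)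
  proof (intro conjI allI impI)
    fix a assume a: "a \<in> Arr \<S> \<and> Cod \<S> a = IOb D'"
    have a': "a \<in> Arr \<S>" "Cod \<S> a = Pr1 C I (IOb D)"
      using a by simp_all
    obtain z where z: "Dom \<S> a = z"
      by simp
    obtain x where x: "a = lift z x" "x \<in> Arr C" "Dom C x = Dom C z" "Cod C x = IOb D" "z \<in> Arr C" "Cod C z = I"
      by (rule lift_cases[OF a' icat_data(1)[OF cD] z])
    show "Comp \<S> (ISrc A') (Comp \<S> (lift (Pr1 C I (IOb D)) \<mu>) a) = Comp \<S> (FOb F') a"
      "Comp \<S> (ITgt A') (Comp \<S> (lift (Pr1 C I (IOb D)) \<mu>) a) = Comp \<S> (lift (Ide C I) v) (S.bang (Dom \<S> a))"
      using x(2-) s[of z x] unfolding x(1) by (simp_all add: FD FA)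
  next
    fix a assume a: "a \<in> Arr \<S> \<and> Cod \<S> a = IAr D'"
    have a': "a \<in> Arr \<S>" "Cod \<S> a = Pr1 C I (IAr D)"
      using a by simp_all
    obtain t where z: "Dom \<S> a = t"
      by simp
    obtain d where x: "a = lift t d" "d \<in> Arr C" "Dom C d = Dom C t" "Cod C d = IAr D" "t \<in> Arr C" "Cod C t = I"
      by (rule lift_cases[OF a' icat_data(2)[OF cD] z])
    have c: "composable A (FAr F \<cdot> d) (\<mu> \<cdot> pair C t (ITgt D \<cdot> d))"
      using x(2-) s Ff2 by (simp add: composable_def)
    show "icomp \<S> A' (Comp \<S> (FAr F') a) (Comp \<S> (lift (Pr1 C I (IOb D)) \<mu>) (Comp \<S> (ITgt D') a)) = Comp \<S> (lift (Pr1 C I (IOb D)) \<mu>) (Comp \<S> (ISrc D') a)"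
      using x(2-) nat[of t d] c unfolding x(1) by (simp add: icomp_pull FD FA)
  qed simp_all
qed

lemma ecocone_pull_cases:
  assumes S: "S.ecocone F' v' \<mu>'"
  obtains v \<mu> where "v' = lift (Ide C I) v" "\<mu>' = lift (Pr1 C I (IOb D)) \<mu>" "v \<in> hom C I (IOb A)"
    "\<mu> \<in> hom C (Prod C I (IOb D)) (IAr A)"
proof -
  have v': "v' \<in> Arr \<S>" "Cod \<S> v' = Pr1 C I (IOb A)" "Dom \<S> v' = Ide C I"
    and m': "\<mu>' \<in> Arr \<S>" "Cod \<S> \<mu>' = Pr1 C I (IAr A)" "Dom \<S> \<mu>' = Pr1 C I (IOb D)"
    using S unfolding S.ecocone_def F'(2,3) by simp_all
  obtain v where v: "v' = lift (Ide C I) v" "v \<in> Arr C" "Dom C v = Dom C (Ide C I)" "Cod C v = IOb A"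
    by (rule lift_cases[OF v'(1,2) icat_data(1)[OF cA] v'(3)])
  obtain m where m: "\<mu>' = lift (Pr1 C I (IOb D)) m" "m \<in> Arr C" "Dom C m = Dom C (Pr1 C I (IOb D))" "Cod C m = IAr A"
    by (rule lift_cases[OF m'(1,2) icat_data(2)[OF cA] m'(3)])
  show ?thesis
    by (rule that[OF v(1) m(1)]) (use v m cD in simp_all)
qed

lemma pull_cocone_initial_iff:
  assumes c: "is_cocone C F (V, \<gamma>)"
  shows "is_initial (Cocones \<S> F') (pull_icone C I F (V, \<gamma>)) \<longleftrightarrow> (\<forall>u \<mu>. gcocone F I u \<mu> \<longrightarrow>
    (\<exists>!h. h \<in> hom C I (IAr A) \<and> ISrc A \<cdot> h = FOb V \<cdot> bang I \<and> ITgt A \<cdot> h = u \<and>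
      icomp C A (leg F \<gamma> \<cdot> Pr2 C I (IOb D)) (h \<cdot> Pr1 C I (IOb D)) = \<mu>))"
proof -
  obtain V' \<gamma>' where p: "pull_icone C I F (V, \<gamma>) = (V', \<gamma>')" and c': "is_cocone \<S> F' (V', \<gamma>')"
    and V': "FOb V' = lift (Ide C I) (FOb V \<cdot> bang I)" and l': "S.leg F' \<gamma>' = pull_ar C I (leg F \<gamma>)"
    by (rule pull_cocone[OF c])
  have V: "is_ifun C V" "FDom V = icat_one C" "FCod V = A" and g: "NMap \<gamma> \<in> hom C (One C) (IAr \<Y>)"
    using c unfolding is_cocone_iff[OF F FD FA] by simp_all
  note l = leg_typ[OF F FD FA g]
  have ec: "ecocone F (FOb V) (leg F \<gamma>)"
    by (rule econe_of_cocone[OF F FD FA c])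
  note [simp] = tys l[simplified] ifun_simps(1-6)[OF V(1), unfolded V(2,3), simplified icat_one_simps]
  have lst: "ITgt A \<cdot> (leg F \<gamma> \<cdot> x) = FOb V \<cdot> bang (Dom C x)" if "x \<in> Arr C" "Cod C x = IOb D" for x
    using ec that unfolding ecocone_def FD FA by blast
  let ?Q = "\<lambda>v' \<mu>' h'. h' \<in> hom \<S> (One \<S>) (IAr A') \<and> Comp \<S> (ISrc A') h' = lift (Ide C I) (FOb V \<cdot> bang I) \<and> Comp \<S> (ITgt A') h' = v' \<and>
      icomp \<S> A' (pull_ar C I (leg F \<gamma>)) (Comp \<S> h' (S.bang (IOb D'))) = \<mu>'"
  let ?P = "\<lambda>u \<mu> h. h \<in> hom C I (IAr A) \<and> ISrc A \<cdot> h = FOb V \<cdot> bang I \<and> ITgt A \<cdot> h = u \<and>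
      icomp C A (leg F \<gamma> \<cdot> Pr2 C I (IOb D)) (h \<cdot> Pr1 C I (IOb D)) = \<mu>"
  have ex1: "(\<exists>!h'. ?Q (lift (Ide C I) u) (lift (Pr1 C I (IOb D)) \<mu>) h') \<longleftrightarrow> (\<exists>!h. ?P u \<mu> h)"
    if u: "u \<in> hom C I (IOb A)" and m: "\<mu> \<in> hom C (Prod C I (IOb D)) (IAr A)" for u \<mu>
  proof -
    note [simp] = u[simplified] m[simplified]
    have Q: "?Q (lift (Ide C I) u) (lift (Pr1 C I (IOb D)) \<mu>) (lift (Ide C I) h) \<longleftrightarrow> ?P u \<mu> h"
      if h: "h \<in> hom C I (IAr A)" for h
    proof -
      note [simp] = h[simplified]
      have st: "(Comp \<S> (ISrc A') (lift (Ide C I) h) = lift (Ide C I) (FOb V \<cdot> bang I) \<and> Comp \<S> (ITgt A') (lift (Ide C I) h) = lift (Ide C I) u) \<longleftrightarrow> ISrc A \<cdot> h = FOb V \<cdot> bang I \<and> ITgt A \<cdot> h = u"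
        by simp
      have "icomp \<S> A' (pull_ar C I (leg F \<gamma>)) (Comp \<S> (lift (Ide C I) h) (S.bang (IOb D'))) = lift (Pr1 C I (IOb D)) (icomp C A (leg F \<gamma> \<cdot> Pr2 C I (IOb D)) (h \<cdot> Pr1 C I (IOb D)))"
        if s: "ISrc A \<cdot> h = FOb V \<cdot> bang I \<and> ITgt A \<cdot> h = u"
      proof -
        have hc: "ISrc A \<cdot> (h \<cdot> Pr1 C I (IOb D)) = FOb V \<cdot> bang (Prod C I (IOb D))"
          using comp_eq_comp[of "ISrc A" h _ "Pr1 C I (IOb D)"] s by simp
        have c: "composable A (leg F \<gamma> \<cdot> Pr2 C I (IOb D)) (h \<cdot> Pr1 C I (IOb D))"
          using hc lst[of "Pr2 C I (IOb D)"] by (simp add: composable_def)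
        have "Comp \<S> (lift (Ide C I) h) (S.bang (Pr1 C I (IOb D))) = lift (Pr1 C I (IOb D)) (h \<cdot> Pr1 C I (IOb D))"
          "pull_ar C I (leg F \<gamma>) = lift (Pr1 C I (IOb D)) (leg F \<gamma> \<cdot> Pr2 C I (IOb D))"
          by (simp_all add: pull_ar_lift)
        then show ?thesis
          using c by (simp add: icomp_pull)
      qed
      moreover have "icomp C A (leg F \<gamma> \<cdot> Pr2 C I (IOb D)) (h \<cdot> Pr1 C I (IOb D)) \<in> Arr C \<and> Dom C (icomp C A (leg F \<gamma> \<cdot> Pr2 C I (IOb D)) (h \<cdot> Pr1 C I (IOb D))) = Prod C I (IOb D) \<and> Cod C (icomp C A (leg F \<gamma> \<cdot> Pr2 C I (IOb D)) (h \<cdot> Pr1 C I (IOb D))) = IAr A"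
        if s: "ISrc A \<cdot> h = FOb V \<cdot> bang I \<and> ITgt A \<cdot> h = u"
      proof -
        have hc: "ISrc A \<cdot> (h \<cdot> Pr1 C I (IOb D)) = FOb V \<cdot> bang (Prod C I (IOb D))"
          using comp_eq_comp[of "ISrc A" h _ "Pr1 C I (IOb D)"] s by simp
        then show ?thesis
          using lst[of "Pr2 C I (IOb D)"] by simp
      qed
      ultimately show ?thesis
        using st by auto
    qed
    have "?Q (lift (Ide C I) u) (lift (Pr1 C I (IOb D)) \<mu>) h' \<longleftrightarrow> (\<exists>h. h' = lift (Ide C I) h \<and> ?P u \<mu> h)" for h'
    proof
      assume Q': "?Q (lift (Ide C I) u) (lift (Pr1 C I (IOb D)) \<mu>) h'"
      then have h': "h' \<in> Arr \<S>" "Cod \<S> h' = Pr1 C I (IAr A)" "Dom \<S> h' = Ide C I"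
        by simp_all
      obtain h where h: "h' = lift (Ide C I) h" "h \<in> Arr C" "Dom C h = Dom C (Ide C I)" "Cod C h = IAr A"
        by (rule lift_cases[OF h'(1,2) icat_data(2)[OF cA] h'(3)])
      have "?P u \<mu> h"
        using Q[of h] Q' h by simp
      then show "\<exists>h. h' = lift (Ide C I) h \<and> ?P u \<mu> h"
        using h(1) by blast
    next
      assume "\<exists>h. h' = lift (Ide C I) h \<and> ?P u \<mu> h"
      then obtain h where h: "h' = lift (Ide C I) h" "?P u \<mu> h"
        by blast
      then show "?Q (lift (Ide C I) u) (lift (Pr1 C I (IOb D)) \<mu>) h'"
        using Q[of h] by blast
    qed
    note Q_iff = this
    have inj: "h = h'" if "?P u \<mu> h" "?P u \<mu> h'" "lift (Ide C I) h = lift (Ide C I) h'" for h h'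
      using that by simp
    show ?thesis
      unfolding Q_iff using inj by blast
  qed
  have t: "is_initial (Cocones \<S> F') (V', \<gamma>') \<longleftrightarrow> (\<forall>v' \<mu>'. S.ecocone F' v' \<mu>' \<longrightarrow> (\<exists>!h'. ?Q v' \<mu>' h'))"
    unfolding S.initial_cocone_iff[OF F' c'] V' l' by simp
  show ?thesis
    unfolding p t
  proof (intro iffI allI impI)
    fix u \<mu> assume a: "\<forall>v' \<mu>'. S.ecocone F' v' \<mu>' \<longrightarrow> (\<exists>!h'. ?Q v' \<mu>' h')" and G: "gcocone F I u \<mu>"
    have u: "u \<in> hom C I (IOb A)" and m: "\<mu> \<in> hom C (Prod C I (IOb D)) (IAr A)"
      using G unfolding gcocone_def FD FA by blast+
    show "\<exists>!h. ?P u \<mu> h"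
      using a ecocone_pull_iff[OF u m] G ex1[OF u m] by blast
  next
    fix v' \<mu>' assume a: "\<forall>u \<mu>. gcocone F I u \<mu> \<longrightarrow> (\<exists>!h. ?P u \<mu> h)" and E: "S.ecocone F' v' \<mu>'"
    obtain u \<mu> where um: "v' = lift (Ide C I) u" "\<mu>' = lift (Pr1 C I (IOb D)) \<mu>" "u \<in> hom C I (IOb A)"
      "\<mu> \<in> hom C (Prod C I (IOb D)) (IAr A)"
      by (rule ecocone_pull_cases[OF E])
    show "\<exists>!h'. ?Q v' \<mu>' h'"
      unfolding um(1,2) ex1[OF um(3,4)] using a E ecocone_pull_iff[OF um(3,4)] unfolding um(1,2) by blast
  qed
qed

end

end

text \<open>To be used with a slice in the role of \<open>C\<close>: universality there refers to
  pulling back to each slice of that slice, so these have to be cartesian closed too.\<close>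

locale lccc = ccc C for C :: "('o, 'a) cart_category" (structure) +
  assumes slices_closed: "K \<in> Obj C \<Longrightarrow> cartesian_closed (slice C K)"
begin

lemma ccc_pull: "K \<in> Obj C \<Longrightarrow> ccc_pull C K"
  by unfold_locales (simp_all add: slices_closed)

text \<open>For a given cone, \<open>pull_cone_terminal_iff\<close> at all stages turns one notion
  into the other; for existence, \<open>cone_of_econe\<close> supplies a cone with the given vertex
  and legs.\<close>

lemma universal_cone_ex_iff:
  assumes F: "is_ifun C F"
  shows "(\<exists>c. universal_cone C F c) \<longleftrightarrow> (\<exists>v \<kappa>. euniv F v \<kappa>)"
proof -
  have iff: "universal_cone C F (V, \<gamma>) \<longleftrightarrow> euniv F (FOb V) (leg F \<gamma>)" if c: "is_cone C F (V, \<gamma>)" for V \<gamma>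
    unfolding universal_cone_def euniv_def
    using c econe_of_cone[OF F refl refl c] ccc_pull.pull_cone_terminal_iff[OF ccc_pull F refl refl c] by simp
  show ?thesis
  proof
    assume "\<exists>c. universal_cone C F c"
    then obtain V \<gamma> where u: "universal_cone C F (V, \<gamma>)"
      by auto
    then have "is_cone C F (V, \<gamma>)"
      by (simp add: universal_cone_def)
    then show "\<exists>v \<kappa>. euniv F v \<kappa>"
      using iff u by blast
  next
    assume "\<exists>v \<kappa>. euniv F v \<kappa>"
    then obtain v \<kappa> where u: "euniv F v \<kappa>"
      by blast
    then obtain V \<gamma> where "is_cone C F (V, \<gamma>)" "FOb V = v" "leg F \<gamma> = \<kappa>"
      using cone_of_econe[OF F refl refl, of v \<kappa>] unfolding euniv_def by blast
    then show "\<exists>c. universal_cone C F c"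
      using iff u by blast
  qed
qed

lemma universal_cocone_ex_iff:
  assumes F: "is_ifun C F"
  shows "(\<exists>c. universal_cocone C F c) \<longleftrightarrow> (\<exists>v \<kappa>. ecouniv F v \<kappa>)"
proof -
  have iff: "universal_cocone C F (V, \<gamma>) \<longleftrightarrow> ecouniv F (FOb V) (leg F \<gamma>)" if c: "is_cocone C F (V, \<gamma>)" for V \<gamma>
    unfolding universal_cocone_def ecouniv_def
    using c econe_of_cocone[OF F refl refl c] ccc_pull.pull_cocone_initial_iff[OF ccc_pull F refl refl c] by simp
  show ?thesis
  proof
    assume "\<exists>c. universal_cocone C F c"
    then obtain V \<gamma> where u: "universal_cocone C F (V, \<gamma>)"
      by auto
    then have "is_cocone C F (V, \<gamma>)"
      by (simp add: universal_cocone_def)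
    then show "\<exists>v \<kappa>. ecouniv F v \<kappa>"
      using iff u by blast
  next
    assume "\<exists>v \<kappa>. ecouniv F v \<kappa>"
    then obtain v \<kappa> where u: "ecouniv F v \<kappa>"
      by blast
    then obtain V \<gamma> where "is_cocone C F (V, \<gamma>)" "FOb V = v" "leg F \<gamma> = \<kappa>"
      using cocone_of_econe[OF F refl refl, of v \<kappa>] unfolding ecouniv_def by blast
    then show "\<exists>c. universal_cocone C F c"
      using iff u by blast
  qed
qed

end

section \<open>Colimits from limits\<close>

context ccc
begin

lemma gcocone_simps:
  assumes "gcocone F Z v \<mu>"
  shows "v \<in> hom C Z (IOb (FCod F))" "\<mu> \<in> hom C (Prod C Z (IOb (FDom F))) (IAr (FCod F))"
    "\<And>t x. el2 t x Z (IOb (FDom F)) \<Longrightarrow> ISrc (FCod F) \<cdot> (\<mu> \<cdot> pair C t x) = FOb F \<cdot> x"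
    "\<And>t x. el2 t x Z (IOb (FDom F)) \<Longrightarrow> ITgt (FCod F) \<cdot> (\<mu> \<cdot> pair C t x) = v \<cdot> t"
    "\<And>t d. el2 t d Z (IAr (FDom F)) \<Longrightarrow>
      icomp C (FCod F) (FAr F \<cdot> d) (\<mu> \<cdot> pair C t (ITgt (FDom F) \<cdot> d)) = \<mu> \<cdot> pair C t (ISrc (FDom F) \<cdot> d)"
  using assms unfolding gcocone_def by blast+

text \<open>Over the objects of \<open>B\<close> there are two families of functors, the one
  constant at \<open>F\<close> and the one whose member at \<open>u\<close> is the constant functor
  with value \<open>u\<close>. A transformation between them, substituted along \<open>u\<close>, is
  a cocone with vertex \<open>u\<close>, so \<open>natfam_representable\<close> applies.\<close>

lemma gcocone_representable:
  assumes F: "is_ifun C F" and FD: "FDom F = D" and FB: "FCod F = B"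
  shows "\<exists>N p \<phi>. N \<in> Obj C \<and> gcocone F N p \<phi> \<and>
    (\<forall>Z u a. gcocone F Z u a \<longrightarrow> (\<exists>w\<in>hom C Z N. p \<cdot> w = u \<and> (\<forall>t x. el2 t x Z (IOb D) \<longrightarrow> \<phi> \<cdot> pair C (w \<cdot> t) x = a \<cdot> pair C t x))) \<and>
    (\<forall>w v. w \<in> Arr C \<and> v \<in> Arr C \<and> Dom C v = Dom C w \<and> Cod C w = N \<and> Cod C v = N \<and> p \<cdot> w = p \<cdot> v \<and>
      (\<forall>t x. el2 t x (Dom C w) (IOb D) \<longrightarrow> \<phi> \<cdot> pair C (w \<cdot> t) x = \<phi> \<cdot> pair C (v \<cdot> t) x) \<longrightarrow> w = v)"
proof -
  have D: "is_icat C D" and B: "is_icat C B"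
    using ifun_icat[OF F] FD FB by simp_all
  note f = functor_simps[OF ifun_icat(3)[OF F], unfolded FD FB]
  note [simp] = D B f(1-9)
  let ?f0 = "FOb F \<cdot> Pr2 C (IOb B) (IOb D)" and ?f1 = "FAr F \<cdot> Pr2 C (IOb B) (IAr D)"
  let ?g0 = "Pr1 C (IOb B) (IOb D)" and ?g1 = "IIde B \<cdot> Pr1 C (IOb B) (IAr D)"
  have F1: "fam D B (IOb B) ?f0 ?f1"
    unfolding fam_def by (simp add: f(10))
  have G1: "fam D B (IOb B) ?g0 ?g1"
    unfolding fam_def by simp
  have nf: "natfam D B ?f0 ?f1 ?g0 ?g1 u a \<longleftrightarrow> gcocone F Z u a" if u: "u \<in> hom C Z (IOb B)" for Z u a
  proof
    note [simp] = u[simplified]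
    assume n: "natfam D B ?f0 ?f1 ?g0 ?g1 u a"
    note s = natfam_simps[OF n]
    show "gcocone F Z u a"
      unfolding gcocone_def FD FB
    proof (intro conjI allI impI)
      fix t d assume td: "el2 t d Z (IAr D)"
      then show "icomp C B (FAr F \<cdot> d) (a \<cdot> pair C t (ITgt D \<cdot> d)) = a \<cdot> pair C t (ISrc D \<cdot> d)"
        using s(6)[of t d] s(1-3) s(5)[of t "ISrc D \<cdot> d"] by simp
    qed (use u s(1-5) in simp_all)
  next
    note [simp] = u[simplified]
    assume G: "gcocone F Z u a"
    note s = gcocone_simps[OF G, unfolded FD FB]
    have a: "a \<in> Arr C" "Dom C a = Prod C Z (IOb D)" "Cod C a = IAr B"
      using s(2) by simp_all
    show "natfam D B ?f0 ?f1 ?g0 ?g1 u a"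
      unfolding natfam_def by (simp add: a s(3-5) cong: conj_cong)
  qed
  show ?thesis
  proof (rule natfam_representable[OF D B icat_data(1)[OF B] F1 G1])
    fix N p \<phi> assume N: "N \<in> Obj C" "p \<in> hom C N (IOb B)" "natfam D B ?f0 ?f1 ?g0 ?g1 p \<phi>"
      and ex: "\<And>u a. u \<in> Arr C \<Longrightarrow> Cod C u = IOb B \<Longrightarrow> natfam D B ?f0 ?f1 ?g0 ?g1 u a \<Longrightarrow>
        \<exists>w\<in>hom C (Dom C u) N. p \<cdot> w = u \<and> (\<forall>t x. el2 t x (Dom C u) (IOb D) \<longrightarrow> \<phi> \<cdot> pair C (w \<cdot> t) x = a \<cdot> pair C t x)"
      and un: "\<And>w v. w \<in> Arr C \<Longrightarrow> v \<in> Arr C \<Longrightarrow> Dom C v = Dom C w \<Longrightarrow> Cod C w = N \<Longrightarrow> Cod C v = N \<Longrightarrow> p \<cdot> w = p \<cdot> v \<Longrightarrow>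
        (\<And>t x. el2 t x (Dom C w) (IOb D) \<Longrightarrow> \<phi> \<cdot> pair C (w \<cdot> t) x = \<phi> \<cdot> pair C (v \<cdot> t) x) \<Longrightarrow> w = v"
    have "gcocone F N p \<phi>"
      using nf[OF N(2)] N(3) by blast
    moreover have "\<exists>w\<in>hom C Z N. p \<cdot> w = u \<and> (\<forall>t x. el2 t x Z (IOb D) \<longrightarrow> \<phi> \<cdot> pair C (w \<cdot> t) x = a \<cdot> pair C t x)"
      if G: "gcocone F Z u a" for Z u a
    proof -
      have u: "u \<in> hom C Z (IOb B)"
        using gcocone_simps(1)[OF G] FB by simp
      then show ?thesis
        using ex[of u a] nf[OF u] G by simp
    qed
    ultimately show ?thesis
      using N(1) un by blast
  qed
qed

text \<open>The limit is formed once, over the global category of cocones, and still gives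
  universality at every stage: a cocone at stage \<open>Z\<close> is an arrow from \<open>Z\<close>
  to \<open>N\<close>, with which the legs \<open>\<kappa>\<close> can be composed.\<close>

lemma colimit_of_limits:
  assumes B: "is_icat C B"
    and lim: "\<And>G. is_ifun C G \<Longrightarrow> FCod G = B \<Longrightarrow> \<exists>v \<kappa>. euniv G v \<kappa>"
    and F: "is_ifun C F" and FB: "FCod F = B"
  shows "\<exists>v \<kappa>. ecouniv F v \<kappa>"
proof -
  obtain D where FD: "FDom F = D" by simp
  have D: "is_icat C D"
    using ifun_icat(1)[OF F] FD by simp
  note f = functor_simps[OF ifun_icat(3)[OF F], unfolded FD FB]
  obtain N p \<phi> where N: "N \<in> Obj C" and G: "gcocone F N p \<phi>"
    and ex': "\<forall>Z u a. gcocone F Z u a \<longrightarrow> (\<exists>w\<in>hom C Z N. p \<cdot> w = u \<and> (\<forall>t x. el2 t x Z (IOb D) \<longrightarrow> \<phi> \<cdot> pair C (w \<cdot> t) x = a \<cdot> pair C t x))"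
    and ext': "\<forall>w v. w \<in> Arr C \<and> v \<in> Arr C \<and> Dom C v = Dom C w \<and> Cod C w = N \<and> Cod C v = N \<and> p \<cdot> w = p \<cdot> v \<and>
      (\<forall>t x. el2 t x (Dom C w) (IOb D) \<longrightarrow> \<phi> \<cdot> pair C (w \<cdot> t) x = \<phi> \<cdot> pair C (v \<cdot> t) x) \<longrightarrow> w = v"
    using gcocone_representable[OF F FD FB] by (elim exE conjE) (rule that)
  note ex = ex'[rule_format]
  have ext: "w = v" if "w \<in> Arr C" "v \<in> Arr C" "Dom C v = Dom C w" "Cod C w = N" "Cod C v = N" "p \<cdot> w = p \<cdot> v"
    "\<And>t x. el2 t x (Dom C w) (IOb D) \<Longrightarrow> \<phi> \<cdot> pair C (w \<cdot> t) x = \<phi> \<cdot> pair C (v \<cdot> t) x" for w v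
  proof -
    have "\<forall>t x. el2 t x (Dom C w) (IOb D) \<longrightarrow> \<phi> \<cdot> pair C (w \<cdot> t) x = \<phi> \<cdot> pair C (v \<cdot> t) x"
      using that(7) by blast
    then show ?thesis
      using ext' that(1-6) by blast
  qed
  note g = gcocone_simps[OF G, unfolded FD FB]
  have \<phi>_st [simp]: "ISrc B \<cdot> (\<phi> \<cdot> pair C n x) = FOb F \<cdot> x" "ITgt B \<cdot> (\<phi> \<cdot> pair C n x) = p \<cdot> n"
    if "n \<in> Arr C" "x \<in> Arr C" "Dom C x = Dom C n" "Cod C n = N" "Cod C x = IOb D" for n x
    using g(3,4)[of n x] that by simp_all
  have \<phi>_nat: "icomp C B (FAr F \<cdot> d) (\<phi> \<cdot> pair C n (ITgt D \<cdot> d)) = \<phi> \<cdot> pair C n (ISrc D \<cdot> d)"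
    if "n \<in> Arr C" "d \<in> Arr C" "Dom C d = Dom C n" "Cod C n = N" "Cod C d = IAr D" for n d
    using g(5)[of n d] that by simp
  note [simp] = B D f(1-9) N g(1,2)[simplified]

  \<comment> \<open>An element of \<open>P\<close> is a cocone \<open>pn\<close> with an arrow
    \<open>ph\<close> of \<open>B\<close> out of its vertex, that is, an arrow of cocones; its
    target \<open>\<tau>\<close> is determined by these and found below.\<close>
  obtain P pn ph where pb: "is_pullback C p (ISrc B) P pn ph"
    using pullback_ex[of p N "IOb B" "ISrc B" "IAr B"] by auto
  note pbs = pullback_simps[OF pb]
  note [simp] = pbs(1) pbs(2,3)[simplified]
  have src_ph [simp]: "ISrc B \<cdot> (ph \<cdot> w) = p \<cdot> (pn \<cdot> w)" if "w \<in> Arr C" "Cod C w = P" for w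
    using comp_eq_comp[OF pbs(4), of w] that by simp
  have mk: "\<exists>w\<in>hom C (Dom C n) P. pn \<cdot> w = n \<and> ph \<cdot> w = h"
    if "n \<in> Arr C" "h \<in> Arr C" "Dom C h = Dom C n" "Cod C n = N" "Cod C h = IAr B" "ISrc B \<cdot> h = p \<cdot> n" for n h
  proof -
    have "\<exists>!w. w \<in> hom C (Dom C n) P \<and> pn \<cdot> w = n \<and> ph \<cdot> w = h"
      using that by (intro pullback_unique[OF pb]) simp_all
    then show ?thesis
      by blast
  qed
  have P_ext: "w = w'" if "w \<in> Arr C" "w' \<in> Arr C" "Dom C w = Dom C w'" "Cod C w = P" "Cod C w' = P"
    "pn \<cdot> w = pn \<cdot> w'" "ph \<cdot> w = ph \<cdot> w'" for w w'
    by (rule pullback_ext[OF pb that])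

  \<comment> \<open>The components of the cocone \<open>pn\<close> followed by \<open>ph\<close>:
    the cocone extended along \<open>ph\<close>, which \<open>\<tau>\<close> names.\<close>
  let ?a = "icomp C B (\<phi> \<cdot> pair C (pn \<cdot> Pr1 C P (IOb D)) (Pr2 C P (IOb D))) (ph \<cdot> Pr1 C P (IOb D))"
  have "gcocone F P (ITgt B \<cdot> ph) ?a"
    unfolding gcocone_def FD FB
  proof (intro conjI allI impI)
    fix t d assume td: "el2 t d P (IAr D)"
    then have "icomp C B (FAr F \<cdot> d) (icomp C B (\<phi> \<cdot> pair C (pn \<cdot> t) (ITgt D \<cdot> d)) (ph \<cdot> t)) =
      icomp C B (\<phi> \<cdot> pair C (pn \<cdot> t) (ISrc D \<cdot> d)) (ph \<cdot> t)"
      using \<phi>_nat[of "pn \<cdot> t" d] by (simp add: icomp_assoc[symmetric])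
    then show "icomp C B (FAr F \<cdot> d) (?a \<cdot> pair C t (ITgt D \<cdot> d)) = ?a \<cdot> pair C t (ISrc D \<cdot> d)"
      using td by simp
  qed simp_all
  then obtain \<tau> where \<tau>: "\<tau> \<in> hom C P N" "p \<cdot> \<tau> = ITgt B \<cdot> ph"
    and \<phi>_\<tau>': "\<And>t x. el2 t x P (IOb D) \<Longrightarrow> \<phi> \<cdot> pair C (\<tau> \<cdot> t) x = ?a \<cdot> pair C t x"
    using ex by blast
  note [simp] = \<tau>(1)[simplified]
  have p_\<tau> [simp]: "p \<cdot> (\<tau> \<cdot> w) = ITgt B \<cdot> (ph \<cdot> w)" if "w \<in> Arr C" "Cod C w = P" for w
    using comp_eq_comp[OF \<tau>(2), of w] that by simp
  have \<phi>_\<tau>: "\<phi> \<cdot> pair C (\<tau> \<cdot> w) x = icomp C B (\<phi> \<cdot> pair C (pn \<cdot> w) x) (ph \<cdot> w)"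
    if "w \<in> Arr C" "x \<in> Arr C" "Dom C x = Dom C w" "Cod C w = P" "Cod C x = IOb D" for w x
    using \<phi>_\<tau>'[of w x] that by simp

  \<comment> \<open>The identity of a cocone is the identity of its vertex; by the unit law in
    \<open>B\<close>, extending along it changes no component, whence
    \<open>\<tau> \<cdot> i\<close> is an identity.\<close>
  obtain i where i: "i \<in> hom C (Dom C (Ide C N)) P" "pn \<cdot> i = Ide C N" "ph \<cdot> i = IIde B \<cdot> p"
    using mk[of "Ide C N" "IIde B \<cdot> p"] by auto
  have i1 [simp]: "i \<in> Arr C" "Dom C i = N" "Cod C i = P"
    using i(1) by simp_all
  have i_el [simp]: "pn \<cdot> (i \<cdot> n) = n" "ph \<cdot> (i \<cdot> n) = IIde B \<cdot> (p \<cdot> n)" if "n \<in> Arr C" "Cod C n = N" for n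
    using comp_eq_comp[OF i(2), of n] comp_eq_comp[OF i(3), of n] that by simp_all
  have \<tau>_i: "\<tau> \<cdot> i = Ide C N"
  proof (rule ext)
    fix t x assume "el2 t x (Dom C (\<tau> \<cdot> i)) (IOb D)"
    then show "\<phi> \<cdot> pair C ((\<tau> \<cdot> i) \<cdot> t) x = \<phi> \<cdot> pair C (Ide C N \<cdot> t) x"
      by (simp add: \<phi>_\<tau>)
  qed (simp_all add: i(3))
  have \<tau>_i_el [simp]: "\<tau> \<cdot> (i \<cdot> n) = n" if "n \<in> Arr C" "Cod C n = N" for n
    using comp_eq_comp[OF \<tau>_i, of n] that by simp

  \<comment> \<open>Composition of arrows of cocones keeps the source of the first and composes the
    underlying arrows of \<open>B\<close>. The choice is unique by \<open>P_ext\<close>.\<close>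
  define m where "m w w' = (SOME v. v \<in> hom C (Dom C w) P \<and> pn \<cdot> v = pn \<cdot> w \<and> ph \<cdot> v = icomp C B (ph \<cdot> w) (ph \<cdot> w'))" for w w'
  have m: "m w w' \<in> Arr C" "Dom C (m w w') = Dom C w'" "Cod C (m w w') = P" "pn \<cdot> m w w' = pn \<cdot> w"
      "ph \<cdot> m w w' = icomp C B (ph \<cdot> w) (ph \<cdot> w')"
    if w: "w \<in> Arr C" "w' \<in> Arr C" "Cod C w = P" "Cod C w' = P" "Dom C w = Dom C w'" "\<tau> \<cdot> w = pn \<cdot> w'" for w w'
  proof -
    have c: "ITgt B \<cdot> (ph \<cdot> w) = ISrc B \<cdot> (ph \<cdot> w')"
      using p_\<tau>[OF w(1,3)] w by simp
    have "\<exists>v\<in>hom C (Dom C (pn \<cdot> w)) P. pn \<cdot> v = pn \<cdot> w \<and> ph \<cdot> v = icomp C B (ph \<cdot> w) (ph \<cdot> w')"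
      by (rule mk) (use w(1-5) c in simp_all)
    then have "\<exists>v. v \<in> hom C (Dom C w) P \<and> pn \<cdot> v = pn \<cdot> w \<and> ph \<cdot> v = icomp C B (ph \<cdot> w) (ph \<cdot> w')"
      using w(1,3) by auto
    from someI_ex[OF this, folded m_def]
    show "m w w' \<in> Arr C" "Dom C (m w w') = Dom C w'" "Cod C (m w w') = P" "pn \<cdot> m w w' = pn \<cdot> w"
      "ph \<cdot> m w w' = icomp C B (ph \<cdot> w) (ph \<cdot> w')"
      using w(5) by simp_all
  qed
  have m_el: "pn \<cdot> (m w w' \<cdot> t) = pn \<cdot> (w \<cdot> t)" "ph \<cdot> (m w w' \<cdot> t) = icomp C B (ph \<cdot> (w \<cdot> t)) (ph \<cdot> (w' \<cdot> t))"
    if w: "w \<in> Arr C" "w' \<in> Arr C" "Cod C w = P" "Cod C w' = P" "Dom C w = Dom C w'" "\<tau> \<cdot> w = pn \<cdot> w'"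
      and t: "t \<in> Arr C" "Cod C t = Dom C w'" for w w' t
  proof -
    have c: "ITgt B \<cdot> (ph \<cdot> w) = ISrc B \<cdot> (ph \<cdot> w')"
      using p_\<tau>[OF w(1,3)] w by simp
    show "pn \<cdot> (m w w' \<cdot> t) = pn \<cdot> (w \<cdot> t)" "ph \<cdot> (m w w' \<cdot> t) = icomp C B (ph \<cdot> (w \<cdot> t)) (ph \<cdot> (w' \<cdot> t))"
      using comp_eq_comp[OF m(4)[OF w], of t] comp_eq_comp[OF m(5)[OF w], of t] m(1-3)[OF w] w(1-5) t c by simp_all
  qed
  have \<tau>_el: "\<tau> \<cdot> (w \<cdot> t) = pn \<cdot> (w' \<cdot> t)"
    if "\<tau> \<cdot> w = pn \<cdot> w'" "w \<in> Arr C" "w' \<in> Arr C" "Cod C w = P" "Cod C w' = P" "Dom C w = Dom C w'" "t \<in> Arr C" "Cod C t = Dom C w'" for w w' t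
    using comp_eq_comp[OF that(1), of t] that by simp
  have c_el: "ITgt B \<cdot> (ph \<cdot> (w \<cdot> t)) = p \<cdot> (pn \<cdot> (w' \<cdot> t))"
    if "\<tau> \<cdot> w = pn \<cdot> w'" "w \<in> Arr C" "w' \<in> Arr C" "Cod C w = P" "Cod C w' = P" "Dom C w = Dom C w'" "t \<in> Arr C" "Cod C t = Dom C w'" for w w' t
    using p_\<tau>[of "w \<cdot> t"] \<tau>_el[OF that] that by simp
  have c0: "ITgt B \<cdot> (ph \<cdot> w) = p \<cdot> (pn \<cdot> w')"
    if "\<tau> \<cdot> w = pn \<cdot> w'" "w \<in> Arr C" "w' \<in> Arr C" "Cod C w = P" "Cod C w' = P" "Dom C w = Dom C w'" for w w'
    using p_\<tau>[of w] that by simp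
  \<comment> \<open>Extending a cocone along a composite is extending twice, by associativity in
    \<open>B\<close>; equality of the named cocones follows from equal components.\<close>
  have \<tau>_m: "\<tau> \<cdot> m w w' = \<tau> \<cdot> w'"
    if w: "w \<in> Arr C" "w' \<in> Arr C" "Cod C w = P" "Cod C w' = P" "Dom C w = Dom C w'" "\<tau> \<cdot> w = pn \<cdot> w'" for w w'
  proof (rule ext)
    fix t x assume tx: "el2 t x (Dom C (\<tau> \<cdot> m w w')) (IOb D)"
    then have t: "t \<in> Arr C" "Cod C t = Dom C w'" "x \<in> Arr C" "Dom C x = Dom C t" "Cod C x = IOb D"
      using m(1-3)[OF w] by simp_all
    note c = c_el[OF w(6,1-5) t(1,2)]
    have wt: "w \<cdot> t \<in> Arr C" "Cod C (w \<cdot> t) = P" "Dom C (w \<cdot> t) = Dom C t" "w' \<cdot> t \<in> Arr C" "Cod C (w' \<cdot> t) = P" "Dom C (w' \<cdot> t) = Dom C t"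
      using w(1-5) t by simp_all
    have "\<phi> \<cdot> pair C (\<tau> \<cdot> (m w w' \<cdot> t)) x =
      icomp C B (\<phi> \<cdot> pair C (pn \<cdot> (w \<cdot> t)) x) (icomp C B (ph \<cdot> (w \<cdot> t)) (ph \<cdot> (w' \<cdot> t)))"
      using \<phi>_\<tau>[of "m w w' \<cdot> t" x] m(1-3)[OF w] m_el[OF w t(1,2)] t by simp
    also have "\<dots> = icomp C B (icomp C B (\<phi> \<cdot> pair C (pn \<cdot> (w \<cdot> t)) x) (ph \<cdot> (w \<cdot> t))) (ph \<cdot> (w' \<cdot> t))"
      using wt t c by (simp add: icomp_assoc)
    also have "icomp C B (\<phi> \<cdot> pair C (pn \<cdot> (w \<cdot> t)) x) (ph \<cdot> (w \<cdot> t)) = \<phi> \<cdot> pair C (\<tau> \<cdot> (w \<cdot> t)) x"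
      using \<phi>_\<tau>[of "w \<cdot> t" x] wt t by simp
    also have "\<tau> \<cdot> (w \<cdot> t) = pn \<cdot> (w' \<cdot> t)"
      by (rule \<tau>_el[OF w(6,1-5) t(1,2)])
    also have "icomp C B (\<phi> \<cdot> pair C (pn \<cdot> (w' \<cdot> t)) x) (ph \<cdot> (w' \<cdot> t)) = \<phi> \<cdot> pair C (\<tau> \<cdot> (w' \<cdot> t)) x"
      using \<phi>_\<tau>[of "w' \<cdot> t" x] wt t by simp
    finally show "\<phi> \<cdot> pair C ((\<tau> \<cdot> m w w') \<cdot> t) x = \<phi> \<cdot> pair C ((\<tau> \<cdot> w') \<cdot> t) x"
      using m(1-3)[OF w] w(1-5) t by simp
  qed (use m[OF w] w(1-5) c0[OF w(6,1-5)] in simp_all)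
  obtain Q q1 q2 where pb2: "is_pullback C \<tau> pn Q q1 q2"
    using pullback_ex[of \<tau> P N pn P] by auto
  have "\<exists>X. is_icat C X \<and> IOb X = N \<and> IAr X = P \<and> ISrc X = pn \<and> ITgt X = \<tau> \<and> IIde X = i \<and>
    (\<forall>f g. composable X f g \<longrightarrow> icomp C X f g = m f g)"
  proof (rule icat_exists[OF _ _ _ _ _ pb2])
    fix w w' assume w: "w \<in> Arr C" "w' \<in> Arr C" "Cod C w = P" "Cod C w' = P" "Dom C w = Dom C w'" "\<tau> \<cdot> w = pn \<cdot> w'"
    show "m w w' \<in> hom C (Dom C w) P \<and> pn \<cdot> m w w' = pn \<cdot> w \<and> \<tau> \<cdot> m w w' = \<tau> \<cdot> w'"
      using m[OF w] \<tau>_m[OF w] w(5) by simp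
    fix u assume u: "u \<in> Arr C" "Cod C u = Dom C w"
    have u': "Cod C u = Dom C w'"
      using u w(5) by simp
    have wu: "w \<cdot> u \<in> Arr C" "w' \<cdot> u \<in> Arr C" "Cod C (w \<cdot> u) = P" "Cod C (w' \<cdot> u) = P" "Dom C (w \<cdot> u) = Dom C (w' \<cdot> u)"
      "\<tau> \<cdot> (w \<cdot> u) = pn \<cdot> (w' \<cdot> u)"
      using w(1-5) u(1) u' \<tau>_el[OF w(6,1-5) u(1) u'] by simp_all
    show "m w w' \<cdot> u = m (w \<cdot> u) (w' \<cdot> u)"
      by (rule P_ext) (use m[OF w] m[OF wu] m_el[OF w u(1) u'] w(1-5) u(1) u' in simp_all)
  next
    fix w assume w: "w \<in> Arr C" "Cod C w = P"
    have a: "i \<cdot> (pn \<cdot> w) \<in> Arr C" "w \<in> Arr C" "Cod C (i \<cdot> (pn \<cdot> w)) = P" "Cod C w = P" "Dom C (i \<cdot> (pn \<cdot> w)) = Dom C w"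
      "\<tau> \<cdot> (i \<cdot> (pn \<cdot> w)) = pn \<cdot> w"
      using w by simp_all
    have b: "w \<in> Arr C" "i \<cdot> (\<tau> \<cdot> w) \<in> Arr C" "Cod C w = P" "Cod C (i \<cdot> (\<tau> \<cdot> w)) = P" "Dom C w = Dom C (i \<cdot> (\<tau> \<cdot> w))"
      "\<tau> \<cdot> w = pn \<cdot> (i \<cdot> (\<tau> \<cdot> w))"
      using w by simp_all
    show "m (i \<cdot> (pn \<cdot> w)) w = w"
      by (rule P_ext) (use m[OF a] w in simp_all)
    show "m w (i \<cdot> (\<tau> \<cdot> w)) = w"
      by (rule P_ext) (use m[OF b] w in simp_all)
  next
    fix u v w assume u: "u \<in> Arr C" and v: "v \<in> Arr C" and w: "w \<in> Arr C" and cu: "Cod C u = P" and cv: "Cod C v = P" and cw: "Cod C w = P"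
      and uv: "Dom C u = Dom C v" and vw: "Dom C v = Dom C w" and e1: "\<tau> \<cdot> u = pn \<cdot> v" and e2: "\<tau> \<cdot> v = pn \<cdot> w"
    note a = u v cu cv uv e1
    note b = v w cv cw vw e2
    have c: "m u v \<in> Arr C" "w \<in> Arr C" "Cod C (m u v) = P" "Cod C w = P" "Dom C (m u v) = Dom C w" "\<tau> \<cdot> m u v = pn \<cdot> w"
      using m[OF a] \<tau>_m[OF a] w cw vw e2 by simp_all
    have d: "u \<in> Arr C" "m v w \<in> Arr C" "Cod C u = P" "Cod C (m v w) = P" "Dom C u = Dom C (m v w)" "\<tau> \<cdot> u = pn \<cdot> m v w"
      using m[OF b] u cu uv vw e1 by simp_all
    show "m (m u v) w = m u (m v w)"
    proof (rule P_ext)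
      show "ph \<cdot> m (m u v) w = ph \<cdot> m u (m v w)"
        using m(5)[OF a] m(5)[OF b] m(5)[OF c] m(5)[OF d] c0[OF e1 u v cu cv uv] c0[OF e2 v w cv cw vw] u v w cu cv cw uv vw
        by (simp add: icomp_assoc)
    qed (use m(1-4)[OF a] m(1-4)[OF b] m(1-4)[OF c] m(1-4)[OF d] in simp_all)
  qed (use i(2) \<tau>_i in simp_all)
  then obtain X where X [simp]: "is_icat C X" and X_simps: "IOb X = N" "IAr X = P" "ISrc X = pn" "ITgt X = \<tau>" "IIde X = i"
    and X_comp: "\<And>f g. composable X f g \<Longrightarrow> icomp C X f g = m f g"
    by blast

  \<comment> \<open>The forgetful functor from cocones to \<open>B\<close>, a cocone to its vertex
    and an arrow of cocones to its underlying arrow.\<close>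
  let ?G = "\<lparr>FDom = X, FCod = B, FOb = p, FAr = ph\<rparr>"
  have "is_functor X B p ph"
  proof (rule functorI)
    fix w w' assume w: "w \<in> Arr C" "w' \<in> Arr C" "Dom C w = Dom C w'" "Cod C w = IAr X" "Cod C w' = IAr X" "ITgt X \<cdot> w = ISrc X \<cdot> w'"
    then have w': "w \<in> Arr C" "w' \<in> Arr C" "Cod C w = P" "Cod C w' = P" "Dom C w = Dom C w'" "\<tau> \<cdot> w = pn \<cdot> w'"
      by (simp_all add: X_simps)
    have "icomp C X w w' = m w w'"
      by (rule X_comp) (use w in \<open>simp add: composable_def\<close>)
    then show "ph \<cdot> icomp C X w w' = icomp C B (ph \<cdot> w) (ph \<cdot> w')"
      using m(5)[OF w'] by simp
  qed (simp_all add: X_simps)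
  then have "is_ifun C ?G"
    by (simp add: is_ifun_iff)
  then obtain L \<kappa> where EL: "euniv ?G L \<kappa>"
    using lim[of ?G] by auto
  have L [simp]: "L \<in> Arr C" "Dom C L = One C" "Cod C L = IOb B" and k [simp]: "\<kappa> \<in> Arr C" "Dom C \<kappa> = N" "Cod C \<kappa> = IAr B"
    using EL unfolding euniv_def econe_def by (simp_all add: X_simps)
  have k_st [simp]: "ISrc B \<cdot> (\<kappa> \<cdot> n) = L \<cdot> bang (Dom C n)" "ITgt B \<cdot> (\<kappa> \<cdot> n) = p \<cdot> n" if "n \<in> Arr C" "Cod C n = N" for n
    using EL that unfolding euniv_def econe_def by (simp_all add: X_simps)
  have k_nat: "icomp C B (\<kappa> \<cdot> (pn \<cdot> w)) (ph \<cdot> w) = \<kappa> \<cdot> (\<tau> \<cdot> w)" if "w \<in> Arr C" "Cod C w = P" for w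
    using EL that unfolding euniv_def econe_def by (simp add: X_simps)
  have univ: "\<exists>!h. h \<in> hom C Z (IAr B) \<and> ISrc B \<cdot> h = u \<and> ITgt B \<cdot> h = L \<cdot> bang Z \<and>
      icomp C B (h \<cdot> Pr1 C Z N) (\<kappa> \<cdot> Pr2 C Z N) = \<mu>" if "Z \<in> Obj C" "gcone ?G Z u \<mu>" for Z u \<mu>
    using EL that unfolding euniv_def by (simp add: X_simps)

  \<comment> \<open>The legs are jointly monic at each stage: composing \<open>h\<close> with them
    is a cone over \<open>?G\<close>, and both \<open>h\<close> and \<open>h'\<close> mediate
    it.\<close>
  have uniq: "h = h'" if h: "h \<in> hom C Z (IAr B)" and h': "h' \<in> hom C Z (IAr B)" and Z: "Z \<in> Obj C"
    and st: "ISrc B \<cdot> h = ISrc B \<cdot> h'" "ITgt B \<cdot> h = L \<cdot> bang Z" "ITgt B \<cdot> h' = L \<cdot> bang Z"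
    and e: "\<And>t n. el2 t n Z N \<Longrightarrow> icomp C B (h \<cdot> t) (\<kappa> \<cdot> n) = icomp C B (h' \<cdot> t) (\<kappa> \<cdot> n)" for h h' Z
  proof -
    note [simp] = h[simplified] h'[simplified] Z
    let ?m = "icomp C B (h \<cdot> Pr1 C Z N) (\<kappa> \<cdot> Pr2 C Z N)"
    have ht: "ITgt B \<cdot> (h \<cdot> t) = L \<cdot> bang (Dom C t)" "ITgt B \<cdot> (h' \<cdot> t) = L \<cdot> bang (Dom C t)" if "t \<in> Arr C" "Cod C t = Z" for t
      using comp_eq_comp[OF st(2), of t] comp_eq_comp[OF st(3), of t] that by simp_all
    have "gcone ?G Z (ISrc B \<cdot> h) ?m"
      unfolding gcone_def
    proof (intro conjI allI impI)
      fix t w assume tw: "el2 t w Z (IAr (FDom ?G))"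
      then have tw': "t \<in> Arr C" "w \<in> Arr C" "Dom C w = Dom C t" "Cod C t = Z" "Cod C w = P"
        by (simp_all add: X_simps)
      show "icomp C (FCod ?G) (?m \<cdot> pair C t (ISrc (FDom ?G) \<cdot> w)) (FAr ?G \<cdot> w) = ?m \<cdot> pair C t (ITgt (FDom ?G) \<cdot> w)"
        using tw' k_nat[of w] by (simp add: X_simps ht icomp_assoc)
    qed (simp_all add: X_simps ht)
    from univ[OF Z this] have ex1: "\<exists>!g. g \<in> hom C Z (IAr B) \<and> ISrc B \<cdot> g = ISrc B \<cdot> h \<and> ITgt B \<cdot> g = L \<cdot> bang Z \<and>
      icomp C B (g \<cdot> Pr1 C Z N) (\<kappa> \<cdot> Pr2 C Z N) = ?m" .
    have "icomp C B (h' \<cdot> Pr1 C Z N) (\<kappa> \<cdot> Pr2 C Z N) = ?m"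
      by (rule e[symmetric]) simp
    then have "h' \<in> hom C Z (IAr B) \<and> ISrc B \<cdot> h' = ISrc B \<cdot> h \<and> ITgt B \<cdot> h' = L \<cdot> bang Z \<and>
      icomp C B (h' \<cdot> Pr1 C Z N) (\<kappa> \<cdot> Pr2 C Z N) = ?m"
      by (intro conjI h' st(1)[symmetric] st(3))
    moreover have "h \<in> hom C Z (IAr B) \<and> ISrc B \<cdot> h = ISrc B \<cdot> h \<and> ITgt B \<cdot> h = L \<cdot> bang Z \<and>
      icomp C B (h \<cdot> Pr1 C Z N) (\<kappa> \<cdot> Pr2 C Z N) = ?m"
      by (intro conjI h st(2) refl)
    ultimately show ?thesis
      using the1_equality[OF ex1, of h] the1_equality[OF ex1, of h'] by metis
  qed

  \<comment> \<open>For an object \<open>x\<close> of \<open>D\<close>, the components at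
    \<open>x\<close> of all cocones form a cone over \<open>?G\<close> with vertex
    \<open>F x\<close>; its compatibility with arrows of cocones is \<open>\<phi>_\<tau>\<close>.
    Taken at the stage \<open>IOb D\<close>, the universal property gives all components
    \<open>c\<close> of a cocone with vertex \<open>L\<close> at once.\<close>
  let ?\<mu> = "\<phi> \<cdot> pair C (Pr2 C (IOb D) N) (Pr1 C (IOb D) N)"
  have "gcone ?G (IOb D) (FOb F) ?\<mu>"
    unfolding gcone_def by (simp add: X_simps \<phi>_\<tau>)
  from ex1_implies_ex[OF univ[OF icat_data(1)[OF D] this]] obtain c where c: "c \<in> hom C (IOb D) (IAr B)" "ISrc B \<cdot> c = FOb F" "ITgt B \<cdot> c = L \<cdot> bang (IOb D)"
    and ce: "icomp C B (c \<cdot> Pr1 C (IOb D) N) (\<kappa> \<cdot> Pr2 C (IOb D) N) = ?\<mu>"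
    by blast
  note [simp] = c(1)[simplified]
  have c_st [simp]: "ISrc B \<cdot> (c \<cdot> x) = FOb F \<cdot> x" "ITgt B \<cdot> (c \<cdot> x) = L \<cdot> bang (Dom C x)" if "x \<in> Arr C" "Cod C x = IOb D" for x
    using comp_eq_comp[OF c(2), of x] comp_eq_comp[OF c(3), of x] that by simp_all
  have c_k: "icomp C B (c \<cdot> x) (\<kappa> \<cdot> n) = \<phi> \<cdot> pair C n x"
    if "x \<in> Arr C" "n \<in> Arr C" "Dom C n = Dom C x" "Cod C x = IOb D" "Cod C n = N" for x n
  proof -
    have "icomp C B (c \<cdot> Pr1 C (IOb D) N) (\<kappa> \<cdot> Pr2 C (IOb D) N) \<cdot> pair C x n = ?\<mu> \<cdot> pair C x n"
      using ce by simp
    then show ?thesis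
      using that by simp
  qed
  \<comment> \<open>Naturality is tested against the legs: after composing with
    \<open>\<kappa>\<close> at \<open>n\<close> it is the naturality of the cocone
    \<open>n\<close>.\<close>
  have c_nat: "icomp C B (FAr F \<cdot> d) (c \<cdot> (ITgt D \<cdot> d)) = c \<cdot> (ISrc D \<cdot> d)" if d: "d \<in> Arr C" "Cod C d = IAr D" for d
  proof (rule uniq[of _ "Dom C d"])
    fix t n assume "el2 t n (Dom C d) N"
    then show "icomp C B (icomp C B (FAr F \<cdot> d) (c \<cdot> (ITgt D \<cdot> d)) \<cdot> t) (\<kappa> \<cdot> n) = icomp C B ((c \<cdot> (ISrc D \<cdot> d)) \<cdot> t) (\<kappa> \<cdot> n)"
      using d by (simp add: icomp_assoc c_k \<phi>_nat)
  qed (use d in simp_all)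
  have cocone: "ecocone F L c"
    unfolding ecocone_def FD FB by (simp add: c_nat)

  \<comment> \<open>The cocone \<open>c\<close> is itself among the objects of the diagram;
    \<open>l\<close> is its name.\<close>
  have "gcocone F (One C) L (c \<cdot> Pr2 C (One C) (IOb D))"
    unfolding gcocone_def FD FB
  proof (intro conjI allI impI)
    fix t x assume tx: "el2 t x (One C) (IOb D)"
    then have "t = bang (Dom C x)"
      using bang_eq[of t] by simp
    then show "ISrc B \<cdot> ((c \<cdot> Pr2 C (One C) (IOb D)) \<cdot> pair C t x) = FOb F \<cdot> x" "ITgt B \<cdot> ((c \<cdot> Pr2 C (One C) (IOb D)) \<cdot> pair C t x) = L \<cdot> t"
      using tx by simp_all
  qed (simp_all add: c_nat)
  then obtain l where l: "l \<in> hom C (One C) N" "p \<cdot> l = L"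
    and \<phi>_l': "\<And>t x. el2 t x (One C) (IOb D) \<Longrightarrow> \<phi> \<cdot> pair C (l \<cdot> t) x = (c \<cdot> Pr2 C (One C) (IOb D)) \<cdot> pair C t x"
    using ex by blast
  note [simp] = l(1)[simplified]
  have p_l [simp]: "p \<cdot> (l \<cdot> t) = L \<cdot> t" if "t \<in> Arr C" "Cod C t = One C" for t
    using comp_eq_comp[OF l(2), of t] that by simp
  have \<phi>_l: "\<phi> \<cdot> pair C (l \<cdot> t) x = c \<cdot> x" if "t \<in> Arr C" "x \<in> Arr C" "Dom C x = Dom C t" "Cod C t = One C" "Cod C x = IOb D" for t x
    using \<phi>_l'[of t x] that by simp
  text \<open>An arrow \<open>h\<close> out of the vertex \<open>L\<close> that is compatible with the cocones \<open>c\<close> and \<open>n\<close> is an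
    arrow of the category of cocones, so naturality of \<open>\<kappa>\<close> applies to it.\<close>
  have k_l: "icomp C B (\<kappa> \<cdot> (l \<cdot> bang Z)) h = \<kappa> \<cdot> n"
    if h: "h \<in> hom C Z (IAr B)" and n: "n \<in> hom C Z N" and Z: "Z \<in> Obj C" and st: "ISrc B \<cdot> h = L \<cdot> bang Z" "ITgt B \<cdot> h = p \<cdot> n"
      and e: "\<And>t x. el2 t x Z (IOb D) \<Longrightarrow> icomp C B (c \<cdot> x) (h \<cdot> t) = \<phi> \<cdot> pair C (n \<cdot> t) x" for h n Z
  proof -
    note [simp] = h[simplified] n[simplified] Z
    obtain w where w: "w \<in> hom C (Dom C (l \<cdot> bang Z)) P" "pn \<cdot> w = l \<cdot> bang Z" "ph \<cdot> w = h"
      using mk[of "l \<cdot> bang Z" h] st(1) by auto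
    have w1 [simp]: "w \<in> Arr C" "Dom C w = Z" "Cod C w = P"
      using w(1) by simp_all
    have w_el: "pn \<cdot> (w \<cdot> t) = l \<cdot> bang (Dom C t)" "ph \<cdot> (w \<cdot> t) = h \<cdot> t" if "t \<in> Arr C" "Cod C t = Z" for t
      using comp_eq_comp[OF w(2), of t] comp_eq_comp[OF w(3), of t] that by simp_all
    have "\<tau> \<cdot> w = n"
    proof (rule ext)
      show "p \<cdot> (\<tau> \<cdot> w) = p \<cdot> n"
        using w(3) st(2) by simp
      fix t x assume "el2 t x (Dom C (\<tau> \<cdot> w)) (IOb D)"
      then show "\<phi> \<cdot> pair C ((\<tau> \<cdot> w) \<cdot> t) x = \<phi> \<cdot> pair C (n \<cdot> t) x"
        using e[of t x] by (simp add: \<phi>_\<tau> w_el \<phi>_l)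
    qed simp_all
    then show ?thesis
      using k_nat[of w] w by simp
  qed
  \<comment> \<open>By \<open>c_k\<close> the leg at \<open>n\<close> is an arrow of cocones from
    \<open>c\<close> to \<open>n\<close>, so \<open>k_l\<close> applies to it: the leg at
    \<open>c\<close> followed by the leg at \<open>n\<close> is again the leg at \<open>n\<close>.
    As the legs are jointly monic, the leg at \<open>c\<close> is an identity.\<close>
  have kl: "\<kappa> \<cdot> l = IIde B \<cdot> L"
  proof (rule uniq[of _ "One C"])
    fix t n assume tn: "el2 t n (One C) N"
    then have t: "t = bang (Dom C n)" and n: "n \<in> Arr C" "Cod C n = N"
      using bang_eq[of t] by simp_all
    have "icomp C B (\<kappa> \<cdot> (l \<cdot> bang (Dom C n))) (\<kappa> \<cdot> n) = \<kappa> \<cdot> n"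
      by (rule k_l) (use n in \<open>simp_all add: c_k\<close>)
    then show "icomp C B ((\<kappa> \<cdot> l) \<cdot> t) (\<kappa> \<cdot> n) = icomp C B ((IIde B \<cdot> L) \<cdot> t) (\<kappa> \<cdot> n)"
      unfolding t using n by simp
  qed (simp_all add: l(2))
  have kl_el: "\<kappa> \<cdot> (l \<cdot> bang Z) = IIde B \<cdot> (L \<cdot> bang Z)" if "Z \<in> Obj C" for Z
    using comp_eq_comp[OF kl, of "bang Z"] that by simp

  have "\<exists>!h. h \<in> hom C Z (IAr B) \<and> ISrc B \<cdot> h = L \<cdot> bang Z \<and> ITgt B \<cdot> h = u \<and>
      icomp C B (c \<cdot> Pr2 C Z (IOb D)) (h \<cdot> Pr1 C Z (IOb D)) = \<mu>" (is "\<exists>!h. ?P h")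
    if Z: "Z \<in> Obj C" and U: "gcocone F Z u \<mu>" for Z u \<mu>
  proof -
    note s = gcocone_simps[OF U, unfolded FD FB]
    note [simp] = Z s(1,2)[simplified]
    obtain n where n: "n \<in> hom C Z N" "p \<cdot> n = u" and \<phi>_n: "\<And>t x. el2 t x Z (IOb D) \<Longrightarrow> \<phi> \<cdot> pair C (n \<cdot> t) x = \<mu> \<cdot> pair C t x"
      using ex[OF U] by blast
    note [simp] = n(1)[simplified]
    show ?thesis
    proof (rule ex1I[of _ "\<kappa> \<cdot> n"])
      \<comment> \<open>The mediating arrow to the cocone named by \<open>n\<close> is the limit leg
        at \<open>n\<close>; it mediates by \<open>c_k\<close>.\<close>
      show "?P (\<kappa> \<cdot> n)"
        using \<phi>_n[of "Pr1 C Z (IOb D)" "Pr2 C Z (IOb D)"] by (simp add: n(2) c_k)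
      fix h assume h: "?P h"
      then have h1 [simp]: "h \<in> Arr C" "Dom C h = Z" "Cod C h = IAr B" and h2: "ISrc B \<cdot> h = L \<cdot> bang Z" "ITgt B \<cdot> h = u"
        and h3: "icomp C B (c \<cdot> Pr2 C Z (IOb D)) (h \<cdot> Pr1 C Z (IOb D)) = \<mu>"
        by simp_all
      have h_st: "ISrc B \<cdot> (h \<cdot> t) = L \<cdot> bang (Dom C t)" if "t \<in> Arr C" "Cod C t = Z" for t
        using comp_eq_comp[OF h2(1), of t] that by simp
      \<comment> \<open>Uniqueness: any mediating \<open>h\<close> is an arrow of cocones from
        \<open>c\<close> to \<open>n\<close>, so the leg at \<open>c\<close> followed by
        \<open>h\<close> is the leg at \<open>n\<close>, and the leg at \<open>c\<close> is an
        identity.\<close>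
      have "icomp C B (\<kappa> \<cdot> (l \<cdot> bang Z)) h = \<kappa> \<cdot> n"
      proof (rule k_l)
        fix t x assume tx: "el2 t x Z (IOb D)"
        have "icomp C B (c \<cdot> Pr2 C Z (IOb D)) (h \<cdot> Pr1 C Z (IOb D)) \<cdot> pair C t x = \<mu> \<cdot> pair C t x"
          by (simp only: h3)
        then show "icomp C B (c \<cdot> x) (h \<cdot> t) = \<phi> \<cdot> pair C (n \<cdot> t) x"
          using tx \<phi>_n[OF tx] by (simp add: h_st)
      qed (use h2 n in simp_all)
      then show "h = \<kappa> \<cdot> n"
        using h2(1) by (simp add: kl_el)
    qed
  qed
  then have "ecouniv F L c"
    unfolding ecouniv_def FD FB using cocone by blast
  then show ?thesis
    by blast
qed

end

section \<open>Duality\<close>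

text \<open>The composition arrow and the object of composable pairs are kept and the two
  projections exchange their names. Hence taking the opposite twice returns the same record, not
  just an isomorphic one.\<close>

definition op_icat :: "('o, 'a) icat \<Rightarrow> ('o, 'a) icat" where
  "op_icat X = X\<lparr>ISrc := ITgt X, ITgt := ISrc X, IFst := ISnd X, ISnd := IFst X\<rparr>"

definition op_ifun :: "('o, 'a) ifun \<Rightarrow> ('o, 'a) ifun" where
  "op_ifun F = F\<lparr>FDom := op_icat (FDom F), FCod := op_icat (FCod F)\<rparr>"

lemma op_icat_simps [simp]:
  "IOb (op_icat X) = IOb X" "IAr (op_icat X) = IAr X" "ICp (op_icat X) = ICp X" "ISrc (op_icat X) = ITgt X"
  "ITgt (op_icat X) = ISrc X" "IIde (op_icat X) = IIde X" "IFst (op_icat X) = ISnd X" "ISnd (op_icat X) = IFst X"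
  "ICmp (op_icat X) = ICmp X" "op_icat (op_icat X) = X"
  by (simp_all add: op_icat_def)

lemma op_ifun_simps [simp]:
  "FDom (op_ifun F) = op_icat (FDom F)" "FCod (op_ifun F) = op_icat (FCod F)" "FOb (op_ifun F) = FOb F"
  "FAr (op_ifun F) = FAr F" "op_ifun (op_ifun F) = F"
  by (simp_all add: op_ifun_def)

context cart
begin

lemma composable_op [simp]: "composable (op_icat X) f g \<longleftrightarrow> composable X g f"
  by (auto simp: composable_def)

text \<open>The description inside \<open>icomp\<close> is typed by the domain of its first
  argument, which accounts for the condition on domains.\<close>

lemma icomp_op: "icomp C (op_icat X) f g = icomp C X g f" if "Dom C f = Dom C g"
proof -
  have "(\<lambda>u. u \<in> hom C (Dom C f) (ICp X) \<and> ISnd X \<cdot> u = f \<and> IFst X \<cdot> u = g) =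
    (\<lambda>u. u \<in> hom C (Dom C g) (ICp X) \<and> IFst X \<cdot> u = g \<and> ISnd X \<cdot> u = f)"
    using that by auto
  then show ?thesis
    by (simp add: icomp_def)
qed

lemma is_icat_op:
  assumes X: "is_icat C X"
  shows "is_icat C (op_icat X)"
proof (rule icatI)
  note pb = icat_pb(1)[OF X]
  show "is_pullback C (ITgt (op_icat X)) (ISrc (op_icat X)) (ICp (op_icat X)) (IFst (op_icat X)) (ISnd (op_icat X))"
  proof (rule pullbackI)
    fix h k assume hk: "h \<in> Arr C" "k \<in> Arr C" "Dom C h = Dom C k" "Cod C h = Dom C (ITgt (op_icat X))"
      "Cod C k = Dom C (ISrc (op_icat X))" "ITgt (op_icat X) \<cdot> h = ISrc (op_icat X) \<cdot> k"
    then have c: "composable X k h"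
      using X by (simp add: composable_def)
    show "\<exists>u. u \<in> hom C (Dom C h) (ICp (op_icat X)) \<and> IFst (op_icat X) \<cdot> u = h \<and> ISnd (op_icat X) \<cdot> u = k"
      using ipair_typing[OF X c] hk(3) by (intro exI[of _ "ipair X k h"]) simp
  next
    fix u v assume uv: "u \<in> Arr C" "v \<in> Arr C" "Dom C u = Dom C v" "Cod C u = ICp (op_icat X)" "Cod C v = ICp (op_icat X)"
      "IFst (op_icat X) \<cdot> u = IFst (op_icat X) \<cdot> v" "ISnd (op_icat X) \<cdot> u = ISnd (op_icat X) \<cdot> v"
    show "u = v"
      by (rule pullback_ext[OF pb]) (use uv in simp_all)
  qed (use X pullback_simps(4)[OF pb] in simp_all)
next
  fix f g assume c: "composable (op_icat X) f g"
  then have "composable X g f" "Dom C f = Dom C g"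
    by (simp_all add: composable_def)
  then show "ISrc (op_icat X) \<cdot> icomp C (op_icat X) f g = ISrc (op_icat X) \<cdot> f"
    "ITgt (op_icat X) \<cdot> icomp C (op_icat X) f g = ITgt (op_icat X) \<cdot> g"
    using icomp_typing[OF X, of g f] by (simp_all add: icomp_op)
next
  fix f assume "f \<in> Arr C" "Cod C f = IAr (op_icat X)"
  then show "icomp C (op_icat X) (IIde (op_icat X) \<cdot> (ISrc (op_icat X) \<cdot> f)) f = f"
    "icomp C (op_icat X) f (IIde (op_icat X) \<cdot> (ITgt (op_icat X) \<cdot> f)) = f"
    using X by (simp_all add: icomp_op)
next
  fix f g h assume "composable (op_icat X) f g" "composable (op_icat X) g h"
  then have "composable X g f" "composable X h g"
    by simp_all
  then have "f \<in> Arr C" "g \<in> Arr C" "h \<in> Arr C" "Dom C f = Dom C h" "Dom C g = Dom C h" "Cod C f = IAr X" "Cod C g = IAr X" "Cod C h = IAr X"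
    "ITgt X \<cdot> h = ISrc X \<cdot> g" "ITgt X \<cdot> g = ISrc X \<cdot> f"
    by (simp_all add: composable_def)
  then show "icomp C (op_icat X) (icomp C (op_icat X) f g) h = icomp C (op_icat X) f (icomp C (op_icat X) g h)"
    using X by (simp add: icomp_op icomp_assoc)
qed (use X in simp_all)

lemma is_ifun_op:
  assumes "is_ifun C F"
  shows "is_ifun C (op_ifun F)"
proof -
  note c = ifun_icat[OF assms]
  note f = functor_simps[OF c(3)]
  have "is_functor (op_icat (FDom F)) (op_icat (FCod F)) (FOb F) (FAr F)"
    by (rule functorI) (use c(1,2) in \<open>simp_all add: f icomp_op\<close>)
  then show ?thesis
    using c(1,2) by (simp add: is_ifun_iff is_icat_op)
qed

end

context ccc
begin

lemma econe_op:
  assumes F: "is_ifun C F"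
  shows "econe (op_ifun F) v \<kappa> \<longleftrightarrow> ecocone F v \<kappa>"
proof -
  note [simp] = ifun_icat(1,2)[OF F] ifun_simps(1-6)[OF F]
  have "icomp C (op_icat (FCod F)) (\<kappa> \<cdot> (ITgt (FDom F) \<cdot> d)) (FAr F \<cdot> d) = icomp C (FCod F) (FAr F \<cdot> d) (\<kappa> \<cdot> (ITgt (FDom F) \<cdot> d))"
    if "\<kappa> \<in> hom C (IOb (FDom F)) (IAr (FCod F))" "d \<in> Arr C" "Cod C d = IAr (FDom F)" for d
    using that by (intro icomp_op) simp
  then show ?thesis
    unfolding econe_def ecocone_def by (auto simp del: in_hom_iff)
qed

lemma gcone_op:
  assumes F: "is_ifun C F"
  shows "gcone (op_ifun F) Z v \<mu> \<longleftrightarrow> gcocone F Z v \<mu>"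
proof -
  note [simp] = ifun_icat(1,2)[OF F] ifun_simps(1-6)[OF F]
  have "icomp C (op_icat (FCod F)) (\<mu> \<cdot> pair C t (ITgt (FDom F) \<cdot> d)) (FAr F \<cdot> d) =
    icomp C (FCod F) (FAr F \<cdot> d) (\<mu> \<cdot> pair C t (ITgt (FDom F) \<cdot> d))"
    if "\<mu> \<in> hom C (Prod C Z (IOb (FDom F))) (IAr (FCod F))" "el2 t d Z (IAr (FDom F))" for t d
    using that by (intro icomp_op) simp
  then show ?thesis
    unfolding gcone_def gcocone_def by (auto simp del: in_hom_iff)
qed

text \<open>In the main case the cocone supplies the typing of \<open>\<kappa>\<close>, from which
  the equal domains required by \<open>icomp_op\<close> follow; otherwise both sides already fail in
  their first conjunct.\<close>

lemma euniv_op: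
  assumes F: "is_ifun C F"
  shows "euniv (op_ifun F) v \<kappa> \<longleftrightarrow> ecouniv F v \<kappa>"
proof (cases "ecocone F v \<kappa>")
  case True
  note [simp] = ifun_icat(1,2)[OF F] ifun_simps(1-6)[OF F]
  have k: "\<kappa> \<in> hom C (IOb (FDom F)) (IAr (FCod F))"
    using True unfolding ecocone_def by blast
  have c: "icomp C (op_icat (FCod F)) (h \<cdot> Pr1 C Z (IOb (FDom F))) (\<kappa> \<cdot> Pr2 C Z (IOb (FDom F))) =
    icomp C (FCod F) (\<kappa> \<cdot> Pr2 C Z (IOb (FDom F))) (h \<cdot> Pr1 C Z (IOb (FDom F)))"
    if "h \<in> hom C Z (IAr (FCod F))" "Z \<in> Obj C" for h Z
    using that k by (intro icomp_op) simp
  have "(h \<in> hom C Z (IAr (op_icat (FCod F))) \<and> ISrc (op_icat (FCod F)) \<cdot> h = u \<and> ITgt (op_icat (FCod F)) \<cdot> h = v \<cdot> bang Z \<and>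
      icomp C (op_icat (FCod F)) (h \<cdot> Pr1 C Z (IOb (op_icat (FDom F)))) (\<kappa> \<cdot> Pr2 C Z (IOb (op_icat (FDom F)))) = \<mu>) \<longleftrightarrow>
    (h \<in> hom C Z (IAr (FCod F)) \<and> ISrc (FCod F) \<cdot> h = v \<cdot> bang Z \<and> ITgt (FCod F) \<cdot> h = u \<and>
      icomp C (FCod F) (\<kappa> \<cdot> Pr2 C Z (IOb (FDom F))) (h \<cdot> Pr1 C Z (IOb (FDom F))) = \<mu>)" if "Z \<in> Obj C" for h Z u \<mu>
    using c[OF _ that, of h] unfolding op_icat_simps by (cases "h \<in> hom C Z (IAr (FCod F))") (simp_all only:, blast+)
  then show ?thesis
    unfolding euniv_def ecouniv_def econe_op[OF F] gcone_op[OF F] op_ifun_simps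
    by (simp del: in_hom_iff op_icat_simps)
next
  case False
  then show ?thesis
    unfolding euniv_def ecouniv_def econe_op[OF F] by blast
qed

lemma limits_iff_colimits:
  assumes B: "is_icat C B"
  shows "(\<forall>F. is_ifun C F \<and> FCod F = B \<longrightarrow> (\<exists>v \<kappa>. euniv F v \<kappa>)) \<longleftrightarrow>
    (\<forall>F. is_ifun C F \<and> FCod F = B \<longrightarrow> (\<exists>v \<kappa>. ecouniv F v \<kappa>))"
proof
  assume "\<forall>F. is_ifun C F \<and> FCod F = B \<longrightarrow> (\<exists>v \<kappa>. euniv F v \<kappa>)"
  then show "\<forall>F. is_ifun C F \<and> FCod F = B \<longrightarrow> (\<exists>v \<kappa>. ecouniv F v \<kappa>)"
    using colimit_of_limits[OF B] by blast
next
  assume colim: "\<forall>F. is_ifun C F \<and> FCod F = B \<longrightarrow> (\<exists>v \<kappa>. ecouniv F v \<kappa>)"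
  show "\<forall>F. is_ifun C F \<and> FCod F = B \<longrightarrow> (\<exists>v \<kappa>. euniv F v \<kappa>)"
  proof (intro allI impI)
    fix F assume F: "is_ifun C F \<and> FCod F = B"
    \<comment> \<open>The limits which \<open>colimit_of_limits\<close> asks for in the opposite of
      \<open>B\<close> are colimits in \<open>B\<close>, and a colimit of \<open>op_ifun F\<close>
      is a limit of \<open>F\<close>.\<close>
    have "\<exists>v \<kappa>. ecouniv (op_ifun F) v \<kappa>"
    proof (rule colimit_of_limits[OF is_icat_op[OF B]])
      fix G assume G: "is_ifun C G" "FCod G = op_icat B"
      then have "\<exists>v \<kappa>. ecouniv (op_ifun G) v \<kappa>"
        using colim is_ifun_op[of G] by simp
      then show "\<exists>v \<kappa>. euniv G v \<kappa>"
        using euniv_op[OF is_ifun_op[OF G(1)]] by simp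
    qed (use F is_ifun_op[of F] in simp_all)
    then show "\<exists>v \<kappa>. euniv F v \<kappa>"
      using euniv_op[OF is_ifun_op[of F]] F by simp
  qed
qed

end

theorem theorem2p18:
  fixes E :: "('o, 'a) cart_category" and A :: "('o, 'a) icat"
  assumes "cartesian E"
    and "has_finite_limits E"
    and "locally_cartesian_closed E"
    and "is_icat E A"
  shows "internally_complete E A \<longleftrightarrow> internally_cocomplete E A"
proof -
  interpret E: flc E
  proof
    show "cartesian E" by fact
    then show "has_equalizers E"
      using assms(2) has_equalizers_of_finite_limits unfolding cartesian_def by blast
  qed
  \<comment> \<open>The two properties agree slice by slice, with the slice over \<open>I\<close> as
    base and \<open>I\<^sup>*A\<close> as internal category; all shapes over the same
    \<open>I\<close> are used together.\<close>
  have "(\<forall>F. is_ifun (slice E I) F \<and> FCod F = pull_icat E I A \<longrightarrow> (\<exists>c. universal_cone (slice E I) F c)) \<longleftrightarrow>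
    (\<forall>F. is_ifun (slice E I) F \<and> FCod F = pull_icat E I A \<longrightarrow> (\<exists>c. universal_cocone (slice E I) F c))"
    if I: "I \<in> Obj E" for I
  proof -
    have cc: "\<And>J. J \<in> Obj E \<Longrightarrow> cartesian_closed (slice E J)"
      using assms(3) by (simp add: locally_cartesian_closed_def)
    interpret P: slice_pull E I
      by unfold_locales (rule I)
    interpret S: lccc "slice E I"
    proof
      show "cartesian_closed (slice E I)"
        by (rule cc[OF I])
      \<comment> \<open>Local cartesian closedness is given for slices of \<open>E\<close> only; at
        the domain of \<open>K\<close> it yields the iterated slice.\<close>
      fix K assume K: "K \<in> Obj (slice E I)"
      then have "ccc (slice (slice E I) K)"
        using E.ccc_slice_slice[OF I K] cc[of "Dom E K"] by simp
      then show "cartesian_closed (slice (slice E I) K)"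
        by (rule ccc.closed)
    qed
    have B: "is_icat (slice E I) (pull_icat E I A)"
      using P.is_icat_pull assms(4) by blast
    show ?thesis
      using S.limits_iff_colimits[OF B] S.universal_cone_ex_iff S.universal_cocone_ex_iff by blast
  qed
  then show ?thesis
    unfolding internally_complete_def internally_cocomplete_def by blast
qed

end
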